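(* Let $M$ be a compact connected Riemannian submanifold of $\mathbf{R}^m$ of dimension $d<m$, possibly with boundary, with Riemannian volume measure $\mu$ and $|\mu|=\mu(M)$, and let $p$ be an interior point of $M$ (any point if $M$ has no boundary). Let $X_1,X_2,\ldots$ be i.i.d. random variables with values in $M$ and law $\mu/|\mu|$. Let $h_n>0$ and, for $f:M\to\mathbf{R}$, let $$\Delta_{h_n,n}f(p)=\frac{1}{nh_n^{d+2}}\sum_{i=1}^n K\Big(\frac{p-X_i}{h_n}\Big)(f(X_i)-f(p)),\qquad K(u)=\frac{1}{(4\pi)^{d/2}}e^{-\|u\|^2/4},\ u\in\mathbf{R}^m .$$ Let $U$ be a normal neighborhood of $p$ and let $\mathcal{F}$ be a class of functions on $M$ uniformly bounded up to the third order in $U$. Assume $nh_n^{d+4}\to 0$ and $nh_n^d\to\infty$. Then, as $n\to\infty$, the processes $$\left\{\sqrt{nh_n^{d+2}}\Big[\Delta_{h_n,n}f(p)-\frac{1}{|\mu|}\Delta_Mf(p)\Big]:\ f\in\mathcal{F}\right\}$$ converge in law in $\ell^\infty(\mathcal{F})$ to the Gaussian process $$\left\{G(f):=\frac{1}{2^{d/2}(2\pi)^{d/4}|\mu|^{1/2}}\sum_{j=1}^d Z_j\frac{\partial f}{\partial x_j^p}(p):\ f\in\mathcal{F}\right\},$$ where $Z=(Z_1,\ldots,Z_d)$ is the standard normal vector in $T_p(M)\,(=\mathbf{R}^d)$.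
   Context: A Riemannian submanifold of $\mathbf{R}^m$ is a smooth Riemannian manifold isometrically embedded in $\mathbf{R}^m$; points of $M$ are identified with their images in $\mathbf{R}^m$, so $p-X_i$ is a difference of vectors in $\mathbf{R}^m$ and $\|\cdot\|$ is the Euclidean norm of $\mathbf{R}^m$. A normal neighborhood $U$ of $p$ is one on which every point is joined to $p$ by a unique geodesic in $U$ and which is the diffeomorphic image under the exponential map $\mathcal{E}_p$ of a neighborhood of $0\in T_p(M)$. Given an orthonormal basis $e_1,\dots,e_d$ of $T_p(M)$, the $p$-normal coordinates of $x\in U$ are $x_i^p=\langle\mathcal{E}_p^{-1}(x),e_i\rangle$. A class $\mathcal{F}$ of functions on $M$ is uniformly bounded up to the $k$-th order in $U$ if its members are $k$ times differentiable in $U$ and their partial derivatives of all orders up to $k$ in the $p$-normal coordinates are bounded on $U$ by a constant independent of $f\in\mathcal{F}$. $\Delta_M f=\operatorname{div}\operatorname{grad} f$ is the Laplace–Beltrami operator; $\Delta_M f(p)=\sum_{i=1}^d\frac{\partial^2 f}{\partial (x_i^p)^2}(p)$. $\ell^\infty(\mathcal{F})$ is the space of bounded real functions on $\mathcal{F}$ with the sup norm; convergence in law in $\ell^\infty(\mathcal{F})$ is in the usual (Hoffmann-Jørgensen) sense of empirical process theory.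
   Formalization: Added: the functions in F are dominated on M∖U by one μ-integrable function. Without control outside U the claim fails: for F={c·1_{M∖U}: c real}, with μ(M∖U)>0, the process is unbounded over F as soon as some X_i lies outside U. *)

theory Defs
  imports "HOL-Probability.Probability"
begin

section \<open>Smooth maps between subsets of Euclidean spaces\<close>

text \<open>Intended for open \<open>S\<close>. All \<open>k\<close>-th Frechet derivatives exist; the highest ones are not
  required to be continuous.\<close>

primrec times_differentiable_on ::
    "nat \<Rightarrow> ('a::euclidean_space \<Rightarrow> 'b::real_normed_vector) \<Rightarrow> 'a set \<Rightarrow> bool" where
  "times_differentiable_on 0 f S \<longleftrightarrow> True"
| "times_differentiable_on (Suc k) f S \<longleftrightarrow>
     f differentiable_on S \<and>
     (\<forall>v. times_differentiable_on k (\<lambda>x. frechet_derivative f (at x) v) S)"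

text \<open>Smoothness on an arbitrary subset means local extendability to a smooth function on an open
  set.\<close>

definition smooth_map :: "'a::euclidean_space set \<Rightarrow> ('a \<Rightarrow> 'b::euclidean_space) \<Rightarrow> bool" where
  "smooth_map S f \<longleftrightarrow>
     (\<forall>x\<in>S. \<exists>W g. open W \<and> x \<in> W \<and> (\<forall>k. times_differentiable_on k g W) \<and>
        (\<forall>y\<in>S \<inter> W. g y = f y))"

definition diffeomorphism ::
    "'a::euclidean_space set \<Rightarrow> 'b::euclidean_space set \<Rightarrow> ('a \<Rightarrow> 'b) \<Rightarrow> bool" where
  "diffeomorphism S T f \<longleftrightarrow> bij_betw f S T \<and> smooth_map S f \<and> smooth_map T (inv_into S f)"

section \<open>Submanifolds with boundary\<close>

text \<open>The dimension of the submanifold is \<open>CARD('d)\<close>. The submanifold carries the metric induced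
  by the inner product of the ambient space.\<close>

definition local_param ::
    "(real^'m) set \<Rightarrow> (real^'d \<Rightarrow> real^'m) \<Rightarrow> (real^'d) set \<Rightarrow> bool" where
  "local_param M \<phi> D \<longleftrightarrow>
     (\<exists>k. openin (top_of_set {y. 0 \<le> y $ k}) D) \<and>
     openin (top_of_set M) (\<phi> ` D) \<and> diffeomorphism D (\<phi> ` D) \<phi>"

definition submanifold :: "'d::finite itself \<Rightarrow> (real^'m) set \<Rightarrow> bool" where
  "submanifold d M \<longleftrightarrow>
     (\<forall>x\<in>M. \<exists>\<phi> (D :: (real^'d) set). local_param M \<phi> D \<and> x \<in> \<phi> ` D)"

definition manifold_interior :: "'d::finite itself \<Rightarrow> (real^'m) set \<Rightarrow> (real^'m) set" where
  "manifold_interior d M =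
     {x. \<exists>\<phi> (D :: (real^'d) set). local_param M \<phi> D \<and> open D \<and> x \<in> \<phi> ` D}"

definition tangent_space ::
    "'d::finite itself \<Rightarrow> (real^'m) set \<Rightarrow> real^'m \<Rightarrow> (real^'m) set" where
  "tangent_space d M x =
     {v. \<exists>\<phi> (D :: (real^'d) set) a \<phi>' w.
           local_param M \<phi> D \<and> a \<in> D \<and> \<phi> a = x \<and>
           (\<phi> has_derivative \<phi>') (at a within D) \<and> v = \<phi>' w}"

definition orthonormal_frame ::
    "(real^'m) set \<Rightarrow> ('d::finite \<Rightarrow> real^'m) \<Rightarrow> bool" where
  "orthonormal_frame T e \<longleftrightarrow>
     (\<forall>i j. e i \<bullet> e j = (if i = j then 1 else 0)) \<and> span (range e) = T"

subsection \<open>Riemannian volume\<close>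

definition volume_density ::
    "(real^'d \<Rightarrow> real^'m) \<Rightarrow> (real^'d) set \<Rightarrow> real^'d \<Rightarrow> real" where
  "volume_density \<phi> D y =
     sqrt (det (\<chi> i j. frechet_derivative \<phi> (at y within D) (axis i 1) \<bullet>
                       frechet_derivative \<phi> (at y within D) (axis j 1)))"

text \<open>Prescribing the measure in all local parametrizations determines it uniquely.\<close>

definition riemannian_volume ::
    "'d::finite itself \<Rightarrow> (real^'m) set \<Rightarrow> (real^'m) measure \<Rightarrow> bool" where
  "riemannian_volume d M \<mu> \<longleftrightarrow>
     sets \<mu> = sets (restrict_space borel M) \<and>
     (\<forall>\<phi> (D :: (real^'d) set) B. local_param M \<phi> D \<and> B \<in> sets borel \<and> B \<subseteq> D \<longrightarrow>
        emeasure \<mu> (\<phi> ` B) = (\<integral>\<^sup>+ y\<in>B. ennreal (volume_density \<phi> D y) \<partial>lborel))"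

subsection \<open>Gradient, divergence and the Laplace--Beltrami operator\<close>

text \<open>Derivatives are taken within \<open>M\<close>. Such a derivative is determined only on the tangent space,
  which is why the gradient is required to be tangential and why the divergence only evaluates
  \<open>X'\<close> on a tangent frame. The covariant derivative of a tangential field is the tangential
  projection of its ambient derivative, so its trace is \<open>\<Sum>j. X' (b j) \<bullet> b j\<close>.\<close>

definition gradient ::
    "'d::finite itself \<Rightarrow> (real^'m) set \<Rightarrow> (real^'m \<Rightarrow> real) \<Rightarrow> real^'m \<Rightarrow> real^'m" where
  "gradient d M f x =
     (THE g. g \<in> tangent_space d M x \<and> (f has_derivative (\<lambda>v. g \<bullet> v)) (at x within M))"

definition divergence ::
    "'d::finite itself \<Rightarrow> (real^'m) set \<Rightarrow> (real^'m \<Rightarrow> real^'m) \<Rightarrow> real^'m \<Rightarrow> real" where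
  "divergence d M X x =
     (THE c. \<exists>X' (b :: 'd \<Rightarrow> real^'m).
        (X has_derivative X') (at x within M) \<and> orthonormal_frame (tangent_space d M x) b \<and>
        c = (\<Sum>j\<in>UNIV. X' (b j) \<bullet> b j))"

definition laplace_beltrami ::
    "'d::finite itself \<Rightarrow> (real^'m) set \<Rightarrow> (real^'m \<Rightarrow> real) \<Rightarrow> real^'m \<Rightarrow> real" where
  "laplace_beltrami d M f x = divergence d M (gradient d M f) x"

subsection \<open>Geodesics and the exponential map\<close>

definition velocity :: "(real \<Rightarrow> 'a::real_normed_vector) \<Rightarrow> real \<Rightarrow> 'a" where
  "velocity \<gamma> t = vector_derivative \<gamma> (at t within {0..1})"

text \<open>The covariant acceleration in the induced metric is the tangential part of the ambient
  acceleration.\<close>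

definition geodesic ::
    "'d::finite itself \<Rightarrow> (real^'m) set \<Rightarrow> (real \<Rightarrow> real^'m) \<Rightarrow> bool" where
  "geodesic d M \<gamma> \<longleftrightarrow>
     smooth_map {0..1} \<gamma> \<and> \<gamma> ` {0..1} \<subseteq> M \<and>
     (\<forall>t\<in>{0..1}. \<forall>w\<in>tangent_space d M (\<gamma> t). velocity (velocity \<gamma>) t \<bullet> w = 0)"

definition exp_domain ::
    "'d::finite itself \<Rightarrow> (real^'m) set \<Rightarrow> real^'m \<Rightarrow> (real^'m) set" where
  "exp_domain d M p =
     {v \<in> tangent_space d M p. \<exists>\<gamma>. geodesic d M \<gamma> \<and> \<gamma> 0 = p \<and> velocity \<gamma> 0 = v}"

definition exp_map ::
    "'d::finite itself \<Rightarrow> (real^'m) set \<Rightarrow> real^'m \<Rightarrow> real^'m \<Rightarrow> real^'m" where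
  "exp_map d M p v =
     (THE x. \<exists>\<gamma>. geodesic d M \<gamma> \<and> \<gamma> 0 = p \<and> velocity \<gamma> 0 = v \<and> \<gamma> 1 = x)"

text \<open>\<open>U\<close> is a normal neighborhood of \<open>p\<close> and \<open>V\<close> is the neighborhood of \<open>0\<close> in the tangent space of
  which it is the image. Geodesics are parametrized affinely by \<open>{0..1}\<close>. The set \<open>V\<close> is
  determined by \<open>U\<close>.\<close>

definition normal_neighborhood ::
    "'d::finite itself \<Rightarrow> (real^'m) set \<Rightarrow> real^'m \<Rightarrow> (real^'m) set \<Rightarrow> (real^'m) set \<Rightarrow> bool" where
  "normal_neighborhood d M p V U \<longleftrightarrow>
     openin (top_of_set M) U \<and> p \<in> U \<and>
     (\<forall>x\<in>U.
        (\<exists>\<gamma>. geodesic d M \<gamma> \<and> \<gamma> ` {0..1} \<subseteq> U \<and> \<gamma> 0 = p \<and> \<gamma> 1 = x) \<and>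
        (\<forall>\<gamma> \<gamma>'. geodesic d M \<gamma> \<and> \<gamma> ` {0..1} \<subseteq> U \<and> \<gamma> 0 = p \<and> \<gamma> 1 = x \<and>
           geodesic d M \<gamma>' \<and> \<gamma>' ` {0..1} \<subseteq> U \<and> \<gamma>' 0 = p \<and> \<gamma>' 1 = x \<longrightarrow>
           (\<forall>t\<in>{0..1}. \<gamma> t = \<gamma>' t))) \<and>
     openin (top_of_set (tangent_space d M p)) V \<and> 0 \<in> V \<and> V \<subseteq> exp_domain d M p \<and>
     diffeomorphism V U (exp_map d M p)"

subsection \<open>Normal coordinates\<close>

definition normal_coords ::
    "(real^'m) set \<Rightarrow> real^'m \<Rightarrow> (real^'m) set \<Rightarrow> ('d::finite \<Rightarrow> real^'m) \<Rightarrow> real^'m \<Rightarrow> real^'d" where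
  "normal_coords M p V e x = (\<chi> i. inv_into V (exp_map TYPE('d) M p) x \<bullet> e i)"

text \<open>The coordinate expression of \<open>f\<close> in a chart \<open>c\<close> with domain \<open>U\<close>.\<close>

definition in_coords :: "'a set \<Rightarrow> ('a \<Rightarrow> real^'d) \<Rightarrow> ('a \<Rightarrow> real) \<Rightarrow> real^'d \<Rightarrow> real" where
  "in_coords U c f = f \<circ> inv_into U c"

definition partial :: "'d::finite \<Rightarrow> (real^'d \<Rightarrow> real) \<Rightarrow> real^'d \<Rightarrow> real" where
  "partial i g y = deriv (\<lambda>t. g (y + t *\<^sub>R axis i 1)) 0"

primrec partials :: "'d::finite list \<Rightarrow> (real^'d \<Rightarrow> real) \<Rightarrow> real^'d \<Rightarrow> real" where
  "partials [] g = g"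
| "partials (i # is) g = partial i (partials is g)"

definition uniformly_bounded_upto ::
    "nat \<Rightarrow> 'a set \<Rightarrow> ('a \<Rightarrow> real^'d::finite) \<Rightarrow> ('a \<Rightarrow> real) set \<Rightarrow> bool" where
  "uniformly_bounded_upto k U c F \<longleftrightarrow>
     (\<forall>f\<in>F. times_differentiable_on k (in_coords U c f) (c ` U)) \<and>
     (\<exists>C. \<forall>f\<in>F. \<forall>is. length is \<le> k \<longrightarrow> (\<forall>y\<in>c ` U. \<bar>partials is (in_coords U c f) y\<bar> \<le> C))"

section \<open>The empirical operator\<close>

definition gauss_kernel :: "nat \<Rightarrow> 'a::real_normed_vector \<Rightarrow> real" where
  "gauss_kernel d u = 1 / (4 * pi) powr (real d / 2) * exp (- (norm u)\<^sup>2 / 4)"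

text \<open>The sample is \<open>x 0, \<dots>, x (n - 1)\<close>.\<close>

definition graph_laplacian ::
    "nat \<Rightarrow> real \<Rightarrow> nat \<Rightarrow> (nat \<Rightarrow> 'a::real_normed_vector) \<Rightarrow> ('a \<Rightarrow> real) \<Rightarrow> 'a \<Rightarrow> real" where
  "graph_laplacian d h n x f p =
     1 / (real n * h ^ (d + 2)) *
       (\<Sum>i<n. gauss_kernel d ((p - x i) /\<^sub>R h) * (f (x i) - f p))"

section \<open>Convergence in law of processes with bounded sample paths\<close>

definition linf_space :: "'i set \<Rightarrow> ('i \<Rightarrow> real) set" where
  "linf_space I = {z \<in> extensional I. bounded (z ` I)}"

text \<open>Inserting \<open>0\<close> makes the supremum meaningful for an empty index set; the metric is only
  relevant on \<open>linf_space I\<close>.\<close>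

definition linf_dist :: "'i set \<Rightarrow> ('i \<Rightarrow> real) \<Rightarrow> ('i \<Rightarrow> real) \<Rightarrow> real" where
  "linf_dist I z w =
     (if z \<in> linf_space I \<and> w \<in> linf_space I then Sup (insert 0 ((\<lambda>i. \<bar>z i - w i\<bar>) ` I)) else 0)"

definition linf_metric :: "'i set \<Rightarrow> ('i \<Rightarrow> real) metric" where
  "linf_metric I = metric (linf_space I, linf_dist I)"

lemma bdd_above_linf:
  assumes "z \<in> linf_space I" "w \<in> linf_space I"
  shows "bdd_above (insert 0 ((\<lambda>i. \<bar>z i - w i\<bar>) ` I))"
proof -
  obtain a b where a: "\<And>i. i \<in> I \<Longrightarrow> \<bar>z i\<bar> \<le> a" and b: "\<And>i. i \<in> I \<Longrightarrow> \<bar>w i\<bar> \<le> b"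
    using assms unfolding linf_space_def bounded_iff by (auto simp: real_norm_def)
  have "x \<le> \<bar>a\<bar> + \<bar>b\<bar>" if "x \<in> insert 0 ((\<lambda>i. \<bar>z i - w i\<bar>) ` I)" for x
    using that a b by fastforce
  then show ?thesis by (rule bdd_aboveI)
qed

lemma Metric_space_linf: "Metric_space (linf_space I) (linf_dist I)"
proof
  fix z w :: "'a \<Rightarrow> real"
  show "0 \<le> linf_dist I z w"
    by (auto simp: linf_dist_def intro!: cSup_upper bdd_above_linf)
  show "linf_dist I z w = linf_dist I w z"
    by (simp add: linf_dist_def abs_minus_commute conj_commute)
next
  have le: "\<bar>z i - w i\<bar> \<le> linf_dist I z w"
    if "z \<in> linf_space I" "w \<in> linf_space I" "i \<in> I" for z w :: "'a \<Rightarrow> real" and i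
    using that by (auto simp: linf_dist_def intro!: cSup_upper bdd_above_linf)
  {
    fix z w :: "'a \<Rightarrow> real"
    assume zw: "z \<in> linf_space I" "w \<in> linf_space I"
    show "linf_dist I z w = 0 \<longleftrightarrow> z = w"
    proof
      assume "linf_dist I z w = 0"
      then have "z i = w i" if "i \<in> I" for i
        using le[OF zw that] by simp
      then show "z = w"
        using zw by (intro extensionalityI[of _ I]) (auto simp: linf_space_def)
    next
      assume "z = w"
      then show "linf_dist I z w = 0"
        by (cases "I = {}") (auto simp: linf_dist_def image_constant_conv)
    qed
  }
  fix x y z :: "'a \<Rightarrow> real"
  assume xyz: "x \<in> linf_space I" "y \<in> linf_space I" "z \<in> linf_space I"
  have nonneg: "0 \<le> linf_dist I x y" "0 \<le> linf_dist I y z"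
    by (auto simp: linf_dist_def intro!: cSup_upper bdd_above_linf)
  have "\<bar>x i - z i\<bar> \<le> linf_dist I x y + linf_dist I y z" if "i \<in> I" for i
    using le[OF xyz(1,2) that] le[OF xyz(2,3) that] by linarith
  then have "Sup (insert 0 ((\<lambda>i. \<bar>x i - z i\<bar>) ` I)) \<le> linf_dist I x y + linf_dist I y z"
    using nonneg by (intro cSup_least) auto
  then show "linf_dist I x z \<le> linf_dist I x y + linf_dist I y z"
    using xyz by (simp add: linf_dist_def)
qed

lemma mspace_linf_metric: "mspace (linf_metric I) = linf_space I"
  and mdist_linf_metric: "mdist (linf_metric I) = linf_dist I"
  using Metric_space_linf[of I] unfolding linf_metric_def
  by (simp_all add: Metric_space.mspace_metric Metric_space.mdist_metric)

definition outer_expectation :: "'w measure \<Rightarrow> ('w \<Rightarrow> real) \<Rightarrow> real" where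
  "outer_expectation P T =
     Inf {integral\<^sup>L P S | S. integrable P S \<and> (\<forall>\<omega>\<in>space P. T \<omega> \<le> S \<omega>)}"

text \<open>Hoffmann-Jorgensen convergence in law: the processes \<open>Y n\<close> take values in the metric space
  but need not be measurable, the limit \<open>G\<close> is Borel measurable.\<close>

definition converges_in_law ::
    "'a metric \<Rightarrow> 'w measure \<Rightarrow> (nat \<Rightarrow> 'w \<Rightarrow> 'a) \<Rightarrow> 'q measure \<Rightarrow> ('q \<Rightarrow> 'a) \<Rightarrow> bool" where
  "converges_in_law m P Y Q G \<longleftrightarrow>
     (\<forall>n. Y n \<in> space P \<rightarrow> mspace m) \<and>
     G \<in> measurable Q (sigma (mspace m) {W. openin (mtopology_of m) W}) \<and>
     (\<forall>H. continuous_map (mtopology_of m) euclideanreal H \<and> bounded (H ` mspace m) \<longrightarrow>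
        (\<lambda>n. outer_expectation P (\<lambda>\<omega>. H (Y n \<omega>))) \<longlonglongrightarrow> integral\<^sup>L Q (\<lambda>\<omega>. H (G \<omega>)))"

end

theory Submission
  imports Defs
begin

text \<open>Let \<open>\<psi>\<close> be the inverse of the normal coordinates, \<open>\<psi> y\<close> the end of the geodesic with initial
  velocity \<open>y\<close>. Since geodesics have normal acceleration, the second derivative of \<open>\<psi>\<close> at \<open>0\<close> is
  normal to \<open>M\<close>. This makes \<open>\<bar>\<psi> y - p\<bar>\<close> and \<open>\<bar>y\<bar>\<close> agree to the next order, \<open>\<bar>\<psi> y - p\<bar>\<^sup>2 = \<bar>y\<bar>\<^sup>2 + O(\<bar>y\<bar>\<^sup>4)\<close>,
  gives the volume density \<open>1 + O(\<bar>y\<bar>\<^sup>2)\<close>, and turns the Laplace--Beltrami operator at \<open>p\<close> into the sum of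
  the pure second partial derivatives. By Laplace's method the moments of the Gaussian kernel on \<open>M\<close> are
  then those of a Gaussian on the tangent space, with relative error \<open>O(h\<^sup>2)\<close>.

  Inserting the second order Taylor polynomial of \<open>f\<close> splits the process into three parts. The linear
  part is a linear function, with coefficients the first partial derivatives of \<open>f\<close>, of a row sum of an
  i.i.d. triangular array in the tangent space; its characteristic functions converge to the Gaussian
  one. The quadratic part minus its limit tends to \<open>0\<close> in quadratic mean, the bias being
  \<open>O((n h\<^sup>d\<^sup>+\<^sup>4)\<^sup>1\<^sup>/\<^sup>2)\<close>, and so does the expectation of the Taylor remainder and of the contribution away
  from \<open>p\<close>. The coefficients enter only through the uniform bounds on the partial derivatives, so one
  integrable random variable dominates the error for all \<open>f\<close> at once. Hence the processes are Lipschitz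
  images of a convergent finite-dimensional sequence up to an error vanishing in \<open>L\<^sup>1\<close>, which suffices
  for convergence of outer expectations.\<close>

section \<open>Smooth maps\<close>

text \<open>\<open>exp_map\<close> is a definite description, so its values are accessible only
  after geodesics with equal short initial velocity are known to coincide. Speed conservation keeps
  such geodesics in a chart; there the acceleration is known only through its orthogonality to the
  image of the differential, and an energy estimate turns this implicit equation into uniqueness.
  Normality of the second derivative matters because it removes every first-order correction: with
  relative error O(h) instead of O(h^2) the bias bound would be sqrt(n h^(d+2)), which need not
  vanish. The \<open>a\<close>-th power of the kernel is, up to a factor, a Gaussian with standard
  deviation sqrt(2/a) h. For \<open>a = 1\<close> the second moment 2 h^2 cancels the Taylor factor
  1/2, \<open>a = 2\<close> gives the variance of the limit, and \<open>a = 3\<close> gives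
  Lyapunov's condition. The Gaussian vector of the limit has a second use: Lebesgue integrals
  against Gaussians are its expectations, and test functions are smoothed with it.\<close>

lemma frechet_derivative_cong_open:
  assumes "open S" "x \<in> S" "\<And>y. y \<in> S \<Longrightarrow> f y = g y"
  shows "frechet_derivative f (at x) = frechet_derivative g (at x)"
proof -
  \<comment> \<open>\<open>frechet_derivative\<close> is a choice among the derivatives, so equality
    holds even where none exists, as soon as both functions have the same ones.\<close>
  have "(f has_derivative D) (at x) \<longleftrightarrow> (g has_derivative D) (at x)" for D
    using assms has_derivative_transform_within_open[of f D x UNIV S g]
      has_derivative_transform_within_open[of g D x UNIV S f] by auto
  then show ?thesis by (simp add: frechet_derivative_def)
qed

lemma times_differentiable_on_cong:
  assumes "open S" "\<And>x. x \<in> S \<Longrightarrow> f x = g x"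
  shows "times_differentiable_on k f S \<longleftrightarrow> times_differentiable_on k g S"
  using assms(2)
proof (induction k arbitrary: f g)
  case 0
  then show ?case by simp
next
  case (Suc k)
  have "frechet_derivative f (at x) = frechet_derivative g (at x)" if "x \<in> S" for x
    using frechet_derivative_cong_open[OF assms(1) that] Suc.prems by blast
  then have "times_differentiable_on k (\<lambda>x. frechet_derivative f (at x) v) S
     \<longleftrightarrow> times_differentiable_on k (\<lambda>x. frechet_derivative g (at x) v) S" for v
    by (intro Suc.IH) simp
  moreover have "f differentiable_on S \<longleftrightarrow> g differentiable_on S"
    unfolding differentiable_on_def
    using Suc.prems
    by (intro ball_cong refl iffI) (auto simp: differentiable_def intro: has_derivative_transform,
      metis has_derivative_transform)
  ultimately show ?case by simp
qed

lemma times_differentiable_on_subset: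
  "times_differentiable_on k f S \<Longrightarrow> T \<subseteq> S \<Longrightarrow> times_differentiable_on k f T"
  by (induction k arbitrary: f) (auto intro: differentiable_on_subset)

lemma times_differentiable_on_SucD:
  "times_differentiable_on (Suc k) f S \<Longrightarrow> times_differentiable_on k f S"
  by (induction k arbitrary: f) auto

lemma times_differentiable_on_le:
  "times_differentiable_on k f S \<Longrightarrow> j \<le> k \<Longrightarrow> times_differentiable_on j f S"
  by (induction k) (metis le_0_eq, metis le_Suc_eq times_differentiable_on_SucD)

lemma has_derivative_frechet:
  assumes "times_differentiable_on (Suc k) f S" "open S" "x \<in> S"
  shows "(f has_derivative frechet_derivative f (at x)) (at x)"
  using assms by (auto simp: differentiable_on_def at_within_open[of x S] frechet_derivative_works[symmetric])

text \<open>The derivative of the composite along \<open>v\<close> is the composite of the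
  derivative of \<open>f\<close> along \<open>L v\<close>, so the induction closes. Translated
  charts, rescaled curves and the passage from the tangent space to coordinates are all of this
  form.\<close>

lemma times_differentiable_on_affine:
  fixes f :: "'a::euclidean_space \<Rightarrow> 'b::real_normed_vector" and L :: "'c::euclidean_space \<Rightarrow> 'a"
  assumes "open S" "bounded_linear L" "times_differentiable_on k f S"
  shows "times_differentiable_on k (\<lambda>y. f (L y + a)) {y. L y + a \<in> S}"
  using assms(3)
proof (induction k arbitrary: f)
  case 0
  then show ?case by simp
next
  case (Suc k)
  interpret L: bounded_linear L by fact
  have "continuous_on UNIV (\<lambda>y. L y + a)"
    by (intro continuous_intros L.continuous_on)
  then have op: "open {y. L y + a \<in> S}"
    using open_vimage[OF assms(1)] by (simp add: vimage_def)
  have der: "((\<lambda>y. f (L y + a)) has_derivative (\<lambda>v. frechet_derivative f (at (L y + a)) (L v))) (at y)"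
    if "L y + a \<in> S" for y
  proof -
    have "((\<lambda>y. L y + a) has_derivative L) (at y)"
      by (auto intro!: derivative_eq_intros bounded_linear_imp_has_derivative[OF assms(2)])
    from diff_chain_at[OF this has_derivative_frechet[OF Suc.prems assms(1) that]]
    show ?thesis by (simp add: o_def)
  qed
  have "times_differentiable_on k (\<lambda>y. frechet_derivative f (at (L y + a)) (L v)) {y. L y + a \<in> S}" for v
    using Suc.IH[of "\<lambda>x. frechet_derivative f (at x) (L v)"] Suc.prems by simp
  then have "times_differentiable_on k (\<lambda>y. frechet_derivative (\<lambda>y. f (L y + a)) (at y) v) {y. L y + a \<in> S}" for v
    by (subst times_differentiable_on_cong[OF op, where g="\<lambda>y. frechet_derivative f (at (L y + a)) (L v)"])
      (simp_all add: frechet_derivative_at[OF der, symmetric])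
  moreover have "(\<lambda>y. f (L y + a)) differentiable_on {y. L y + a \<in> S}"
    using der by (auto simp: differentiable_on_def differentiable_def intro: has_derivative_at_withinI)
  ultimately show ?case by simp
qed

lemma times_differentiable_on_linear:
  fixes f :: "'a::euclidean_space \<Rightarrow> 'b::real_normed_vector"
  assumes "open S" "bounded_linear L" "times_differentiable_on k f S"
  shows "times_differentiable_on k (\<lambda>y. L (f y)) S"
  using assms(3)
proof (induction k arbitrary: f)
  case 0
  then show ?case by simp
next
  case (Suc k)
  interpret L: bounded_linear L by fact
  have der: "((\<lambda>y. L (f y)) has_derivative (\<lambda>v. L (frechet_derivative f (at y) v))) (at y)"
    if "y \<in> S" for y
    using L.has_derivative[OF has_derivative_frechet[OF Suc.prems assms(1) that]] .
  have "times_differentiable_on k (\<lambda>y. L (frechet_derivative f (at y) v)) S" for v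
    using Suc.IH[of "\<lambda>x. frechet_derivative f (at x) v"] Suc.prems by simp
  then have "times_differentiable_on k (\<lambda>y. frechet_derivative (\<lambda>y. L (f y)) (at y) v) S" for v
    by (subst times_differentiable_on_cong[OF assms(1), where g="\<lambda>y. L (frechet_derivative f (at y) v)"])
      (simp_all add: frechet_derivative_at[OF der, symmetric])
  moreover have "(\<lambda>y. L (f y)) differentiable_on S"
    using der by (auto simp: differentiable_on_def differentiable_def intro: has_derivative_at_withinI)
  ultimately show ?case by simp
qed

text \<open>The directions stand in the order of differentiation, \<open>v\<close> before
  \<open>w\<close>. Fixing \<open>v\<close> first follows the recursion of
  \<open>times_differentiable_on\<close>, which iterates directional derivatives; bilinearity and
  symmetry are therefore to be proved.\<close>

definition deriv2 :: "('a::euclidean_space \<Rightarrow> 'b::real_normed_vector) \<Rightarrow> 'a \<Rightarrow> 'a \<Rightarrow> 'a \<Rightarrow> 'b" where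
  "deriv2 f x v w = frechet_derivative (\<lambda>x. frechet_derivative f (at x) v) (at x) w"

lemma has_derivative_deriv2:
  assumes "times_differentiable_on (Suc (Suc k)) f S" "open S" "x \<in> S"
  shows "((\<lambda>x. frechet_derivative f (at x) v) has_derivative deriv2 f x v) (at x)"
  using has_derivative_frechet[of k "\<lambda>x. frechet_derivative f (at x) v" S x] assms
  by (auto simp: deriv2_def[abs_def])

lemma linear_frechet:
  assumes "times_differentiable_on (Suc k) f S" "open S" "x \<in> S"
  shows "linear (frechet_derivative f (at x))"
  using has_derivative_frechet[OF assms] has_derivative_linear by blast

lemma linear_deriv2_right:
  assumes "times_differentiable_on (Suc (Suc k)) f S" "open S" "x \<in> S"
  shows "linear (deriv2 f x v)"
  using has_derivative_deriv2[OF assms] has_derivative_linear by blast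

text \<open>The first derivative is linear in its direction at every nearby point, and by uniqueness
  of derivatives this identity survives a further differentiation.\<close>

lemma linear_deriv2_left:
  assumes f: "times_differentiable_on (Suc (Suc k)) f S" and S: "open S" and x: "x \<in> S"
  shows "linear (\<lambda>v. deriv2 f x v w)"
proof (rule linearI)
  note f1 = times_differentiable_on_SucD[OF f]
  fix u v
  have "((\<lambda>x. frechet_derivative f (at x) (u + v)) has_derivative (\<lambda>w. deriv2 f x u w + deriv2 f x v w)) (at x)"
    by (rule has_derivative_transform_within_open[OF has_derivative_add[OF
       has_derivative_deriv2[OF f S x] has_derivative_deriv2[OF f S x]] S x])
       (use linear_add[OF linear_frechet[OF f1 S]] in simp)
  with has_derivative_deriv2[OF f S x, of "u + v"] have "deriv2 f x (u + v) = (\<lambda>w. deriv2 f x u w + deriv2 f x v w)"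
    by (rule has_derivative_unique)
  then show "deriv2 f x (u + v) w = deriv2 f x u w + deriv2 f x v w" by metis
next
  note f1 = times_differentiable_on_SucD[OF f]
  fix c :: real and v
  have "((\<lambda>x. frechet_derivative f (at x) (c *\<^sub>R v)) has_derivative (\<lambda>w. c *\<^sub>R deriv2 f x v w)) (at x)"
    by (rule has_derivative_transform_within_open[OF has_derivative_scaleR_right[OF
       has_derivative_deriv2[OF f S x]] S x])
       (use linear_cmul[OF linear_frechet[OF f1 S]] in simp)
  with has_derivative_deriv2[OF f S x, of "c *\<^sub>R v"] have "deriv2 f x (c *\<^sub>R v) = (\<lambda>w. c *\<^sub>R deriv2 f x v w)"
    by (rule has_derivative_unique)
  then show "deriv2 f x (c *\<^sub>R v) w = c *\<^sub>R deriv2 f x v w" by metis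
qed

text \<open>Expansion in the finite basis turns bounds for each basis vector, with unrelated
  constants, into one bound for all vectors. The weight \<open>N\<close> lets the same lemma serve
  Lipschitz estimates and, applied repeatedly, bilinear maps.\<close>

lemma linear_family_bound:
  fixes B :: "'i \<Rightarrow> 'a::euclidean_space \<Rightarrow> 'b::real_normed_vector"
  assumes lin: "\<And>x. x \<in> K \<Longrightarrow> linear (B x)"
    and bd: "\<And>b. b \<in> Basis \<Longrightarrow> \<exists>C. \<forall>x\<in>K. norm (B x b) \<le> C * N x"
    and N: "\<And>x. x \<in> K \<Longrightarrow> 0 \<le> N x"
  shows "\<exists>C\<ge>0. \<forall>x\<in>K. \<forall>v. norm (B x v) \<le> C * N x * norm v"
proof -
  obtain C where C: "\<And>b x. b \<in> Basis \<Longrightarrow> x \<in> K \<Longrightarrow> norm (B x b) \<le> C b * N x"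
    using bd by metis
  have "norm (B x v) \<le> (\<Sum>b\<in>Basis. \<bar>C b\<bar>) * N x * norm v" if x: "x \<in> K" for x v
  proof -
    have "B x v = B x (\<Sum>b\<in>Basis. (v \<bullet> b) *\<^sub>R b)"
      by (simp add: euclidean_representation)
    also have "\<dots> = (\<Sum>b\<in>Basis. (v \<bullet> b) *\<^sub>R B x b)"
      by (simp add: linear_sum[OF lin[OF x]] linear_cmul[OF lin[OF x]])
    also have "norm \<dots> \<le> (\<Sum>b\<in>Basis. \<bar>v \<bullet> b\<bar> * norm (B x b))"
      by (rule norm_sum[THEN order_trans]) simp
    also have "\<dots> \<le> (\<Sum>b\<in>Basis. norm v * (\<bar>C b\<bar> * N x))"
    proof (intro sum_mono mult_mono)
      fix b :: 'a assume b: "b \<in> Basis"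
      show "\<bar>v \<bullet> b\<bar> \<le> norm v" using b by (rule Basis_le_norm)
      have "C b * N x \<le> \<bar>C b\<bar> * N x" using N[OF x] by (intro mult_right_mono) auto
      then show "norm (B x b) \<le> \<bar>C b\<bar> * N x" using C[OF b x] by linarith
    qed auto
    finally show ?thesis by (simp add: sum_distrib_left sum_distrib_right mult_ac)
  qed
  then show ?thesis by (intro exI[of _ "\<Sum>b\<in>Basis. \<bar>C b\<bar>"]) (auto intro: sum_nonneg)
qed

text \<open>The highest derivative counted by \<open>times_differentiable_on\<close> need not be
  continuous. One order more makes the first derivative continuous, hence bounded on a compact
  ball.\<close>

lemma frechet_bound_cball:
  fixes f :: "'a::euclidean_space \<Rightarrow> 'b::real_normed_vector"
  assumes f: "times_differentiable_on 2 f S" and S: "open S" and K: "cball a r \<subseteq> S"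
  shows "\<exists>C\<ge>0. \<forall>x\<in>cball a r. \<forall>v. norm (frechet_derivative f (at x) v) \<le> C * norm v"
proof -
  have f2: "times_differentiable_on (Suc (Suc 0)) f S" using f by (simp add: numeral_2_eq_2)
  have "\<exists>C. \<forall>x\<in>cball a r. norm (frechet_derivative f (at x) b) \<le> C * 1" for b
  proof -
    have "continuous_on (cball a r) (\<lambda>x. frechet_derivative f (at x) b)"
    proof (rule continuous_at_imp_continuous_on, rule ballI)
      fix x assume "x \<in> cball a r"
      then have "x \<in> S" using K by auto
      from has_derivative_continuous[OF has_derivative_deriv2[OF f2 S this]]
      show "isCont (\<lambda>x. frechet_derivative f (at x) b) x" .
    qed
    then have "bounded ((\<lambda>x. frechet_derivative f (at x) b) ` cball a r)"
      by (intro compact_imp_bounded compact_continuous_image) auto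
    then show ?thesis by (auto simp: bounded_iff)
  qed
  from linear_family_bound[of "cball a r" "\<lambda>x. frechet_derivative f (at x)" "\<lambda>_. 1", OF _ this]
  show ?thesis
    using linear_frechet[OF times_differentiable_on_SucD[OF f2] S] K by (simp add: subset_iff)
qed

lemma lipschitz_cball:
  fixes f :: "'a::euclidean_space \<Rightarrow> 'b::real_normed_vector"
  assumes f: "times_differentiable_on 2 f S" and S: "open S" and K: "cball a r \<subseteq> S"
  shows "\<exists>C\<ge>0. \<forall>x\<in>cball a r. \<forall>y\<in>cball a r. norm (f x - f y) \<le> C * norm (x - y)"
proof -
  have f2: "times_differentiable_on (Suc (Suc 0)) f S" using f by (simp add: numeral_2_eq_2)
  obtain C where C: "C \<ge> 0" "\<And>x v. x \<in> cball a r \<Longrightarrow> norm (frechet_derivative f (at x) v) \<le> C * norm v"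
    using frechet_bound_cball[OF assms] by blast
  have "norm (f x - f y) \<le> C * norm (x - y)" if "x \<in> cball a r" "y \<in> cball a r" for x y
  proof (rule differentiable_bound[OF convex_cball _ _ that])
    fix z assume z: "z \<in> cball a r"
    show "(f has_derivative frechet_derivative f (at z)) (at z within cball a r)"
      using has_derivative_frechet[OF f2 S] z K by (blast intro: has_derivative_at_withinI)
    show "onorm (frechet_derivative f (at z)) \<le> C"
      using C(2)[OF z] by (intro onorm_le)
  qed
  then show ?thesis using C by blast
qed

text \<open>Order four is what the last estimate costs: a Lipschitz bound for \<open>deriv2\<close>
  requires it to be twice differentiable. All estimates share one positive constant.\<close>

lemma smooth_bounds_cball:
  fixes f :: "'a::euclidean_space \<Rightarrow> 'b::real_normed_vector"
  assumes f: "times_differentiable_on 4 f S" and S: "open S" and K: "cball a r \<subseteq> S"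
  shows "\<exists>C>0. \<forall>x\<in>cball a r. \<forall>y\<in>cball a r. \<forall>v w.
     norm (f x - f y) \<le> C * norm (x - y) \<and>
     norm (frechet_derivative f (at x) v) \<le> C * norm v \<and>
     norm (frechet_derivative f (at x) v - frechet_derivative f (at y) v) \<le> C * norm (x - y) * norm v \<and>
     norm (deriv2 f x v w) \<le> C * norm v * norm w \<and>
     norm (deriv2 f x v w - deriv2 f y v w) \<le> C * norm (x - y) * norm v * norm w"
proof -
  let ?K = "cball a r"
  have f4: "times_differentiable_on (Suc (Suc (Suc (Suc 0)))) f S" using f by (simp add: eval_nat_numeral)
  note f3 = times_differentiable_on_SucD[OF f4]
  note f2 = times_differentiable_on_SucD[OF f3]
  have g: "times_differentiable_on 2 (\<lambda>x. frechet_derivative f (at x) v) S" for v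
    using f3 by (simp add: eval_nat_numeral)
  have h: "times_differentiable_on 2 (\<lambda>x. deriv2 f x v w) S" for v w
    using f4 by (simp add: eval_nat_numeral deriv2_def)
  have x: "x \<in> S" if "x \<in> ?K" for x using that K by auto
  obtain C0 where C0: "C0 \<ge> 0" "\<And>x y. x \<in> ?K \<Longrightarrow> y \<in> ?K \<Longrightarrow> norm (f x - f y) \<le> C0 * norm (x - y)"
    using lipschitz_cball[of f S a r] f2 S K by (auto simp: numeral_2_eq_2)
  obtain C1 where C1: "C1 \<ge> 0" "\<And>x v. x \<in> ?K \<Longrightarrow> norm (frechet_derivative f (at x) v) \<le> C1 * norm v"
    using frechet_bound_cball[of f S a r] f2 S K by (auto simp: numeral_2_eq_2)
  let ?P = "\<lambda>z. frechet_derivative f (at (fst z))" and ?Q = "\<lambda>z. frechet_derivative f (at (snd z))"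
  have "\<exists>C\<ge>0. \<forall>z\<in>?K \<times> ?K. \<forall>v. norm (?P z v - ?Q z v) \<le> C * norm (fst z - snd z) * norm v"
  proof (rule linear_family_bound)
    fix z assume "z \<in> ?K \<times> ?K"
    then show "linear (\<lambda>v. ?P z v - ?Q z v)"
      using linear_frechet[OF f2 S] x by (intro linear_compose_sub) auto
  next
    fix b :: 'a
    show "\<exists>C. \<forall>z\<in>?K \<times> ?K. norm (?P z b - ?Q z b) \<le> C * norm (fst z - snd z)"
      using lipschitz_cball[OF g S K, of b] by auto
  qed auto
  then obtain C2 where C2: "C2 \<ge> 0" "\<And>x y v. x \<in> ?K \<Longrightarrow> y \<in> ?K \<Longrightarrow>
      norm (frechet_derivative f (at x) v - frechet_derivative f (at y) v) \<le> C2 * norm (x - y) * norm v"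
    by auto
  \<comment> \<open>The bilinear bound is an instance of the linear one: the index is the point
    together with the second direction, whose norm is the weight.\<close>
  have "\<exists>C\<ge>0. \<forall>z\<in>?K \<times> UNIV. \<forall>v. norm (deriv2 f (fst z) v (snd z)) \<le> C * norm (snd z) * norm v"
  proof (rule linear_family_bound)
    fix z :: "'a \<times> 'a" assume "z \<in> ?K \<times> UNIV"
    then show "linear (\<lambda>v. deriv2 f (fst z) v (snd z))"
      using linear_deriv2_left[OF f2 S] x by auto
  next
    fix b :: 'a
    show "\<exists>C. \<forall>z\<in>?K \<times> UNIV. norm (deriv2 f (fst z) b (snd z)) \<le> C * norm (snd z)"
      using frechet_bound_cball[OF g S K, of b] by (auto simp: deriv2_def)
  qed auto
  then obtain C3 where C3: "C3 \<ge> 0" "\<And>x v w. x \<in> ?K \<Longrightarrow> norm (deriv2 f x v w) \<le> C3 * norm w * norm v"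
    by auto
  let ?D = "\<lambda>z v w. deriv2 f (fst z) v w - deriv2 f (snd z) v w"
  have "\<exists>C\<ge>0. \<forall>z\<in>?K \<times> ?K. \<forall>w. norm (?D z v w) \<le> C * norm (fst z - snd z) * norm w" for v
  proof (rule linear_family_bound)
    fix z assume "z \<in> ?K \<times> ?K"
    then show "linear (?D z v)"
      using linear_deriv2_right[OF f2 S] x by (intro linear_compose_sub) auto
  next
    fix b :: 'a
    show "\<exists>C. \<forall>z\<in>?K \<times> ?K. norm (?D z v b) \<le> C * norm (fst z - snd z)"
      using lipschitz_cball[OF h S K, of v b] by auto
  qed auto
  then have bd: "\<exists>C. \<forall>z\<in>?K \<times> ?K. \<forall>w. norm (?D z v w) \<le> C * norm (fst z - snd z) * norm w" for v by meson
  \<comment> \<open>\<open>bd\<close> has a constant that depends on \<open>v\<close>; linearity in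
    \<open>v\<close> leaves only the finitely many constants of the basis vectors.\<close>
  have "\<exists>C\<ge>0. \<forall>z\<in>(?K \<times> ?K) \<times> UNIV. \<forall>v. norm (?D (fst z) v (snd z)) \<le>
      C * (norm (fst (fst z) - snd (fst z)) * norm (snd z)) * norm v"
  proof (rule linear_family_bound)
    fix z :: "('a \<times> 'a) \<times> 'a" assume "z \<in> (?K \<times> ?K) \<times> UNIV"
    then show "linear (\<lambda>v. ?D (fst z) v (snd z))"
      using linear_deriv2_left[OF f2 S] x by (intro linear_compose_sub) auto
  next
    fix b :: 'a
    show "\<exists>C. \<forall>z\<in>(?K \<times> ?K) \<times> UNIV. norm (?D (fst z) b (snd z)) \<le>
       C * (norm (fst (fst z) - snd (fst z)) * norm (snd z))"
      using bd[of b] by (auto simp: mult.assoc)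
  qed auto
  then obtain C4 where C4: "C4 \<ge> 0" "\<And>x y v w. x \<in> ?K \<Longrightarrow> y \<in> ?K \<Longrightarrow>
     norm (deriv2 f x v w - deriv2 f y v w) \<le> C4 * (norm (x - y) * norm w) * norm v"
    by auto
  let ?C = "C0 + C1 + C2 + C3 + C4 + 1"
  have up: "t \<le> c * s \<Longrightarrow> c \<le> ?C \<Longrightarrow> 0 \<le> s \<Longrightarrow> t \<le> ?C * s" for t c s :: real
    by (meson mult_right_mono order_trans)
  show ?thesis
  proof (intro exI[of _ ?C] conjI ballI allI)
    show "0 < ?C" using C0(1) C1(1) C2(1) C3(1) C4(1) by linarith
  next
    fix x y v w assume xy: "x \<in> ?K" "y \<in> ?K"
    show "norm (f x - f y) \<le> ?C * norm (x - y)"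
      using up[OF C0(2)[OF xy]] C0(1) C1(1) C2(1) C3(1) C4(1) by auto
    show "norm (frechet_derivative f (at x) v) \<le> ?C * norm v"
      using up[OF C1(2)[OF xy(1)]] C0(1) C1(1) C2(1) C3(1) C4(1) by auto
    show "norm (frechet_derivative f (at x) v - frechet_derivative f (at y) v) \<le> ?C * norm (x - y) * norm v"
      using up[of _ C2 "norm (x - y) * norm v"] C2(2)[OF xy, of v] C0(1) C1(1) C2(1) C3(1) C4(1)
      by (simp add: mult.assoc)
    show "norm (deriv2 f x v w) \<le> ?C * norm v * norm w"
      using up[of _ C3 "norm v * norm w"] C3(2)[OF xy(1), of v w] C0(1) C1(1) C2(1) C3(1) C4(1)
      by (simp add: mult_ac)
    show "norm (deriv2 f x v w - deriv2 f y v w) \<le> ?C * norm (x - y) * norm v * norm w"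
      using up[of _ C4 "norm (x - y) * norm v * norm w"] C4(2)[OF xy, of v w] C0(1) C1(1) C2(1) C3(1) C4(1)
      by (simp add: mult_ac)
  qed
qed

section \<open>Symmetry of the second derivative\<close>

lemma vector_derivative_norm_bound:
  fixes g :: "real \<Rightarrow> 'a::real_normed_vector"
  assumes "a \<le> b" "\<And>s. s \<in> {a..b} \<Longrightarrow> (g has_vector_derivative g' s) (at s within {a..b})"
    and "\<And>s. s \<in> {a..b} \<Longrightarrow> norm (g' s) \<le> B"
  shows "norm (g b - g a) \<le> B * (b - a)"
proof -
  have "norm (g b - g a) \<le> B * norm (b - a)"
  proof (rule differentiable_bound[of "{a..b}" g "\<lambda>s h. h *\<^sub>R g' s"])
    fix s assume s: "s \<in> {a..b}"
    show "(g has_derivative (\<lambda>h. h *\<^sub>R g' s)) (at s within {a..b})"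
      using assms(2)[OF s] by (simp add: has_vector_derivative_def)
    show "onorm (\<lambda>h. h *\<^sub>R g' s) \<le> B"
      using assms(3)[OF s] by (intro onorm_le) (simp add: mult.commute[of B] mult_left_mono)
  qed (use assms(1) in auto)
  then show ?thesis using assms(1) by simp
qed

text \<open>Only differentiability of the first derivative at the single point \<open>x\<close>
  enters: the mean value inequality in one variable reduces the second difference to two first-order
  remainders at \<open>x\<close>.\<close>

lemma second_difference_bound:
  fixes f :: "'a::euclidean_space \<Rightarrow> 'b::real_normed_vector"
  assumes f: "times_differentiable_on 2 f S" and S: "open S" and x: "x \<in> S" and \<epsilon>: "\<epsilon> > 0"
  shows "\<exists>\<delta>>0. \<forall>t. 0 < t \<and> t < \<delta> \<longrightarrow>
    norm (f (x + t *\<^sub>R v + t *\<^sub>R w) - f (x + t *\<^sub>R v) - (f (x + t *\<^sub>R w) - f x) - t\<^sup>2 *\<^sub>R deriv2 f x v w)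
      \<le> \<epsilon> * t\<^sup>2"
proof -
  have f2: "times_differentiable_on (Suc (Suc 0)) f S" using f by (simp add: numeral_2_eq_2)
  note f1 = times_differentiable_on_SucD[OF f2]
  let ?N = "norm v + norm w + 1"
  have N: "?N > 0" by (simp add: add_nonneg_pos)
  \<comment> \<open>Two remainders occur, each at distance at most \<open>t * ?N\<close> from
    \<open>x\<close>, whence the factor \<open>2 * ?N\<close>.\<close>
  define \<eta> where "\<eta> = \<epsilon> / (2 * ?N)"
  have \<eta>: "\<eta> > 0" using \<epsilon> N by (simp add: \<eta>_def)
  obtain d1 where d1: "d1 > 0" "\<And>y. norm (y - x) < d1 \<Longrightarrow>
      norm (frechet_derivative f (at y) v - frechet_derivative f (at x) v - deriv2 f x v (y - x)) \<le> \<eta> * norm (y - x)"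
    using has_derivative_deriv2[OF f2 S x, of v] \<eta> unfolding has_derivative_at_alt by blast
  obtain d2 where d2: "d2 > 0" "ball x d2 \<subseteq> S" using S x by (meson openE)
  define \<delta> where "\<delta> = min d1 d2 / ?N"
  have \<delta>: "\<delta> > 0" using d1 d2 N by (simp add: \<delta>_def)
  show ?thesis
  proof (intro exI[of _ \<delta>] conjI allI impI)
    fix t assume t: "0 < t \<and> t < \<delta>"
    have tN: "t * ?N < min d1 d2" using t N by (simp add: \<delta>_def pos_less_divide_eq)
    have sm: "norm (s *\<^sub>R v + u *\<^sub>R w) \<le> t * ?N" if "s \<in> {0..t}" "u \<in> {0..t}" for s u
    proof -
      have "norm (s *\<^sub>R v + u *\<^sub>R w) \<le> s * norm v + u * norm w"
        using that norm_triangle_ineq[of "s *\<^sub>R v" "u *\<^sub>R w"] by simp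
      also have "\<dots> \<le> t * norm v + t * norm w" using that by (intro add_mono mult_right_mono) auto
      finally show ?thesis using t by (simp add: algebra_simps)
    qed
    have inS: "x + s *\<^sub>R v + u *\<^sub>R w \<in> S" if "s \<in> {0..t}" "u \<in> {0..t}" for s u
      using sm[OF that] tN d2(2) by (auto simp: subset_iff dist_norm add.assoc norm_minus_commute
          simp del: dist_add_cancel)
    \<comment> \<open>The increment of \<open>?g\<close> over \<open>{0..t}\<close> is the quantity
      to be bounded; in its derivative the term \<open>t *\<^sub>R deriv2 f x v w\<close> cancels
      the linear parts at the two points.\<close>
    let ?g = "\<lambda>s. f (x + s *\<^sub>R v + t *\<^sub>R w) - f (x + s *\<^sub>R v) - (s * t) *\<^sub>R deriv2 f x v w"
    let ?g' = "\<lambda>s. frechet_derivative f (at (x + s *\<^sub>R v + t *\<^sub>R w)) v - frechet_derivative f (at (x + s *\<^sub>R v)) v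
        - t *\<^sub>R deriv2 f x v w"
    have "norm (?g t - ?g 0) \<le> (\<epsilon> * t) * (t - 0)"
    proof (rule vector_derivative_norm_bound)
      show "0 \<le> t" using t by simp
      fix s assume s: "s \<in> {0..t}"
      have t0: "t \<in> {0..t}" "0 \<in> {0..t}" using t by auto
      have D: "((\<lambda>s. f (x + s *\<^sub>R v + u *\<^sub>R w)) has_vector_derivative
           frechet_derivative f (at (x + s *\<^sub>R v + u *\<^sub>R w)) v) (at s within {0..t})" if u: "u \<in> {0..t}" for u
      proof -
        have "((\<lambda>s. x + s *\<^sub>R v + u *\<^sub>R w) has_derivative (\<lambda>h. h *\<^sub>R v)) (at s)"
          by (auto intro!: derivative_eq_intros)
        from diff_chain_at[OF this has_derivative_frechet[OF f1 S inS[OF s u]]]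
        show ?thesis
          using linear_cmul[OF linear_frechet[OF f1 S inS[OF s u]]]
          by (simp add: has_vector_derivative_def o_def has_derivative_at_withinI)
      qed
      show "(?g has_vector_derivative ?g' s) (at s within {0..t})"
        using D[OF t0(1)] D[OF t0(2)] by (auto intro!: derivative_eq_intros)
      let ?y = "x + s *\<^sub>R v + t *\<^sub>R w" and ?z = "x + s *\<^sub>R v"
      let ?R = "\<lambda>y. frechet_derivative f (at y) v - frechet_derivative f (at x) v - deriv2 f x v (y - x)"
      have y: "norm (?y - x) \<le> t * ?N" and z: "norm (?z - x) \<le> t * ?N"
        using sm[OF s t0(1)] sm[OF s t0(2)] by (simp_all add: add.assoc)
      have "t *\<^sub>R deriv2 f x v w = deriv2 f x v (?y - x) - deriv2 f x v (?z - x)"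
        using linear_deriv2_right[OF f2 S x, of v] by (simp add: linear_add linear_cmul add.assoc)
      then have "?g' s = ?R ?y - ?R ?z" by simp
      also have "norm \<dots> \<le> norm (?R ?y) + norm (?R ?z)" by (rule norm_triangle_ineq4)
      also have "\<dots> \<le> \<eta> * norm (?y - x) + \<eta> * norm (?z - x)"
        using y z tN by (intro add_mono d1(2)) auto
      also have "\<dots> \<le> \<eta> * (t * ?N) + \<eta> * (t * ?N)"
        using y z \<eta> by (intro add_mono mult_left_mono) auto
      also have "\<dots> = \<epsilon> * t" 
      proof -
        have "\<eta> * ?N = \<epsilon> / 2" using N by (simp add: \<eta>_def divide_simps)
        then have "\<eta> * (t * ?N) = \<epsilon> / 2 * t" by (metis mult.assoc mult.commute)
        then show ?thesis by linarith
      qed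
      finally show "norm (?g' s) \<le> \<epsilon> * t" .
    qed
    then show "norm (f (x + t *\<^sub>R v + t *\<^sub>R w) - f (x + t *\<^sub>R v) - (f (x + t *\<^sub>R w) - f x) - t\<^sup>2 *\<^sub>R deriv2 f x v w)
      \<le> \<epsilon> * t\<^sup>2"
      by (simp add: power2_eq_square algebra_simps)
  qed (fact \<delta>)
qed

text \<open>The second difference does not change when \<open>v\<close> and \<open>w\<close> are
  exchanged, while divided by t^2 it approximates both values; a third of their distance as
  tolerance gives the contradiction.\<close>

lemma deriv2_commute:
  fixes f :: "'a::euclidean_space \<Rightarrow> 'b::real_normed_vector"
  assumes f: "times_differentiable_on 2 f S" and S: "open S" and x: "x \<in> S"
  shows "deriv2 f x v w = deriv2 f x w v"
proof (rule ccontr)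
  let ?a = "deriv2 f x v w" and ?b = "deriv2 f x w v"
  assume "?a \<noteq> ?b"
  then have pos: "norm (?a - ?b) / 3 > 0" by simp
  let ?e = "norm (?a - ?b) / 3"
  obtain d1 d2 where d: "d1 > 0" "d2 > 0"
    and d1: "\<And>t. 0 < t \<Longrightarrow> t < d1 \<Longrightarrow>
      norm (f (x + t *\<^sub>R v + t *\<^sub>R w) - f (x + t *\<^sub>R v) - (f (x + t *\<^sub>R w) - f x) - t\<^sup>2 *\<^sub>R ?a) \<le> ?e * t\<^sup>2"
    and d2: "\<And>t. 0 < t \<Longrightarrow> t < d2 \<Longrightarrow>
      norm (f (x + t *\<^sub>R w + t *\<^sub>R v) - f (x + t *\<^sub>R w) - (f (x + t *\<^sub>R v) - f x) - t\<^sup>2 *\<^sub>R ?b) \<le> ?e * t\<^sup>2"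
    using second_difference_bound[OF f S x pos, of v w] second_difference_bound[OF f S x pos, of w v] by auto
  define t where "t = min d1 d2 / 2"
  have t: "0 < t" "t < d1" "t < d2" using d by (auto simp: t_def)
  let ?A = "f (x + t *\<^sub>R v + t *\<^sub>R w) - f (x + t *\<^sub>R v) - (f (x + t *\<^sub>R w) - f x)"
  let ?B = "f (x + t *\<^sub>R w + t *\<^sub>R v) - f (x + t *\<^sub>R w) - (f (x + t *\<^sub>R v) - f x)"
  have sw: "x + t *\<^sub>R v + t *\<^sub>R w = x + t *\<^sub>R w + t *\<^sub>R v" by (simp add: algebra_simps)
  have AB: "?A = ?B" unfolding sw by (simp add: algebra_simps)
  have "t\<^sup>2 *\<^sub>R (?a - ?b) = (?B - t\<^sup>2 *\<^sub>R ?b) - (?A - t\<^sup>2 *\<^sub>R ?a)"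
    unfolding AB by (simp add: scaleR_diff_right)
  then have "norm (t\<^sup>2 *\<^sub>R (?a - ?b)) \<le> norm (?B - t\<^sup>2 *\<^sub>R ?b) + norm (?A - t\<^sup>2 *\<^sub>R ?a)"
    by (metis norm_triangle_ineq4)
  also have "\<dots> \<le> ?e * t\<^sup>2 + ?e * t\<^sup>2" using d1[OF t(1,2)] d2[OF t(1,3)] by linarith
  finally have "t\<^sup>2 * norm (?a - ?b) \<le> t\<^sup>2 * (2 * ?e)" by simp
  then have "norm (?a - ?b) \<le> 2 * ?e" using t by (simp add: mult_le_cancel_left)
  then show False using pos by simp
qed

section \<open>Curves and geodesics\<close>

lemma times_differentiable_on_add_const:
  fixes f :: "'a::euclidean_space \<Rightarrow> 'b::real_normed_vector"
  assumes "open S" "times_differentiable_on k f S"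
  shows "times_differentiable_on k (\<lambda>y. f y + c) S"
proof (cases k)
  case (Suc j)
  with assms have f: "times_differentiable_on (Suc j) f S" by simp
  have der: "((\<lambda>y. f y + c) has_derivative frechet_derivative f (at y)) (at y)" if "y \<in> S" for y
    using has_derivative_add[OF has_derivative_frechet[OF f assms(1) that] has_derivative_const[of c]] by simp
  have "times_differentiable_on j (\<lambda>y. frechet_derivative (\<lambda>y. f y + c) (at y) v) S" for v
    using f by (subst times_differentiable_on_cong[OF assms(1), where g="\<lambda>y. frechet_derivative f (at y) v"])
      (simp_all add: frechet_derivative_at[OF der, symmetric])
  moreover have "(\<lambda>y. f y + c) differentiable_on S"
    using der by (auto simp: differentiable_on_def differentiable_def intro: has_derivative_at_withinI)
  ultimately show ?thesis using Suc by simp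
qed simp

lemma smooth_mapE:
  assumes "smooth_map S f" "x \<in> S"
  obtains W g where "open W" "x \<in> W" "\<And>k. times_differentiable_on k g W" "\<And>y. y \<in> S \<inter> W \<Longrightarrow> g y = f y"
proof -
  have "\<exists>W g. open W \<and> x \<in> W \<and> (\<forall>k. times_differentiable_on k g W) \<and> (\<forall>y\<in>S \<inter> W. g y = f y)"
    using assms unfolding smooth_map_def by (rule bspec)
  then obtain W g where "open W \<and> x \<in> W \<and> (\<forall>k. times_differentiable_on k g W) \<and> (\<forall>y\<in>S \<inter> W. g y = f y)"
    by (elim exE)
  then show thesis by (intro that[of W g]) simp_all
qed

lemma velocity_eqI:
  "t \<in> {0..1} \<Longrightarrow> (\<gamma> has_vector_derivative v) (at t within {0..1}) \<Longrightarrow> velocity \<gamma> t = v"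
  unfolding velocity_def using vector_derivative_within_cbox[of 0 1 t \<gamma> v] by (simp add: cbox_interval)

lemma has_vector_derivative_frechet_real:
  fixes g :: "real \<Rightarrow> 'a::real_normed_vector"
  assumes "times_differentiable_on (Suc k) g W" "open W" "s \<in> W"
  shows "(g has_vector_derivative frechet_derivative g (at s) 1) (at s)"
proof -
  have "frechet_derivative g (at s) = (\<lambda>h. h *\<^sub>R frechet_derivative g (at s) 1)"
  proof
    fix h :: real
    have "frechet_derivative g (at s) (h *\<^sub>R 1) = h *\<^sub>R frechet_derivative g (at s) 1"
      by (rule linear_cmul[OF linear_frechet[OF assms]])
    then show "frechet_derivative g (at s) h = h *\<^sub>R frechet_derivative g (at s) 1"
      unfolding real_scaleR_def mult_1_right .
  qed
  then show ?thesis
    unfolding has_vector_derivative_def by (rule has_derivative_eq_rhs[OF has_derivative_frechet[OF assms]])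
qed

text \<open>At the ends of the interval only one-sided derivatives exist. A local smooth extension
  has ordinary derivatives of all orders, and on the interval these agree with those of the
  curve.\<close>

lemma smooth_curve_local:
  fixes \<gamma> :: "real \<Rightarrow> 'a::euclidean_space"
  assumes "smooth_map {0..1} \<gamma>" "t \<in> {0..1}"
  obtains W g where "open W" "t \<in> W" "\<And>k. times_differentiable_on k g W" "\<And>s. s \<in> {0..1} \<inter> W \<Longrightarrow> g s = \<gamma> s"
    "\<And>s. s \<in> {0..1} \<inter> W \<Longrightarrow> (\<gamma> has_vector_derivative frechet_derivative g (at s) 1) (at s within {0..1})"
proof -
  obtain W g where W: "open W" "t \<in> W" "\<And>k. times_differentiable_on k g W" "\<And>s. s \<in> {0..1} \<inter> W \<Longrightarrow> g s = \<gamma> s"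
    by (rule smooth_mapE[OF assms], rule that)
  have "(\<gamma> has_vector_derivative frechet_derivative g (at s) 1) (at s within {0..1})" if s: "s \<in> {0..1} \<inter> W" for s
  proof -
    obtain d where d: "d > 0" "ball s d \<subseteq> W" using W(1) s by (meson IntD2 openE)
    have "(g has_vector_derivative frechet_derivative g (at s) 1) (at s within {0..1})"
      using s by (intro has_vector_derivative_at_within[OF has_vector_derivative_frechet_real[OF W(3) W(1)]]) (rule IntD2)
    then show ?thesis
    proof (rule has_vector_derivative_transform_within[OF _ d(1)])
      show "s \<in> {0..1}" using s by simp
      fix x' assume "x' \<in> {0..1}" "dist x' s < d"
      then show "g x' = \<gamma> x'" using d(2) by (intro W(4)) (auto simp: dist_commute)
    qed
  qed
  with W show ?thesis by (rule that)
qed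

lemma smooth_curve_velocity:
  fixes \<gamma> :: "real \<Rightarrow> 'a::euclidean_space"
  assumes "smooth_map {0..1} \<gamma>" "t \<in> {0..1}"
  shows "(\<gamma> has_vector_derivative velocity \<gamma> t) (at t within {0..1})"
proof -
  obtain W g where "open W" "t \<in> W"
    "\<And>s. s \<in> {0..1} \<inter> W \<Longrightarrow> (\<gamma> has_vector_derivative frechet_derivative g (at s) 1) (at s within {0..1})"
    using smooth_curve_local[OF assms] by metis
  then show ?thesis using velocity_eqI[OF assms(2)] assms(2) by (metis IntI)
qed

lemma smooth_map_velocity:
  fixes \<gamma> :: "real \<Rightarrow> 'a::euclidean_space"
  assumes "smooth_map {0..1} \<gamma>"
  shows "smooth_map {0..1} (velocity \<gamma>)"
  unfolding smooth_map_def
proof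
  fix t :: real assume t: "t \<in> {0..1}"
  obtain W g where W: "open W" "t \<in> W" "\<And>k. times_differentiable_on k g W"
    and v: "\<And>s. s \<in> {0..1} \<inter> W \<Longrightarrow> (\<gamma> has_vector_derivative frechet_derivative g (at s) 1) (at s within {0..1})"
    using smooth_curve_local[OF assms t] by metis
  have "times_differentiable_on k (\<lambda>s. frechet_derivative g (at s) 1) W" for k
    using W(3)[of "Suc k"] by simp
  moreover have "frechet_derivative g (at s) 1 = velocity \<gamma> s" if "s \<in> {0..1} \<inter> W" for s
    using velocity_eqI[of s \<gamma>] v[OF that] that by simp
  ultimately show "\<exists>W h. open W \<and> t \<in> W \<and> (\<forall>k. times_differentiable_on k h W) \<and> (\<forall>y\<in>{0..1} \<inter> W. h y = velocity \<gamma> y)"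
    using W by (intro exI[of _ W] exI[of _ "\<lambda>s. frechet_derivative g (at s) 1"] conjI allI ballI)
qed

lemma smooth_curve_continuous:
  fixes \<gamma> :: "real \<Rightarrow> 'a::euclidean_space"
  assumes "smooth_map {0..1} \<gamma>"
  shows "continuous_on {0..1} \<gamma>"
  using smooth_curve_velocity[OF assms] has_vector_derivative_continuous
  by (metis continuous_on_eq_continuous_within)

text \<open>Near \<open>t\<close> the curve is the parametrization composed with its coordinates.
  Both \<open>\<phi>\<close> and its inverse are replaced by smooth extensions to open sets, since
  \<open>D\<close> may contain boundary points of a half-space; the chain rule then exhibits the
  velocity as a value of the derivative of \<open>\<phi>\<close>.\<close>

lemma velocity_in_tangent_space:
  fixes M :: "(real^'m::finite) set" and \<gamma> :: "real \<Rightarrow> real^'m"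
  assumes M: "submanifold TYPE('d::finite) M" and \<gamma>: "smooth_map {0..1} \<gamma>" "\<gamma> ` {0..1} \<subseteq> M" and t: "t \<in> {0..1}"
  shows "velocity \<gamma> t \<in> tangent_space TYPE('d) M (\<gamma> t)"
proof -
  have "\<gamma> t \<in> M" using \<gamma>(2) t by auto
  then obtain \<phi> and D :: "(real^'d) set" where lp: "local_param M \<phi> D" and x: "\<gamma> t \<in> \<phi> ` D"
    using M unfolding submanifold_def by blast
  then obtain a where a: "a \<in> D" "\<phi> a = \<gamma> t" by auto
  have op: "openin (top_of_set M) (\<phi> ` D)" and bij: "inj_on \<phi> D" and sm: "smooth_map D \<phi>" "smooth_map (\<phi> ` D) (inv_into D \<phi>)"
    using lp unfolding local_param_def diffeomorphism_def bij_betw_def by auto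
  obtain W1 g where W1: "open W1" "a \<in> W1" "\<And>k. times_differentiable_on k g W1" "\<And>y. y \<in> D \<inter> W1 \<Longrightarrow> g y = \<phi> y"
    by (rule smooth_mapE[OF sm(1) a(1)], rule that)
  obtain W2 k where W2: "open W2" "\<gamma> t \<in> W2" "\<And>j. times_differentiable_on j k W2" "\<And>y. y \<in> \<phi> ` D \<inter> W2 \<Longrightarrow> k y = inv_into D \<phi> y"
    by (rule smooth_mapE[OF sm(2) x], rule that)
  obtain O2 where O2: "open O2" "\<phi> ` D = M \<inter> O2" using op by (auto simp: openin_open)
  have dphi: "(\<phi> has_derivative frechet_derivative g (at a)) (at a within D)"
  proof -
    obtain d where d: "d > 0" "ball a d \<subseteq> W1" using W1(1,2) by (meson openE)
    have "(g has_derivative frechet_derivative g (at a)) (at a within D)"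
      using has_derivative_frechet[OF W1(3)[of "Suc 0"] W1(1,2)] by (rule has_derivative_at_withinI)
    then show ?thesis
    proof (rule has_derivative_transform_within[OF _ d(1) a(1)])
      fix x' assume x': "x' \<in> D" "dist x' a < d"
      then have "x' \<in> W1" using d(2) by (auto simp: dist_commute subset_iff)
      then show "g x' = \<phi> x'" using W1(4) x'(1) by blast
    qed
  qed
  have ka: "k (\<gamma> t) = a" using W2(4)[of "\<gamma> t"] x W2(2) a bij by (metis IntI inv_into_f_f)
  let ?c = "\<lambda>s. k (\<gamma> s)"
  let ?c' = "frechet_derivative k (at (\<gamma> t)) (velocity \<gamma> t)"
  have dc: "(?c has_vector_derivative ?c') (at t within {0..1})"
    using vector_derivative_diff_chain_within[OF smooth_curve_velocity[OF \<gamma>(1) t]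
      has_derivative_at_withinI[OF has_derivative_frechet[OF W2(3)[of "Suc 0"] W2(1,2)]]] by (simp add: o_def)
  have "(g has_derivative frechet_derivative g (at a)) (at (?c t) within ?c ` {0..1})"
    unfolding ka using has_derivative_frechet[OF W1(3)[of "Suc 0"] W1(1,2)] by (rule has_derivative_at_withinI)
  from vector_derivative_diff_chain_within[OF dc this]
  have dgc: "((\<lambda>s. g (?c s)) has_vector_derivative frechet_derivative g (at a) ?c') (at t within {0..1})"
    by (simp add: o_def)
  have cont: "continuous (at t within {0..1}) \<gamma>" "continuous (at t within {0..1}) ?c"
    using has_vector_derivative_continuous smooth_curve_velocity[OF \<gamma>(1) t] dc by blast+
  have "\<forall>\<^sub>F s in at t within {0..1}. \<gamma> s \<in> O2 \<inter> W2"
    using cont(1) O2 x W2 unfolding continuous_within by (intro topological_tendstoD) auto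
  moreover have "\<forall>\<^sub>F s in at t within {0..1}. ?c s \<in> W1"
    using cont(2) W1(1,2) ka unfolding continuous_within by (intro topological_tendstoD) auto
  ultimately have "\<forall>\<^sub>F s in at t within {0..1}. \<gamma> s \<in> O2 \<inter> W2 \<and> ?c s \<in> W1" by (rule eventually_conj)
  then obtain d where d: "d > 0" "\<And>s. s \<in> {0..1} \<Longrightarrow> s \<noteq> t \<Longrightarrow> dist s t < d \<Longrightarrow> \<gamma> s \<in> O2 \<inter> W2 \<and> ?c s \<in> W1"
    unfolding eventually_at by blast
  have "(\<gamma> has_vector_derivative frechet_derivative g (at a) ?c') (at t within {0..1})"
  proof (rule has_vector_derivative_transform_within[OF dgc d(1) t])
    fix s assume s: "s \<in> {0..1}" "dist s t < d"
    have in1: "\<gamma> s \<in> O2 \<inter> W2 \<and> ?c s \<in> W1"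
    proof (cases "s = t")
      case True then show ?thesis using O2 x W2(2) ka W1(2) by auto
    next
      case False then show ?thesis using d(2) s by blast
    qed
    have g1: "\<gamma> s \<in> \<phi> ` D" using in1 O2(2) \<gamma>(2) s(1) by auto
    then have "?c s = inv_into D \<phi> (\<gamma> s)" using W2(4) in1 by auto
    then have "?c s \<in> D" "\<phi> (?c s) = \<gamma> s" using g1 by (simp_all add: inv_into_into f_inv_into_f)
    then show "g (?c s) = \<gamma> s" using W1(4) in1 by auto
  qed
  then have "velocity \<gamma> t = frechet_derivative g (at a) ?c'" using t by (intro velocity_eqI)
  then show ?thesis using lp a dphi unfolding tangent_space_def by blast
qed

text \<open>The derivative of the squared speed is twice the product of acceleration and velocity,
  which vanishes because the velocity is tangent. The resulting distance bound is what confines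
  short geodesics to a chart.\<close>

lemma geodesic_speed:
  fixes M :: "(real^'m::finite) set"
  assumes M: "submanifold TYPE('d::finite) M" and g: "geodesic TYPE('d) M \<gamma>" and t: "t \<in> {0..1}"
  shows "norm (velocity \<gamma> t) = norm (velocity \<gamma> 0)" and "norm (\<gamma> t - \<gamma> 0) \<le> norm (velocity \<gamma> 0)"
proof -
  have sm: "smooth_map {0..1} \<gamma>" "\<gamma> ` {0..1} \<subseteq> M"
    and acc: "\<And>t w. t \<in> {0..1} \<Longrightarrow> w \<in> tangent_space TYPE('d) M (\<gamma> t) \<Longrightarrow> velocity (velocity \<gamma>) t \<bullet> w = 0"
    using g unfolding geodesic_def by auto
  have "\<exists>c. \<forall>s\<in>{0..1}. velocity \<gamma> s \<bullet> velocity \<gamma> s = c"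
  proof (rule has_derivative_zero_constant)
    fix s :: real assume s: "s \<in> {0..1}"
    have "(velocity \<gamma> has_derivative (\<lambda>h. h *\<^sub>R velocity (velocity \<gamma>) s)) (at s within {0..1})"
      using smooth_curve_velocity[OF smooth_map_velocity[OF sm(1)] s] by (simp add: has_vector_derivative_def)
    from has_derivative_inner[OF this this]
    have "((\<lambda>s. velocity \<gamma> s \<bullet> velocity \<gamma> s) has_derivative
       (\<lambda>h. velocity \<gamma> s \<bullet> (h *\<^sub>R velocity (velocity \<gamma>) s) + (h *\<^sub>R velocity (velocity \<gamma>) s) \<bullet> velocity \<gamma> s)) (at s within {0..1})" .
    then show "((\<lambda>s. velocity \<gamma> s \<bullet> velocity \<gamma> s) has_derivative (\<lambda>h. 0)) (at s within {0..1})"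
      using acc[OF s velocity_in_tangent_space[OF M sm s]] by (simp add: inner_commute)
  qed simp
  then have sp: "norm (velocity \<gamma> s) = norm (velocity \<gamma> 0)" if "s \<in> {0..1}" for s
    using that by (auto simp: norm_eq)
  then show "norm (velocity \<gamma> t) = norm (velocity \<gamma> 0)" using t by blast
  have "norm (\<gamma> t - \<gamma> 0) \<le> norm (velocity \<gamma> 0) * (t - 0)"
  proof (rule vector_derivative_norm_bound)
    fix s assume s: "s \<in> {0..t}"
    then show "(\<gamma> has_vector_derivative velocity \<gamma> s) (at s within {0..t})"
      using t by (intro has_vector_derivative_within_subset[OF smooth_curve_velocity[OF sm(1)]]) auto
    show "norm (velocity \<gamma> s) \<le> norm (velocity \<gamma> 0)" using sp[of s] s t by simp
  qed (use t in auto)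
  also have "\<dots> \<le> norm (velocity \<gamma> 0) * 1" using t by (intro mult_left_mono) auto
  finally show "norm (\<gamma> t - \<gamma> 0) \<le> norm (velocity \<gamma> 0)" by simp
qed

text \<open>A product rule in which base point and direction both move. Differentiability of the
  first derivative is available for fixed directions only, so the moving direction is expanded in
  the basis.\<close>

lemma has_vector_derivative_frechet_along:
  fixes f :: "'a::euclidean_space \<Rightarrow> 'b::euclidean_space"
  assumes f: "times_differentiable_on 2 f S" and S: "open S"
    and c: "(c has_vector_derivative c') (at t within T)" and v: "(v has_vector_derivative v') (at t within T)"
    and T: "\<And>s. s \<in> T \<Longrightarrow> c s \<in> S" and t: "t \<in> T"
  shows "((\<lambda>s. frechet_derivative f (at (c s)) (v s)) has_vector_derivative
     deriv2 f (c t) (v t) c' + frechet_derivative f (at (c t)) v') (at t within T)"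
proof -
  have f2: "times_differentiable_on (Suc (Suc 0)) f S" using f by (simp add: numeral_2_eq_2)
  note f1 = times_differentiable_on_SucD[OF f2]
  have exp: "frechet_derivative f (at x) u = (\<Sum>b\<in>Basis. (u \<bullet> b) *\<^sub>R frechet_derivative f (at x) b)" if "x \<in> S" for x u
    by (subst euclidean_representation[of u, symmetric])
      (simp add: linear_sum[OF linear_frechet[OF f1 S that]] linear_cmul[OF linear_frechet[OF f1 S that]])
  have exp2: "deriv2 f x u w = (\<Sum>b\<in>Basis. (u \<bullet> b) *\<^sub>R deriv2 f x b w)" if "x \<in> S" for x u w
    by (subst euclidean_representation[of u, symmetric])
      (simp add: linear_sum[OF linear_deriv2_left[OF f2 S that]] linear_cmul[OF linear_deriv2_left[OF f2 S that]])
  have vb: "((\<lambda>s. v s \<bullet> b) has_vector_derivative v' \<bullet> b) (at t within T)" for b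
    using has_derivative_inner_left[OF v[unfolded has_vector_derivative_def], of b] by (simp add: has_vector_derivative_def)
  have fb: "((\<lambda>s. frechet_derivative f (at (c s)) b) has_vector_derivative deriv2 f (c t) b c') (at t within T)" for b
    using vector_derivative_diff_chain_within[OF c has_derivative_at_withinI[OF has_derivative_deriv2[OF f2 S T[OF t], of b]]]
    by (simp add: o_def)
  have "((\<lambda>s. \<Sum>b\<in>Basis. (v s \<bullet> b) *\<^sub>R frechet_derivative f (at (c s)) b) has_vector_derivative
     (\<Sum>b\<in>Basis. (v t \<bullet> b) *\<^sub>R deriv2 f (c t) b c' + (v' \<bullet> b) *\<^sub>R frechet_derivative f (at (c t)) b)) (at t within T)"
    by (intro has_vector_derivative_sum has_vector_derivative_scaleR[OF _ fb])
      (use vb in \<open>simp add: has_real_derivative_iff_has_vector_derivative\<close>)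
  also have "(\<Sum>b\<in>Basis. (v t \<bullet> b) *\<^sub>R deriv2 f (c t) b c' + (v' \<bullet> b) *\<^sub>R frechet_derivative f (at (c t)) b) =
     deriv2 f (c t) (v t) c' + frechet_derivative f (at (c t)) v'"
    by (simp add: sum.distrib exp2[OF T[OF t], of "v t"] exp[OF T[OF t], of v'])
  finally show ?thesis
    by (rule has_vector_derivative_transform[OF t, rotated]) (rule exp[OF T])
qed

text \<open>By the mean value theorem \<open>exp (- K * t) * E t\<close> does not exceed its initial
  value 0.\<close>

lemma gronwall_zero:
  fixes E :: "real \<Rightarrow> real"
  assumes "\<And>t. t \<in> {0..1} \<Longrightarrow> (E has_vector_derivative E' t) (at t within {0..1})"
    and "\<And>t. t \<in> {0..1} \<Longrightarrow> E' t \<le> K * E t" and "E 0 = 0" and t: "t \<in> {0..1}"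
  shows "E t \<le> 0"
proof -
  let ?F = "\<lambda>t. exp (- K * t) * E t"
  have "\<exists>x\<in>{0..t}. ?F t - ?F 0 = (\<lambda>h. h * (exp (- K * x) * (E' x - K * E x))) (t - 0)"
  proof (rule mvt_very_simple)
    show "0 \<le> t" using t by simp
    fix x assume x: "0 \<le> x" "x \<le> t"
    have "(E has_vector_derivative E' x) (at x within {0..t})"
      using x t by (intro has_vector_derivative_within_subset[OF assms(1)]) auto
    then have "(E has_field_derivative E' x) (at x within {0..t})"
      by (simp add: has_real_derivative_iff_has_vector_derivative)
    then have "(?F has_field_derivative exp (- K * x) * (E' x - K * E x)) (at x within {0..t})"
      by (auto intro!: derivative_eq_intros simp: algebra_simps)
    then show "(?F has_derivative (\<lambda>h. h * (exp (- K * x) * (E' x - K * E x)))) (at x within {0..t})"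
      by (simp add: has_field_derivative_def mult.commute[of _ "exp _ * _"])
  qed
  then obtain x where x: "x \<in> {0..t}" "?F t = t * (exp (- K * x) * (E' x - K * E x))" using assms(3) by auto
  have "E' x - K * E x \<le> 0" using assms(2)[of x] x t by auto
  then have "?F t \<le> 0" unfolding x(2) using t by (intro mult_nonneg_nonpos) auto
  then show ?thesis by (simp add: mult_le_0_iff)
qed

text \<open>In coordinates the geodesic equation says only that the ambient acceleration is
  orthogonal to the image of the differential. An energy made of the coordinate difference and the
  pushed-forward velocity difference satisfies a Gronwall inequality: the unknown acceleration
  \<open>a1\<close> enters only through products to which the orthogonality relations apply.\<close>

lemma geodesic_equation_unique:
  fixes \<psi> :: "'a::euclidean_space \<Rightarrow> 'b::euclidean_space"
  assumes \<psi>: "times_differentiable_on 4 \<psi> S" and S: "open S" "cball 0 r \<subseteq> S"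
    and \<Lambda>: "0 \<le> \<Lambda>" "\<And>y w. y \<in> cball 0 r \<Longrightarrow> norm w \<le> \<Lambda> * norm (frechet_derivative \<psi> (at y) w)"
    and c: "\<And>t. t \<in> {0..1} \<Longrightarrow> c1 t \<in> cball 0 r" "\<And>t. t \<in> {0..1} \<Longrightarrow> c2 t \<in> cball 0 r"
    and dc: "\<And>t. t \<in> {0..1} \<Longrightarrow> (c1 has_vector_derivative u1 t) (at t within {0..1})"
      "\<And>t. t \<in> {0..1} \<Longrightarrow> (c2 has_vector_derivative u2 t) (at t within {0..1})"
    and du: "\<And>t. t \<in> {0..1} \<Longrightarrow> (u1 has_vector_derivative a1 t) (at t within {0..1})"
      "\<And>t. t \<in> {0..1} \<Longrightarrow> (u2 has_vector_derivative a2 t) (at t within {0..1})"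
    and B: "\<And>t. t \<in> {0..1} \<Longrightarrow> norm (u1 t) \<le> B" "\<And>t. t \<in> {0..1} \<Longrightarrow> norm (u2 t) \<le> B"
      "\<And>t. t \<in> {0..1} \<Longrightarrow> norm (a2 t) \<le> B"
    and ge1: "\<And>t w. t \<in> {0..1} \<Longrightarrow> (deriv2 \<psi> (c1 t) (u1 t) (u1 t) + frechet_derivative \<psi> (at (c1 t)) (a1 t)) \<bullet> frechet_derivative \<psi> (at (c1 t)) w = 0"
    and ge2: "\<And>t w. t \<in> {0..1} \<Longrightarrow> (deriv2 \<psi> (c2 t) (u2 t) (u2 t) + frechet_derivative \<psi> (at (c2 t)) (a2 t)) \<bullet> frechet_derivative \<psi> (at (c2 t)) w = 0"
    and init: "c1 0 = c2 0" "u1 0 = u2 0" and t: "t \<in> {0..1}"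
  shows "c1 t = c2 t"
proof -
  have \<psi>3: "times_differentiable_on (Suc (Suc 0)) \<psi> S" using \<psi> by (rule times_differentiable_on_le) simp
  then have \<psi>2: "times_differentiable_on 2 \<psi> S" by (simp add: numeral_2_eq_2)
  note \<psi>1 = times_differentiable_on_SucD[OF \<psi>3]
  define D1 where "D1 y w = frechet_derivative \<psi> (at y) w" for y w
  define D2 where "D2 = deriv2 \<psi>"
  obtain C where C: "C > 0" and bounds: "\<And>x y v w. x \<in> cball 0 r \<Longrightarrow> y \<in> cball 0 r \<Longrightarrow>
     norm (D1 x v) \<le> C * norm v \<and> norm (D1 x v - D1 y v) \<le> C * norm (x - y) * norm v \<and>
     norm (D2 x v w) \<le> C * norm v * norm w \<and> norm (D2 x v w - D2 y v w) \<le> C * norm (x - y) * norm v * norm w"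
    using smooth_bounds_cball[OF \<psi> S] unfolding D1_def D2_def by metis
  have linD1: "linear (D1 y)" if "y \<in> cball 0 r" for y
    unfolding D1_def using linear_frechet[OF \<psi>1 S(1)] that S(2) by (auto simp: subset_iff)
  have linD2: "linear (D2 y v)" "linear (\<lambda>v. D2 y v w)" if "y \<in> cball 0 r" for y v w
    unfolding D2_def using linear_deriv2_right[OF \<psi>3 S(1)] linear_deriv2_left[OF \<psi>3 S(1)] that S(2) by (auto simp: subset_iff)
  define \<delta> where "\<delta> t = c1 t - c2 t" for t
  define \<eta> where "\<eta> t = u1 t - u2 t" for t
  \<comment> \<open>The velocity difference is measured in the ambient space, since there the
    orthogonality relations can be tested with it; \<open>\<Lambda>\<close> recovers
    \<open>\<eta>\<close> from \<open>w\<close>.\<close>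
  define w where "w t = D1 (c1 t) (\<eta> t)" for t
  define w' where "w' t = D2 (c1 t) (\<eta> t) (u1 t) + D1 (c1 t) (a1 t - a2 t)" for t
  have d\<delta>: "(\<delta> has_vector_derivative \<eta> t) (at t within {0..1})" if "t \<in> {0..1}" for t
    unfolding \<delta>_def \<eta>_def using dc that by (intro has_vector_derivative_diff) auto
  have d\<eta>: "(\<eta> has_vector_derivative a1 t - a2 t) (at t within {0..1})" if "t \<in> {0..1}" for t
    unfolding \<eta>_def using du that by (intro has_vector_derivative_diff) auto
  have dw: "(w has_vector_derivative w' t) (at t within {0..1})" if t: "t \<in> {0..1}" for t
    unfolding w_def w'_def D1_def D2_def
    using c(1) S(2) by (intro has_vector_derivative_frechet_along[OF \<psi>2 S(1) dc(1)[OF t] d\<eta>[OF t] _ t]) auto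
  define E where "E t = \<delta> t \<bullet> \<delta> t + w t \<bullet> w t" for t
  define E' where "E' t = 2 * (\<delta> t \<bullet> \<eta> t) + 2 * (w t \<bullet> w' t)" for t
  have dE: "(E has_vector_derivative E' t) (at t within {0..1})" if t: "t \<in> {0..1}" for t
  proof -
    have "((\<lambda>t. \<delta> t \<bullet> \<delta> t) has_vector_derivative (\<delta> t \<bullet> \<eta> t + \<eta> t \<bullet> \<delta> t)) (at t within {0..1})"
      using has_derivative_inner[OF d\<delta>[OF t, unfolded has_vector_derivative_def] d\<delta>[OF t, unfolded has_vector_derivative_def]]
      by (simp add: has_vector_derivative_def algebra_simps)
    moreover have "((\<lambda>t. w t \<bullet> w t) has_vector_derivative (w t \<bullet> w' t + w' t \<bullet> w t)) (at t within {0..1})"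
      using has_derivative_inner[OF dw[OF t, unfolded has_vector_derivative_def] dw[OF t, unfolded has_vector_derivative_def]]
      by (simp add: has_vector_derivative_def algebra_simps)
    ultimately have "((\<lambda>t. \<delta> t \<bullet> \<delta> t + w t \<bullet> w t) has_vector_derivative
       (\<delta> t \<bullet> \<eta> t + \<eta> t \<bullet> \<delta> t) + (w t \<bullet> w' t + w' t \<bullet> w t)) (at t within {0..1})"
      by (rule has_vector_derivative_add)
    then show ?thesis unfolding E_def E'_def by (simp add: inner_commute)
  qed
  \<comment> \<open>\<open>K1\<close> is the sum of the coefficients of
    \<open>norm (\<delta> t) * norm (\<eta> t)\<close> in \<open>q1\<close> to \<open>q4\<close>,
    and it also dominates the square term of \<open>q2\<close>. In \<open>K\<close> the factor
    \<open>1 + \<Lambda>\<^sup>2\<close> passes from \<open>\<eta>\<close> back to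
    \<open>w\<close>.\<close>
  define K1 where "K1 = 2 * C\<^sup>2 * B\<^sup>2 + 2 * C\<^sup>2 * B"
  define K where "K = (2 + 4 * K1 + 2 * (C\<^sup>2 * B)) * (1 + \<Lambda>\<^sup>2)"
  have B0: "0 \<le> B" using B(1)[of 0] norm_ge_zero[of "u1 0"] by (simp del: norm_ge_zero)
  have K1: "0 \<le> K1" using B0 by (simp add: K1_def)
  have bE: "E' t \<le> K * E t" if t: "t \<in> {0..1}" for t
  proof -
    note y1 = c(1)[OF t] and y2 = c(2)[OF t]
    \<comment> \<open>The second geodesic may be tested only with vectors tangent at
      \<open>c2 t\<close>, hence a second copy of the velocity difference, pushed forward
      there.\<close>
    define wt where "wt = D1 (c2 t) (\<eta> t)"
    let ?d = "norm (\<delta> t)" and ?h = "norm (\<eta> t)"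
    have nw: "norm (w t) \<le> C * ?h" and nwt: "norm wt \<le> C * ?h"
      unfolding w_def wt_def using bounds[OF y1 y1] bounds[OF y2 y2] by auto
    have ndiff: "norm (w t - wt) \<le> C * ?d * ?h"
      unfolding w_def wt_def \<delta>_def using bounds[OF y1 y2] by auto
    have na2: "norm (a2 t) \<le> B" "norm (u1 t) \<le> B" "norm (u2 t) \<le> B" using B t by auto
    have g1: "w t \<bullet> D1 (c1 t) (a1 t) = - (w t \<bullet> D2 (c1 t) (u1 t) (u1 t))"
      using ge1[OF t, of "\<eta> t"] inner_commute[of "w t" "D1 (c1 t) (a1 t)"] inner_commute[of "w t" "D2 (c1 t) (u1 t) (u1 t)"]
      unfolding w_def D1_def D2_def inner_add_left by linarith
    have g2: "wt \<bullet> D1 (c2 t) (a2 t) = - (wt \<bullet> D2 (c2 t) (u2 t) (u2 t))"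
      using ge2[OF t, of "\<eta> t"] inner_commute[of wt "D1 (c2 t) (a2 t)"] inner_commute[of wt "D2 (c2 t) (u2 t) (u2 t)"]
      unfolding wt_def D1_def D2_def inner_add_left by linarith
    have s1: "D2 (c1 t) (u1 t) (u1 t) - D2 (c2 t) (u2 t) (u2 t) =
       (D2 (c1 t) (u1 t) (u1 t) - D2 (c2 t) (u1 t) (u1 t)) + D2 (c2 t) (\<eta> t) (u1 t) + D2 (c2 t) (u2 t) (\<eta> t)"
      using linear_diff[OF linD2(1)[OF y2]] linear_diff[OF linD2(2)[OF y2]] by (simp add: \<eta>_def)
    have n1: "norm (D2 (c1 t) (u1 t) (u1 t) - D2 (c2 t) (u2 t) (u2 t)) \<le> C * ?d * B\<^sup>2 + 2 * (C * ?h * B)"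
    proof -
      have "norm (D2 (c1 t) (u1 t) (u1 t) - D2 (c2 t) (u1 t) (u1 t)) \<le> C * ?d * norm (u1 t) * norm (u1 t)"
        unfolding \<delta>_def using bounds[OF y1 y2] by auto
      also have "\<dots> \<le> C * ?d * B * B" using na2 C B0 by (intro mult_mono mult_left_mono) auto
      finally have p1: "norm (D2 (c1 t) (u1 t) (u1 t) - D2 (c2 t) (u1 t) (u1 t)) \<le> C * ?d * B\<^sup>2" by (simp add: power2_eq_square mult.assoc)
      have "norm (D2 (c2 t) (\<eta> t) (u1 t)) \<le> C * ?h * norm (u1 t)" using bounds[OF y2 y2] by auto
      also have "\<dots> \<le> C * ?h * B" using na2 C by (intro mult_left_mono) auto
      finally have p2: "norm (D2 (c2 t) (\<eta> t) (u1 t)) \<le> C * ?h * B" .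
      have "norm (D2 (c2 t) (u2 t) (\<eta> t)) \<le> C * norm (u2 t) * ?h" using bounds[OF y2 y2] by auto
      also have "\<dots> \<le> C * B * ?h" using na2 C by (intro mult_right_mono mult_left_mono) auto
      finally have p3: "norm (D2 (c2 t) (u2 t) (\<eta> t)) \<le> C * ?h * B" by (simp add: mult_ac)
      show ?thesis unfolding s1 using p1 p2 p3 by (intro order_trans[OF norm_triangle_ineq] order_trans[OF add_right_mono[OF norm_triangle_ineq]]) linarith
    qed
    \<comment> \<open>The two geodesic equations eliminate \<open>a1\<close> and leave only terms
      carrying a difference between the two solutions, so that every term is quadratic in
      \<open>\<delta>\<close> and \<open>\<eta>\<close>.\<close>
    have eq: "w t \<bullet> w' t = w t \<bullet> D2 (c1 t) (\<eta> t) (u1 t) - (w t - wt) \<bullet> D2 (c1 t) (u1 t) (u1 t)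
       - wt \<bullet> (D2 (c1 t) (u1 t) (u1 t) - D2 (c2 t) (u2 t) (u2 t)) - (w t - wt) \<bullet> D1 (c1 t) (a2 t)
       - wt \<bullet> (D1 (c1 t) (a2 t) - D1 (c2 t) (a2 t))"
      using g1 g2 linear_diff[OF linD1[OF y1], of "a1 t" "a2 t"]
      by (simp add: w'_def inner_add_right inner_diff_left inner_diff_right)
    have q0: "w t \<bullet> D2 (c1 t) (\<eta> t) (u1 t) \<le> C\<^sup>2 * B * ?h\<^sup>2"
    proof -
      have "norm (D2 (c1 t) (\<eta> t) (u1 t)) \<le> C * ?h * norm (u1 t)" using bounds[OF y1 y1] by auto
      also have "\<dots> \<le> C * ?h * B" using na2 C by (intro mult_left_mono) auto
      finally have "norm (w t) * norm (D2 (c1 t) (\<eta> t) (u1 t)) \<le> (C * ?h) * (C * ?h * B)"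
        using nw C B0 by (intro mult_mono) auto
      then show ?thesis using norm_cauchy_schwarz[of "w t" "D2 (c1 t) (\<eta> t) (u1 t)"] by (simp add: power2_eq_square mult_ac)
    qed
    have q1: "- ((w t - wt) \<bullet> D2 (c1 t) (u1 t) (u1 t)) \<le> C\<^sup>2 * B\<^sup>2 * (?d * ?h)"
    proof -
      have "norm (D2 (c1 t) (u1 t) (u1 t)) \<le> C * norm (u1 t) * norm (u1 t)" using bounds[OF y1 y1] by auto
      also have "\<dots> \<le> C * B * B" using na2 C B0 by (intro mult_mono mult_left_mono) auto
      finally have "norm (w t - wt) * norm (D2 (c1 t) (u1 t) (u1 t)) \<le> (C * ?d * ?h) * (C * B * B)"
        using ndiff C B0 by (intro mult_mono) auto
      then show ?thesis using Cauchy_Schwarz_ineq2[of "w t - wt" "D2 (c1 t) (u1 t) (u1 t)"] by (simp add: power2_eq_square mult_ac)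
    qed
    have q2: "- (wt \<bullet> (D2 (c1 t) (u1 t) (u1 t) - D2 (c2 t) (u2 t) (u2 t))) \<le> C\<^sup>2 * B\<^sup>2 * (?d * ?h) + 2 * C\<^sup>2 * B * ?h\<^sup>2"
    proof -
      have "norm wt * norm (D2 (c1 t) (u1 t) (u1 t) - D2 (c2 t) (u2 t) (u2 t)) \<le> (C * ?h) * (C * ?d * B\<^sup>2 + 2 * (C * ?h * B))"
        using nwt n1 C by (intro mult_mono) auto
      also have "\<dots> = C\<^sup>2 * B\<^sup>2 * (?d * ?h) + 2 * C\<^sup>2 * B * ?h\<^sup>2" by (simp add: power2_eq_square algebra_simps)
      finally show ?thesis using Cauchy_Schwarz_ineq2[of wt "D2 (c1 t) (u1 t) (u1 t) - D2 (c2 t) (u2 t) (u2 t)"] by linarith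
    qed
    have q3: "- ((w t - wt) \<bullet> D1 (c1 t) (a2 t)) \<le> C\<^sup>2 * B * (?d * ?h)"
    proof -
      have "norm (D1 (c1 t) (a2 t)) \<le> C * norm (a2 t)" using bounds[OF y1 y1] by auto
      also have "\<dots> \<le> C * B" using na2 C by (intro mult_left_mono) auto
      finally have "norm (w t - wt) * norm (D1 (c1 t) (a2 t)) \<le> (C * ?d * ?h) * (C * B)"
        using ndiff C B0 by (intro mult_mono) auto
      then show ?thesis using Cauchy_Schwarz_ineq2[of "w t - wt" "D1 (c1 t) (a2 t)"] by (simp add: power2_eq_square mult_ac)
    qed
    have q4: "- (wt \<bullet> (D1 (c1 t) (a2 t) - D1 (c2 t) (a2 t))) \<le> C\<^sup>2 * B * (?d * ?h)"
    proof -
      have "norm (D1 (c1 t) (a2 t) - D1 (c2 t) (a2 t)) \<le> C * ?d * norm (a2 t)" unfolding \<delta>_def using bounds[OF y1 y2] by auto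
      also have "\<dots> \<le> C * ?d * B" using na2 C by (intro mult_left_mono) auto
      finally have "norm wt * norm (D1 (c1 t) (a2 t) - D1 (c2 t) (a2 t)) \<le> (C * ?h) * (C * ?d * B)"
        using nwt C B0 by (intro mult_mono) auto
      then show ?thesis using Cauchy_Schwarz_ineq2[of wt "D1 (c1 t) (a2 t) - D1 (c2 t) (a2 t)"] by (simp add: power2_eq_square mult_ac)
    qed
    have dh: "?d * ?h \<le> ?d\<^sup>2 + ?h\<^sup>2"
      using sum_squares_bound[of ?d ?h] by (simp add: mult.assoc) (smt (verit) mult_nonneg_nonneg norm_ge_zero)
    have k1: "w t \<bullet> w' t \<le> C\<^sup>2 * B * ?h\<^sup>2 + K1 * (?d * ?h) + K1 * ?h\<^sup>2"
    proof -
      have "2 * C\<^sup>2 * B * ?h\<^sup>2 \<le> K1 * ?h\<^sup>2" unfolding K1_def by (intro mult_right_mono) auto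
      moreover have "K1 * (?d * ?h) = 2 * (C\<^sup>2 * B\<^sup>2 * (?d * ?h)) + 2 * (C\<^sup>2 * B * (?d * ?h))"
        by (simp add: K1_def algebra_simps)
      ultimately show ?thesis unfolding eq using q0 q1 q2 q3 q4 by linarith
    qed
    have "\<delta> t \<bullet> \<eta> t \<le> ?d\<^sup>2 + ?h\<^sup>2" using norm_cauchy_schwarz[of "\<delta> t" "\<eta> t"] dh by linarith
    moreover have "K1 * (?d * ?h) \<le> K1 * (?d\<^sup>2 + ?h\<^sup>2)" using dh K1 by (rule mult_left_mono)
    ultimately have "E' t \<le> 2 * (?d\<^sup>2 + ?h\<^sup>2) + 2 * (C\<^sup>2 * B * ?h\<^sup>2 + K1 * (?d\<^sup>2 + ?h\<^sup>2) + K1 * ?h\<^sup>2)"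
    proof -
      have "2 * a + 2 * b \<le> 2 * s + 2 * (c + m + k)" if "a \<le> s" "q \<le> m" "b \<le> c + q + k" for a b s c m k q :: real
      proof -
        have "b \<le> c + m + k" using that(2,3) by simp
        then show ?thesis using that(1) by simp
      qed
      then show ?thesis unfolding E'_def using k1 \<open>\<delta> t \<bullet> \<eta> t \<le> ?d\<^sup>2 + ?h\<^sup>2\<close> \<open>K1 * (?d * ?h) \<le> K1 * (?d\<^sup>2 + ?h\<^sup>2)\<close> by blast
    qed
    also have "\<dots> \<le> (2 + 4 * K1 + 2 * (C\<^sup>2 * B)) * (?d\<^sup>2 + ?h\<^sup>2)"
    proof -
      have "0 \<le> K1 * ?d\<^sup>2" "0 \<le> (C\<^sup>2 * B) * ?d\<^sup>2" using K1 B0 by auto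
      then show ?thesis by (simp add: algebra_simps)
    qed
    also have "\<dots> \<le> (2 + 4 * K1 + 2 * (C\<^sup>2 * B)) * ((1 + \<Lambda>\<^sup>2) * E t)"
    proof (intro mult_left_mono)
      have "?h \<le> \<Lambda> * norm (w t)" unfolding w_def D1_def by (rule \<Lambda>(2)[OF y1])
      then have "?h\<^sup>2 \<le> (\<Lambda> * norm (w t))\<^sup>2" by (intro power_mono) auto
      then have "?h\<^sup>2 \<le> \<Lambda>\<^sup>2 * (w t \<bullet> w t)" by (simp add: power_mult_distrib power2_norm_eq_inner)
      moreover have "0 \<le> \<Lambda>\<^sup>2 * (\<delta> t \<bullet> \<delta> t)" "0 \<le> w t \<bullet> w t" by auto
      moreover have "?d\<^sup>2 + ?h\<^sup>2 \<le> (1 + \<Lambda>\<^sup>2) * E t"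
        if "?h\<^sup>2 \<le> \<Lambda>\<^sup>2 * (w t \<bullet> w t)" "0 \<le> \<Lambda>\<^sup>2 * (\<delta> t \<bullet> \<delta> t)" "0 \<le> w t \<bullet> w t"
      proof -
        have "(1 + \<Lambda>\<^sup>2) * E t = \<delta> t \<bullet> \<delta> t + w t \<bullet> w t + \<Lambda>\<^sup>2 * (\<delta> t \<bullet> \<delta> t) + \<Lambda>\<^sup>2 * (w t \<bullet> w t)"
          by (simp add: E_def algebra_simps)
        then show ?thesis using that unfolding power2_norm_eq_inner[of "\<delta> t"] by linarith
      qed
      ultimately show "?d\<^sup>2 + ?h\<^sup>2 \<le> (1 + \<Lambda>\<^sup>2) * E t" by blast
      show "0 \<le> 2 + 4 * K1 + 2 * (C\<^sup>2 * B)" using K1 B0 by simp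
    qed
    finally show ?thesis by (simp add: K_def mult.assoc)
  qed
  have "w 0 = 0"
    using init linear_0[OF linD1[OF c(1)[of 0]]] by (simp add: w_def \<eta>_def)
  then have "E 0 = 0" using init by (simp add: E_def \<delta>_def)
  from gronwall_zero[OF dE bE this t] have "E t \<le> 0" .
  then have "\<delta> t \<bullet> \<delta> t \<le> 0" unfolding E_def using inner_ge_zero[of "w t"] by linarith
  then have "\<delta> t = 0" by (metis inner_eq_zero_iff inner_ge_zero order_antisym)
  then show ?thesis by (simp add: \<delta>_def)
qed

section \<open>Charts of a submanifold\<close>

text \<open>An interior chart centred at \<open>p\<close>. The inverse \<open>\<kappa>\<close> is
  given on an ambient open set, so that it has ordinary derivatives; inverse relations are required
  only from the ball side.\<close>

locale chart_at =
  fixes M :: "(real^'m::finite) set" and p :: "real^'m" and \<psi> :: "real^'d::finite \<Rightarrow> real^'m"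
    and \<kappa> :: "real^'m \<Rightarrow> real^'d" and W :: "(real^'m) set" and R :: real
  assumes M: "submanifold TYPE('d) M" and R: "0 < R"
    and smooth_\<psi>: "\<And>k. times_differentiable_on k \<psi> (ball 0 R)"
    and W: "open W" and smooth_\<kappa>: "\<And>k. times_differentiable_on k \<kappa> W"
    and \<psi>_0: "\<psi> 0 = p"
    and \<psi>_W: "\<And>y. y \<in> ball 0 R \<Longrightarrow> \<psi> y \<in> W" and \<kappa>_\<psi>: "\<And>y. y \<in> ball 0 R \<Longrightarrow> \<kappa> (\<psi> y) = y"
    and image_open: "openin (top_of_set M) (\<psi> ` ball 0 R)"
begin

text \<open>\<open>local_param\<close> wants a domain that is relatively open in a coordinate
  half-space. Translation by \<open>corner\<close> moves the ball of radius \<open>R\<close> into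
  one; the coordinate chosen is arbitrary.\<close>

definition corner :: "real^'d" where "corner = R *\<^sub>R axis undefined 1"

lemma smooth_\<psi>_Suc: "times_differentiable_on (Suc (Suc 0)) \<psi> (ball 0 R)"
  by (rule smooth_\<psi>)

lemma der_\<psi>: "y \<in> ball 0 R \<Longrightarrow> (\<psi> has_derivative frechet_derivative \<psi> (at y)) (at y)"
  by (rule has_derivative_frechet[OF smooth_\<psi> open_ball])

lemma der_\<kappa>: "x \<in> W \<Longrightarrow> (\<kappa> has_derivative frechet_derivative \<kappa> (at x)) (at x)"
  by (rule has_derivative_frechet[OF smooth_\<kappa> W])

lemma linear_D\<psi>: "y \<in> ball 0 R \<Longrightarrow> linear (frechet_derivative \<psi> (at y))"
  by (rule linear_frechet[OF smooth_\<psi> open_ball])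

lemma D\<kappa>_D\<psi>:
  assumes y: "y \<in> ball 0 R"
  shows "frechet_derivative \<kappa> (at (\<psi> y)) (frechet_derivative \<psi> (at y) w) = w"
proof -
  have "((\<lambda>z. \<kappa> (\<psi> z)) has_derivative (\<lambda>w. frechet_derivative \<kappa> (at (\<psi> y)) (frechet_derivative \<psi> (at y) w))) (at y)"
    using diff_chain_at[OF der_\<psi>[OF y] der_\<kappa>[OF \<psi>_W[OF y]]] by (simp add: o_def)
  moreover have "((\<lambda>z. \<kappa> (\<psi> z)) has_derivative (\<lambda>w. w)) (at y)"
    by (rule has_derivative_transform_within_open[OF has_derivative_ident open_ball y]) (simp only: \<kappa>_\<psi>)
  ultimately have "(\<lambda>w. frechet_derivative \<kappa> (at (\<psi> y)) (frechet_derivative \<psi> (at y) w)) = (\<lambda>w. w)"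
    by (rule has_derivative_unique)
  then show ?thesis by (rule fun_cong)
qed

lemma image_ball_subset: "\<psi> ` ball 0 R \<subseteq> M"
  using image_open by (rule openin_imp_subset)

lemma p_in_M: "p \<in> M"
  using image_ball_subset R \<psi>_0 by force

lemma p_in_W: "p \<in> W"
  using \<psi>_W[of 0] R by (simp add: \<psi>_0)

lemma \<kappa>_p: "\<kappa> p = 0"
  using \<kappa>_\<psi>[of 0] R by (simp add: \<psi>_0)

lemma local_param_shift: "local_param M (\<lambda>y. \<psi> (y - corner)) (ball corner R)"
proof -
  let ?\<phi> = "\<lambda>y. \<psi> (y - corner)" and ?D = "ball corner R"
  have inball: "y - corner \<in> ball 0 R \<longleftrightarrow> y \<in> ?D" for y
    by (simp add: dist_norm norm_minus_commute)
  have im: "?\<phi> ` ?D = \<psi> ` ball 0 R"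
  proof (intro equalityI image_subsetI)
    fix y assume "y \<in> ?D" then show "?\<phi> y \<in> \<psi> ` ball 0 R" using inball by blast
  next
    fix y :: "real^'d" assume "y \<in> ball 0 R"
    then have "y + corner \<in> ?D" using inball[of "y + corner"] by simp
    then show "\<psi> y \<in> ?\<phi> ` ?D" by (intro image_eqI[of _ _ "y + corner"]) auto
  qed
  have half: "?D \<subseteq> {y. 0 \<le> y $ undefined}"
  proof
    fix y assume "y \<in> ?D"
    then have "\<bar>(corner - y) $ undefined\<bar> < R"
      using component_le_norm_cart[of "corner - y" undefined] by (simp add: dist_norm)
    then show "y \<in> {y. 0 \<le> y $ undefined}" by (simp add: corner_def)
  qed
  have o1: "openin (top_of_set {y. 0 \<le> y $ undefined}) ?D"
    unfolding openin_open by (intro exI[of _ ?D]) (use half in auto)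
  have inj: "inj_on ?\<phi> ?D"
  proof (rule inj_onI)
    fix x y assume xy: "x \<in> ?D" "y \<in> ?D" "?\<phi> x = ?\<phi> y"
    then have "x - corner = y - corner" using \<kappa>_\<psi>[of "x - corner"] \<kappa>_\<psi>[of "y - corner"] inball by metis
    then show "x = y" by simp
  qed
  have s1: "smooth_map ?D ?\<phi>"
    unfolding smooth_map_def
  proof
    fix x assume x: "x \<in> ?D"
    have pre: "{y. y + (- corner) \<in> ball 0 R} = ?D"
      by (rule set_eqI) (simp only: mem_Collect_eq inball diff_conv_add_uminus[symmetric])
    have "times_differentiable_on k ?\<phi> ?D" for k
    proof -
      have "times_differentiable_on k (\<lambda>y. \<psi> (y + (- corner))) {y. y + (- corner) \<in> ball 0 R}"
        by (rule times_differentiable_on_affine[where L="\<lambda>x. x"]) (rule open_ball bounded_linear_ident smooth_\<psi>)+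
      then show ?thesis unfolding pre by (simp only: diff_conv_add_uminus)
    qed
    then show "\<exists>W g. open W \<and> x \<in> W \<and> (\<forall>k. times_differentiable_on k g W) \<and> (\<forall>y\<in>?D \<inter> W. g y = ?\<phi> y)"
      using x by (intro exI[of _ ?D] exI[of _ ?\<phi>]) simp
  qed
  have s2: "smooth_map (?\<phi> ` ?D) (inv_into ?D ?\<phi>)"
    unfolding smooth_map_def
  proof
    fix x assume "x \<in> ?\<phi> ` ?D"
    then have xW: "x \<in> W" unfolding im using \<psi>_W by auto
    have td: "times_differentiable_on k (\<lambda>x. \<kappa> x + corner) W" for k
      by (rule times_differentiable_on_add_const[OF W smooth_\<kappa>])
    have eq: "\<kappa> x + corner = inv_into ?D ?\<phi> x" if xi: "x \<in> ?\<phi> ` ?D" for x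
    proof -
      obtain y where y: "y \<in> ?D" "x = ?\<phi> y" using xi by auto
      then show ?thesis using inv_into_f_f[OF inj y(1)] \<kappa>_\<psi>[of "y - corner"] inball[of y] by simp
    qed
    show "\<exists>W g. open W \<and> x \<in> W \<and> (\<forall>k. times_differentiable_on k g W) \<and> (\<forall>y\<in>?\<phi> ` ?D \<inter> W. g y = inv_into ?D ?\<phi> y)"
      by (intro exI[of _ W] exI[of _ "\<lambda>x. \<kappa> x + corner"] conjI allI ballI W xW td) (use eq in blast)
  qed
  show ?thesis
    unfolding local_param_def diffeomorphism_def bij_betw_def
    using o1 image_open inj s1 s2 unfolding im by blast
qed

section \<open>Tangent spaces in a chart\<close>

lemma range_D\<psi>_subset_tangent_space:
  assumes y: "y \<in> ball 0 R"
  shows "frechet_derivative \<psi> (at y) w \<in> tangent_space TYPE('d) M (\<psi> y)"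
proof -
  have "((\<lambda>z. \<psi> (z - corner)) has_derivative frechet_derivative \<psi> (at y)) (at (y + corner) within ball corner R)"
  proof -
    have "((\<lambda>z. z - corner) has_derivative (\<lambda>h. h)) (at (y + corner))" by (auto intro!: derivative_eq_intros)
    from diff_chain_at[OF this, of \<psi> "frechet_derivative \<psi> (at y)"] der_\<psi>[OF y] show ?thesis
      by (simp add: o_def has_derivative_at_withinI)
  qed
  moreover have "y + corner \<in> ball corner R" using y by (simp add: dist_norm)
  ultimately show ?thesis
    unfolding tangent_space_def using local_param_shift by force
qed

text \<open>Near \<open>a\<close> another parametrization factors as \<open>\<psi>\<close> after
  \<open>\<kappa>\<close> after \<open>\<phi>\<close>, so its derivative takes values in the image
  of the derivative of \<open>\<psi>\<close>.\<close>

lemma tangent_space_subset: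
  assumes y: "y \<in> ball 0 R" and v: "v \<in> tangent_space TYPE('d) M (\<psi> y)"
  shows "v \<in> range (frechet_derivative \<psi> (at y))"
proof -
  obtain \<phi> and D :: "(real^'d) set" and a \<phi>' w where lp: "local_param M \<phi> D" and a: "a \<in> D" "\<phi> a = \<psi> y"
    and d\<phi>: "(\<phi> has_derivative \<phi>') (at a within D)" and vw: "v = \<phi>' w"
    using v unfolding tangent_space_def by blast
  obtain k where k: "openin (top_of_set {y. 0 \<le> y $ k}) D" and sub: "\<phi> ` D \<subseteq> M"
    using lp openin_imp_subset unfolding local_param_def by metis
  obtain T where T: "open T" "D = {y. 0 \<le> y $ k} \<inter> T" using k by (auto simp: openin_open)
  obtain O2 where O2: "open O2" "\<psi> ` ball 0 R = M \<inter> O2" using image_open by (auto simp: openin_open)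
  have yW: "\<psi> y \<in> W" using y by (rule \<psi>_W)
  have "(\<kappa> has_derivative frechet_derivative \<kappa> (at (\<psi> y))) (at (\<phi> a) within \<phi> ` D)"
    unfolding a(2) by (rule has_derivative_at_withinI[OF der_\<kappa>[OF yW]])
  from diff_chain_within[OF d\<phi> this]
  have d1: "((\<lambda>z. \<kappa> (\<phi> z)) has_derivative (\<lambda>h. frechet_derivative \<kappa> (at (\<psi> y)) (\<phi>' h))) (at a within D)"
    by (simp add: o_def)
  have ka: "\<kappa> (\<phi> a) = y" using a(2) \<kappa>_\<psi>[OF y] by simp
  have "(\<psi> has_derivative frechet_derivative \<psi> (at y)) (at (\<kappa> (\<phi> a)) within (\<lambda>z. \<kappa> (\<phi> z)) ` D)"
    unfolding ka by (rule has_derivative_at_withinI[OF der_\<psi>[OF y]])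
  from diff_chain_within[OF d1 this]
  have d2: "((\<lambda>z. \<psi> (\<kappa> (\<phi> z))) has_derivative (\<lambda>h. frechet_derivative \<psi> (at y) (frechet_derivative \<kappa> (at (\<psi> y)) (\<phi>' h)))) (at a within D)"
    by (simp add: o_def)
  have "continuous (at a within D) \<phi>" using d\<phi> by (rule has_derivative_continuous)
  moreover have "\<phi> a \<in> O2" using O2(2) y a(2) by blast
  ultimately have "\<forall>\<^sub>F z in at a within D. \<phi> z \<in> O2"
    using O2(1) unfolding continuous_within by (intro topological_tendstoD)
  then obtain d where d: "d > 0" "\<And>z. z \<in> D \<Longrightarrow> z \<noteq> a \<Longrightarrow> dist z a < d \<Longrightarrow> \<phi> z \<in> O2"
    unfolding eventually_at by blast
  have d3: "(\<phi> has_derivative (\<lambda>h. frechet_derivative \<psi> (at y) (frechet_derivative \<kappa> (at (\<psi> y)) (\<phi>' h)))) (at a within D)"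
  proof (rule has_derivative_transform_within[OF d2 d(1) a(1)])
    fix z assume z: "z \<in> D" "dist z a < d"
    have "\<phi> z \<in> O2" using d(2)[OF z(1) _ z(2)] \<open>\<phi> a \<in> O2\<close> by blast
    then have "\<phi> z \<in> \<psi> ` ball 0 R" using O2(2) sub z(1) by blast
    then obtain y' where "y' \<in> ball 0 R" "\<phi> z = \<psi> y'" by blast
    then show "\<psi> (\<kappa> (\<phi> z)) = \<phi> z" using \<kappa>_\<psi> by simp
  qed
  \<comment> \<open>Derivatives within a relatively open part of a half-space are unique: from any
    of its points a small positive step along each basis vector stays inside, boundary points
    included.\<close>
  have "\<phi>' = (\<lambda>h. frechet_derivative \<psi> (at y) (frechet_derivative \<kappa> (at (\<psi> y)) (\<phi>' h)))"
  proof (rule frechet_derivative_unique_within[OF d\<phi> d3])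
    fix i :: "real^'d" and e :: real assume i: "i \<in> Basis" and e: "0 < e"
    have aT: "a \<in> T" and ak: "0 \<le> a $ k" using a(1) T(2) by auto
    obtain e' where e': "e' > 0" "ball a e' \<subseteq> T" using T(1) aT by (meson openE)
    define s where "s = min e e' / 2"
    have s: "0 < s" "s < e" "s < e'" using e e'(1) by (auto simp: s_def)
    have "norm i = 1" using i by simp
    then have "a + s *\<^sub>R i \<in> ball a e'" using s by (simp add: dist_norm)
    moreover have "0 \<le> i $ k" using i by (auto simp: Basis_vec_def axis_def)
    ultimately have "a + s *\<^sub>R i \<in> D" using T(2) e'(2) ak s(1) by auto
    then show "\<exists>d. 0 < \<bar>d\<bar> \<and> \<bar>d\<bar> < e \<and> a + d *\<^sub>R i \<in> D" using s by (intro exI[of _ s]) auto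
  qed
  then have "v = frechet_derivative \<psi> (at y) (frechet_derivative \<kappa> (at (\<psi> y)) (\<phi>' w))" using vw by metis
  then show ?thesis by blast
qed

lemma tangent_space_eq:
  "y \<in> ball 0 R \<Longrightarrow> tangent_space TYPE('d) M (\<psi> y) = range (frechet_derivative \<psi> (at y))"
  using tangent_space_subset range_D\<psi>_subset_tangent_space by blast

text \<open>Relative openness of the chart image: ambient closeness to \<open>p\<close> already
  forces a point of \<open>M\<close> into the chart. It confines short geodesics and later bounds
  the kernel away from the chart.\<close>

lemma near_p:
  assumes r: "0 < r"
  shows "\<exists>\<rho>>0. \<forall>x\<in>M. norm (x - p) < \<rho> \<longrightarrow> x \<in> W \<and> norm (\<kappa> x) < r \<and> norm (\<kappa> x) < R \<and> \<psi> (\<kappa> x) = x"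
proof -
  obtain O2 where O2: "open O2" "\<psi> ` ball 0 R = M \<inter> O2" using image_open by (auto simp: openin_open)
  have pO: "p \<in> O2" using O2(2) R \<psi>_0 by force
  have "isCont \<kappa> p" using has_derivative_continuous[OF der_\<kappa>[OF p_in_W]] .
  then obtain d1 where d1: "d1 > 0" "\<And>x. dist x p < d1 \<Longrightarrow> dist (\<kappa> x) (\<kappa> p) < r"
    using r unfolding continuous_at_eps_delta by metis
  obtain d2 where d2: "d2 > 0" "ball p d2 \<subseteq> O2 \<inter> W" using O2(1) W pO p_in_W by (meson IntI open_Int openE)
  show ?thesis
  proof (intro exI[of _ "min d1 d2"] conjI ballI impI)
    show "0 < min d1 d2" using d1 d2 by simp
    fix x assume x: "x \<in> M" "norm (x - p) < min d1 d2"
    have xb: "x \<in> O2 \<inter> W" using d2(2) x(2) by (auto simp: subset_iff dist_norm norm_minus_commute)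
    show "x \<in> W" using xb by simp
    show "norm (\<kappa> x) < r" using d1(2)[of x] x(2) by (simp add: dist_norm \<kappa>_p)
    have "x \<in> \<psi> ` ball 0 R" using O2(2) xb x(1) by blast
    then obtain y where y: "y \<in> ball 0 R" "x = \<psi> y" by blast
    then show "norm (\<kappa> x) < R" "\<psi> (\<kappa> x) = x" using \<kappa>_\<psi>[OF y(1)] by auto
  qed
qed

section \<open>Geodesics in coordinates and their uniqueness near the centre\<close>

lemma geodesic_in_chart:
  assumes \<gamma>: "geodesic TYPE('d) M \<gamma>" and inW: "\<And>t. t \<in> {0..1} \<Longrightarrow> \<gamma> t \<in> W"
    and inB: "\<And>t. t \<in> {0..1} \<Longrightarrow> \<kappa> (\<gamma> t) \<in> ball 0 R" and eq: "\<And>t. t \<in> {0..1} \<Longrightarrow> \<psi> (\<kappa> (\<gamma> t)) = \<gamma> t"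
    and t: "t \<in> {0..1}"
  defines "u \<equiv> \<lambda>t. frechet_derivative \<kappa> (at (\<gamma> t)) (velocity \<gamma> t)"
    and "a \<equiv> \<lambda>t. deriv2 \<kappa> (\<gamma> t) (velocity \<gamma> t) (velocity \<gamma> t) + frechet_derivative \<kappa> (at (\<gamma> t)) (velocity (velocity \<gamma>) t)"
  shows "((\<lambda>t. \<kappa> (\<gamma> t)) has_vector_derivative u t) (at t within {0..1})"
    and "(u has_vector_derivative a t) (at t within {0..1})"
    and "(deriv2 \<psi> (\<kappa> (\<gamma> t)) (u t) (u t) + frechet_derivative \<psi> (at (\<kappa> (\<gamma> t))) (a t)) \<bullet> frechet_derivative \<psi> (at (\<kappa> (\<gamma> t))) w = 0"
proof -
  have sm: "smooth_map {0..1} \<gamma>"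
    and acc: "\<And>t w. t \<in> {0..1} \<Longrightarrow> w \<in> tangent_space TYPE('d) M (\<gamma> t) \<Longrightarrow> velocity (velocity \<gamma>) t \<bullet> w = 0"
    using \<gamma> unfolding geodesic_def by auto
  note v1 = smooth_curve_velocity[OF sm] and v2 = smooth_curve_velocity[OF smooth_map_velocity[OF sm]]
  have dc: "((\<lambda>t. \<kappa> (\<gamma> t)) has_vector_derivative u t) (at t within {0..1})" if t: "t \<in> {0..1}" for t
    using vector_derivative_diff_chain_within[OF v1[OF t] has_derivative_at_withinI[OF der_\<kappa>[OF inW[OF t]]]]
    by (simp add: o_def u_def)
  have du: "(u has_vector_derivative a t) (at t within {0..1})" if t: "t \<in> {0..1}" for t
    unfolding u_def a_def
    by (rule has_vector_derivative_frechet_along[OF smooth_\<kappa> W v1[OF t] v2[OF t] inW t])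
  have vel: "velocity \<gamma> t = frechet_derivative \<psi> (at (\<kappa> (\<gamma> t))) (u t)" if t: "t \<in> {0..1}" for t
  proof (rule velocity_eqI[OF t])
    have "((\<lambda>t. \<psi> (\<kappa> (\<gamma> t))) has_vector_derivative frechet_derivative \<psi> (at (\<kappa> (\<gamma> t))) (u t)) (at t within {0..1})"
      using vector_derivative_diff_chain_within[OF dc[OF t] has_derivative_at_withinI[OF der_\<psi>[OF inB[OF t]]]]
      by (simp add: o_def)
    then show "(\<gamma> has_vector_derivative frechet_derivative \<psi> (at (\<kappa> (\<gamma> t))) (u t)) (at t within {0..1})"
      by (rule has_vector_derivative_transform[OF t, rotated]) (simp only: eq)
  qed
  have "velocity (velocity \<gamma>) t = deriv2 \<psi> (\<kappa> (\<gamma> t)) (u t) (u t) + frechet_derivative \<psi> (at (\<kappa> (\<gamma> t))) (a t)"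
  proof (rule velocity_eqI[OF t])
    have "((\<lambda>t. frechet_derivative \<psi> (at (\<kappa> (\<gamma> t))) (u t)) has_vector_derivative
       deriv2 \<psi> (\<kappa> (\<gamma> t)) (u t) (u t) + frechet_derivative \<psi> (at (\<kappa> (\<gamma> t))) (a t)) (at t within {0..1})"
      by (rule has_vector_derivative_frechet_along[OF smooth_\<psi> open_ball dc[OF t] du[OF t] inB t])
    then show "(velocity \<gamma> has_vector_derivative
       deriv2 \<psi> (\<kappa> (\<gamma> t)) (u t) (u t) + frechet_derivative \<psi> (at (\<kappa> (\<gamma> t))) (a t)) (at t within {0..1})"
      by (rule has_vector_derivative_transform[OF t, rotated]) (simp only: vel)
  qed
  moreover have "frechet_derivative \<psi> (at (\<kappa> (\<gamma> t))) w \<in> tangent_space TYPE('d) M (\<gamma> t)"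
    using range_D\<psi>_subset_tangent_space[OF inB[OF t], of w] unfolding eq[OF t] .
  ultimately show "(deriv2 \<psi> (\<kappa> (\<gamma> t)) (u t) (u t) + frechet_derivative \<psi> (at (\<kappa> (\<gamma> t))) (a t)) \<bullet> frechet_derivative \<psi> (at (\<kappa> (\<gamma> t))) w = 0"
    using acc[OF t] by metis
  show "((\<lambda>t. \<kappa> (\<gamma> t)) has_vector_derivative u t) (at t within {0..1})" by (rule dc[OF t])
  show "(u has_vector_derivative a t) (at t within {0..1})" by (rule du[OF t])
qed

text \<open>By speed conservation both curves stay within \<open>\<rho>\<close> of \<open>p\<close>
  during the whole unit interval, hence in the chart, where \<open>geodesic_equation_unique\<close>
  compares their coordinates.\<close>

lemma geodesic_unique:
  "\<exists>\<rho>>0. \<forall>\<gamma>1 \<gamma>2. geodesic TYPE('d) M \<gamma>1 \<and> geodesic TYPE('d) M \<gamma>2 \<and> \<gamma>1 0 = p \<and> \<gamma>2 0 = p \<and>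
     velocity \<gamma>1 0 = velocity \<gamma>2 0 \<and> norm (velocity \<gamma>1 0) < \<rho> \<longrightarrow> (\<forall>t\<in>{0..1}. \<gamma>1 t = \<gamma>2 t)"
proof -
  obtain \<rho>1 where \<rho>1: "\<rho>1 > 0" "cball p \<rho>1 \<subseteq> W" using W p_in_W by (meson open_contains_cball)
  have "isCont \<psi> 0" using has_derivative_continuous[OF der_\<psi>[of 0]] R by simp
  then obtain r1 where r1: "r1 > 0" "\<And>y. dist y 0 < r1 \<Longrightarrow> dist (\<psi> y) (\<psi> 0) < \<rho>1"
    using \<rho>1(1) unfolding continuous_at_eps_delta by metis
  define r where "r = min r1 R / 2"
  have r: "r > 0" "r < r1" "r < R" using r1(1) R by (auto simp: r_def)
  have cb: "cball 0 r \<subseteq> (ball 0 R :: (real^'d) set)" using r by auto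
  obtain C where C: "C > 0" and Cb: "\<And>x v w. x \<in> cball p \<rho>1 \<Longrightarrow>
      norm (frechet_derivative \<kappa> (at x) v) \<le> C * norm v \<and> norm (deriv2 \<kappa> x v w) \<le> C * norm v * norm w"
    using smooth_bounds_cball[OF smooth_\<kappa> W \<rho>1(2)] by metis
  \<comment> \<open>The derivative of \<open>\<kappa>\<close> is a left inverse of that of
    \<open>\<psi>\<close>, so its bound \<open>C\<close> can serve as the constant
    \<open>\<Lambda>\<close>.\<close>
  have \<Lambda>: "norm w \<le> C * norm (frechet_derivative \<psi> (at y) w)" if y: "y \<in> cball 0 r" for y w
  proof -
    have "y \<in> ball 0 R" using y cb by blast
    moreover have "\<psi> y \<in> cball p \<rho>1" using r1(2)[of y] y r(2) \<psi>_0 by (simp add: dist_commute less_imp_le)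
    ultimately show ?thesis using Cb[of "\<psi> y" "frechet_derivative \<psi> (at y) w"] D\<kappa>_D\<psi> by simp
  qed
  obtain \<rho>2 where \<rho>2: "\<rho>2 > 0" "\<And>x. x \<in> M \<Longrightarrow> norm (x - p) < \<rho>2 \<Longrightarrow> x \<in> W \<and> norm (\<kappa> x) < r \<and> norm (\<kappa> x) < R \<and> \<psi> (\<kappa> x) = x"
    using near_p[OF r(1)] by blast
  define \<rho> where "\<rho> = min \<rho>1 \<rho>2"
  have \<rho>: "\<rho> > 0" "\<rho> \<le> \<rho>1" "\<rho> \<le> \<rho>2" using \<rho>1 \<rho>2 by (auto simp: \<rho>_def)
  have "\<gamma>1 t = \<gamma>2 t" if g1: "geodesic TYPE('d) M \<gamma>1" and g2: "geodesic TYPE('d) M \<gamma>2"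
    and st: "\<gamma>1 0 = p" "\<gamma>2 0 = p" and vel: "velocity \<gamma>1 0 = velocity \<gamma>2 0" and small: "norm (velocity \<gamma>1 0) < \<rho>"
    and t: "t \<in> {0..1}" for \<gamma>1 \<gamma>2 t
  proof -
    let ?v = "velocity \<gamma>1 0"
    have near: "\<gamma> t \<in> M \<and> norm (\<gamma> t - p) < \<rho> \<and> norm (velocity \<gamma> t) = norm ?v"
      if "geodesic TYPE('d) M \<gamma>" "\<gamma> 0 = p" "velocity \<gamma> 0 = ?v" "t \<in> {0..1}" for \<gamma> t
      using geodesic_speed[OF M that(1,4)] that small unfolding geodesic_def by auto
    note n1 = near[OF g1 st(1) refl] and n2 = near[OF g2 st(2) vel[symmetric]]
    have props: "\<gamma> t \<in> W" "norm (\<kappa> (\<gamma> t)) < r" "\<kappa> (\<gamma> t) \<in> ball 0 R" "\<psi> (\<kappa> (\<gamma> t)) = \<gamma> t" "\<gamma> t \<in> cball p \<rho>1"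
      if "\<gamma> t \<in> M \<and> norm (\<gamma> t - p) < \<rho> \<and> norm (velocity \<gamma> t) = norm ?v" for \<gamma> t
      using \<rho>2(2)[of "\<gamma> t"] that \<rho> by (auto simp: dist_norm norm_minus_commute)
    note p1 = props[OF n1] and p2 = props[OF n2]
    let ?u = "\<lambda>\<gamma> t. frechet_derivative \<kappa> (at (\<gamma> t)) (velocity \<gamma> t)"
    let ?a = "\<lambda>\<gamma> t. deriv2 \<kappa> (\<gamma> t) (velocity \<gamma> t) (velocity \<gamma> t) + frechet_derivative \<kappa> (at (\<gamma> t)) (velocity (velocity \<gamma>) t)"
    note c1 = geodesic_in_chart[OF g1 p1(1) p1(3) p1(4)] and c2 = geodesic_in_chart[OF g2 p2(1) p2(3) p2(4)]
    have "smooth_map {0..1} \<gamma>2" using g2 unfolding geodesic_def by blast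
    then have "continuous_on {0..1} (velocity (velocity \<gamma>2))"
      by (intro smooth_curve_continuous smooth_map_velocity)
    then have "bounded (velocity (velocity \<gamma>2) ` {0..1})"
      by (intro compact_imp_bounded compact_continuous_image compact_Icc)
    then obtain G where G: "\<And>t. t \<in> {0..1} \<Longrightarrow> norm (velocity (velocity \<gamma>2) t) \<le> G"
      unfolding bounded_iff by blast
    \<comment> \<open>One bound for both coordinate velocities and for the coordinate acceleration
      of the second curve; the latter uses that the ambient acceleration is continuous on a compact
      interval.\<close>
    define B where "B = C * norm ?v + C * norm ?v * norm ?v + C * \<bar>G\<bar>"
    have B0: "0 \<le> C * norm ?v" "0 \<le> C * norm ?v * norm ?v" "0 \<le> C * \<bar>G\<bar>" using C by auto
    have bu: "norm (?u \<gamma>1 t) \<le> B" "norm (?u \<gamma>2 t) \<le> B" if "t \<in> {0..1}" for t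
    proof -
      have "norm (?u \<gamma>1 t) \<le> C * norm ?v" using Cb[OF p1(5)[OF that]] n1[OF that] by metis
      then show "norm (?u \<gamma>1 t) \<le> B" using B0 unfolding B_def by linarith
      have "norm (?u \<gamma>2 t) \<le> C * norm ?v" using Cb[OF p2(5)[OF that]] n2[OF that] by metis
      then show "norm (?u \<gamma>2 t) \<le> B" using B0 unfolding B_def by linarith
    qed
    have ba: "norm (?a \<gamma>2 t) \<le> B" if t: "t \<in> {0..1}" for t
    proof -
      have "norm (deriv2 \<kappa> (\<gamma>2 t) (velocity \<gamma>2 t) (velocity \<gamma>2 t)) \<le> C * norm ?v * norm ?v"
        using Cb[OF p2(5)[OF t]] n2[OF t] by metis
      moreover have "norm (frechet_derivative \<kappa> (at (\<gamma>2 t)) (velocity (velocity \<gamma>2) t)) \<le> C * \<bar>G\<bar>"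
      proof -
        have "norm (frechet_derivative \<kappa> (at (\<gamma>2 t)) (velocity (velocity \<gamma>2) t)) \<le> C * norm (velocity (velocity \<gamma>2) t)"
          using Cb[OF p2(5)[OF t]] by blast
        also have "\<dots> \<le> C * \<bar>G\<bar>" using G[OF t] C by (intro mult_left_mono) auto
        finally show ?thesis .
      qed
      ultimately show ?thesis
        using B0(1) norm_triangle_ineq[of "deriv2 \<kappa> (\<gamma>2 t) (velocity \<gamma>2 t) (velocity \<gamma>2 t)"
            "frechet_derivative \<kappa> (at (\<gamma>2 t)) (velocity (velocity \<gamma>2) t)"] unfolding B_def by linarith
    qed
    have "\<kappa> (\<gamma>1 t) = \<kappa> (\<gamma>2 t)"
    proof (rule geodesic_equation_unique[of \<psi> "ball 0 R" r C "\<lambda>t. \<kappa> (\<gamma>1 t)" "\<lambda>t. \<kappa> (\<gamma>2 t)" "?u \<gamma>1" "?u \<gamma>2" "?a \<gamma>1" "?a \<gamma>2" B,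
          OF smooth_\<psi> open_ball cb less_imp_le[OF C] \<Lambda> _ _ c1(1) c2(1) c1(2) c2(2) bu(1) bu(2) ba c1(3) c2(3) _ _ t])
      show "\<kappa> (\<gamma>1 t) \<in> cball 0 r" if "t \<in> {0..1}" for t using p1(2)[OF that] by simp
      show "\<kappa> (\<gamma>2 t) \<in> cball 0 r" if "t \<in> {0..1}" for t using p2(2)[OF that] by simp
      show "\<kappa> (\<gamma>1 0) = \<kappa> (\<gamma>2 0)" "?u \<gamma>1 0 = ?u \<gamma>2 0" using st vel by simp_all
    qed
    then show ?thesis using p1(4)[OF t] p2(4)[OF t] by metis
  qed
  then show ?thesis using \<rho>(1) by blast
qed

end

section \<open>Normal charts\<close>

text \<open>The vectors that equal their own expansion form a subspace containing the frame.\<close>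

lemma orthonormal_expansion:
  fixes b :: "'d::finite \<Rightarrow> 'a::real_inner"
  assumes b: "\<And>i j. b i \<bullet> b j = (if i = j then 1 else 0)" and x: "x \<in> span (range b)"
  shows "x = (\<Sum>j\<in>UNIV. (x \<bullet> b j) *\<^sub>R b j)"
proof -
  let ?S = "{x. x = (\<Sum>j\<in>UNIV. (x \<bullet> b j) *\<^sub>R b j)}"
  have "span (range b) \<subseteq> ?S"
  proof (rule span_minimal)
    show "range b \<subseteq> ?S"
    proof
      fix v assume "v \<in> range b"
      then obtain i where i: "v = b i" by blast
      have "(\<Sum>j\<in>UNIV. (b i \<bullet> b j) *\<^sub>R b j) = (\<Sum>j\<in>UNIV. if i = j then b j else 0)"
        by (intro sum.cong refl) (simp add: b)
      then show "v \<in> ?S" by (simp add: i)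
    qed
    show "subspace ?S"
    proof (rule subspaceI)
      show "0 \<in> ?S" by simp
    next
      fix x y assume xy: "x \<in> ?S" "y \<in> ?S"
      have "(\<Sum>j\<in>UNIV. ((x + y) \<bullet> b j) *\<^sub>R b j) = (\<Sum>j\<in>UNIV. (x \<bullet> b j) *\<^sub>R b j) + (\<Sum>j\<in>UNIV. (y \<bullet> b j) *\<^sub>R b j)"
        by (simp add: inner_add_left scaleR_add_left sum.distrib)
      then show "x + y \<in> ?S" using xy by simp
    next
      fix c x assume x: "x \<in> ?S"
      have "(\<Sum>j\<in>UNIV. ((c *\<^sub>R x) \<bullet> b j) *\<^sub>R b j) = c *\<^sub>R (\<Sum>j\<in>UNIV. (x \<bullet> b j) *\<^sub>R b j)"
        by (simp add: scaleR_sum_right)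
      then show "c *\<^sub>R x \<in> ?S" using x by simp
    qed
  qed
  then show ?thesis using x by blast
qed

text \<open>The trace on the span does not depend on the orthonormal frame, which is why the
  description in \<open>divergence\<close> has a unique solution. The proof expands one frame in the
  other and sums the coefficient products to Kronecker deltas.\<close>

lemma trace_orthonormal_frame:
  fixes b e :: "'d::finite \<Rightarrow> 'a::real_inner"
  assumes b: "\<And>i j. b i \<bullet> b j = (if i = j then 1 else 0)" and e: "\<And>i j. e i \<bullet> e j = (if i = j then 1 else 0)"
    and span: "span (range b) = span (range e)" and T: "linear T"
  shows "(\<Sum>j\<in>UNIV. T (b j) \<bullet> b j) = (\<Sum>j\<in>UNIV. T (e j) \<bullet> e j)"
proof -
  have bx: "b j = (\<Sum>k\<in>UNIV. (b j \<bullet> e k) *\<^sub>R e k)" for j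
    by (rule orthonormal_expansion[OF e]) (metis span rangeI span_base)
  have ex: "e k = (\<Sum>j\<in>UNIV. (e k \<bullet> b j) *\<^sub>R b j)" for k
    by (rule orthonormal_expansion[OF b]) (metis span rangeI span_base)
  have "T (b j) \<bullet> b j = (\<Sum>k\<in>UNIV. \<Sum>l\<in>UNIV. ((b j \<bullet> e k) * (b j \<bullet> e l)) * (T (e k) \<bullet> e l))" for j
  proof -
    have "T (b j) = (\<Sum>k\<in>UNIV. (b j \<bullet> e k) *\<^sub>R T (e k))"
      by (subst bx) (simp add: linear_sum[OF T] linear_cmul[OF T])
    then have "T (b j) \<bullet> b j = (\<Sum>k\<in>UNIV. (b j \<bullet> e k) * (T (e k) \<bullet> b j))"
      by (simp add: inner_sum_left)
    also have "\<dots> = (\<Sum>k\<in>UNIV. (b j \<bullet> e k) * (\<Sum>l\<in>UNIV. (b j \<bullet> e l) * (T (e k) \<bullet> e l)))"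
    proof (intro sum.cong refl arg_cong2[where f="(*)"])
      fix k
      show "T (e k) \<bullet> b j = (\<Sum>l\<in>UNIV. (b j \<bullet> e l) * (T (e k) \<bullet> e l))"
        by (subst (1) bx) (simp add: inner_sum_right)
    qed
    finally show ?thesis by (simp add: sum_distrib_left mult.assoc)
  qed
  then have "(\<Sum>j\<in>UNIV. T (b j) \<bullet> b j) = (\<Sum>j\<in>UNIV. \<Sum>k\<in>UNIV. \<Sum>l\<in>UNIV. ((b j \<bullet> e k) * (b j \<bullet> e l)) * (T (e k) \<bullet> e l))"
    by simp
  also have "\<dots> = (\<Sum>k\<in>UNIV. \<Sum>l\<in>UNIV. \<Sum>j\<in>UNIV. ((b j \<bullet> e k) * (b j \<bullet> e l)) * (T (e k) \<bullet> e l))"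
    by (subst sum.swap, rule sum.cong[OF refl], rule sum.swap)
  also have "\<dots> = (\<Sum>k\<in>UNIV. \<Sum>l\<in>UNIV. (if k = l then 1 else 0) * (T (e k) \<bullet> e l))"
  proof (intro sum.cong refl)
    fix k l
    have "(if k = l then 1 else 0) = e k \<bullet> e l" by (simp add: e)
    also have "\<dots> = (\<Sum>j\<in>UNIV. (e k \<bullet> b j) * (b j \<bullet> e l))"
      by (subst (1) ex) (simp add: inner_sum_left)
    finally show "(\<Sum>j\<in>UNIV. ((b j \<bullet> e k) * (b j \<bullet> e l)) * (T (e k) \<bullet> e l)) = (if k = l then 1 else 0) * (T (e k) \<bullet> e l)"
      by (simp only: sum_distrib_right inner_commute)
  qed
  also have "\<dots> = (\<Sum>k\<in>UNIV. T (e k) \<bullet> e k)"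
    by (simp add: mult_delta_left)
  finally show ?thesis .
qed

text \<open>Transfers differentiability at the origin from an explicit approximation to a function
  known only up to a quadratic error; it will be applied to the gradient.\<close>

lemma has_derivative_quadratic_perturbation:
  fixes f g :: "'a::real_normed_vector \<Rightarrow> 'b::real_normed_vector"
  assumes f: "(f has_derivative D) (at 0)" and r: "0 < r" and K: "\<And>y. norm y < r \<Longrightarrow> norm (g y - f y) \<le> K * (norm y)\<^sup>2"
  shows "(g has_derivative D) (at 0)"
proof -
  have h0: "g 0 - f 0 = 0" using K[of 0] r by simp
  have "((\<lambda>y. g y - f y) has_derivative (\<lambda>_. 0)) (at 0)"
    unfolding has_derivative_at_alt
  proof (intro conjI allI impI)
    fix e :: real assume e: "0 < e"
    define d where "d = min r (e / (\<bar>K\<bar> + 1))"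
    have d: "d > 0" using r e by (simp add: d_def)
    show "\<exists>d>0. \<forall>y. norm (y - 0) < d \<longrightarrow> norm (g y - f y - (g 0 - f 0) - 0) \<le> e * norm (y - 0)"
    proof (intro exI[of _ d] conjI allI impI d)
      fix y :: 'a assume y: "norm (y - 0) < d"
      have "norm (g y - f y) \<le> K * (norm y)\<^sup>2" using y by (intro K) (simp add: d_def)
      also have "\<dots> \<le> (\<bar>K\<bar> + 1) * (norm y)\<^sup>2" by (intro mult_right_mono) auto
      also have "\<dots> = ((\<bar>K\<bar> + 1) * norm y) * norm y" by (simp add: power2_eq_square)
      also have "\<dots> \<le> e * norm y"
      proof (rule mult_right_mono)
        have "norm y \<le> e / (\<bar>K\<bar> + 1)" using y by (simp add: d_def)
        then show "(\<bar>K\<bar> + 1) * norm y \<le> e" by (simp add: pos_le_divide_eq mult.commute)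
      qed simp
      finally show "norm (g y - f y - (g 0 - f 0) - 0) \<le> e * norm (y - 0)" by (simp add: h0)
    qed
  qed (rule bounded_linear_zero)
  from has_derivative_add[OF f this] show ?thesis by simp
qed

lemma geodesic_rescale:
  fixes M :: "(real^'m::finite) set"
  assumes \<gamma>: "geodesic TYPE('d::finite) M \<gamma>" and t: "t \<in> {0..1}"
  shows "geodesic TYPE('d) M (\<lambda>s. \<gamma> (t * s))" and "velocity (\<lambda>s. \<gamma> (t * s)) 0 = t *\<^sub>R velocity \<gamma> 0"
proof -
  have sm: "smooth_map {0..1} \<gamma>" and im: "\<gamma> ` {0..1} \<subseteq> M"
    and acc: "\<And>t w. t \<in> {0..1} \<Longrightarrow> w \<in> tangent_space TYPE('d) M (\<gamma> t) \<Longrightarrow> velocity (velocity \<gamma>) t \<bullet> w = 0"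
    using \<gamma> unfolding geodesic_def by auto
  have ts: "t * s \<in> {0..1}" if "s \<in> {0..1}" for s using t that by (simp add: mult_le_one)
  have chain: "velocity (\<lambda>s. c (t * s)) s = t *\<^sub>R velocity c (t * s) \<and>
      ((\<lambda>s. c (t * s)) has_vector_derivative t *\<^sub>R velocity c (t * s)) (at s within {0..1})"
    if c: "smooth_map {0..1} c" and s: "s \<in> {0..1}" for c :: "real \<Rightarrow> real^'m" and s
  proof -
    have d1: "((\<lambda>s. t * s) has_vector_derivative t) (at s within {0..1})"
      by (auto intro!: derivative_eq_intros simp: has_vector_derivative_def)
    have d2: "(c has_derivative (\<lambda>h. h *\<^sub>R velocity c (t * s))) (at (t * s) within (\<lambda>s. t * s) ` {0..1})"
      by (rule has_derivative_subset[OF smooth_curve_velocity[OF c ts[OF s], unfolded has_vector_derivative_def]])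
        (use ts in auto)
    have "((\<lambda>s. c (t * s)) has_vector_derivative t *\<^sub>R velocity c (t * s)) (at s within {0..1})"
      using vector_derivative_diff_chain_within[OF d1 d2] by (simp add: o_def)
    then show ?thesis using velocity_eqI[OF s] by blast
  qed
  have smt: "smooth_map {0..1} (\<lambda>s. \<gamma> (t * s))"
    unfolding smooth_map_def
  proof
    fix s :: real assume s: "s \<in> {0..1}"
    obtain W g where W: "open W" "t * s \<in> W" "\<And>k. times_differentiable_on k g W" "\<And>y. y \<in> {0..1} \<inter> W \<Longrightarrow> g y = \<gamma> y"
      by (rule smooth_mapE[OF sm ts[OF s]], rule that)
    have td: "times_differentiable_on k (\<lambda>y. g (t * y + 0)) {y. t * y + 0 \<in> W}" for k
      by (rule times_differentiable_on_affine[OF W(1) bounded_linear_mult_right W(3)])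
    have op: "open {y. t * y + 0 \<in> W}"
      using open_vimage[OF W(1), of "\<lambda>y. t * y + 0"] by (simp add: vimage_def continuous_intros)
    show "\<exists>W g. open W \<and> s \<in> W \<and> (\<forall>k. times_differentiable_on k g W) \<and> (\<forall>y\<in>{0..1} \<inter> W. g y = \<gamma> (t * y))"
    proof (intro exI[of _ "{y. t * y + 0 \<in> W}"] exI[of _ "\<lambda>y. g (t * y + 0)"] conjI allI ballI td op)
      show "s \<in> {y. t * y + 0 \<in> W}" using W(2) by simp
      fix y assume "y \<in> {0..1} \<inter> {y. t * y + 0 \<in> W}"
      then have "t * y \<in> {0..1} \<inter> W" using ts by simp
      then show "g (t * y + 0) = \<gamma> (t * y)" using W(4) by simp
    qed
  qed
  have acct: "velocity (velocity (\<lambda>s. \<gamma> (t * s))) s \<bullet> w = 0"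
    if s: "s \<in> {0..1}" and w: "w \<in> tangent_space TYPE('d) M (\<gamma> (t * s))" for s w
  proof -
    have "((\<lambda>s. t *\<^sub>R velocity \<gamma> (t * s)) has_vector_derivative t *\<^sub>R (t *\<^sub>R velocity (velocity \<gamma>) (t * s))) (at s within {0..1})"
      using bounded_linear.has_vector_derivative[OF bounded_linear_scaleR_right
          conjunct2[OF chain[OF smooth_map_velocity[OF sm] s]]] .
    then have "(velocity (\<lambda>s. \<gamma> (t * s)) has_vector_derivative t *\<^sub>R (t *\<^sub>R velocity (velocity \<gamma>) (t * s))) (at s within {0..1})"
      by (rule has_vector_derivative_transform[OF s, rotated]) (use chain[OF sm] in blast)
    then have "velocity (velocity (\<lambda>s. \<gamma> (t * s))) s = t *\<^sub>R (t *\<^sub>R velocity (velocity \<gamma>) (t * s))"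
      by (rule velocity_eqI[OF s])
    then show ?thesis using acc[OF ts[OF s] w] by simp
  qed
  show "geodesic TYPE('d) M (\<lambda>s. \<gamma> (t * s))"
    unfolding geodesic_def
  proof (intro conjI ballI)
    show "(\<lambda>s. \<gamma> (t * s)) ` {0..1} \<subseteq> M" using im ts by blast
  qed (use smt acct in auto)
  show "velocity (\<lambda>s. \<gamma> (t * s)) 0 = t *\<^sub>R velocity \<gamma> 0"
    using chain[OF sm, of 0] by simp
qed

text \<open>Existence of a geodesic and the value of \<open>exp_map\<close> are separate
  assumptions, because the definite description is linked to a particular geodesic only through
  uniqueness.\<close>

locale normal_chart = chart_at M p \<psi> \<kappa> W R
  for M :: "(real^'m::finite) set" and p :: "real^'m" and \<psi> :: "real^'d::finite \<Rightarrow> real^'m"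
    and \<kappa> :: "real^'m \<Rightarrow> real^'d" and W :: "(real^'m) set" and R :: real +
  fixes e :: "'d \<Rightarrow> real^'m"
  assumes ortho: "\<And>i j. e i \<bullet> e j = (if i = j then 1 else 0)"
    and span_e: "span (range e) = tangent_space TYPE('d) M p"
    and geo: "\<And>y. y \<in> ball 0 R \<Longrightarrow> \<exists>\<gamma>. geodesic TYPE('d) M \<gamma> \<and> \<gamma> 0 = p \<and> velocity \<gamma> 0 = (\<Sum>i\<in>UNIV. y $ i *\<^sub>R e i)"
    and exp_\<psi>: "\<And>y. y \<in> ball 0 R \<Longrightarrow> exp_map TYPE('d) M p (\<Sum>i\<in>UNIV. y $ i *\<^sub>R e i) = \<psi> y"
begin

definition frame :: "real^'d \<Rightarrow> real^'m" where "frame y = (\<Sum>i\<in>UNIV. y $ i *\<^sub>R e i)"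

lemma frame_inner: "frame y \<bullet> frame z = y \<bullet> z"
proof -
  have "frame y \<bullet> frame z = (\<Sum>i\<in>UNIV. \<Sum>j\<in>UNIV. y $ i * z $ j * (if i = j then 1 else 0))"
    by (simp add: frame_def inner_sum_left inner_sum_right ortho sum_distrib_left mult_ac if_distrib cong: if_cong)
  also have "\<dots> = y \<bullet> z" by (simp add: inner_vec_def if_distrib cong: if_cong)
  finally show ?thesis .
qed

lemma norm_frame: "norm (frame y) = norm y"
  by (simp add: norm_eq_sqrt_inner frame_inner)

lemma linear_frame: "linear frame"
  by (rule linearI) (simp_all add: frame_def scaleR_add_left sum.distrib scaleR_sum_right)

lemma frame_axis: "frame (axis i 1) = e i"
proof -
  have "frame (axis i 1) = (\<Sum>j\<in>UNIV. if j = i then e j else 0)"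
    unfolding frame_def by (intro sum.cong refl) (simp add: axis_def)
  then show ?thesis by simp
qed

text \<open>For short velocities uniqueness turns the description defining \<open>exp_map\<close>
  into the endpoint of any geodesic with that velocity.\<close>

lemma exp_map_geodesic:
  "\<exists>\<rho>>0. \<forall>\<gamma>. geodesic TYPE('d) M \<gamma> \<and> \<gamma> 0 = p \<and> norm (velocity \<gamma> 0) < \<rho> \<longrightarrow> exp_map TYPE('d) M p (velocity \<gamma> 0) = \<gamma> 1"
proof -
  obtain \<rho> where \<rho>: "\<rho> > 0" and un: "\<And>\<gamma>1 \<gamma>2 t. geodesic TYPE('d) M \<gamma>1 \<Longrightarrow> geodesic TYPE('d) M \<gamma>2 \<Longrightarrow> \<gamma>1 0 = p \<Longrightarrow> \<gamma>2 0 = p \<Longrightarrow>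
     velocity \<gamma>1 0 = velocity \<gamma>2 0 \<Longrightarrow> norm (velocity \<gamma>1 0) < \<rho> \<Longrightarrow> t \<in> {0..1} \<Longrightarrow> \<gamma>1 t = \<gamma>2 t"
    using geodesic_unique by metis
  have "exp_map TYPE('d) M p (velocity \<gamma> 0) = \<gamma> 1"
    if g: "geodesic TYPE('d) M \<gamma>" "\<gamma> 0 = p" "norm (velocity \<gamma> 0) < \<rho>" for \<gamma>
    unfolding exp_map_def
  proof (rule the_equality)
    show "\<exists>\<gamma>'. geodesic TYPE('d) M \<gamma>' \<and> \<gamma>' 0 = p \<and> velocity \<gamma>' 0 = velocity \<gamma> 0 \<and> \<gamma>' 1 = \<gamma> 1"
      using g by (intro exI[of _ \<gamma>]) simp
    fix x assume "\<exists>\<gamma>'. geodesic TYPE('d) M \<gamma>' \<and> \<gamma>' 0 = p \<and> velocity \<gamma>' 0 = velocity \<gamma> 0 \<and> \<gamma>' 1 = x"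
    then obtain \<gamma>' where g': "geodesic TYPE('d) M \<gamma>'" "\<gamma>' 0 = p" "velocity \<gamma>' 0 = velocity \<gamma> 0" "\<gamma>' 1 = x"
      by (elim exE conjE)
    have "\<gamma> 1 = \<gamma>' 1" by (rule un[OF g(1) g'(1) g(2) g'(2) g'(3)[symmetric] g(3)]) simp
    then show "x = \<gamma> 1" using g'(4) by simp
  qed
  then show ?thesis using \<rho> by (intro exI[of _ \<rho>]) simp
qed

text \<open>Rays through the origin are mapped to geodesics, so their second derivative is normal.\<close>

lemma ray_geodesic:
  "\<exists>\<rho>>0. \<forall>y. norm y < \<rho> \<longrightarrow> norm y < R \<and> (\<exists>\<gamma>. geodesic TYPE('d) M \<gamma> \<and> velocity \<gamma> 0 = frame y \<and> (\<forall>t\<in>{0..1}. \<psi> (t *\<^sub>R y) = \<gamma> t))"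
proof -
  obtain \<rho> where \<rho>: "\<rho> > 0" and ex: "\<And>\<gamma>. geodesic TYPE('d) M \<gamma> \<Longrightarrow> \<gamma> 0 = p \<Longrightarrow> norm (velocity \<gamma> 0) < \<rho> \<Longrightarrow>
      exp_map TYPE('d) M p (velocity \<gamma> 0) = \<gamma> 1"
    using exp_map_geodesic by metis
  have "norm y < R \<and> (\<exists>\<gamma>. geodesic TYPE('d) M \<gamma> \<and> velocity \<gamma> 0 = frame y \<and> (\<forall>t\<in>{0..1}. \<psi> (t *\<^sub>R y) = \<gamma> t))"
    if y: "norm y < min \<rho> R" for y
  proof -
    have yR: "y \<in> ball 0 R" using y by simp
    obtain \<gamma> where g: "geodesic TYPE('d) M \<gamma>" "\<gamma> 0 = p" "velocity \<gamma> 0 = frame y"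
      using geo[OF yR] unfolding frame_def by metis
    have "\<psi> (t *\<^sub>R y) = \<gamma> t" if t: "t \<in> {0..1}" for t
    proof -
      have le: "norm (t *\<^sub>R y) \<le> norm y" using t by (simp add: mult_left_le_one_le)
      then have tR: "t *\<^sub>R y \<in> ball 0 R" using y by simp
      have f: "(\<Sum>i\<in>UNIV. (t *\<^sub>R y) $ i *\<^sub>R e i) = t *\<^sub>R frame y" by (simp add: frame_def scaleR_sum_right)
      have "exp_map TYPE('d) M p (velocity (\<lambda>s. \<gamma> (t * s)) 0) = \<gamma> (t * 1)"
      proof (rule ex[OF geodesic_rescale(1)[OF g(1) t]])
        show "norm (velocity (\<lambda>s. \<gamma> (t * s)) 0) < \<rho>"
          unfolding geodesic_rescale(2)[OF g(1) t] g(3) using le y t by (simp add: norm_frame)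
      qed (simp add: g(2))
      then show ?thesis
        using exp_\<psi>[OF tR] unfolding f geodesic_rescale(2)[OF g(1) t] g(3) by simp
    qed
    then show ?thesis using g y by auto
  qed
  then show ?thesis using \<rho> R by (intro exI[of _ "min \<rho> R"]) simp
qed

section \<open>Second-order expansion of the normal chart at its centre\<close>

lemma zero_in_ball: "(0 :: real^'d) \<in> ball 0 R" using R by simp

lemma tangent_p: "tangent_space TYPE('d) M p = range (frechet_derivative \<psi> (at 0))"
  using tangent_space_eq[OF zero_in_ball] by (simp add: \<psi>_0)

lemma small_multiple:
  fixes y :: "real^'d" assumes "0 < \<rho>" shows "\<exists>s>0. norm (s *\<^sub>R y) < \<rho>"
proof (intro exI[of _ "\<rho> / (norm y + 1)"] conjI)
  have n: "0 < norm y + 1" by (simp add: add_nonneg_pos)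
  show "0 < \<rho> / (norm y + 1)" using assms n by simp
  have "\<rho> * norm y < \<rho> * (norm y + 1)" using assms by simp
  then show "norm ((\<rho> / (norm y + 1)) *\<^sub>R y) < \<rho>" using assms n by (simp add: pos_divide_less_eq)
qed

text \<open>Along a short ray the chart is a geodesic, with initial velocity \<open>frame y\<close>
  and initial acceleration \<open>deriv2 \<psi> 0 y y\<close>, which is normal to the tangent space.
  Homogeneity extends both facts to all \<open>y\<close>.\<close>

lemma D\<psi>_0: "frechet_derivative \<psi> (at 0) y = frame y"
  and D2\<psi>_0_diag: "deriv2 \<psi> 0 y y \<bullet> frechet_derivative \<psi> (at 0) w = 0"
proof -
  obtain \<rho> where \<rho>: "\<rho> > 0" and ray: "\<And>y. norm y < \<rho> \<Longrightarrow> norm y < R \<and> (\<exists>\<gamma>. geodesic TYPE('d) M \<gamma> \<and> velocity \<gamma> 0 = frame y \<and> (\<forall>t\<in>{0..1}. \<psi> (t *\<^sub>R y) = \<gamma> t))"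
    using ray_geodesic by metis
  have small: "frechet_derivative \<psi> (at 0) y = frame y \<and> deriv2 \<psi> 0 y y \<bullet> frechet_derivative \<psi> (at 0) w = 0"
    if y: "norm y < \<rho>" for y
  proof -
    obtain \<gamma> where g: "geodesic TYPE('d) M \<gamma>" "velocity \<gamma> 0 = frame y" "\<And>t. t \<in> {0..1} \<Longrightarrow> \<psi> (t *\<^sub>R y) = \<gamma> t" and yR: "norm y < R"
      using ray[OF y] by metis
    have tR: "t *\<^sub>R y \<in> ball 0 R" if t: "t \<in> {0..1}" for t
    proof -
      have "norm (t *\<^sub>R y) \<le> norm y" using t by (simp add: mult_left_le_one_le)
      then show ?thesis using yR by simp
    qed
    have dl: "((\<lambda>t. t *\<^sub>R y) has_vector_derivative y) (at t within {0..1})" for t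
      by (auto intro!: derivative_eq_intros simp: has_vector_derivative_def)
    have vel: "velocity \<gamma> t = frechet_derivative \<psi> (at (t *\<^sub>R y)) y" if t: "t \<in> {0..1}" for t
    proof (rule velocity_eqI[OF t])
      have "((\<lambda>t. \<psi> (t *\<^sub>R y)) has_vector_derivative frechet_derivative \<psi> (at (t *\<^sub>R y)) y) (at t within {0..1})"
        using vector_derivative_diff_chain_within[OF dl has_derivative_at_withinI[OF der_\<psi>[OF tR[OF t]]]] by (simp add: o_def)
      then show "(\<gamma> has_vector_derivative frechet_derivative \<psi> (at (t *\<^sub>R y)) y) (at t within {0..1})"
        by (rule has_vector_derivative_transform[OF t, rotated]) (simp only: g(3))
    qed
    have z: "(0::real) \<in> {0..1}" by simp
    have "velocity (velocity \<gamma>) 0 = deriv2 \<psi> (0 *\<^sub>R y) y y + frechet_derivative \<psi> (at (0 *\<^sub>R y)) 0"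
    proof (rule velocity_eqI[OF z])
      have "((\<lambda>t. frechet_derivative \<psi> (at (t *\<^sub>R y)) y) has_vector_derivative
          deriv2 \<psi> (0 *\<^sub>R y) y y + frechet_derivative \<psi> (at (0 *\<^sub>R y)) 0) (at 0 within {0..1})"
        by (rule has_vector_derivative_frechet_along[OF smooth_\<psi> open_ball dl has_vector_derivative_const tR z])
      then show "(velocity \<gamma> has_vector_derivative
          deriv2 \<psi> (0 *\<^sub>R y) y y + frechet_derivative \<psi> (at (0 *\<^sub>R y)) 0) (at 0 within {0..1})"
        by (rule has_vector_derivative_transform[OF z, rotated]) (simp only: vel)
    qed
    then have a: "velocity (velocity \<gamma>) 0 = deriv2 \<psi> 0 y y"
      using linear_0[OF linear_D\<psi>[OF zero_in_ball]] by simp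
    have "\<gamma> 0 = p" using g(3)[OF z] \<psi>_0 by simp
    then have "velocity (velocity \<gamma>) 0 \<bullet> frechet_derivative \<psi> (at 0) w = 0"
      using g(1) z tangent_p unfolding geodesic_def by blast
    then show ?thesis using vel[OF z] g(2) a by simp
  qed
  \<comment> \<open>The derivative scales by \<open>s\<close> and the second derivative by its
    square, so the claims for \<open>s *\<^sub>R y\<close> give those for \<open>y\<close>.\<close>
  obtain s where s: "s > 0" "norm (s *\<^sub>R y) < \<rho>" using small_multiple[OF \<rho>] by blast
  have "s *\<^sub>R frechet_derivative \<psi> (at 0) y = s *\<^sub>R frame y"
    using small[OF s(2)] linear_cmul[OF linear_D\<psi>[OF zero_in_ball], of s y] linear_cmul[OF linear_frame, of s y] by metis
  then show "frechet_derivative \<psi> (at 0) y = frame y" using s(1) by simp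
  have "deriv2 \<psi> 0 (s *\<^sub>R y) (s *\<^sub>R y) = s *\<^sub>R s *\<^sub>R deriv2 \<psi> 0 y y"
  proof -
    have "deriv2 \<psi> 0 (s *\<^sub>R y) (s *\<^sub>R y) = s *\<^sub>R deriv2 \<psi> 0 (s *\<^sub>R y) y"
      by (rule linear_cmul[OF linear_deriv2_right[OF smooth_\<psi>_Suc open_ball zero_in_ball]])
    also have "deriv2 \<psi> 0 (s *\<^sub>R y) y = s *\<^sub>R deriv2 \<psi> 0 y y"
      by (rule linear_cmul[OF linear_deriv2_left[OF smooth_\<psi>_Suc open_ball zero_in_ball]])
    finally show ?thesis .
  qed
  then show "deriv2 \<psi> 0 y y \<bullet> frechet_derivative \<psi> (at 0) w = 0" using small[OF s(2)] s(1) by simp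
qed

lemma D2\<psi>_0_commute: "deriv2 \<psi> 0 u v = deriv2 \<psi> 0 v u"
  by (rule deriv2_commute[OF smooth_\<psi> open_ball zero_in_ball])

text \<open>Polarization of the diagonal case, which rests on the symmetry of the second
  derivative.\<close>

lemma D2\<psi>_0_normal: "deriv2 \<psi> 0 u v \<bullet> frame w = 0"
proof -
  note l = linear_add[OF linear_deriv2_right[OF smooth_\<psi>_Suc open_ball zero_in_ball]]
    linear_add[OF linear_deriv2_left[OF smooth_\<psi>_Suc open_ball zero_in_ball]]
  have "deriv2 \<psi> 0 (u + v) (u + v) = deriv2 \<psi> 0 u u + deriv2 \<psi> 0 v v + 2 *\<^sub>R deriv2 \<psi> 0 u v"
    using D2\<psi>_0_commute[of v u] by (simp add: l scaleR_2)
  then have "(deriv2 \<psi> 0 u u + deriv2 \<psi> 0 v v + 2 *\<^sub>R deriv2 \<psi> 0 u v) \<bullet> frame w = 0"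
    using D2\<psi>_0_diag[of "u + v" w] by (simp add: D\<psi>_0)
  then show ?thesis using D2\<psi>_0_diag[of u w] D2\<psi>_0_diag[of v w] by (simp add: D\<psi>_0 inner_add_left)
qed

text \<open>Both remainders come from the Lipschitz bound on \<open>deriv2\<close>, by the mean
  value inequality along the ray from the origin; the second uses the first as its derivative
  bound.\<close>

lemma taylor_bounds:
  "\<exists>r>0. r < R \<and> r \<le> 1 \<and> (\<exists>C>0. \<forall>y\<in>cball 0 r. \<forall>u w.
     norm (deriv2 \<psi> 0 u y) \<le> C * norm y * norm u \<and>
     norm (frechet_derivative \<psi> (at y) u) \<le> C * norm u \<and>
     norm (frechet_derivative \<psi> (at y) u - frame u - deriv2 \<psi> 0 u y) \<le> C * (norm y)\<^sup>2 * norm u \<and>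
     norm (\<psi> y - p - frame y - (1 / 2) *\<^sub>R deriv2 \<psi> 0 y y) \<le> C * norm y ^ 3)"
proof -
  define r where "r = min (R / 2) 1"
  have r: "r > 0" "r < R" "r \<le> 1" using R by (auto simp: r_def)
  have cb: "cball 0 r \<subseteq> (ball 0 R :: (real^'d) set)" using r by auto
  obtain C where C: "C > 0" and bd: "\<And>x y v w. x \<in> cball 0 r \<Longrightarrow> y \<in> cball 0 r \<Longrightarrow>
      norm (frechet_derivative \<psi> (at x) v) \<le> C * norm v \<and> norm (deriv2 \<psi> x v w) \<le> C * norm v * norm w \<and>
      norm (deriv2 \<psi> x v w - deriv2 \<psi> y v w) \<le> C * norm (x - y) * norm v * norm w"
    using smooth_bounds_cball[OF smooth_\<psi> open_ball cb] by metis
  have z: "(0::real^'d) \<in> cball 0 r" using r by simp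
  have ty: "t *\<^sub>R y \<in> cball 0 r" if "y \<in> cball 0 r" "t \<in> {0..1}" for t :: real and y :: "real^'d"
  proof -
    have "norm (t *\<^sub>R y) \<le> norm y" using that(2) by (simp add: mult_left_le_one_le)
    then show ?thesis using that(1) by simp
  qed
  have dl: "((\<lambda>t. t *\<^sub>R y) has_vector_derivative y) (at t within {0..1})" for t :: real and y :: "real^'d"
    by (auto intro!: derivative_eq_intros simp: has_vector_derivative_def)
  have E1: "norm (frechet_derivative \<psi> (at y) u - frame u - deriv2 \<psi> 0 u y) \<le> C * (norm y)\<^sup>2 * norm u"
    if y: "y \<in> cball 0 r" for y u
  proof -
    let ?g = "\<lambda>t. frechet_derivative \<psi> (at (t *\<^sub>R y)) u - t *\<^sub>R deriv2 \<psi> 0 u y"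
    have "norm (?g 1 - ?g 0) \<le> (C * (norm y)\<^sup>2 * norm u) * (1 - 0)"
    proof (rule vector_derivative_norm_bound)
      fix t :: real assume t: "t \<in> {0..1}"
      have inb: "t *\<^sub>R y \<in> ball 0 R" using ty[OF y t] cb by blast
      have "((\<lambda>t. frechet_derivative \<psi> (at (t *\<^sub>R y)) u) has_vector_derivative deriv2 \<psi> (t *\<^sub>R y) u y) (at t within {0..1})"
        using vector_derivative_diff_chain_within[OF dl has_derivative_at_withinI[OF has_derivative_deriv2[OF smooth_\<psi>_Suc open_ball inb]]]
        by (simp add: o_def)
      moreover have "((\<lambda>t. t *\<^sub>R deriv2 \<psi> 0 u y) has_vector_derivative deriv2 \<psi> 0 u y) (at t within {0..1})"
        by (auto intro!: derivative_eq_intros simp: has_vector_derivative_def)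
      ultimately show "(?g has_vector_derivative deriv2 \<psi> (t *\<^sub>R y) u y - deriv2 \<psi> 0 u y) (at t within {0..1})"
        by (rule has_vector_derivative_diff)
      have "norm (deriv2 \<psi> (t *\<^sub>R y) u y - deriv2 \<psi> 0 u y) \<le> C * norm (t *\<^sub>R y - 0) * norm u * norm y"
        using bd[OF ty[OF y t] z] by blast
      also have "\<dots> \<le> C * norm y * norm u * norm y"
        using C t by (intro mult_right_mono mult_left_mono) (auto simp: mult_left_le_one_le)
      finally show "norm (deriv2 \<psi> (t *\<^sub>R y) u y - deriv2 \<psi> 0 u y) \<le> C * (norm y)\<^sup>2 * norm u"
        by (simp add: power2_eq_square mult_ac)
    qed simp
    then show ?thesis by (simp add: D\<psi>_0 algebra_simps)
  qed
  have E2: "norm (\<psi> y - p - frame y - (1 / 2) *\<^sub>R deriv2 \<psi> 0 y y) \<le> C * norm y ^ 3" if y: "y \<in> cball 0 r" for y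
  proof -
    let ?g = "\<lambda>t. \<psi> (t *\<^sub>R y) - (t\<^sup>2 / 2) *\<^sub>R deriv2 \<psi> 0 y y - t *\<^sub>R frame y"
    have "norm (?g 1 - ?g 0) \<le> (C * norm y ^ 3) * (1 - 0)"
    proof (rule vector_derivative_norm_bound)
      fix t :: real assume t: "t \<in> {0..1}"
      have inb: "t *\<^sub>R y \<in> ball 0 R" using ty[OF y t] cb by blast
      have 1: "((\<lambda>t. \<psi> (t *\<^sub>R y)) has_vector_derivative frechet_derivative \<psi> (at (t *\<^sub>R y)) y) (at t within {0..1})"
        using vector_derivative_diff_chain_within[OF dl has_derivative_at_withinI[OF der_\<psi>[OF inb]]] by (simp add: o_def)
      have 2: "((\<lambda>t. (t\<^sup>2 / 2) *\<^sub>R deriv2 \<psi> 0 y y) has_vector_derivative t *\<^sub>R deriv2 \<psi> 0 y y) (at t within {0..1})"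
        by (auto intro!: derivative_eq_intros simp: has_vector_derivative_def)
      have 3: "((\<lambda>t. t *\<^sub>R frame y) has_vector_derivative frame y) (at t within {0..1})"
        by (auto intro!: derivative_eq_intros simp: has_vector_derivative_def)
      show "(?g has_vector_derivative frechet_derivative \<psi> (at (t *\<^sub>R y)) y - t *\<^sub>R deriv2 \<psi> 0 y y - frame y) (at t within {0..1})"
        by (rule has_vector_derivative_diff[OF has_vector_derivative_diff[OF 1 2] 3])
      have "deriv2 \<psi> 0 y (t *\<^sub>R y) = t *\<^sub>R deriv2 \<psi> 0 y y"
        by (rule linear_cmul[OF linear_deriv2_right[OF smooth_\<psi>_Suc open_ball zero_in_ball]])
      then have "norm (frechet_derivative \<psi> (at (t *\<^sub>R y)) y - t *\<^sub>R deriv2 \<psi> 0 y y - frame y) \<le> C * (norm (t *\<^sub>R y))\<^sup>2 * norm y"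
        using E1[OF ty[OF y t], of y] by (simp add: algebra_simps)
      also have "\<dots> \<le> C * (norm y)\<^sup>2 * norm y"
        using C t by (intro mult_right_mono mult_left_mono power_mono) (auto simp: mult_left_le_one_le)
      finally show "norm (frechet_derivative \<psi> (at (t *\<^sub>R y)) y - t *\<^sub>R deriv2 \<psi> 0 y y - frame y) \<le> C * norm y ^ 3"
        by (simp add: power2_eq_square power3_eq_cube mult_ac)
    qed simp
    then show ?thesis by (simp add: \<psi>_0 algebra_simps)
  qed
  have B1: "norm (deriv2 \<psi> 0 u y) \<le> C * norm y * norm u" if "y \<in> cball 0 r" for y u
    using bd[OF z z, of u y] by (simp add: mult_ac)
  have B2: "norm (frechet_derivative \<psi> (at y) u) \<le> C * norm u" if "y \<in> cball 0 r" for y u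
    using bd[OF that that] by blast
  show ?thesis
    by (intro exI[of _ r] exI[of _ C] conjI ballI allI r C B1 B2 E1 E2)
qed

text \<open>In the product of two differentials, and in the squared distance, the terms of lowest
  order beyond the Euclidean one pair a tangent vector with a second derivative at 0, so they
  vanish. The errors thus start one order later than in a general chart.\<close>

lemma metric_bounds:
  "\<exists>r>0. r < R \<and> r \<le> 1 \<and> (\<exists>C>0. \<forall>y\<in>cball 0 r. \<forall>u w.
     norm (frechet_derivative \<psi> (at y) u) \<le> C * norm u \<and>
     \<bar>frechet_derivative \<psi> (at y) u \<bullet> frechet_derivative \<psi> (at y) w - u \<bullet> w\<bar> \<le> C * (norm y)\<^sup>2 * norm u * norm w \<and>
     \<bar>(norm (\<psi> y - p))\<^sup>2 - (norm y)\<^sup>2\<bar> \<le> C * norm y ^ 4)"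
proof -
  obtain r C where r: "r > 0" "r < R" "r \<le> 1" and C: "C > 0"
    and B1: "\<And>y u. y \<in> cball 0 r \<Longrightarrow> norm (deriv2 \<psi> 0 u y) \<le> C * norm y * norm u"
    and B2: "\<And>y u. y \<in> cball 0 r \<Longrightarrow> norm (frechet_derivative \<psi> (at y) u) \<le> C * norm u"
    and B3: "\<And>y u. y \<in> cball 0 r \<Longrightarrow> norm (frechet_derivative \<psi> (at y) u - frame u - deriv2 \<psi> 0 u y) \<le> C * (norm y)\<^sup>2 * norm u"
    and B4: "\<And>y. y \<in> cball 0 r \<Longrightarrow> norm (\<psi> y - p - frame y - (1 / 2) *\<^sub>R deriv2 \<psi> 0 y y) \<le> C * norm y ^ 3"
    using taylor_bounds by metis
  define K where "K = C + 2 * C + 4 * C\<^sup>2"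
  have K: "K > 0" "C \<le> K" "2 * C + 4 * C\<^sup>2 \<le> K" using C by (auto simp: K_def add_pos_pos)
  have P1: "\<bar>frechet_derivative \<psi> (at y) u \<bullet> frechet_derivative \<psi> (at y) w - u \<bullet> w\<bar> \<le> K * (norm y)\<^sup>2 * norm u * norm w"
    if y: "y \<in> cball 0 r" for y u w
  proof -
    define Ru where "Ru = frechet_derivative \<psi> (at y) u - frame u - deriv2 \<psi> 0 u y"
    define Rw where "Rw = frechet_derivative \<psi> (at y) w - frame w - deriv2 \<psi> 0 w y"
    define a where "a = deriv2 \<psi> 0 u y + Ru"
    define b where "b = deriv2 \<psi> 0 w y + Rw"
    have y1: "norm y \<le> 1" using y r by simp
    have sq: "(norm y)\<^sup>2 \<le> norm y" using y1 by (simp add: power2_eq_square mult_left_le)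
    have nRu: "norm Ru \<le> C * (norm y)\<^sup>2 * norm u" and nRw: "norm Rw \<le> C * (norm y)\<^sup>2 * norm w"
      unfolding Ru_def Rw_def using B3[OF y] by auto
    have na: "norm a \<le> 2 * C * norm y * norm u" and nb: "norm b \<le> 2 * C * norm y * norm w"
    proof -
      have *: "C * (norm y)\<^sup>2 * norm v \<le> C * norm y * norm v" for v :: "real^'d" using sq C by (intro mult_right_mono mult_left_mono) auto
      show "norm a \<le> 2 * C * norm y * norm u"
        using norm_triangle_ineq[of "deriv2 \<psi> 0 u y" Ru] B1[OF y, of u] nRu *[of u] unfolding a_def by linarith
      show "norm b \<le> 2 * C * norm y * norm w"
        using norm_triangle_ineq[of "deriv2 \<psi> 0 w y" Rw] B1[OF y, of w] nRw *[of w] unfolding b_def by linarith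
    qed
    have fu: "frechet_derivative \<psi> (at y) u = frame u + a" "frechet_derivative \<psi> (at y) w = frame w + b"
      by (simp_all add: a_def b_def Ru_def Rw_def)
    \<comment> \<open>Normality removes the part of \<open>a\<close> and \<open>b\<close> that is
      linear in \<open>y\<close>, leaving the quadratic remainders and the product
      \<open>a \<bullet> b\<close>, itself quadratic in \<open>y\<close>.\<close>
    have "frame u \<bullet> b = frame u \<bullet> Rw" "a \<bullet> frame w = Ru \<bullet> frame w"
      using D2\<psi>_0_normal[of w y u] D2\<psi>_0_normal[of u y w] by (simp_all add: a_def b_def inner_add_left inner_add_right inner_commute)
    then have eq: "frechet_derivative \<psi> (at y) u \<bullet> frechet_derivative \<psi> (at y) w - u \<bullet> w = frame u \<bullet> Rw + Ru \<bullet> frame w + a \<bullet> b"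
      unfolding fu by (simp add: inner_add_left inner_add_right frame_inner)
    have i1: "\<bar>frame u \<bullet> Rw\<bar> \<le> C * (norm y)\<^sup>2 * norm u * norm w"
    proof -
      have "\<bar>frame u \<bullet> Rw\<bar> \<le> norm u * norm Rw" using Cauchy_Schwarz_ineq2[of "frame u" Rw] by (simp add: norm_frame)
      also have "\<dots> \<le> norm u * (C * (norm y)\<^sup>2 * norm w)" using nRw by (intro mult_left_mono) auto
      finally show ?thesis by (simp add: mult_ac)
    qed
    have i2: "\<bar>Ru \<bullet> frame w\<bar> \<le> C * (norm y)\<^sup>2 * norm u * norm w"
    proof -
      have "\<bar>Ru \<bullet> frame w\<bar> \<le> norm Ru * norm w" using Cauchy_Schwarz_ineq2[of Ru "frame w"] by (simp add: norm_frame)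
      also have "\<dots> \<le> (C * (norm y)\<^sup>2 * norm u) * norm w" using nRu by (intro mult_right_mono) auto
      finally show ?thesis .
    qed
    have i3: "\<bar>a \<bullet> b\<bar> \<le> 4 * C\<^sup>2 * (norm y)\<^sup>2 * norm u * norm w"
    proof -
      have "\<bar>a \<bullet> b\<bar> \<le> norm a * norm b" by (rule Cauchy_Schwarz_ineq2)
      also have "\<dots> \<le> (2 * C * norm y * norm u) * (2 * C * norm y * norm w)" using na nb C by (intro mult_mono) auto
      finally show ?thesis by (simp add: power2_eq_square mult_ac)
    qed
    have "\<bar>frame u \<bullet> Rw + Ru \<bullet> frame w + a \<bullet> b\<bar> \<le> (2 * C + 4 * C\<^sup>2) * ((norm y)\<^sup>2 * norm u * norm w)"
      using i1 i2 i3 by (simp add: algebra_simps)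
    also have "\<dots> \<le> K * ((norm y)\<^sup>2 * norm u * norm w)" using K(3) by (intro mult_right_mono) auto
    finally show ?thesis unfolding eq by (simp add: mult.assoc)
  qed
  have P2: "\<bar>(norm (\<psi> y - p))\<^sup>2 - (norm y)\<^sup>2\<bar> \<le> K * norm y ^ 4" if y: "y \<in> cball 0 r" for y
  proof -
    define c where "c = \<psi> y - p - frame y - (1 / 2) *\<^sub>R deriv2 \<psi> 0 y y"
    define b where "b = (1 / 2) *\<^sub>R deriv2 \<psi> 0 y y"
    have y1: "norm y \<le> 1" using y r by simp
    have nc: "norm c \<le> C * norm y ^ 3" unfolding c_def by (rule B4[OF y])
    have nb: "norm b \<le> C * (norm y)\<^sup>2"
    proof -
      have "norm b = norm (deriv2 \<psi> 0 y y) / 2" by (simp add: b_def)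
      also have "\<dots> \<le> C * norm y * norm y / 2" using B1[OF y, of y] by simp
      also have "\<dots> \<le> C * (norm y)\<^sup>2" using C by (simp add: power2_eq_square)
      finally show ?thesis .
    qed
    have nbc: "norm (b + c) \<le> 2 * C * (norm y)\<^sup>2"
    proof -
      have "norm y ^ 3 \<le> (norm y)\<^sup>2" using y1 by (intro power_decreasing) auto
      then have "C * norm y ^ 3 \<le> C * (norm y)\<^sup>2" using C by (intro mult_left_mono) auto
      then show ?thesis using norm_triangle_ineq[of b c] nb nc by linarith
    qed
    have e: "\<psi> y - p = frame y + (b + c)" by (simp add: b_def c_def)
    \<comment> \<open>This would be the cubic term of the squared distance.\<close>
    have "frame y \<bullet> b = 0" using D2\<psi>_0_normal[of y y y] by (simp add: b_def inner_commute)
    then have "(norm (\<psi> y - p))\<^sup>2 - (norm y)\<^sup>2 = 2 * (frame y \<bullet> c) + (norm (b + c))\<^sup>2"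
      unfolding e power2_norm_eq_inner by (simp add: inner_add_left inner_add_right frame_inner inner_commute)
    moreover have "\<bar>frame y \<bullet> c\<bar> \<le> C * norm y ^ 4"
    proof -
      have "\<bar>frame y \<bullet> c\<bar> \<le> norm y * norm c" using Cauchy_Schwarz_ineq2[of "frame y" c] by (simp add: norm_frame)
      also have "\<dots> \<le> norm y * (C * norm y ^ 3)" using nc by (intro mult_left_mono) auto
      finally show ?thesis by (simp add: power_Suc[symmetric] mult.left_commute eval_nat_numeral)
    qed
    moreover have "(norm (b + c))\<^sup>2 \<le> 4 * C\<^sup>2 * norm y ^ 4"
    proof -
      have "(norm (b + c))\<^sup>2 \<le> (2 * C * (norm y)\<^sup>2)\<^sup>2" using nbc by (intro power_mono) auto
      also have "\<dots> = 4 * C\<^sup>2 * norm y ^ 4" by (simp add: power_mult_distrib flip: power_mult)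
      finally show ?thesis .
    qed
    ultimately have "\<bar>(norm (\<psi> y - p))\<^sup>2 - (norm y)\<^sup>2\<bar> \<le> (2 * C + 4 * C\<^sup>2) * norm y ^ 4"
      unfolding distrib_right using zero_le_power2[of "norm (b + c)"] by linarith
    also have "\<dots> \<le> K * norm y ^ 4" using K(3) by (intro mult_right_mono) auto
    finally show ?thesis .
  qed
  have P3: "norm (frechet_derivative \<psi> (at y) u) \<le> K * norm u" if y: "y \<in> cball 0 r" for y u
    using B2[OF y, of u] mult_right_mono[OF K(2), of "norm u"] by simp
  show ?thesis
    by (intro exI[of _ r] exI[of _ K] conjI ballI allI r K(1) P1 P2 P3)
qed

end

section \<open>The Laplace--Beltrami operator in a normal chart\<close>

context chart_at
begin

lemma near_image:
  assumes y: "y \<in> ball 0 R"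
  obtains d where "d > 0" "\<And>x. x \<in> M \<Longrightarrow> dist x (\<psi> y) < d \<Longrightarrow> \<psi> (\<kappa> x) = x \<and> \<kappa> x \<in> ball 0 R"
proof -
  obtain O2 where O2: "open O2" "\<psi> ` ball 0 R = M \<inter> O2" using image_open by (auto simp: openin_open)
  have "\<psi> y \<in> O2" using O2(2) y by blast
  then obtain d where d: "d > 0" "ball (\<psi> y) d \<subseteq> O2" using O2(1) by (meson openE)
  show ?thesis
  proof (rule that[OF d(1)])
    fix x assume x: "x \<in> M" "dist x (\<psi> y) < d"
    then have "x \<in> O2" using d(2) by (auto simp: subset_iff dist_commute)
    then have "x \<in> \<psi> ` ball 0 R" using O2(2) x(1) by blast
    then obtain z where "z \<in> ball 0 R" "x = \<psi> z" by blast
    then show "\<psi> (\<kappa> x) = x \<and> \<kappa> x \<in> ball 0 R" using \<kappa>_\<psi> by metis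
  qed
qed

lemma \<psi>_in_M: "y \<in> ball 0 R \<Longrightarrow> \<psi> y \<in> M"
  using image_ball_subset by blast

text \<open>The coordinates \<open>a\<close> of the gradient solve the linear system with the Gram
  matrix of the differential, which is solvable because the differential is injective. The solution
  is then shown to be the only tangent vector representing a derivative of \<open>f\<close> within
  \<open>M\<close>.\<close>

lemma gradient_in_chart:
  assumes F: "times_differentiable_on 1 (\<lambda>y. f (\<psi> y)) (ball 0 R)" and y: "y \<in> ball 0 R"
  shows "\<exists>a. gradient TYPE('d) M f (\<psi> y) = frechet_derivative \<psi> (at y) a \<and>
     (\<forall>w. frechet_derivative \<psi> (at y) a \<bullet> frechet_derivative \<psi> (at y) w = frechet_derivative (\<lambda>y. f (\<psi> y)) (at y) w)"
proof -
  let ?F = "\<lambda>y. f (\<psi> y)"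
  define D where "D = frechet_derivative \<psi> (at y)"
  define DF where "DF = frechet_derivative ?F (at y)"
  define D\<kappa> where "D\<kappa> = frechet_derivative \<kappa> (at (\<psi> y))"
  have F1: "times_differentiable_on (Suc 0) ?F (ball 0 R)" using F by simp
  have dF: "(?F has_derivative DF) (at y)" unfolding DF_def by (rule has_derivative_frechet[OF F1 open_ball y])
  have dD: "(\<psi> has_derivative D) (at y)" unfolding D_def by (rule der_\<psi>[OF y])
  have d\<kappa>: "(\<kappa> has_derivative D\<kappa>) (at (\<psi> y))" unfolding D\<kappa>_def by (rule der_\<kappa>[OF \<psi>_W[OF y]])
  have linD: "linear D" and linF: "linear DF" using dD dF has_derivative_linear by blast+
  have inv: "D\<kappa> (D w) = w" for w unfolding D\<kappa>_def D_def by (rule D\<kappa>_D\<psi>[OF y])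
  have D0: "D a = 0 \<Longrightarrow> a = 0" for a using inv[of a] inv[of 0] linear_0[OF linD] by simp
  \<comment> \<open>The Gram operator of the induced metric in coordinates.\<close>
  define T where "T a = (\<chi> i. D a \<bullet> D (axis i 1))" for a
  have linT: "linear T" unfolding T_def
    by (rule linearI) (simp_all add: vec_eq_iff linear_add[OF linD] linear_cmul[OF linD] inner_add_left)
  have Texp: "T a \<bullet> w = D a \<bullet> D w" for a w
  proof -
    have "D w = D (\<Sum>i\<in>UNIV. w $ i *\<^sub>R axis i 1)" by (simp add: basis_expansion flip: scalar_mult_eq_scaleR)
    also have "\<dots> = (\<Sum>i\<in>UNIV. w $ i *\<^sub>R D (axis i 1))" by (simp add: linear_sum[OF linD] linear_cmul[OF linD])
    finally have Dw: "D a \<bullet> D w = (\<Sum>i\<in>UNIV. w $ i * (D a \<bullet> D (axis i 1)))" by (simp add: inner_sum_right)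
    have "T a \<bullet> w = (\<Sum>i\<in>UNIV. T a $ i * w $ i)" by (simp only: inner_vec_def inner_real_def)
    then show ?thesis unfolding Dw by (simp add: T_def mult.commute)
  qed
  have "inj T"
  proof (rule linear_injective_0[OF linT, THEN iffD2], intro allI impI)
    fix a assume "T a = 0"
    then have "D a \<bullet> D a = 0" using Texp[of a a] by simp
    then show "a = 0" using D0 by simp
  qed
  then have "surj T" by (rule linear_injective_imp_surjective[OF linT]) simp_all
  then obtain a where a: "T a = (\<chi> i. DF (axis i 1))" by (metis surjD)
  have Ta: "D a \<bullet> D w = DF w" for w
  proof -
    have "DF w = DF (\<Sum>i\<in>UNIV. w $ i *\<^sub>R axis i 1)" by (simp add: basis_expansion flip: scalar_mult_eq_scaleR)
    also have "\<dots> = (\<Sum>i\<in>UNIV. w $ i * DF (axis i 1))" by (simp add: linear_sum[OF linF] linear_cmul[OF linF])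
    also have "\<dots> = T a \<bullet> w" unfolding a by (simp add: inner_vec_def mult.commute)
    finally show ?thesis by (simp add: Texp)
  qed
  have tan: "tangent_space TYPE('d) M (\<psi> y) = range D" unfolding D_def by (rule tangent_space_eq[OF y])
  obtain d where d: "d > 0" "\<And>x. x \<in> M \<Longrightarrow> dist x (\<psi> y) < d \<Longrightarrow> \<psi> (\<kappa> x) = x \<and> \<kappa> x \<in> ball 0 R"
    using near_image[OF y] by metis
  have \<kappa>y: "\<kappa> (\<psi> y) = y" by (rule \<kappa>_\<psi>[OF y])
  \<comment> \<open>Within \<open>M\<close> the identity also has the derivative that passes through
    the chart. So the functional on the chart side, known only on tangent vectors, can be exchanged
    for the ambient product with \<open>D a\<close>.\<close>
  have idM: "((\<lambda>x. x) has_derivative (\<lambda>v. D (D\<kappa> v))) (at (\<psi> y) within M)"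
  proof -
    have "((\<lambda>x. \<psi> (\<kappa> x)) has_derivative (\<lambda>v. D (D\<kappa> v))) (at (\<psi> y) within M)"
      using diff_chain_at[OF d\<kappa>, of \<psi> D] dD by (simp add: \<kappa>y o_def has_derivative_at_withinI)
    then show ?thesis
      by (rule has_derivative_transform_within[OF _ d(1) \<psi>_in_M[OF y]]) (use d(2) in blast)
  qed
  have fM: "(f has_derivative (\<lambda>v. DF (D\<kappa> v))) (at (\<psi> y) within M)"
  proof -
    have "((\<lambda>x. ?F (\<kappa> x)) has_derivative (\<lambda>v. DF (D\<kappa> v))) (at (\<psi> y) within M)"
      using diff_chain_at[OF d\<kappa>, of ?F DF] dF by (simp add: \<kappa>y o_def has_derivative_at_withinI)
    then show ?thesis
      by (rule has_derivative_transform_within[OF _ d(1) \<psi>_in_M[OF y]]) (use d(2) in auto)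
  qed
  have grad: "(f has_derivative (\<lambda>v. D a \<bullet> v)) (at (\<psi> y) within M)"
  proof -
    have "((\<lambda>x. D a \<bullet> x) has_derivative (\<lambda>v. D a \<bullet> D (D\<kappa> v))) (at (\<psi> y) within M)"
      by (rule has_derivative_inner_right[OF idM])
    from has_derivative_diff[OF fM this]
    have "((\<lambda>x. f x - D a \<bullet> x) has_derivative (\<lambda>v. 0)) (at (\<psi> y) within M)" by (simp add: Ta)
    from has_derivative_add[OF this has_derivative_inner_right[OF has_derivative_ident, of "D a"]]
    show ?thesis by simp
  qed
  have "gradient TYPE('d) M f (\<psi> y) = D a"
    unfolding gradient_def
  proof (rule the_equality)
    show "D a \<in> tangent_space TYPE('d) M (\<psi> y) \<and> (f has_derivative (\<lambda>v. D a \<bullet> v)) (at (\<psi> y) within M)"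
      using grad by (simp add: tan)
    fix g assume g: "g \<in> tangent_space TYPE('d) M (\<psi> y) \<and> (f has_derivative (\<lambda>v. g \<bullet> v)) (at (\<psi> y) within M)"
    then obtain b where b: "g = D b" unfolding tan by blast
    have "(f has_derivative (\<lambda>v. g \<bullet> v)) (at (\<psi> y) within \<psi> ` ball 0 R)"
      using g image_ball_subset by (blast intro: has_derivative_subset)
    from diff_chain_within[OF has_derivative_at_withinI[OF dD] this]
    have "(?F has_derivative (\<lambda>w. g \<bullet> D w)) (at y)"
      unfolding at_within_open[OF y open_ball] by (simp add: o_def)
    then have "(\<lambda>w. g \<bullet> D w) = DF" using dF by (rule has_derivative_unique)
    then have gw: "g \<bullet> D w = D a \<bullet> D w" for w using Ta by metis
    have "(g - D a) \<bullet> (g - D a) = g \<bullet> D (b - a) - D a \<bullet> D (b - a)"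
      unfolding b by (simp add: linear_diff[OF linD] inner_diff_left)
    then have "(g - D a) \<bullet> (g - D a) = 0" using gw[of "b - a"] by simp
    then show "g = D a" by simp
  qed
  then show ?thesis using Ta unfolding D_def DF_def by (intro exI[of _ a]) simp
qed

end

context normal_chart
begin

text \<open>The exact gradient contains the inverse Gram matrix. As this matrix is the identity up
  to O(|y|^2), the gradient differs quadratically from \<open>Gt\<close>, built with the partial
  derivatives as coefficients, and \<open>Gt\<close> is visibly differentiable at 0.\<close>

lemma gradient_differentiable:
  assumes F: "times_differentiable_on 2 (\<lambda>y. f (\<psi> y)) (ball 0 R)"
  shows "\<exists>G'. ((\<lambda>y. gradient TYPE('d) M f (\<psi> y)) has_derivative G') (at 0)"
proof -
  let ?F = "\<lambda>y. f (\<psi> y)"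
  have F2: "times_differentiable_on (Suc (Suc 0)) ?F (ball 0 R)" using F by (simp add: numeral_2_eq_2)
  have F1: "times_differentiable_on 1 ?F (ball 0 R)" using times_differentiable_on_SucD[OF F2] by simp
  define b where "b y = (\<chi> i. frechet_derivative ?F (at y) (axis i 1))" for y
  have bw: "frechet_derivative ?F (at y) w = b y \<bullet> w" if y: "y \<in> ball 0 R" for y w
  proof -
    have lin: "linear (frechet_derivative ?F (at y))" by (rule linear_frechet[OF F2 open_ball y])
    have "frechet_derivative ?F (at y) w = frechet_derivative ?F (at y) (\<Sum>i\<in>UNIV. w $ i *\<^sub>R axis i 1)"
      by (simp add: basis_expansion flip: scalar_mult_eq_scaleR)
    also have "\<dots> = (\<Sum>i\<in>UNIV. w $ i * frechet_derivative ?F (at y) (axis i 1))"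
      by (simp add: linear_sum[OF lin] linear_cmul[OF lin])
    finally show ?thesis by (simp add: b_def inner_vec_def mult.commute)
  qed
  have dbi: "((\<lambda>y. b y $ i) has_derivative deriv2 ?F 0 (axis i 1)) (at 0)" for i
    unfolding b_def using has_derivative_deriv2[OF F2 open_ball zero_in_ball] by simp
  define Gt where "Gt y = (\<Sum>i\<in>UNIV. b y $ i *\<^sub>R frechet_derivative \<psi> (at y) (axis i 1))" for y
  have dGt: "(Gt has_derivative (\<lambda>h. \<Sum>i\<in>UNIV. b 0 $ i *\<^sub>R deriv2 \<psi> 0 (axis i 1) h + deriv2 ?F 0 (axis i 1) h *\<^sub>R frechet_derivative \<psi> (at 0) (axis i 1))) (at 0)"
    unfolding Gt_def
    by (intro has_derivative_sum has_derivative_scaleR dbi has_derivative_deriv2[OF smooth_\<psi>_Suc open_ball zero_in_ball])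
  have Gtb: "Gt y = frechet_derivative \<psi> (at y) (b y)" if y: "y \<in> ball 0 R" for y
  proof -
    have "frechet_derivative \<psi> (at y) (b y) = frechet_derivative \<psi> (at y) (\<Sum>i\<in>UNIV. b y $ i *\<^sub>R axis i 1)"
      by (simp add: basis_expansion flip: scalar_mult_eq_scaleR)
    then show ?thesis unfolding Gt_def by (simp add: linear_sum[OF linear_D\<psi>[OF y]] linear_cmul[OF linear_D\<psi>[OF y]])
  qed
  obtain r C where r: "r > 0" "r < R" "r \<le> 1" and C: "C > 0"
    and B1: "\<And>y u. y \<in> cball 0 r \<Longrightarrow> norm (frechet_derivative \<psi> (at y) u) \<le> C * norm u"
    and B2: "\<And>y u w. y \<in> cball 0 r \<Longrightarrow> \<bar>frechet_derivative \<psi> (at y) u \<bullet> frechet_derivative \<psi> (at y) w - u \<bullet> w\<bar> \<le> C * (norm y)\<^sup>2 * norm u * norm w"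
    using metric_bounds by metis
  have "isCont b 0"
    unfolding continuous_at by (intro vec_tendstoI) (use has_derivative_continuous[OF dbi] in \<open>simp add: continuous_at\<close>)
  then obtain r2 where r2: "r2 > 0" "\<And>y. dist y 0 < r2 \<Longrightarrow> dist (b y) (b 0) < 1"
    unfolding continuous_at_eps_delta using zero_less_one by metis
  define B where "B = norm (b 0) + 1"
  have nb: "norm (b y) \<le> B" if "norm y < r2" for y
    using r2(2)[of y] that norm_triangle_ineq2[of "b y" "b 0"] by (simp add: B_def dist_norm)
  \<comment> \<open>The radius \<open>1 / (2 * C + 1)\<close> makes
    \<open>C * (norm y)\<^sup>2\<close> at most 1/2, so that \<open>norm a\<close> can be absorbed
    and bounded by \<open>2 * B\<close>.\<close>
  define r3 where "r3 = min (min r r2) (1 / (2 * C + 1))"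
  have r3: "r3 > 0" using r r2 C by (simp add: r3_def)
  have near: "norm (gradient TYPE('d) M f (\<psi> y) - Gt y) \<le> (2 * C\<^sup>2 * B) * (norm y)\<^sup>2" if y: "norm y < r3" for y
  proof -
    have yr: "y \<in> cball 0 r" "y \<in> ball 0 R" "norm y < r2" "norm y < 1 / (2 * C + 1)" using y r by (auto simp: r3_def)
    obtain a where a: "gradient TYPE('d) M f (\<psi> y) = frechet_derivative \<psi> (at y) a"
      "\<And>w. frechet_derivative \<psi> (at y) a \<bullet> frechet_derivative \<psi> (at y) w = frechet_derivative ?F (at y) w"
      using gradient_in_chart[OF F1 yr(2)] by metis
    let ?w = "b y - a"
    \<comment> \<open>The equation for the gradient is tested with the error of the coefficients
      itself; one factor \<open>norm ?w\<close> then cancels.\<close>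
    have "(norm ?w)\<^sup>2 = b y \<bullet> ?w - a \<bullet> ?w" by (simp add: power2_norm_eq_inner inner_diff_left)
    also have "\<dots> = frechet_derivative \<psi> (at y) a \<bullet> frechet_derivative \<psi> (at y) ?w - a \<bullet> ?w"
      unfolding a(2) bw[OF yr(2)] ..
    also have "\<dots> \<le> C * (norm y)\<^sup>2 * norm a * norm ?w" using B2[OF yr(1), of a ?w] by linarith
    finally have "norm ?w * norm ?w \<le> (C * (norm y)\<^sup>2 * norm a) * norm ?w" by (simp add: power2_eq_square)
    then have w1: "norm ?w \<le> C * (norm y)\<^sup>2 * norm a"
    proof (cases "norm ?w = 0")
      case True then show ?thesis using C by simp
    next
      case False
      then have "0 < norm ?w" by simp
      with \<open>norm ?w * norm ?w \<le> _\<close> show ?thesis by (metis mult_le_cancel_right_pos)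
    qed
    have small: "C * (norm y)\<^sup>2 \<le> 1 / 2"
    proof -
      have y1: "norm y \<le> 1" using yr(1) r(3) by simp
      have "C * (norm y)\<^sup>2 \<le> C * norm y" using y1 C by (simp add: power2_eq_square mult_left_le)
      also have "\<dots> \<le> C * (1 / (2 * C + 1))" using yr(4) C by (intro mult_left_mono) auto
      also have "\<dots> \<le> 1 / 2" using C by (simp add: divide_simps)
      finally show ?thesis .
    qed
    have "norm a \<le> norm (b y) + norm ?w" by (metis norm_triangle_sub norm_minus_commute)
    moreover have "C * (norm y)\<^sup>2 * norm a \<le> 1 / 2 * norm a" using small by (intro mult_right_mono) auto
    ultimately have "norm a \<le> 2 * norm (b y)" using w1 by linarith
    then have na: "norm a \<le> 2 * B" using nb[OF yr(3)] by linarith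
    have "norm (gradient TYPE('d) M f (\<psi> y) - Gt y) = norm (frechet_derivative \<psi> (at y) (a - b y))"
      unfolding a(1) Gtb[OF yr(2)] by (simp add: linear_diff[OF linear_D\<psi>[OF yr(2)]])
    also have "\<dots> \<le> C * norm ?w" using B1[OF yr(1), of "a - b y"] by (simp add: norm_minus_commute)
    also have "\<dots> \<le> C * (C * (norm y)\<^sup>2 * (2 * B))"
    proof (rule mult_left_mono)
      have "C * (norm y)\<^sup>2 * norm a \<le> C * (norm y)\<^sup>2 * (2 * B)" using na C by (intro mult_left_mono) auto
      then show "norm ?w \<le> C * (norm y)\<^sup>2 * (2 * B)" using w1 by linarith
    qed (use C in simp)
    finally show ?thesis by (simp add: power2_eq_square mult_ac)
  qed
  from has_derivative_quadratic_perturbation[OF dGt r3 near] show ?thesis by blast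
qed

text \<open>The product of the gradient with the coordinate field is the partial derivative of
  \<open>f\<close> in the chart. Differentiating at 0 leaves the second partials as the trace, since
  the remaining term pairs a tangent vector with a normal one.\<close>

lemma laplace_beltrami_eq:
  assumes F: "times_differentiable_on 2 (\<lambda>y. f (\<psi> y)) (ball 0 R)"
  shows "laplace_beltrami TYPE('d) M f p = (\<Sum>j\<in>UNIV. deriv2 (\<lambda>y. f (\<psi> y)) 0 (axis j 1) (axis j 1))"
proof -
  let ?F = "\<lambda>y. f (\<psi> y)" and ?X = "gradient TYPE('d) M f"
  have F2: "times_differentiable_on (Suc (Suc 0)) ?F (ball 0 R)" using F by (simp add: numeral_2_eq_2)
  have F1: "times_differentiable_on 1 ?F (ball 0 R)" using times_differentiable_on_SucD[OF F2] by simp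
  obtain G' where G': "((\<lambda>y. ?X (\<psi> y)) has_derivative G') (at 0)" using gradient_differentiable[OF F] by blast
  have p0: "\<kappa> p = 0" "\<psi> 0 = p" by (rule \<kappa>_p, rule \<psi>_0)
  obtain d where d: "d > 0" "\<And>x. x \<in> M \<Longrightarrow> dist x (\<psi> 0) < d \<Longrightarrow> \<psi> (\<kappa> x) = x \<and> \<kappa> x \<in> ball 0 R"
    using near_image[OF zero_in_ball] by metis
  have X: "(?X has_derivative (\<lambda>v. G' (frechet_derivative \<kappa> (at p) v))) (at p within M)"
  proof -
    have "((\<lambda>x. ?X (\<psi> (\<kappa> x))) has_derivative (\<lambda>v. G' (frechet_derivative \<kappa> (at p) v))) (at p within M)"
      using diff_chain_at[OF der_\<kappa>[OF p_in_W], of "\<lambda>y. ?X (\<psi> y)" G'] G'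
      by (simp add: p0 o_def has_derivative_at_withinI)
    then show ?thesis
      by (rule has_derivative_transform_within[OF _ d(1) p_in_M]) (use d(2) p0 in auto)
  qed
  \<comment> \<open>A derivative within \<open>M\<close> is not unique as an ambient map, but its
    values on tangent vectors are; the trace in \<open>divergence\<close> uses only these.\<close>
  have unique: "X' (e j) = G' (axis j 1)" if X': "(?X has_derivative X') (at p within M)" for X' j
  proof -
    have "(?X has_derivative X') (at (\<psi> 0) within \<psi> ` ball 0 R)"
      unfolding p0(2) using X' image_ball_subset by (rule has_derivative_subset)
    from diff_chain_within[OF has_derivative_at_withinI[OF der_\<psi>[OF zero_in_ball]] this]
    have "((\<lambda>y. ?X (\<psi> y)) has_derivative (\<lambda>w. X' (frechet_derivative \<psi> (at 0) w))) (at 0)"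
      unfolding at_within_open[OF zero_in_ball open_ball] by (simp add: o_def)
    then have "(\<lambda>w. X' (frechet_derivative \<psi> (at 0) w)) = G'" using G' by (rule has_derivative_unique)
    then have "X' (frechet_derivative \<psi> (at 0) (axis j 1)) = G' (axis j 1)" by metis
    then show ?thesis by (simp add: D\<psi>_0 frame_axis)
  qed
  \<comment> \<open>The product rule for the gradient times the \<open>j\<close>-th coordinate
    field, evaluated in direction \<open>j\<close>.\<close>
  have val: "G' (axis j 1) \<bullet> e j = deriv2 ?F 0 (axis j 1) (axis j 1)" for j
  proof -
    have "((\<lambda>y. ?X (\<psi> y) \<bullet> frechet_derivative \<psi> (at y) (axis j 1)) has_derivative
       (\<lambda>h. ?X (\<psi> 0) \<bullet> deriv2 \<psi> 0 (axis j 1) h + G' h \<bullet> frechet_derivative \<psi> (at 0) (axis j 1))) (at 0)"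
      by (rule has_derivative_inner[OF G' has_derivative_deriv2[OF smooth_\<psi>_Suc open_ball zero_in_ball]])
    then have 1: "((\<lambda>y. frechet_derivative ?F (at y) (axis j 1)) has_derivative
       (\<lambda>h. ?X (\<psi> 0) \<bullet> deriv2 \<psi> 0 (axis j 1) h + G' h \<bullet> frechet_derivative \<psi> (at 0) (axis j 1))) (at 0)"
    proof (rule has_derivative_transform_within_open[OF _ open_ball zero_in_ball])
      fix y :: "real^'d" assume "y \<in> ball 0 R"
      then show "?X (\<psi> y) \<bullet> frechet_derivative \<psi> (at y) (axis j 1) = frechet_derivative ?F (at y) (axis j 1)"
        using gradient_in_chart[OF F1] by metis
    qed
    have "(\<lambda>h. ?X (\<psi> 0) \<bullet> deriv2 \<psi> 0 (axis j 1) h + G' h \<bullet> frechet_derivative \<psi> (at 0) (axis j 1)) = deriv2 ?F 0 (axis j 1)"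
      by (rule has_derivative_unique[OF 1 has_derivative_deriv2[OF F2 open_ball zero_in_ball]])
    from fun_cong[OF this, of "axis j 1"] have 2: "?X (\<psi> 0) \<bullet> deriv2 \<psi> 0 (axis j 1) (axis j 1) + G' (axis j 1) \<bullet> frechet_derivative \<psi> (at 0) (axis j 1)
        = deriv2 ?F 0 (axis j 1) (axis j 1)" .
    obtain a where "?X (\<psi> 0) = frame a" using gradient_in_chart[OF F1 zero_in_ball] by (metis D\<psi>_0)
    then have "?X (\<psi> 0) \<bullet> deriv2 \<psi> 0 (axis j 1) (axis j 1) = 0"
      using D2\<psi>_0_normal by (simp add: inner_commute)
    then show ?thesis using 2 by (simp add: D\<psi>_0 frame_axis)
  qed
  have tr: "(\<Sum>j\<in>UNIV. X' (b j) \<bullet> b j) = (\<Sum>j\<in>UNIV. deriv2 ?F 0 (axis j 1) (axis j 1))"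
    if X': "(?X has_derivative X') (at p within M)" and b: "orthonormal_frame (tangent_space TYPE('d) M p) b"
    for X' and b :: "'d \<Rightarrow> real^'m"
  proof -
    have bo: "b i \<bullet> b j = (if i = j then 1 else 0)" "span (range b) = span (range e)" for i j
      using b unfolding orthonormal_frame_def span_e by auto
    have "(\<Sum>j\<in>UNIV. X' (b j) \<bullet> b j) = (\<Sum>j\<in>UNIV. X' (e j) \<bullet> e j)"
      by (rule trace_orthonormal_frame[OF bo(1) ortho bo(2) has_derivative_linear[OF X']])
    then show ?thesis by (simp add: unique[OF X'] val)
  qed
  have ofe: "orthonormal_frame (tangent_space TYPE('d) M p) e"
    unfolding orthonormal_frame_def using ortho span_e by blast
  show ?thesis
    unfolding laplace_beltrami_def divergence_def
  proof (rule the_equality)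
    show "\<exists>X' (b :: 'd \<Rightarrow> real^'m). (?X has_derivative X') (at p within M) \<and> orthonormal_frame (tangent_space TYPE('d) M p) b \<and>
        (\<Sum>j\<in>UNIV. deriv2 ?F 0 (axis j 1) (axis j 1)) = (\<Sum>j\<in>UNIV. X' (b j) \<bullet> b j)"
      using X ofe tr[OF X ofe, symmetric] by (intro exI conjI)
    fix c assume "\<exists>X' (b :: 'd \<Rightarrow> real^'m). (?X has_derivative X') (at p within M) \<and> orthonormal_frame (tangent_space TYPE('d) M p) b \<and>
        c = (\<Sum>j\<in>UNIV. X' (b j) \<bullet> b j)"
    then show "c = (\<Sum>j\<in>UNIV. deriv2 ?F 0 (axis j 1) (axis j 1))" by (elim exE conjE) (simp only: tr)
  qed
qed

end

section \<open>The volume measure in a chart\<close>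

text \<open>In the Leibniz formula each of the n! products is compared with that of the identity
  matrix; a single product changes by at most 2^n n \<epsilon>.\<close>

lemma det_near_identity:
  fixes A :: "real^'n::finite^'n"
  assumes A: "\<And>i j. \<bar>A $ i $ j - (if i = j then 1 else 0)\<bar> \<le> \<epsilon>" and \<epsilon>: "\<epsilon> \<le> 1"
  shows "\<bar>det A - 1\<bar> \<le> fact CARD('n) * (2 ^ CARD('n) * real CARD('n)) * \<epsilon>"
proof -
  let ?I = "mat 1 :: real^'n^'n" and ?n = "CARD('n)"
  have \<epsilon>0: "0 \<le> \<epsilon>" using A[of undefined undefined] by linarith
  have I: "?I $ i $ j = (if i = j then 1 else 0)" for i j by (simp add: mat_def)
  have pd: "\<bar>(\<Prod>i\<in>UNIV. A $ i $ q i) - (\<Prod>i\<in>UNIV. ?I $ i $ q i)\<bar> \<le> 2 ^ ?n * real ?n * \<epsilon>" for q :: "'n \<Rightarrow> 'n"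
  proof -
    \<comment> \<open>\<open>norm_prod_diff\<close> asks for factors of norm at most 1. The entries
      are bounded by 2, so each factor is halved, at the price of 2^n.\<close>
    have "norm ((\<Prod>i\<in>UNIV. A $ i $ q i / 2) - (\<Prod>i\<in>UNIV. ?I $ i $ q i / 2)) \<le> (\<Sum>i\<in>UNIV. norm (A $ i $ q i / 2 - ?I $ i $ q i / 2))"
    proof (rule norm_prod_diff)
      fix i
      have "\<bar>A $ i $ q i\<bar> \<le> 2" using A[of i "q i"] \<epsilon> by (auto split: if_splits)
      then show "norm (A $ i $ q i / 2) \<le> 1" by simp
      show "norm (?I $ i $ q i / 2) \<le> 1" by (simp add: I)
    qed
    also have "\<dots> \<le> (\<Sum>i\<in>(UNIV::'n set). \<epsilon>)"
    proof (rule sum_mono)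
      fix i
      have "norm (A $ i $ q i / 2 - ?I $ i $ q i / 2) = \<bar>A $ i $ q i - (if i = q i then 1 else 0)\<bar> / 2"
        by (simp only: I real_norm_def diff_divide_distrib[symmetric] abs_divide)
      also have "\<dots> \<le> \<epsilon> / 2" using A[of i "q i"] by (rule divide_right_mono) simp
      also have "\<dots> \<le> \<epsilon>" using \<epsilon>0 by simp
      finally show "norm (A $ i $ q i / 2 - ?I $ i $ q i / 2) \<le> \<epsilon>" .
    qed
    finally have "\<bar>(\<Prod>i\<in>UNIV. A $ i $ q i) / 2 ^ ?n - (\<Prod>i\<in>UNIV. ?I $ i $ q i) / 2 ^ ?n\<bar> \<le> real ?n * \<epsilon>"
      by (simp add: prod_dividef)
    then have "\<bar>(\<Prod>i\<in>UNIV. A $ i $ q i) - (\<Prod>i\<in>UNIV. ?I $ i $ q i)\<bar> / 2 ^ ?n \<le> real ?n * \<epsilon>"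
      by (simp add: diff_divide_distrib[symmetric] abs_divide)
    then show ?thesis by (simp add: pos_divide_le_eq mult_ac)
  qed
  have "det A - 1 = (\<Sum>q | q permutes UNIV. of_int (sign q) * ((\<Prod>i\<in>UNIV. A $ i $ q i) - (\<Prod>i\<in>UNIV. ?I $ i $ q i)))"
    using det_I[where 'a=real and 'n='n] by (simp add: det_def right_diff_distrib sum_subtractf)
  also have "\<bar>\<dots>\<bar> \<le> (\<Sum>q | q permutes (UNIV::'n set). 2 ^ ?n * real ?n * \<epsilon>)"
  proof (rule order_trans[OF sum_abs sum_mono])
    fix q :: "'n \<Rightarrow> 'n"
    have "\<bar>of_int (sign q) :: real\<bar> = 1" by (simp add: sign_def)
    then show "\<bar>of_int (sign q) * ((\<Prod>i\<in>UNIV. A $ i $ q i) - (\<Prod>i\<in>UNIV. ?I $ i $ q i))\<bar> \<le> 2 ^ ?n * real ?n * \<epsilon>"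
      using pd[of q] by (simp add: abs_mult)
  qed
  also have "\<dots> = fact ?n * (2 ^ ?n * real ?n) * \<epsilon>"
    by (simp add: card_permutations[OF refl])
  finally show ?thesis .
qed

context chart_at
begin

text \<open>Extension by a constant outside the ball makes the chart data Borel on the whole
  coordinate space.\<close>

definition D\<psi>_ext :: "real^'d \<Rightarrow> real^'d \<Rightarrow> real^'m" where
  "D\<psi>_ext v y = (if y \<in> ball 0 R then frechet_derivative \<psi> (at y) v else 0)"

definition dens :: "real^'d \<Rightarrow> real" where
  "dens y = sqrt (det (\<chi> i j. D\<psi>_ext (axis i 1) y \<bullet> D\<psi>_ext (axis j 1) y))"

text \<open>The default value \<open>p\<close> keeps all values in \<open>M\<close>, so the map is
  measurable into the restricted space.\<close>

definition \<psi>_ext :: "real^'d \<Rightarrow> real^'m" where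
  "\<psi>_ext y = (if y \<in> ball 0 R then \<psi> y else p)"

lemma D\<psi>_ext_measurable [measurable]: "D\<psi>_ext v \<in> borel_measurable borel"
proof -
  have "continuous_on (ball 0 R) (\<lambda>y. frechet_derivative \<psi> (at y) v)"
  proof (rule continuous_at_imp_continuous_on, rule ballI)
    fix y :: "real^'d" assume "y \<in> ball 0 R"
    from has_derivative_continuous[OF has_derivative_deriv2[OF smooth_\<psi>_Suc open_ball this]]
    show "isCont (\<lambda>y. frechet_derivative \<psi> (at y) v) y" .
  qed
  then show ?thesis unfolding D\<psi>_ext_def by (intro borel_measurable_continuous_on_if) auto
qed

lemma dens_measurable [measurable]: "dens \<in> borel_measurable borel"
  unfolding dens_def det_def by simp

lemma \<psi>_ext_measurable_borel [measurable]: "\<psi>_ext \<in> borel_measurable borel"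
proof -
  have "continuous_on (ball 0 R) \<psi>"
    by (rule continuous_at_imp_continuous_on, rule ballI) (rule has_derivative_continuous[OF der_\<psi>])
  then show ?thesis unfolding \<psi>_ext_def by (intro borel_measurable_continuous_on_if) auto
qed

lemma \<psi>_ext_measurable: "\<psi>_ext \<in> measurable borel (restrict_space borel M)"
  by (rule measurable_restrict_space2) (auto simp: \<psi>_ext_def \<psi>_in_M p_in_M)

lemma image_ball_open:
  assumes "r \<le> R" shows "openin (top_of_set M) (\<psi> ` ball 0 r)"
proof -
  obtain O2 where O2: "open O2" "\<psi> ` ball 0 R = M \<inter> O2" using image_open by (auto simp: openin_open)
  have "continuous_on W \<kappa>"
    by (rule continuous_at_imp_continuous_on, rule ballI) (rule has_derivative_continuous[OF der_\<kappa>])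
  then have op: "open (W \<inter> \<kappa> -` ball 0 r)" using W by (intro continuous_open_preimage) auto
  have "\<psi> ` ball 0 r = M \<inter> (O2 \<inter> (W \<inter> \<kappa> -` ball 0 r))"
  proof (intro equalityI subsetI)
    fix x assume "x \<in> \<psi> ` ball 0 r"
    then obtain y where y: "y \<in> ball 0 r" "x = \<psi> y" by blast
    then have yR: "y \<in> ball 0 R" using assms by auto
    then have "x \<in> M \<inter> O2" using y O2(2) by blast
    then show "x \<in> M \<inter> (O2 \<inter> (W \<inter> \<kappa> -` ball 0 r))" using y yR \<psi>_W \<kappa>_\<psi> by simp
  next
    fix x assume x: "x \<in> M \<inter> (O2 \<inter> (W \<inter> \<kappa> -` ball 0 r))"
    then have "x \<in> \<psi> ` ball 0 R" using O2(2) by blast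
    then obtain y where y: "y \<in> ball 0 R" "x = \<psi> y" by blast
    then have "y \<in> ball 0 r" using x \<kappa>_\<psi> by simp
    then show "x \<in> \<psi> ` ball 0 r" using y by blast
  qed
  then show ?thesis using O2(1) op by (auto simp: openin_open)
qed

lemma image_ball_sets: "r \<le> R \<Longrightarrow> \<psi> ` ball 0 r \<in> sets (restrict_space borel M)"
  using image_ball_open unfolding openin_open by (fastforce simp: sets_restrict_space)

lemma volume_density_shift:
  assumes y: "y \<in> ball 0 R"
  shows "volume_density (\<lambda>z. \<psi> (z - corner)) (ball corner R) (y + corner) = dens y"
proof -
  have yc: "y + corner \<in> ball corner R" using y by (simp add: dist_norm)
  have "((\<lambda>z. \<psi> (z - corner)) has_derivative frechet_derivative \<psi> (at y)) (at (y + corner))"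
  proof -
    have "((\<lambda>z. z - corner) has_derivative (\<lambda>h. h)) (at (y + corner))" by (auto intro!: derivative_eq_intros)
    from diff_chain_at[OF this, of \<psi> "frechet_derivative \<psi> (at y)"] der_\<psi>[OF y] show ?thesis by (simp add: o_def)
  qed
  then have "frechet_derivative (\<lambda>z. \<psi> (z - corner)) (at (y + corner) within ball corner R) = frechet_derivative \<psi> (at y)"
    unfolding at_within_open[OF yc open_ball] by (rule frechet_derivative_at[symmetric])
  then show ?thesis using y by (simp add: volume_density_def dens_def D\<psi>_ext_def)
qed

text \<open>\<open>riemannian_volume\<close> speaks about the translated chart; translation
  invariance of Lebesgue measure removes the shift.\<close>

lemma emeasure_image:
  assumes \<mu>: "riemannian_volume TYPE('d) M \<mu>" and B: "B \<in> sets borel" "B \<subseteq> ball 0 R"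
  shows "emeasure \<mu> (\<psi> ` B) = (\<integral>\<^sup>+ y\<in>B. ennreal (dens y) \<partial>lborel)"
proof -
  let ?\<phi> = "\<lambda>z. \<psi> (z - corner)"
  define B' where "B' = {z. z - corner \<in> B}"
  have [measurable]: "B \<in> sets borel" by fact
  have B'm [measurable]: "B' \<in> sets borel"
  proof -
    have "(\<lambda>z. z - corner) -` B \<inter> space borel \<in> sets borel" by measurable
    then show ?thesis by (simp add: B'_def vimage_def)
  qed
  have sub: "B' \<subseteq> ball corner R"
  proof
    fix z assume "z \<in> B'"
    then have "z - corner \<in> ball 0 R" using B(2) unfolding B'_def by blast
    then show "z \<in> ball corner R" by (simp add: dist_norm norm_minus_commute)
  qed
  have im: "?\<phi> ` B' = \<psi> ` B"
  proof (intro equalityI image_subsetI)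
    fix z assume "z \<in> B'" then show "?\<phi> z \<in> \<psi> ` B" unfolding B'_def by blast
  next
    fix y assume "y \<in> B" then show "\<psi> y \<in> ?\<phi> ` B'" by (intro image_eqI[of _ _ "y + corner"]) (auto simp: B'_def)
  qed
  have "emeasure \<mu> (?\<phi> ` B') = (\<integral>\<^sup>+ z\<in>B'. ennreal (volume_density ?\<phi> (ball corner R) z) \<partial>lborel)"
    using \<mu> local_param_shift B'm sub unfolding riemannian_volume_def by blast
  also have "\<dots> = (\<integral>\<^sup>+ z. ennreal (dens (z - corner)) * indicator B' z \<partial>lborel)"
  proof (intro nn_integral_cong)
    fix z
    show "ennreal (volume_density ?\<phi> (ball corner R) z) * indicator B' z = ennreal (dens (z - corner)) * indicator B' z"
    proof (cases "z \<in> B'")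
      case True
      then have "z - corner \<in> ball 0 R" using B(2) unfolding B'_def by blast
      from volume_density_shift[OF this] show ?thesis by simp
    qed simp
  qed
  also have "\<dots> = (\<integral>\<^sup>+ z. ennreal (dens (z - corner)) * indicator B' z \<partial>(distr lborel borel (\<lambda>x. corner + x)))"
    by (simp only: lborel_distr_plus)
  also have "\<dots> = (\<integral>\<^sup>+ y. ennreal (dens (corner + y - corner)) * indicator B' (corner + y) \<partial>lborel)"
    by (subst nn_integral_distr) auto
  also have "\<dots> = (\<integral>\<^sup>+ y\<in>B. ennreal (dens y) \<partial>lborel)"
    by (intro nn_integral_cong) (simp add: B'_def indicator_def)
  finally show ?thesis by (simp only: im)
qed

text \<open>Change of variables as an equality of measures, the volume on the chart image being a
  push-forward from the ball, so that integrals of arbitrary functions can be transported.\<close>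

lemma volume_in_chart:
  assumes \<mu>: "riemannian_volume TYPE('d) M \<mu>" and r: "r \<le> R"
  shows "density \<mu> (\<lambda>x. ennreal (indicator (\<psi> ` ball 0 r) x)) =
    distr (density lborel (\<lambda>y. ennreal (indicator (ball 0 r) y * dens y))) (restrict_space borel M) \<psi>_ext" (is "?L = ?Rm")
proof (rule measure_eqI)
  have sets: "sets \<mu> = sets (restrict_space borel M)" using \<mu> unfolding riemannian_volume_def by blast
  have [measurable_cong]: "sets \<mu> = sets (restrict_space borel M)" by fact
  have [measurable]: "\<psi> ` ball 0 r \<in> sets \<mu>" using image_ball_sets[OF r] sets by simp
  have [measurable]: "\<psi>_ext \<in> measurable borel (restrict_space borel M)" by (rule \<psi>_ext_measurable)
  show "sets ?L = sets ?Rm" using sets by simp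
  fix A assume "A \<in> sets ?L"
  then have A: "A \<in> sets \<mu>" and A2 [measurable]: "A \<in> sets (restrict_space borel M)" using sets by auto
  define B where "B = \<psi>_ext -` A \<inter> ball 0 r"
  have pre: "\<psi>_ext -` A \<in> sets borel"
    using measurable_sets[OF \<psi>_ext_measurable A2] by simp
  have Bm: "B \<in> sets borel" unfolding B_def using pre by auto
  have BR: "B \<subseteq> ball 0 R" unfolding B_def using r by auto
  have im: "\<psi> ` B = \<psi> ` ball 0 r \<inter> A"
    using r unfolding B_def \<psi>_ext_def by (force split: if_splits)
  have "emeasure ?L A = emeasure \<mu> (\<psi> ` ball 0 r \<inter> A)"
    using A by (subst emeasure_density) (auto simp: indicator_inter_arith[symmetric] ennreal_indicator simp flip: indicator_inter_arith)
  also have "\<dots> = (\<integral>\<^sup>+ y\<in>B. ennreal (dens y) \<partial>lborel)"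
    unfolding im[symmetric] by (rule emeasure_image[OF \<mu> Bm BR])
  also have "\<dots> = (\<integral>\<^sup>+ y. ennreal (indicator (ball 0 r) y * dens y) * indicator (\<psi>_ext -` A) y \<partial>lborel)"
    by (intro nn_integral_cong) (auto simp: B_def indicator_def)
  also have "\<dots> = emeasure ?Rm A"
  proof -
    have [measurable]: "ball 0 r \<in> sets (borel :: (real^'d) measure)" by simp
    have "(\<lambda>y. ennreal (indicator (ball 0 r) y * dens y)) \<in> borel_measurable borel" by measurable
    then have "(\<lambda>y. ennreal (indicator (ball 0 r) y * dens y)) \<in> borel_measurable lborel" by simp
    from emeasure_density[OF this, of "\<psi>_ext -` A"] show ?thesis
      using pre by (subst emeasure_distr) auto
  qed
  finally show "emeasure ?L A = emeasure ?Rm A" .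
qed

end

context normal_chart
begin

text \<open>The Gram matrix is within \<open>C * (norm y)\<^sup>2\<close> of the identity, hence so,
  up to a constant, are its determinant and the root of that. The lower bound for the squared
  distance will keep the kernel below a wider Gaussian.\<close>

lemma chart_estimates:
  "\<exists>r>0. r < R \<and> r \<le> 1 \<and> (\<exists>C>0. \<forall>y\<in>ball 0 r. \<bar>dens y - 1\<bar> \<le> C * (norm y)\<^sup>2 \<and>
     \<bar>(norm (\<psi> y - p))\<^sup>2 - (norm y)\<^sup>2\<bar> \<le> C * norm y ^ 4 \<and> (norm y)\<^sup>2 / 2 \<le> (norm (\<psi> y - p))\<^sup>2)"
proof -
  obtain r0 C where r0: "r0 > 0" "r0 < R" "r0 \<le> 1" and C: "C > 0"
    and B2: "\<And>y u w. y \<in> cball 0 r0 \<Longrightarrow> \<bar>frechet_derivative \<psi> (at y) u \<bullet> frechet_derivative \<psi> (at y) w - u \<bullet> w\<bar> \<le> C * (norm y)\<^sup>2 * norm u * norm w"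
    and B3: "\<And>y. y \<in> cball 0 r0 \<Longrightarrow> \<bar>(norm (\<psi> y - p))\<^sup>2 - (norm y)\<^sup>2\<bar> \<le> C * norm y ^ 4"
    using metric_bounds by metis
  let ?n = "CARD('d)"
  define L :: real where "L = fact ?n * (2 ^ ?n * real ?n)"
  define K where "K = C + L * C"
  have L: "0 \<le> L" by (simp add: L_def)
  have K: "K > 0" "C \<le> K" "L * C \<le> K" using C L by (auto simp: K_def add_pos_nonneg)
  \<comment> \<open>This makes \<open>K * (norm y)\<^sup>2\<close> at most 1/2 on the ball, which
    gives the lower distance bound and a nonnegative determinant.\<close>
  define r where "r = min r0 (1 / (2 * K + 1))"
  have r: "r > 0" "r < R" "r \<le> 1" "r \<le> r0" using r0 K by (auto simp: r_def)
  have main: "\<bar>dens y - 1\<bar> \<le> K * (norm y)\<^sup>2 \<and> \<bar>(norm (\<psi> y - p))\<^sup>2 - (norm y)\<^sup>2\<bar> \<le> K * norm y ^ 4 \<and> (norm y)\<^sup>2 / 2 \<le> (norm (\<psi> y - p))\<^sup>2"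
    if y: "y \<in> ball 0 r" for y
  proof (intro conjI)
    have yc: "y \<in> cball 0 r0" "y \<in> ball 0 R" and y1: "norm y \<le> 1" using y r by auto
    have smallK: "K * (norm y)\<^sup>2 \<le> 1 / 2"
    proof -
      have "K * (norm y)\<^sup>2 \<le> K * norm y" using y1 K(1) by (simp add: power2_eq_square mult_left_le)
      also have "\<dots> \<le> K * (1 / (2 * K + 1))" using y K(1) by (intro mult_left_mono) (auto simp: r_def)
      also have "\<dots> \<le> 1 / 2" using K(1) by (simp add: divide_simps)
      finally show ?thesis .
    qed
    have small: "C * (norm y)\<^sup>2 \<le> 1 / 2" and small2: "L * (C * (norm y)\<^sup>2) \<le> 1 / 2"
      using smallK mult_right_mono[OF K(2), of "(norm y)\<^sup>2"] mult_right_mono[OF K(3), of "(norm y)\<^sup>2"]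
      by (simp_all add: mult.assoc)
    show "\<bar>(norm (\<psi> y - p))\<^sup>2 - (norm y)\<^sup>2\<bar> \<le> K * norm y ^ 4"
      using B3[OF yc(1)] mult_right_mono[OF K(2), of "norm y ^ 4"] by simp
    have "C * norm y ^ 4 = C * (norm y)\<^sup>2 * (norm y)\<^sup>2" by (simp add: power2_eq_square eval_nat_numeral)
    also have "\<dots> \<le> 1 / 2 * (norm y)\<^sup>2" using small by (intro mult_right_mono) auto
    finally show "(norm y)\<^sup>2 / 2 \<le> (norm (\<psi> y - p))\<^sup>2" using B3[OF yc(1)] by linarith
    let ?A = "\<chi> i j. D\<psi>_ext (axis i 1) y \<bullet> D\<psi>_ext (axis j 1) y"
    have "\<bar>?A $ i $ j - (if i = j then 1 else 0)\<bar> \<le> C * (norm y)\<^sup>2" for i j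
    proof -
      have ax: "(axis i 1 :: real^'d) \<bullet> axis j 1 = (if i = j then 1 else 0)" by (simp add: inner_axis_axis inner_real_def)
      show ?thesis using B2[OF yc(1), of "axis i 1" "axis j 1"] yc(2) unfolding ax by (simp add: D\<psi>_ext_def)
    qed
    then have dA: "\<bar>det ?A - 1\<bar> \<le> L * (C * (norm y)\<^sup>2)"
      unfolding L_def using small by (intro det_near_identity) auto
    have "\<bar>sqrt x - 1\<bar> \<le> \<bar>x - 1\<bar>" if x: "0 \<le> x" for x :: real
    proof -
      have "x - 1 = (sqrt x - 1) * (sqrt x + 1)" using x by (simp add: algebra_simps)
      then have "\<bar>x - 1\<bar> = \<bar>sqrt x - 1\<bar> * (sqrt x + 1)" using x by (simp add: abs_mult)
      moreover have "\<bar>sqrt x - 1\<bar> * 1 \<le> \<bar>sqrt x - 1\<bar> * (sqrt x + 1)" using x by (intro mult_left_mono) auto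
      ultimately show ?thesis by simp
    qed
    moreover have "0 \<le> det ?A" using dA small2 by linarith
    ultimately have "\<bar>dens y - 1\<bar> \<le> \<bar>det ?A - 1\<bar>" unfolding dens_def by blast
    also have "\<bar>det ?A - 1\<bar> \<le> L * (C * (norm y)\<^sup>2)" by (rule dA)
    also have "\<dots> \<le> K * (norm y)\<^sup>2" using mult_right_mono[OF K(3), of "(norm y)\<^sup>2"] by (simp add: mult.assoc)
    finally show "\<bar>dens y - 1\<bar> \<le> K * (norm y)\<^sup>2" .
  qed
  show ?thesis using r K(1) main by (intro exI[of _ r] exI[of _ K] conjI) auto
qed

end

section \<open>Existence of normal charts\<close>

text \<open>By speed conservation every geodesic with initial velocity 0 is constant, which settles
  the definite description at 0.\<close>

lemma exp_map_0:
  fixes M :: "(real^'m::finite) set"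
  assumes M: "submanifold TYPE('d::finite) M" and 0: "0 \<in> exp_domain TYPE('d) M p"
  shows "exp_map TYPE('d) M p 0 = p"
  unfolding exp_map_def
proof (rule the_equality)
  have const: "\<gamma> 1 = p" if "geodesic TYPE('d) M \<gamma>" "\<gamma> 0 = p" "velocity \<gamma> 0 = 0" for \<gamma>
    using geodesic_speed(2)[OF M that(1), of 1] that by simp
  obtain \<gamma> where g: "geodesic TYPE('d) M \<gamma>" "\<gamma> 0 = p" "velocity \<gamma> 0 = 0"
    using 0 unfolding exp_domain_def by blast
  then show "\<exists>\<gamma>. geodesic TYPE('d) M \<gamma> \<and> \<gamma> 0 = p \<and> velocity \<gamma> 0 = 0 \<and> \<gamma> 1 = p"
    using const[OF g] by (intro exI[of _ \<gamma>]) simp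
  fix x assume "\<exists>\<gamma>. geodesic TYPE('d) M \<gamma> \<and> \<gamma> 0 = p \<and> velocity \<gamma> 0 = 0 \<and> \<gamma> 1 = x"
  then obtain \<gamma>' where g': "geodesic TYPE('d) M \<gamma>'" "\<gamma>' 0 = p" "velocity \<gamma>' 0 = 0" "\<gamma>' 1 = x" by (elim exE conjE)
  show "x = p" using const[OF g'(1-3)] g'(4) by simp
qed

text \<open>The frame identifies coordinates with the tangent space by \<open>E\<close>, with
  inverse \<open>B\<close> there. The exponential map and its inverse are smooth only in the sense
  of local extensions, so \<open>\<psi>\<close> and \<open>\<kappa>\<close> are built from these
  extensions near 0 and \<open>p\<close>.\<close>

lemma normal_chart_exists:
  fixes M U V :: "(real^'m::finite) set" and e :: "'d::finite \<Rightarrow> real^'m"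
  assumes M: "submanifold TYPE('d) M" and frame: "orthonormal_frame (tangent_space TYPE('d) M p) e"
    and nn: "normal_neighborhood TYPE('d) M p V U"
  defines "c \<equiv> normal_coords M p V e"
  shows "\<exists>\<psi> \<kappa> W R. normal_chart M p \<psi> \<kappa> W R e \<and> c p = 0 \<and>
    (\<forall>y\<in>ball 0 R. \<psi> y \<in> U \<and> y \<in> c ` U \<and> inv_into U c y = \<psi> y)"
proof -
  let ?T = "tangent_space TYPE('d) M p" and ?exp = "exp_map TYPE('d) M p"
  have ortho: "e i \<bullet> e j = (if i = j then 1 else 0)" and span: "span (range e) = ?T" for i j
    using frame unfolding orthonormal_frame_def by auto
  note n = nn[unfolded normal_neighborhood_def]
  have opU: "openin (top_of_set M) U" by (rule n[THEN conjunct1])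
  have pU: "p \<in> U" by (rule n[THEN conjunct2, THEN conjunct1])
  note n2 = n[THEN conjunct2, THEN conjunct2, THEN conjunct2]
  have opV: "openin (top_of_set ?T) V" by (rule n2[THEN conjunct1])
  have V0: "0 \<in> V" by (rule n2[THEN conjunct2, THEN conjunct1])
  have Vd: "V \<subseteq> exp_domain TYPE('d) M p" by (rule n2[THEN conjunct2, THEN conjunct2, THEN conjunct1])
  have diff: "diffeomorphism V U ?exp" by (rule n2[THEN conjunct2, THEN conjunct2, THEN conjunct2])
  have bij: "bij_betw ?exp V U" and sm: "smooth_map V ?exp" "smooth_map U (inv_into V ?exp)"
    using diff unfolding diffeomorphism_def by auto
  have inj: "inj_on ?exp V" and im: "?exp ` V = U" using bij unfolding bij_betw_def by auto
  have exp0: "?exp 0 = p" by (rule exp_map_0[OF M]) (use V0 Vd in blast)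
  define E where "E y = (\<Sum>i\<in>UNIV. y $ i *\<^sub>R e i)" for y :: "real^'d"
  have linE: "linear E" unfolding E_def
    by (rule linearI) (simp_all add: scaleR_add_left sum.distrib scaleR_sum_right)
  then have blE: "bounded_linear E" by (simp add: linear_conv_bounded_linear)
  have E0: "E 0 = 0" using linear_0[OF linE] .
  have ET: "E y \<in> ?T" for y
    unfolding span[symmetric] E_def by (intro span_sum span_scale span_base) auto
  have Ee: "E y \<bullet> e i = y $ i" for y i
    by (simp add: E_def inner_sum_left ortho if_distrib cong: if_cong)
  define B where "B x = (\<chi> i. x \<bullet> e i)" for x :: "real^'m"
  have BE: "B (E y) = y" for y by (simp add: B_def Ee vec_eq_iff)
  have EB: "E (B v) = v" if "v \<in> ?T" for v
    using orthonormal_expansion[of e v, OF ortho] that unfolding span by (simp add: E_def B_def)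
  have "linear B" unfolding B_def by (rule linearI) (simp_all add: vec_eq_iff inner_add_left)
  then have blB: "bounded_linear B" by (simp add: linear_conv_bounded_linear)
  obtain W0 g where W0: "open W0" "0 \<in> W0" "\<And>k. times_differentiable_on k g W0" "\<And>v. v \<in> V \<inter> W0 \<Longrightarrow> g v = ?exp v"
    by (rule smooth_mapE[OF sm(1) V0], rule that)
  obtain W k0 where W: "open W" "p \<in> W" "\<And>k. times_differentiable_on k k0 W" "\<And>x. x \<in> U \<inter> W \<Longrightarrow> k0 x = inv_into V ?exp x"
    by (rule smooth_mapE[OF sm(2) pU], rule that)
  obtain O1 where O1: "open O1" "V = ?T \<inter> O1" using opV by (auto simp: openin_open)
  obtain O2 where O2: "open O2" "U = M \<inter> O2" using opU by (auto simp: openin_open)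
  define \<psi> where "\<psi> y = g (E y)" for y
  define \<kappa> where "\<kappa> x = B (k0 x)" for x
  have contE: "continuous_on UNIV E" using blE by (rule linear_continuous_on)
  have op: "open (E -` (O1 \<inter> W0))" using O1 W0 contE by (intro open_vimage) auto
  have td\<psi>: "times_differentiable_on k \<psi> (E -` W0)" for k
  proof -
    have "times_differentiable_on k (\<lambda>y. g (E y + 0)) {y. E y + 0 \<in> W0}"
      by (rule times_differentiable_on_affine[OF W0(1) blE W0(3)])
    then show ?thesis by (simp add: \<psi>_def[abs_def] vimage_def)
  qed
  have td\<kappa>: "times_differentiable_on k \<kappa> W" for k
    unfolding \<kappa>_def[abs_def] by (rule times_differentiable_on_linear[OF W(1) blB W(3)])
  have \<psi>0: "\<psi> 0 = p" using W0(4)[of 0] V0 W0(2) by (simp add: \<psi>_def E0 exp0)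
  have z: "(0::real^'d) \<in> E -` (O1 \<inter> W0)" using E0 W0(2) V0 O1(2) by auto
  obtain d1 where d1: "d1 > 0" "ball 0 d1 \<subseteq> E -` (O1 \<inter> W0)" using op z by (meson openE)
  have opW0: "open (E -` W0)" using W0 contE by (intro open_vimage) auto
  have "isCont \<psi> 0"
    using has_derivative_continuous[OF has_derivative_frechet[OF td\<psi> opW0, of 0]] z by simp
  then have "\<forall>\<^sub>F y in at 0. \<psi> y \<in> W" using W(1,2) \<psi>0 unfolding isCont_def by (intro topological_tendstoD) auto
  then obtain d2 where d2: "d2 > 0" "\<And>y. y \<noteq> 0 \<Longrightarrow> dist y 0 < d2 \<Longrightarrow> \<psi> y \<in> W" unfolding eventually_at by auto
  \<comment> \<open>\<open>d1\<close> keeps \<open>E y\<close> in \<open>V\<close> and in the domain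
    of the extension of the exponential map, \<open>d2\<close> keeps \<open>\<psi> y\<close> in the
    domain of the extension of its inverse.\<close>
  define R where "R = min d1 d2"
  have R: "R > 0" using d1 d2 by (simp add: R_def)
  have EV: "E y \<in> V" "E y \<in> W0" "\<psi> y = ?exp (E y)" "\<psi> y \<in> U" "\<psi> y \<in> W" if y: "y \<in> ball 0 R" for y
  proof -
    have "y \<in> ball 0 d1" using y by (simp add: R_def)
    then have "E y \<in> O1 \<inter> W0" using d1(2) by blast
    then show 1: "E y \<in> V" "E y \<in> W0" using ET O1(2) by auto
    then show 2: "\<psi> y = ?exp (E y)" using W0(4) by (simp add: \<psi>_def)
    show "\<psi> y \<in> U" unfolding 2 using 1(1) im by blast
    show "\<psi> y \<in> W" using d2(2)[of y] y W(2) \<psi>0 by (cases "y = 0") (auto simp: R_def)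
  qed
  have inv: "inv_into V ?exp (\<psi> y) = E y" if y: "y \<in> ball 0 R" for y
    unfolding EV(3)[OF y] by (rule inv_into_f_f[OF inj EV(1)[OF y]])
  have \<kappa>\<psi>: "\<kappa> (\<psi> y) = y" if y: "y \<in> ball 0 R" for y
    using W(4)[of "\<psi> y"] EV[OF y] inv[OF y] by (simp add: \<kappa>_def BE)
  have \<psi>\<kappa>: "\<psi> (\<kappa> x) = x" if x: "x \<in> U" "x \<in> W" "\<kappa> x \<in> ball 0 R" for x
  proof -
    have v: "inv_into V ?exp x \<in> V" "?exp (inv_into V ?exp x) = x"
      using x(1) im by (auto simp: inv_into_into f_inv_into_f)
    have "\<kappa> x = B (inv_into V ?exp x)" using W(4) x by (simp add: \<kappa>_def)
    then have "E (\<kappa> x) = inv_into V ?exp x" using EB v(1) O1(2) by simp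
    then show ?thesis using EV(3)[OF x(3)] v(2) by simp
  qed
  have imo: "openin (top_of_set M) (\<psi> ` ball 0 R)"
  proof -
    have "continuous_on W \<kappa>"
      by (rule continuous_at_imp_continuous_on, rule ballI)
        (rule has_derivative_continuous[OF has_derivative_frechet[OF td\<kappa> W(1)]])
    then have opk: "open (W \<inter> \<kappa> -` ball 0 R)" using W by (intro continuous_open_preimage) auto
    have "\<psi> ` ball 0 R = M \<inter> (O2 \<inter> (W \<inter> \<kappa> -` ball 0 R))"
    proof (intro equalityI subsetI)
      fix x assume "x \<in> \<psi> ` ball 0 R"
      then obtain y where y: "y \<in> ball 0 R" "x = \<psi> y" by blast
      then show "x \<in> M \<inter> (O2 \<inter> (W \<inter> \<kappa> -` ball 0 R))" using EV[OF y(1)] \<kappa>\<psi>[OF y(1)] O2(2) by auto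
    next
      fix x assume x: "x \<in> M \<inter> (O2 \<inter> (W \<inter> \<kappa> -` ball 0 R))"
      then have "x = \<psi> (\<kappa> x)" "\<kappa> x \<in> ball 0 R" using \<psi>\<kappa>[of x] O2(2) by auto
      then show "x \<in> \<psi> ` ball 0 R" by (rule image_eqI)
    qed
    then show ?thesis using O2(1) opk unfolding openin_open by (meson open_Int)
  qed
  have sub: "ball 0 R \<subseteq> E -` W0" using EV(2) by blast
  have nc: "normal_chart M p \<psi> \<kappa> W R e"
  proof (unfold_locales)
    show "times_differentiable_on k \<psi> (ball 0 R)" for k by (rule times_differentiable_on_subset[OF td\<psi> sub])
    show "\<exists>\<gamma>. geodesic TYPE('d) M \<gamma> \<and> \<gamma> 0 = p \<and> velocity \<gamma> 0 = (\<Sum>i\<in>UNIV. y $ i *\<^sub>R e i)" if "y \<in> ball 0 R" for y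
    proof -
      have "E y \<in> exp_domain TYPE('d) M p" using EV(1)[OF that] Vd by blast
      then show ?thesis unfolding exp_domain_def E_def by blast
    qed
    show "exp_map TYPE('d) M p (\<Sum>i\<in>UNIV. y $ i *\<^sub>R e i) = \<psi> y" if "y \<in> ball 0 R" for y
      using EV(3)[OF that] by (simp add: E_def)
  qed (fact M R W(1) td\<kappa> \<psi>0 EV(5) \<kappa>\<psi> imo ortho span)+
  have cB: "c x = B (inv_into V ?exp x)" for x by (simp add: c_def normal_coords_def B_def)
  have c\<psi>: "c (\<psi> y) = y" if y: "y \<in> ball 0 R" for y unfolding cB inv[OF y] by (rule BE)
  have injc: "inj_on c U"
  proof (rule inj_onI)
    fix x x' assume x: "x \<in> U" "x' \<in> U" "c x = c x'"
    have mem: "inv_into V ?exp x \<in> ?T" "inv_into V ?exp x' \<in> ?T"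
      using x(1,2) im O1(2) by (metis IntD1 inv_into_into)+
    then have "inv_into V ?exp x = inv_into V ?exp x'" using EB[OF mem(1)] EB[OF mem(2)] x(3) unfolding cB by metis
    then show "x = x'" using x(1,2) im by (metis f_inv_into_f)
  qed
  have "c p = 0" using c\<psi>[of 0] R \<psi>0 by simp
  moreover have "\<psi> y \<in> U \<and> y \<in> c ` U \<and> inv_into U c y = \<psi> y" if y: "y \<in> ball 0 R" for y
  proof (intro conjI)
    show "\<psi> y \<in> U" by (rule EV(4)[OF y])
    show "y \<in> c ` U" using c\<psi>[OF y] EV(4)[OF y] by (metis image_eqI)
    show "inv_into U c y = \<psi> y" using inv_into_f_f[OF injc EV(4)[OF y]] c\<psi>[OF y] by simp
  qed
  ultimately show ?thesis using nc by (intro exI[of _ \<psi>] exI[of _ \<kappa>] exI[of _ W] exI[of _ R]) simp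
qed

section \<open>Taylor expansion with partial derivatives\<close>

lemma partial_eq:
  assumes "(G has_derivative D) (at y)"
  shows "partial i G y = D (axis i 1)"
proof -
  have "((\<lambda>t. y + t *\<^sub>R axis i 1) has_derivative (\<lambda>t. t *\<^sub>R axis i 1)) (at 0)"
    by (auto intro!: derivative_eq_intros)
  from diff_chain_at[OF this, of G D] assms
  have "((\<lambda>t. G (y + t *\<^sub>R axis i 1)) has_derivative (\<lambda>t. D (t *\<^sub>R axis i 1))) (at 0)" by (simp add: o_def)
  moreover have "(\<lambda>t. D (t *\<^sub>R axis i 1)) = (\<lambda>t. D (axis i 1) * t)"
    using linear_cmul[OF has_derivative_linear[OF assms]] by (auto simp: mult.commute)
  ultimately have "((\<lambda>t. G (y + t *\<^sub>R axis i 1)) has_field_derivative D (axis i 1)) (at 0)"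
    by (simp add: has_field_derivative_def)
  then show ?thesis unfolding partial_def by (rule DERIV_imp_deriv)
qed

lemma partial_frechet:
  assumes "times_differentiable_on (Suc k) G S" "open S" "y \<in> S"
  shows "partial i G y = frechet_derivative G (at y) (axis i 1)"
  by (rule partial_eq[OF has_derivative_frechet[OF assms]])

lemma times_differentiable_on_partial:
  assumes "times_differentiable_on (Suc k) G S" "open S"
  shows "times_differentiable_on k (partial i G) S"
  using assms(1) times_differentiable_on_cong[OF assms(2), of "partial i G" "\<lambda>y. frechet_derivative G (at y) (axis i 1)" k]
    partial_frechet[OF assms] by simp

lemma deriv2_partial:
  assumes G: "times_differentiable_on (Suc (Suc k)) G S" "open S" "y \<in> S"
  shows "deriv2 G y (axis i 1) (axis j 1) = partial j (partial i G) y"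
proof -
  have "partial j (partial i G) y = frechet_derivative (partial i G) (at y) (axis j 1)"
    by (rule partial_frechet[OF times_differentiable_on_partial[OF G(1,2)] G(2,3)])
  also have "frechet_derivative (partial i G) (at y) = frechet_derivative (\<lambda>x. frechet_derivative G (at x) (axis i 1)) (at y)"
    by (rule frechet_derivative_cong_open[OF G(2,3)]) (rule partial_frechet[OF G(1,2)])
  finally show ?thesis by (simp add: deriv2_def)
qed

lemma derivative_along_ray:
  assumes G: "times_differentiable_on (Suc k) G (ball 0 R)" and y: "t *\<^sub>R y \<in> ball 0 R"
  shows "((\<lambda>t. G (t *\<^sub>R y)) has_field_derivative (\<Sum>i\<in>UNIV. y $ i * partial i G (t *\<^sub>R y))) (at t)"
proof -
  let ?D = "frechet_derivative G (at (t *\<^sub>R y))"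
  have lin: "linear ?D" by (rule linear_frechet[OF G open_ball y])
  have "((\<lambda>t. t *\<^sub>R y) has_derivative (\<lambda>h. h *\<^sub>R y)) (at t)" by (auto intro!: derivative_eq_intros)
  from diff_chain_at[OF this has_derivative_frechet[OF G open_ball y]]
  have "((\<lambda>t. G (t *\<^sub>R y)) has_derivative (\<lambda>h. ?D (h *\<^sub>R y))) (at t)" by (simp add: o_def)
  moreover have "?D (h *\<^sub>R y) = (\<Sum>i\<in>UNIV. y $ i * partial i G (t *\<^sub>R y)) * h" for h
  proof -
    have "?D y = ?D (\<Sum>i\<in>UNIV. y $ i *\<^sub>R axis i 1)" by (simp add: basis_expansion flip: scalar_mult_eq_scaleR)
    also have "\<dots> = (\<Sum>i\<in>UNIV. y $ i * partial i G (t *\<^sub>R y))"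
      by (simp add: linear_sum[OF lin] linear_cmul[OF lin] partial_frechet[OF G open_ball y])
    finally show ?thesis by (simp add: linear_cmul[OF lin] mult.commute)
  qed
  ultimately show ?thesis by (simp add: has_field_derivative_def)
qed

text \<open>One-dimensional Maclaurin expansion along the ray through \<open>y\<close>, whose
  Lagrange remainder needs the third derivatives to exist but not to be continuous. The triple sum
  over coordinates gives the cube of the dimension.\<close>

lemma taylor_partials:
  fixes G :: "real^'d::finite \<Rightarrow> real"
  assumes G: "times_differentiable_on 3 G (ball 0 R)"
    and C: "\<And>is y. length is \<le> 3 \<Longrightarrow> y \<in> ball 0 R \<Longrightarrow> \<bar>partials is G y\<bar> \<le> C"
    and y: "y \<in> ball 0 R"
  shows "\<bar>G y - G 0 - (\<Sum>i\<in>UNIV. y $ i * partial i G 0)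
     - (\<Sum>i\<in>UNIV. \<Sum>j\<in>UNIV. y $ i * y $ j * partial j (partial i G) 0) / 2\<bar> \<le> real CARD('d) ^ 3 * C * norm y ^ 3"
proof -
  have G3: "times_differentiable_on (Suc (Suc (Suc 0))) G (ball 0 R)" using G by (simp only: numeral_3_eq_3)
  have G2: "times_differentiable_on (Suc (Suc 0)) (partial i G) (ball 0 R)" for i
    by (rule times_differentiable_on_partial[OF G3 open_ball])
  have G1: "times_differentiable_on (Suc 0) (partial j (partial i G)) (ball 0 R)" for i j
    by (rule times_differentiable_on_partial[OF G2 open_ball])
  define D0 where "D0 t = G (t *\<^sub>R y)" for t
  define D1 where "D1 t = (\<Sum>i\<in>UNIV. y $ i * partial i G (t *\<^sub>R y))" for t
  define D2 where "D2 t = (\<Sum>i\<in>UNIV. y $ i * (\<Sum>j\<in>UNIV. y $ j * partial j (partial i G) (t *\<^sub>R y)))" for t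
  define D3 where "D3 t = (\<Sum>i\<in>UNIV. y $ i * (\<Sum>j\<in>UNIV. y $ j * (\<Sum>l\<in>UNIV. y $ l * partial l (partial j (partial i G)) (t *\<^sub>R y))))" for t
  have ty: "t *\<^sub>R y \<in> ball 0 R" if "0 \<le> t" "t \<le> 1" for t
  proof -
    have "norm (t *\<^sub>R y) \<le> norm y" using that by (simp add: mult_left_le_one_le)
    then show ?thesis using y by simp
  qed
  have d0: "(D0 has_field_derivative D1 t) (at t)" if "0 \<le> t" "t \<le> 1" for t
    unfolding D0_def D1_def by (rule derivative_along_ray[OF G3 ty[OF that]])
  have d1: "(D1 has_field_derivative D2 t) (at t)" if "0 \<le> t" "t \<le> 1" for t
    unfolding D1_def D2_def by (intro DERIV_sum DERIV_cmult derivative_along_ray[OF G2 ty[OF that]])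
  have d2: "(D2 has_field_derivative D3 t) (at t)" if "0 \<le> t" "t \<le> 1" for t
    unfolding D2_def D3_def by (intro DERIV_sum DERIV_cmult derivative_along_ray[OF G1 ty[OF that]])
  let ?diff = "\<lambda>m::nat. if m = 0 then D0 else if m = 1 then D1 else if m = 2 then D2 else D3"
  have "\<exists>t. 0 < t \<and> t < 1 \<and> D0 1 = (\<Sum>m<3. ?diff m 0 / fact m * 1 ^ m) + ?diff 3 t / fact 3 * 1 ^ 3"
  proof (rule Maclaurin)
    show "\<forall>m t. m < 3 \<and> 0 \<le> t \<and> t \<le> 1 \<longrightarrow> DERIV (?diff m) t :> ?diff (Suc m) t"
      using d0 d1 d2 by (auto simp: less_Suc_eq numeral_3_eq_3 numeral_2_eq_2)
  qed auto
  then obtain t where t: "0 < t" "t < 1" "D0 1 = D0 0 + D1 0 + D2 0 / 2 + D3 t / 6"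
    by (auto simp: eval_nat_numeral)
  have C0: "0 \<le> C" using C[of "[]" y] y by (auto intro: order_trans[OF abs_ge_zero])
  have yi: "\<bar>y $ i\<bar> \<le> norm y" for i by (rule component_le_norm_cart)
  have b1: "\<bar>\<Sum>i\<in>UNIV. y $ i * X i\<bar> \<le> real CARD('d) * (norm y * K)" if "\<And>i. \<bar>X i\<bar> \<le> K" for X :: "'d \<Rightarrow> real" and K
  proof -
    have "\<bar>\<Sum>i\<in>UNIV. y $ i * X i\<bar> \<le> (\<Sum>i\<in>UNIV. \<bar>y $ i * X i\<bar>)" by (rule sum_abs)
    also have "\<dots> \<le> (\<Sum>i\<in>(UNIV::'d set). norm y * K)"
      by (intro sum_mono) (auto simp: abs_mult intro!: mult_mono yi that)
    finally show ?thesis by simp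
  qed
  have "\<bar>partial l (partial j (partial i G)) (t *\<^sub>R y)\<bar> \<le> C" for i j l
    using C[of "[l, j, i]" "t *\<^sub>R y"] ty[of t] t by simp
  then have "\<bar>D3 t\<bar> \<le> real CARD('d) * (norm y * (real CARD('d) * (norm y * (real CARD('d) * (norm y * C)))))"
    unfolding D3_def by (intro b1)
  then have D3: "\<bar>D3 t\<bar> \<le> real CARD('d) ^ 3 * C * norm y ^ 3" by (simp add: power3_eq_cube mult_ac)
  have e: "D0 1 = G y" "D0 0 = G 0" "D1 0 = (\<Sum>i\<in>UNIV. y $ i * partial i G 0)"
    "D2 0 = (\<Sum>i\<in>UNIV. \<Sum>j\<in>UNIV. y $ i * y $ j * partial j (partial i G) 0)"
    by (simp_all add: D0_def D1_def D2_def sum_distrib_left mult.assoc)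
  have "\<bar>G y - G 0 - (\<Sum>i\<in>UNIV. y $ i * partial i G 0)
     - (\<Sum>i\<in>UNIV. \<Sum>j\<in>UNIV. y $ i * y $ j * partial j (partial i G) 0) / 2\<bar> = \<bar>D3 t\<bar> / 6"
    using t(3) unfolding e by simp
  \<comment> \<open>The Lagrange factor 1/6 is given away.\<close>
  also have "\<dots> \<le> \<bar>D3 t\<bar>" by simp
  finally show ?thesis using D3 by linarith
qed

section \<open>The standard Gaussian vector\<close>

lemma Basis_vec_real: "(Basis :: (real^'d::finite) set) = range (\<lambda>j. axis j 1)"
  by (auto simp: Basis_vec_def)

lemma prod_Basis_vec:
  fixes g :: "real^'d::finite \<Rightarrow> 'a::comm_monoid_mult"
  shows "(\<Prod>b\<in>Basis. g b) = (\<Prod>j\<in>UNIV. g (axis j 1))"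
  unfolding Basis_vec_real by (subst prod.reindex) (auto simp: inj_on_def axis_eq_axis)

definition gauss_density :: "real \<Rightarrow> real^'d::finite \<Rightarrow> real" where
  "gauss_density \<tau> y = exp (- (norm y)\<^sup>2 / (2 * \<tau>\<^sup>2)) / (sqrt (2 * pi) * \<tau>) ^ CARD('d)"

lemma gauss_density_pos: "0 < \<tau> \<Longrightarrow> 0 < gauss_density \<tau> y"
  by (simp add: gauss_density_def)

lemma gauss_density_le: "0 < \<tau> \<Longrightarrow> gauss_density \<tau> (y :: real^'d::finite) \<le> 1 / (sqrt (2 * pi) * \<tau>) ^ CARD('d)"
  unfolding gauss_density_def by (intro divide_right_mono) auto

lemma borel_measurable_gauss_density [measurable]: "gauss_density \<tau> \<in> borel_measurable borel"
  unfolding gauss_density_def by measurable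

lemma gauss_density_1_prod:
  "gauss_density 1 (y :: real^'d::finite) = (\<Prod>j\<in>UNIV. std_normal_density (y $ j))"
proof -
  have "(\<Prod>j\<in>UNIV. std_normal_density (y $ j)) = (\<Prod>j\<in>UNIV. (1 / sqrt (2 * pi)) * exp (- (y $ j)\<^sup>2 / 2))"
    by (simp add: std_normal_density_def)
  also have "\<dots> = (1 / sqrt (2 * pi)) ^ CARD('d) * exp (\<Sum>j\<in>UNIV. - (y $ j)\<^sup>2 / 2)"
    by (simp only: prod.distrib exp_sum[OF finite] prod_constant)
  also have "(\<Sum>j\<in>UNIV. - (y $ j)\<^sup>2 / 2) = - (norm y)\<^sup>2 / 2"
    by (simp add: norm_vec_def L2_set_def sum_nonneg sum_negf sum_divide_distrib)
  finally show ?thesis by (simp add: gauss_density_def power_divide)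
qed

text \<open>The space carrying the limit process also provides the Gaussian calculus: smoothing
  kernels and Lebesgue integrals against Gaussian weights are expressed by expectations over
  \<open>Q\<close>.\<close>

locale std_gaussian_vector = prob_space Q for Q :: "'q measure" +
  fixes Z :: "'d::finite \<Rightarrow> 'q \<Rightarrow> real"
  assumes indep: "indep_vars (\<lambda>_. borel) Z UNIV"
    and dist: "\<And>j. distributed Q lborel (Z j) std_normal_density"
begin

definition N :: "'q \<Rightarrow> real^'d" where "N \<omega> = (\<chi> j. Z j \<omega>)"

lemma Z_measurable [measurable]: "Z j \<in> borel_measurable Q"
  using distributed_measurable[OF dist] by simp

lemma N_measurable [measurable]: "N \<in> borel_measurable Q"
proof (rule borel_measurableI)
  have "(\<lambda>\<omega>. \<Sum>j\<in>UNIV. Z j \<omega> *\<^sub>R (axis j 1 :: real^'d)) \<in> borel_measurable Q"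
    by measurable
  moreover have "(\<lambda>\<omega>. \<Sum>j\<in>UNIV. Z j \<omega> *\<^sub>R (axis j 1 :: real^'d)) = N"
    by (rule ext) (simp add: N_def vec_eq_iff axis_def if_distrib cong: if_cong)
  ultimately have *: "N \<in> borel_measurable Q" by simp
  show "open S \<Longrightarrow> N -` S \<inter> space Q \<in> sets Q" for S
    using * by (simp add: measurable_sets)
qed

lemma N_nth [simp]: "N \<omega> $ j = Z j \<omega>" by (simp add: N_def)

lemma nn_integral_Z: "g \<in> borel_measurable borel \<Longrightarrow>
    (\<integral>\<^sup>+\<omega>. g (Z j \<omega>) \<partial>Q) = (\<integral>\<^sup>+x. ennreal (std_normal_density x) * g x \<partial>lborel)"
  using distributed_nn_integral[OF dist, of g j] by simp

text \<open>Both measures factor over the coordinates on open boxes, one by independence and the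
  other by the product structure of Lebesgue measure, and boxes generate the Borel sets.\<close>

lemma distr_N: "distr Q borel N = density lborel (\<lambda>y. ennreal (gauss_density 1 y))"
proof (rule measure_eqI_generator_eq[where E="range (\<lambda>(a, b). box a b)" and \<Omega>=UNIV
      and A="\<lambda>n. box (- (real n *\<^sub>R One)) (real n *\<^sub>R One)"])
  show "Int_stable (range (\<lambda>(a, b). box a b :: (real^'d) set))"
    by (auto simp: Int_stable_def box_Int_box)
  show "range (\<lambda>(a, b). box a b) \<subseteq> Pow UNIV" by simp
  show "sets (distr Q borel N) = sigma_sets UNIV (range (\<lambda>(a, b). box a b))"
    by (simp add: borel_eq_box)
  show "sets (density lborel (\<lambda>y. ennreal (gauss_density 1 y))) = sigma_sets UNIV (range (\<lambda>(a, b). box a b :: (real^'d) set))"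
    by (simp add: borel_eq_box)
  show "range (\<lambda>n. box (- (real n *\<^sub>R One)) (real n *\<^sub>R One)) \<subseteq> range (\<lambda>(a, b). box a b :: (real^'d) set)"
    by auto
  show "(\<Union>n. box (- (real n *\<^sub>R One)) (real n *\<^sub>R One)) = (UNIV :: (real^'d) set)"
    by (rule UN_box_eq_UNIV)
  show "emeasure (distr Q borel N) (box (- (real i *\<^sub>R One)) (real i *\<^sub>R One)) \<noteq> \<infinity>" for i
    by (simp add: emeasure_distr emeasure_eq_measure)
  fix X assume "X \<in> range (\<lambda>(a, b). box a b :: (real^'d) set)"
  then obtain a b :: "real^'d" where X: "X = box a b" by auto
  have ind: "indicator X y = (\<Prod>j\<in>UNIV. indicator {a $ j <..< b $ j} (y $ j) :: ennreal)" for y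
    unfolding X by (auto simp: indicator_def box_def Basis_vec_real inner_axis prod_ennreal cart_eq_inner_axis[symmetric])
  have "emeasure (distr Q borel N) X = (\<integral>\<^sup>+\<omega>. indicator X (N \<omega>) \<partial>Q)"
  proof -
    have "emeasure (distr Q borel N) X = (\<integral>\<^sup>+y. indicator X y \<partial>distr Q borel N)"
      unfolding X by (intro nn_integral_indicator[symmetric]) simp
    also have "\<dots> = (\<integral>\<^sup>+\<omega>. indicator X (N \<omega>) \<partial>Q)"
      unfolding X by (intro nn_integral_distr) auto
    finally show ?thesis .
  qed
  also have "\<dots> = (\<integral>\<^sup>+\<omega>. (\<Prod>j\<in>UNIV. indicator {a $ j <..< b $ j} (Z j \<omega>)) \<partial>Q)"
    by (simp add: ind)
  also have "\<dots> = (\<Prod>j\<in>UNIV. (\<integral>\<^sup>+\<omega>. indicator {a $ j <..< b $ j} (Z j \<omega>) \<partial>Q))"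
    by (intro indep_vars_nn_integral indep_vars_compose2[OF indep]) auto
  also have "\<dots> = (\<Prod>j\<in>UNIV. (\<integral>\<^sup>+x. ennreal (std_normal_density x) * indicator {a $ j <..< b $ j} x \<partial>lborel))"
    by (simp add: nn_integral_Z)
  also have "\<dots> = (\<Prod>c\<in>(Basis :: (real^'d) set). (\<integral>\<^sup>+x. ennreal (std_normal_density x * indicator {a \<bullet> c <..< b \<bullet> c} x) \<partial>lborel))"
    by (simp add: prod_Basis_vec cart_eq_inner_axis[symmetric] ennreal_mult'' ennreal_indicator)
  also have "\<dots> = (\<integral>\<^sup>+x. (\<Prod>c\<in>(Basis :: (real^'d) set). ennreal (std_normal_density (x \<bullet> c) * indicator {a \<bullet> c <..< b \<bullet> c} (x \<bullet> c))) \<partial>lborel)"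
    by (intro nn_integral_lborel_prod[symmetric]) auto
  also have "\<dots> = (\<integral>\<^sup>+x. ennreal (gauss_density 1 x) * indicator X x \<partial>lborel)"
    by (simp add: prod_Basis_vec cart_eq_inner_axis[symmetric] ennreal_mult'' ennreal_indicator
        prod.distrib ind gauss_density_1_prod prod_ennreal)
  also have "\<dots> = emeasure (density lborel (\<lambda>y. ennreal (gauss_density 1 y))) X"
    unfolding X by (simp add: emeasure_density)
  finally show "emeasure (distr Q borel N) X = emeasure (density lborel (\<lambda>y. ennreal (gauss_density 1 y))) X" .
qed

lemma distr_affine_N:
  assumes \<tau>: "0 < \<tau>"
  shows "distr Q borel (\<lambda>\<omega>. x + \<tau> *\<^sub>R N \<omega>) = density lborel (\<lambda>y. ennreal (gauss_density \<tau> (y - x)))"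
proof -
  have [simp]: "\<tau> \<noteq> 0" using \<tau> by simp
  have "distr Q borel (\<lambda>\<omega>. x + \<tau> *\<^sub>R N \<omega>) = distr (distr Q borel N) borel (\<lambda>y. x + \<tau> *\<^sub>R y)"
    by (simp add: distr_distr o_def)
  also have "\<dots> = distr (density lborel (\<lambda>y. ennreal (gauss_density 1 y))) borel (\<lambda>y. x + \<tau> *\<^sub>R y)"
    by (simp add: distr_N)
  also have "\<dots> = density (distr lborel borel (\<lambda>y. x + \<tau> *\<^sub>R y)) (\<lambda>y. ennreal (gauss_density 1 ((y - x) /\<^sub>R \<tau>)))"
    by (subst density_distr) (auto simp: o_def)
  also have "\<dots> = density (distr lborel borel (\<lambda>y. x + \<tau> *\<^sub>R y))
      (\<lambda>y. \<bar>\<tau>\<bar> ^ DIM(real^'d) * ennreal (gauss_density \<tau> (y - x)))"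
  proof (intro density_cong AE_I2)
    fix y
    have "(norm ((y - x) /\<^sub>R \<tau>))\<^sup>2 / (2 * 1\<^sup>2) = (norm (y - x))\<^sup>2 / (2 * \<tau>\<^sup>2)"
      using \<tau> by (simp add: power_mult_distrib divide_simps)
    then have "gauss_density 1 ((y - x) /\<^sub>R \<tau>) = \<bar>\<tau>\<bar> ^ CARD('d) * gauss_density \<tau> (y - x)"
      using \<tau> unfolding gauss_density_def by (simp add: power_mult_distrib)
    then show "ennreal (gauss_density 1 ((y - x) /\<^sub>R \<tau>)) = \<bar>\<tau>\<bar> ^ DIM(real^'d) * ennreal (gauss_density \<tau> (y - x))"
      using \<tau> less_imp_le[OF gauss_density_pos[OF \<tau>, of "y - x"]] by (simp add: ennreal_mult)
  qed auto
  also have "\<dots> = density (density (distr lborel borel (\<lambda>y. x + \<tau> *\<^sub>R y)) (\<lambda>_. \<bar>\<tau>\<bar> ^ DIM(real^'d)))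
      (\<lambda>y. ennreal (gauss_density \<tau> (y - x)))"
    by (subst density_density_eq) auto
  also have "density (distr lborel borel (\<lambda>y. x + \<tau> *\<^sub>R y)) (\<lambda>_. \<bar>\<tau>\<bar> ^ DIM(real^'d)) = lborel"
    using lborel_affine[of \<tau> x] by simp
  finally show ?thesis .
qed

lemma integrable_gauss:
  fixes g :: "real^'d \<Rightarrow> 'b::{banach, second_countable_topology}"
  assumes "0 < \<tau>" and [measurable]: "g \<in> borel_measurable borel"
  shows "integrable lborel (\<lambda>y. gauss_density \<tau> (y - x) *\<^sub>R g y) \<longleftrightarrow> integrable Q (\<lambda>\<omega>. g (x + \<tau> *\<^sub>R N \<omega>))"
proof -
  have "integrable lborel (\<lambda>y. gauss_density \<tau> (y - x) *\<^sub>R g y) \<longleftrightarrow>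
      integrable (density lborel (\<lambda>y. ennreal (gauss_density \<tau> (y - x)))) g"
    using gauss_density_pos[OF assms(1)] by (subst integrable_density) (auto intro!: AE_I2 less_imp_le)
  then show ?thesis
    by (simp add: distr_affine_N[OF assms(1), symmetric] integrable_distr_eq)
qed

lemma integral_gauss:
  fixes g :: "real^'d \<Rightarrow> 'b::{banach, second_countable_topology}"
  assumes "0 < \<tau>" and [measurable]: "g \<in> borel_measurable borel"
  shows "(\<integral>y. gauss_density \<tau> (y - x) *\<^sub>R g y \<partial>lborel) = (\<integral>\<omega>. g (x + \<tau> *\<^sub>R N \<omega>) \<partial>Q)"
proof -
  have "(\<integral>y. gauss_density \<tau> (y - x) *\<^sub>R g y \<partial>lborel) =
      (\<integral>y. g y \<partial>(density lborel (\<lambda>y. ennreal (gauss_density \<tau> (y - x)))))"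
    using gauss_density_pos[OF assms(1)] by (subst integral_density) (auto intro!: AE_I2 less_imp_le)
  then show ?thesis
    by (simp add: distr_affine_N[OF assms(1), symmetric] integral_distr)
qed

section \<open>Moments and characteristic function of the Gaussian vector\<close>

lemma integrable_Z_power: "integrable Q (\<lambda>\<omega>. \<bar>Z j \<omega>\<bar> ^ k)"
  using distributed_integrable[OF dist, of "\<lambda>x. \<bar>x\<bar> ^ k" j] integrable_std_normal_moment_abs[of k]
  by simp

lemma integrable_norm_N_power: "integrable Q (\<lambda>\<omega>. norm (N \<omega>) ^ k)"
proof (rule Bochner_Integration.integrable_bound)
  show "integrable Q (\<lambda>\<omega>. real CARD('d) ^ k * (\<Sum>j\<in>UNIV. \<bar>Z j \<omega>\<bar> ^ k))"
    by (intro integrable_mult_right Bochner_Integration.integrable_sum integrable_Z_power)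
  show "AE \<omega> in Q. norm (norm (N \<omega>) ^ k) \<le> norm (real CARD('d) ^ k * (\<Sum>j\<in>UNIV. \<bar>Z j \<omega>\<bar> ^ k))"
  proof (intro AE_I2)
    fix \<omega>
    have "Max (range (\<lambda>j. \<bar>Z j \<omega>\<bar>)) \<in> range (\<lambda>j. \<bar>Z j \<omega>\<bar>)" by (rule Max_in) auto
    then obtain i where "Max (range (\<lambda>j. \<bar>Z j \<omega>\<bar>)) = \<bar>Z i \<omega>\<bar>" by (rule imageE)
    then have i: "\<And>j. \<bar>Z j \<omega>\<bar> \<le> \<bar>Z i \<omega>\<bar>" by (metis Max_ge finite_imageI finite rangeI)
    have "norm (N \<omega>) \<le> (\<Sum>j\<in>UNIV. \<bar>Z j \<omega>\<bar>)" using norm_le_l1_cart[of "N \<omega>"] by simp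
    also have "\<dots> \<le> real CARD('d) * \<bar>Z i \<omega>\<bar>" using sum_bounded_above[of UNIV "\<lambda>j. \<bar>Z j \<omega>\<bar>"] i by simp
    finally have "norm (N \<omega>) ^ k \<le> (real CARD('d) * \<bar>Z i \<omega>\<bar>) ^ k" by (intro power_mono) auto
    also have "\<dots> \<le> real CARD('d) ^ k * (\<Sum>j\<in>UNIV. \<bar>Z j \<omega>\<bar> ^ k)"
      unfolding power_mult_distrib by (intro mult_left_mono member_le_sum) auto
    finally show "norm (norm (N \<omega>) ^ k) \<le> norm (real CARD('d) ^ k * (\<Sum>j\<in>UNIV. \<bar>Z j \<omega>\<bar> ^ k))"
      by (simp add: sum_nonneg)
  qed
qed measurable

lemma expectation_Z: "expectation (Z j) = 0"
  by (rule standard_normal_distributed_expectation[OF dist])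

lemma expectation_Z_Z: "expectation (\<lambda>\<omega>. Z i \<omega> * Z j \<omega>) = (if i = j then 1 else 0)"
proof (cases "i = j")
  case True
  have "variance (Z j) = 1" by (rule standard_normal_distributed_variance[OF dist])
  then show ?thesis using True by (simp add: expectation_Z power2_eq_square)
next
  case False
  have int: "integrable Q (Z j)" for j
    using integrable_Z_power[of j 1] by (intro Bochner_Integration.integrable_bound[OF integrable_Z_power[of j 1]]) auto
  have "expectation (\<lambda>\<omega>. \<Prod>l\<in>{i, j}. Z l \<omega>) = (\<Prod>l\<in>{i, j}. expectation (Z l))"
    by (rule indep_vars_lebesgue_integral) (auto intro: indep_vars_subset[OF indep] int)
  then show ?thesis using False by (simp add: expectation_Z)
qed

lemma char_N: "(\<integral>\<omega>. iexp (t \<bullet> N \<omega>) \<partial>Q) = complex_of_real (exp (- (norm t)\<^sup>2 / 2))"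
proof -
  have "(\<integral>\<omega>. iexp (t \<bullet> N \<omega>) \<partial>Q) = (\<integral>\<omega>. (\<Prod>j\<in>UNIV. iexp (t $ j * Z j \<omega>)) \<partial>Q)"
    by (simp add: inner_vec_def sum_distrib_left exp_sum)
  also have "\<dots> = (\<Prod>j\<in>UNIV. (\<integral>\<omega>. iexp (t $ j * Z j \<omega>) \<partial>Q))"
    by (intro indep_vars_lebesgue_integral indep_vars_compose2[OF indep])
      (auto intro!: integrable_const_bound[of _ 1])
  also have "\<dots> = (\<Prod>j\<in>UNIV. char (distr Q borel (Z j)) (t $ j))"
    by (simp add: char_def integral_distr)
  also have "\<dots> = (\<Prod>j\<in>UNIV. complex_of_real (exp (- (t $ j)\<^sup>2 / 2)))"
  proof (intro prod.cong refl)
    fix j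
    have "distr Q borel (Z j) = std_normal_distribution"
      using distributed_distr_eq_density[OF dist, of j] by (simp cong: distr_cong)
    then show "char (distr Q borel (Z j)) (t $ j) = complex_of_real (exp (- (t $ j)\<^sup>2 / 2))"
      by (simp add: char_std_normal_distribution)
  qed
  also have "\<dots> = complex_of_real (exp (\<Sum>j\<in>UNIV. - (t $ j)\<^sup>2 / 2))"
    by (simp add: exp_sum)
  also have "(\<Sum>j\<in>UNIV. - (t $ j)\<^sup>2 / 2) = - (norm t)\<^sup>2 / 2"
    by (simp add: norm_vec_def L2_set_def sum_nonneg sum_negf sum_divide_distrib)
  finally show ?thesis .
qed

lemma expectation_inner_sq: "expectation (\<lambda>\<omega>. (t \<bullet> N \<omega>)\<^sup>2) = (norm t)\<^sup>2"
proof -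
  have int: "integrable Q (\<lambda>\<omega>. Z i \<omega> * Z j \<omega>)" for i j
  proof (rule Bochner_Integration.integrable_bound[OF integrable_norm_N_power[of 2]])
    show "AE \<omega> in Q. norm (Z i \<omega> * Z j \<omega>) \<le> norm (norm (N \<omega>) ^ 2)"
      using mult_mono[OF component_le_norm_cart[of "N _" i] component_le_norm_cart[of "N _" j]]
      by (auto simp: power2_eq_square abs_mult)
  qed measurable
  have "expectation (\<lambda>\<omega>. (t \<bullet> N \<omega>)\<^sup>2) = expectation (\<lambda>\<omega>. \<Sum>i\<in>UNIV. \<Sum>j\<in>UNIV. t $ i * t $ j * (Z i \<omega> * Z j \<omega>))"
    by (simp add: inner_vec_def power2_eq_square sum_product mult_ac)
  also have "\<dots> = (\<Sum>i\<in>UNIV. \<Sum>j\<in>UNIV. t $ i * t $ j * (if i = j then 1 else 0))"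
    by (subst Bochner_Integration.integral_sum Bochner_Integration.integrable_sum integrable_mult_right int
        | simp add: int expectation_Z_Z)+
  also have "\<dots> = (norm t)\<^sup>2"
    by (simp add: norm_vec_def L2_set_def sum_nonneg power2_eq_square if_distrib cong: if_cong)
  finally show ?thesis .
qed

section \<open>Weak convergence through characteristic functions\<close>

text \<open>By Fubini the density of a law smoothed with Gaussian noise is a Gaussian average of the
  characteristic function of that law. Pointwise convergence of characteristic functions then passes
  through by dominated convergence.\<close>

lemma smoothed_density_tendsto:
  fixes m :: "nat \<Rightarrow> (real^'d) measure"
  assumes m: "\<And>n. prob_space (m n)" "\<And>n. sets (m n) = sets borel"
    and m0: "prob_space m0" "sets m0 = sets borel"
    and char: "\<And>t. (\<lambda>n. \<integral>x. iexp (t \<bullet> x) \<partial>m n) \<longlonglongrightarrow> (\<integral>x. iexp (t \<bullet> x) \<partial>m0)"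
    and \<epsilon>: "0 < \<epsilon>"
  shows "(\<lambda>n. \<integral>x. gauss_density \<epsilon> (z - x) \<partial>m n) \<longlonglongrightarrow> (\<integral>x. gauss_density \<epsilon> (z - x) \<partial>m0)"
proof -
  let ?c = "1 / (sqrt (2 * pi) * \<epsilon>) ^ CARD('d)"
  have eq: "complex_of_real (\<integral>x. gauss_density \<epsilon> (z - x) \<partial>M) =
     ?c * (\<integral>\<omega>. iexp (z \<bullet> N \<omega> / \<epsilon>) * (\<integral>x. iexp ((- (N \<omega> /\<^sub>R \<epsilon>)) \<bullet> x) \<partial>M) \<partial>Q)"
    if M: "prob_space M" "sets M = sets borel" for M :: "(real^'d) measure"
  proof -
    interpret M: prob_space M by fact
    interpret pair_prob_space M Q ..
    have [measurable_cong]: "sets M = sets borel" by fact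
    \<comment> \<open>The Gaussian density is, up to a constant, the characteristic function of a
      Gaussian vector.\<close>
    have g: "complex_of_real (gauss_density \<epsilon> (z - x)) = ?c * (\<integral>\<omega>. iexp (((z - x) /\<^sub>R \<epsilon>) \<bullet> N \<omega>) \<partial>Q)" for x
      using \<epsilon> unfolding char_N by (simp add: gauss_density_def power_mult_distrib divide_simps)
    have "complex_of_real (\<integral>x. gauss_density \<epsilon> (z - x) \<partial>M) = (\<integral>x. ?c * (\<integral>\<omega>. iexp (((z - x) /\<^sub>R \<epsilon>) \<bullet> N \<omega>) \<partial>Q) \<partial>M)"
      unfolding g[symmetric] by simp
    also have "\<dots> = ?c * (\<integral>x. (\<integral>\<omega>. iexp (((z - x) /\<^sub>R \<epsilon>) \<bullet> N \<omega>) \<partial>Q) \<partial>M)"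
      by simp
    also have "(\<integral>x. (\<integral>\<omega>. iexp (((z - x) /\<^sub>R \<epsilon>) \<bullet> N \<omega>) \<partial>Q) \<partial>M) = (\<integral>\<omega>. (\<integral>x. iexp (((z - x) /\<^sub>R \<epsilon>) \<bullet> N \<omega>) \<partial>M) \<partial>Q)"
      by (rule Fubini_integral[symmetric]) (auto intro!: P.integrable_const_bound[of _ 1])
    also have "\<dots> = (\<integral>\<omega>. iexp (z \<bullet> N \<omega> / \<epsilon>) * (\<integral>x. iexp ((- (N \<omega> /\<^sub>R \<epsilon>)) \<bullet> x) \<partial>M) \<partial>Q)"
    proof (intro Bochner_Integration.integral_cong refl)
      fix \<omega>
      have "iexp (((z - x) /\<^sub>R \<epsilon>) \<bullet> N \<omega>) = iexp (z \<bullet> N \<omega> / \<epsilon>) * iexp ((- (N \<omega> /\<^sub>R \<epsilon>)) \<bullet> x)" for x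
      proof -
        have "((z - x) /\<^sub>R \<epsilon>) \<bullet> N \<omega> = z \<bullet> N \<omega> / \<epsilon> + (- (N \<omega> /\<^sub>R \<epsilon>)) \<bullet> x"
          using \<epsilon> by (simp add: inner_diff_left inner_commute[of x] divide_inverse mult.commute algebra_simps)
        then show ?thesis by (simp only: of_real_add ring_distribs exp_add)
      qed
      then show "(\<integral>x. iexp (((z - x) /\<^sub>R \<epsilon>) \<bullet> N \<omega>) \<partial>M) = iexp (z \<bullet> N \<omega> / \<epsilon>) * (\<integral>x. iexp ((- (N \<omega> /\<^sub>R \<epsilon>)) \<bullet> x) \<partial>M)"
        by simp
    qed
    finally show ?thesis .
  qed
  have meas: "(\<lambda>\<omega>. iexp (z \<bullet> N \<omega> / \<epsilon>) * (\<integral>x. iexp ((- (N \<omega> /\<^sub>R \<epsilon>)) \<bullet> x) \<partial>M)) \<in> borel_measurable Q"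
    if M: "prob_space M" "sets M = sets borel" for M :: "(real^'d) measure"
  proof -
    interpret M: prob_space M by fact
    have [measurable_cong]: "sets M = sets borel" by fact
    show ?thesis by measurable
  qed
  have bound: "norm (iexp (z \<bullet> N \<omega> / \<epsilon>) * (\<integral>x. iexp ((- (N \<omega> /\<^sub>R \<epsilon>)) \<bullet> x) \<partial>M)) \<le> 1"
    if M: "prob_space M" "sets M = sets borel" for M :: "(real^'d) measure" and \<omega>
  proof -
    interpret M: prob_space M by fact
    have [measurable_cong]: "sets M = sets borel" by fact
    have "norm (\<integral>x. iexp ((- (N \<omega> /\<^sub>R \<epsilon>)) \<bullet> x) \<partial>M) \<le> (\<integral>x. norm (iexp ((- (N \<omega> /\<^sub>R \<epsilon>)) \<bullet> x)) \<partial>M)"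
      by (rule integral_norm_bound)
    then show ?thesis by (simp add: norm_mult M.prob_space)
  qed
  have "(\<lambda>n. \<integral>\<omega>. iexp (z \<bullet> N \<omega> / \<epsilon>) * (\<integral>x. iexp ((- (N \<omega> /\<^sub>R \<epsilon>)) \<bullet> x) \<partial>m n) \<partial>Q)
     \<longlonglongrightarrow> (\<integral>\<omega>. iexp (z \<bullet> N \<omega> / \<epsilon>) * (\<integral>x. iexp ((- (N \<omega> /\<^sub>R \<epsilon>)) \<bullet> x) \<partial>m0) \<partial>Q)"
  proof (rule integral_dominated_convergence[where w="\<lambda>_. 1"])
    show "AE \<omega> in Q. (\<lambda>n. iexp (z \<bullet> N \<omega> / \<epsilon>) * (\<integral>x. iexp ((- (N \<omega> /\<^sub>R \<epsilon>)) \<bullet> x) \<partial>m n))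
       \<longlonglongrightarrow> iexp (z \<bullet> N \<omega> / \<epsilon>) * (\<integral>x. iexp ((- (N \<omega> /\<^sub>R \<epsilon>)) \<bullet> x) \<partial>m0)"
      by (intro AE_I2 tendsto_intros char)
  qed (use meas[OF m] meas[OF m0] bound[OF m] in auto)
  then have "(\<lambda>n. complex_of_real (\<integral>x. gauss_density \<epsilon> (z - x) \<partial>m n)) \<longlonglongrightarrow> complex_of_real (\<integral>x. gauss_density \<epsilon> (z - x) \<partial>m0)"
    unfolding eq[OF m] eq[OF m0] by (intro tendsto_intros)
  then show ?thesis by (simp only: tendsto_of_real_iff)
qed

text \<open>The test function is replaced by its Gaussian average \<open>S \<epsilon>\<close>.
  Fubini rewrites the integral of \<open>S \<epsilon>\<close> as that of \<open>\<phi>\<close>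
  against the smoothed density, which converges pointwise and boundedly, and \<open>\<phi>\<close>
  is Lebesgue integrable by compact support. Uniform continuity makes \<open>S \<epsilon>\<close>
  uniformly close to \<open>\<phi>\<close>.\<close>

lemma compact_support_tendsto:
  fixes m :: "nat \<Rightarrow> (real^'d) measure" and \<phi> :: "real^'d \<Rightarrow> real"
  assumes m: "\<And>n. prob_space (m n)" "\<And>n. sets (m n) = sets borel"
    and m0: "prob_space m0" "sets m0 = sets borel"
    and char: "\<And>t. (\<lambda>n. \<integral>x. iexp (t \<bullet> x) \<partial>m n) \<longlonglongrightarrow> (\<integral>x. iexp (t \<bullet> x) \<partial>m0)"
    and \<phi>: "continuous_on UNIV \<phi>" "\<And>x. L \<le> norm x \<Longrightarrow> \<phi> x = 0"
  shows "(\<lambda>n. \<integral>x. \<phi> x \<partial>m n) \<longlonglongrightarrow> (\<integral>x. \<phi> x \<partial>m0)"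
proof -
  have [measurable]: "\<phi> \<in> borel_measurable borel" using \<phi>(1) by (rule borel_measurable_continuous_onI)
  have "compact (\<phi> ` cball 0 L)" by (intro compact_continuous_image continuous_on_subset[OF \<phi>(1)]) auto
  then obtain B0 where B0: "\<And>x. norm x \<le> L \<Longrightarrow> \<bar>\<phi> x\<bar> \<le> B0"
    unfolding compact_eq_bounded_closed bounded_iff by fastforce
  define B where "B = \<bar>B0\<bar> + 1"
  have B: "\<bar>\<phi> x\<bar> \<le> B" "0 < B" for x using B0[of x] \<phi>(2)[of x] by (cases "norm x \<le> L"; force simp: B_def)+
  have int\<phi>: "integrable lborel \<phi>"
  proof -
    have "integrable lborel (\<lambda>x. indicator (cball 0 L) x *\<^sub>R \<phi> x)"
      by (intro borel_integrable_compact continuous_on_subset[OF \<phi>(1)]) auto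
    also have "(\<lambda>x. indicator (cball 0 L) x *\<^sub>R \<phi> x) = \<phi>" using \<phi>(2) by (auto simp: fun_eq_iff indicator_def)
    finally show ?thesis .
  qed
  \<comment> \<open>Two points at distance below 1 either both lie in the ball of radius
    \<open>L + 1\<close> or both lie beyond \<open>L\<close>, where \<open>\<phi>\<close>
    vanishes.\<close>
  have uc: "\<exists>\<delta>>0. \<forall>x y. norm (y - x) < \<delta> \<longrightarrow> \<bar>\<phi> y - \<phi> x\<bar> < \<eta>" if \<eta>: "\<eta> > 0" for \<eta>
  proof -
    have "uniformly_continuous_on (cball 0 (L + 1)) \<phi>"
      by (intro compact_uniformly_continuous continuous_on_subset[OF \<phi>(1)]) auto
    then obtain d where d: "d > 0" "\<And>x y. norm x \<le> L + 1 \<Longrightarrow> norm y \<le> L + 1 \<Longrightarrow> norm (y - x) < d \<Longrightarrow> \<bar>\<phi> y - \<phi> x\<bar> < \<eta>"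
      using \<eta> unfolding uniformly_continuous_on_def by (simp add: dist_norm del: mem_cball)
        (metis mem_cball_0)
    have "\<bar>\<phi> y - \<phi> x\<bar> < \<eta>" if "norm (y - x) < min d 1" for x y
    proof (cases "norm x \<le> L + 1 \<and> norm y \<le> L + 1")
      case True then show ?thesis using d(2)[of x y] that by simp
    next
      case False
      then have "L \<le> norm x" "L \<le> norm y"
        using that norm_triangle_ineq2[of y x] norm_triangle_ineq3[of y x] by auto
      then show ?thesis using \<phi>(2) \<eta> by simp
    qed
    then show ?thesis using d(1) by (intro exI[of _ "min d 1"]) auto
  qed
  define S where "S \<epsilon> x = (\<integral>\<omega>. \<phi> (x + \<epsilon> *\<^sub>R N \<omega>) \<partial>Q)" for \<epsilon> x
  have Smeas [measurable]: "S \<epsilon> \<in> borel_measurable borel" for \<epsilon> unfolding S_def by measurable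
  have Sbd: "\<bar>S \<epsilon> x\<bar> \<le> B" for \<epsilon> x
  proof -
    have "norm (S \<epsilon> x) \<le> (\<integral>\<omega>. norm (\<phi> (x + \<epsilon> *\<^sub>R N \<omega>)) \<partial>Q)" unfolding S_def by (rule integral_norm_bound)
    also have "\<dots> \<le> (\<integral>\<omega>. B \<partial>Q)"
      using B by (intro integral_mono integrable_const_bound[of _ B]) auto
    finally show ?thesis by (simp add: prob_space)
  qed
  have Seq: "(\<integral>x. S \<epsilon> x \<partial>M) = (\<integral>z. \<phi> z * (\<integral>x. gauss_density \<epsilon> (z - x) \<partial>M) \<partial>lborel)"
    if M: "prob_space M" "sets M = sets borel" and \<epsilon>: "0 < \<epsilon>" for M :: "(real^'d) measure" and \<epsilon>
  proof -
    interpret M: prob_space M by fact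
    interpret lb: sigma_finite_measure "lborel :: (real^'d) measure" by (rule sigma_finite_lborel)
    interpret pair_sigma_finite M "lborel :: (real^'d) measure" ..
    have [measurable_cong]: "sets M = sets borel" by fact
    let ?c = "1 / (sqrt (2 * pi) * \<epsilon>) ^ CARD('d)"
    have "(\<integral>x. S \<epsilon> x \<partial>M) = (\<integral>x. (\<integral>z. gauss_density \<epsilon> (z - x) * \<phi> z \<partial>lborel) \<partial>M)"
      unfolding S_def using integral_gauss[OF \<epsilon>, of \<phi>] by simp
    also have "\<dots> = (\<integral>z. (\<integral>x. gauss_density \<epsilon> (z - x) * \<phi> z \<partial>M) \<partial>lborel)"
    proof (rule Fubini_integral[symmetric], rule Fubini_integrable)
      show "(\<lambda>(x, z). gauss_density \<epsilon> (z - x) * \<phi> z) \<in> borel_measurable (M \<Otimes>\<^sub>M lborel)" by measurable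
      have iz: "integrable lborel (\<lambda>z. gauss_density \<epsilon> (z - x) * \<phi> z)" for x
      proof (rule Bochner_Integration.integrable_bound[of _ "\<lambda>z. ?c * \<phi> z"])
        show "AE z in lborel. norm (gauss_density \<epsilon> (z - x) * \<phi> z) \<le> norm (?c * \<phi> z)"
        proof (intro AE_I2)
          fix z
          have "norm (gauss_density \<epsilon> (z - x) * \<phi> z) \<le> ?c * \<bar>\<phi> z\<bar>"
            using gauss_density_le[OF \<epsilon>, of "z - x"] gauss_density_pos[OF \<epsilon>, of "z - x"]
            unfolding real_norm_def abs_mult by (intro mult_right_mono) auto
          then show "norm (gauss_density \<epsilon> (z - x) * \<phi> z) \<le> norm (?c * \<phi> z)"
            using \<epsilon> by (simp add: abs_mult)
        qed
      qed (use int\<phi> in auto)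
      show "AE x in M. integrable lborel (\<lambda>y. case (x, y) of (x, z) \<Rightarrow> gauss_density \<epsilon> (z - x) * \<phi> z)"
        using iz by simp
      show "integrable M (\<lambda>x. \<integral>y. norm (case (x, y) of (x, z) \<Rightarrow> gauss_density \<epsilon> (z - x) * \<phi> z) \<partial>lborel)"
      proof (rule M.integrable_const_bound[of _ "\<integral>z. ?c * \<bar>\<phi> z\<bar> \<partial>lborel"])
        show "AE x in M. norm (\<integral>y. norm (case (x, y) of (x, z) \<Rightarrow> gauss_density \<epsilon> (z - x) * \<phi> z) \<partial>lborel) \<le> (\<integral>z. ?c * \<bar>\<phi> z\<bar> \<partial>lborel)"
        proof (intro AE_I2)
          fix x
          have "norm (\<integral>y. norm (case (x, y) of (x, z) \<Rightarrow> gauss_density \<epsilon> (z - x) * \<phi> z) \<partial>lborel)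
            = (\<integral>y. norm (gauss_density \<epsilon> (y - x) * \<phi> y) \<partial>lborel)" by simp
          also have "\<dots> \<le> (\<integral>z. ?c * \<bar>\<phi> z\<bar> \<partial>lborel)"
          proof (rule integral_mono)
            show "integrable lborel (\<lambda>y. norm (gauss_density \<epsilon> (y - x) * \<phi> y))" using iz by (rule integrable_norm)
            show "integrable lborel (\<lambda>z. ?c * \<bar>\<phi> z\<bar>)" using int\<phi> by simp
            show "norm (gauss_density \<epsilon> (y - x) * \<phi> y) \<le> ?c * \<bar>\<phi> y\<bar>" for y
              using gauss_density_le[OF \<epsilon>, of "y - x"] gauss_density_pos[OF \<epsilon>, of "y - x"]
              unfolding real_norm_def abs_mult by (intro mult_right_mono) auto
          qed
          finally show "norm (\<integral>y. norm (case (x, y) of (x, z) \<Rightarrow> gauss_density \<epsilon> (z - x) * \<phi> z) \<partial>lborel) \<le> (\<integral>z. ?c * \<bar>\<phi> z\<bar> \<partial>lborel)" .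
        qed
      qed measurable
    qed
    also have "\<dots> = (\<integral>z. \<phi> z * (\<integral>x. gauss_density \<epsilon> (z - x) \<partial>M) \<partial>lborel)"
      by (simp add: mult.commute)
    finally show ?thesis .
  qed
  have gbd: "\<bar>\<integral>x. gauss_density \<epsilon> (z - x) \<partial>M\<bar> \<le> 1 / (sqrt (2 * pi) * \<epsilon>) ^ CARD('d)"
    if M: "prob_space M" "sets M = sets borel" and \<epsilon>: "0 < \<epsilon>" for M :: "(real^'d) measure" and \<epsilon> z
  proof -
    interpret M: prob_space M by fact
    have [measurable_cong]: "sets M = sets borel" by fact
    have "norm (\<integral>x. gauss_density \<epsilon> (z - x) \<partial>M) \<le> (\<integral>x. norm (gauss_density \<epsilon> (z - x)) \<partial>M)" by (rule integral_norm_bound)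
    also have "\<dots> \<le> (\<integral>x. 1 / (sqrt (2 * pi) * \<epsilon>) ^ CARD('d) \<partial>M)"
    proof (intro integral_mono M.integrable_const_bound[of _ "1 / (sqrt (2 * pi) * \<epsilon>) ^ CARD('d)"])
      show n: "norm (gauss_density \<epsilon> (z - x)) \<le> 1 / (sqrt (2 * pi) * \<epsilon>) ^ CARD('d)" for x
        using gauss_density_le[OF \<epsilon>, of "z - x"] gauss_density_pos[OF \<epsilon>, of "z - x"] by simp
      show "AE x in M. norm (norm (gauss_density \<epsilon> (z - x))) \<le> 1 / (sqrt (2 * pi) * \<epsilon>) ^ CARD('d)"
        using n by simp
    qed (use \<epsilon> in auto)
    finally show ?thesis by (simp add: M.prob_space)
  qed
  have gmeas: "(\<lambda>z. \<phi> z * (\<integral>x. gauss_density \<epsilon> (z - x) \<partial>M)) \<in> borel_measurable lborel"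
    if M: "prob_space M" "sets M = sets borel" for M :: "(real^'d) measure" and \<epsilon>
  proof -
    interpret M: prob_space M by fact
    have [measurable_cong]: "sets M = sets borel" by fact
    show ?thesis by measurable
  qed
  have Slim: "(\<lambda>n. \<integral>x. S \<epsilon> x \<partial>m n) \<longlonglongrightarrow> (\<integral>x. S \<epsilon> x \<partial>m0)" if \<epsilon>: "0 < \<epsilon>" for \<epsilon>
    unfolding Seq[OF m \<epsilon>] Seq[OF m0 \<epsilon>]
  proof (rule integral_dominated_convergence[where w="\<lambda>z. \<bar>\<phi> z\<bar> * (1 / (sqrt (2 * pi) * \<epsilon>) ^ CARD('d))"])
    show "AE z in lborel. (\<lambda>n. \<phi> z * (\<integral>x. gauss_density \<epsilon> (z - x) \<partial>m n)) \<longlonglongrightarrow> \<phi> z * (\<integral>x. gauss_density \<epsilon> (z - x) \<partial>m0)"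
      by (intro AE_I2 tendsto_intros smoothed_density_tendsto m m0 char \<epsilon>)
    show "AE z in lborel. norm (\<phi> z * (\<integral>x. gauss_density \<epsilon> (z - x) \<partial>m n)) \<le> \<bar>\<phi> z\<bar> * (1 / (sqrt (2 * pi) * \<epsilon>) ^ CARD('d))" for n
      using gbd[OF m \<epsilon>] unfolding real_norm_def abs_mult by (intro AE_I2 mult_left_mono) auto
    show "integrable lborel (\<lambda>z. \<bar>\<phi> z\<bar> * (1 / (sqrt (2 * pi) * \<epsilon>) ^ CARD('d)))"
      using int\<phi> by (intro integrable_mult_left integrable_abs) auto
  qed (use gmeas[OF m] gmeas[OF m0] in auto)
  have Sclose: "\<exists>\<epsilon>>0. \<forall>x. \<bar>S \<epsilon> x - \<phi> x\<bar> \<le> \<eta>" if \<eta>: "0 < \<eta>" for \<eta>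
  proof -
    obtain \<delta> where \<delta>: "\<delta> > 0" "\<And>x y. norm (y - x) < \<delta> \<Longrightarrow> \<bar>\<phi> y - \<phi> x\<bar> < \<eta> / 2"
      using uc[of "\<eta> / 2"] \<eta> by auto
    define E where "E = expectation (\<lambda>\<omega>. norm (N \<omega>))"
    have iN: "integrable Q (\<lambda>\<omega>. norm (N \<omega>))" using integrable_norm_N_power[of 1] by simp
    have E0: "0 \<le> E" by (simp add: E_def)
    \<comment> \<open>Chosen so that the expected contribution of large noise is at most \<eta>/2;
      the summand 1 covers a vanishing \<open>E\<close>.\<close>
    define \<epsilon> where "\<epsilon> = \<eta> * \<delta> / (4 * B * (E + 1))"
    have \<epsilon>: "\<epsilon> > 0" using \<eta> \<delta> B(2) E0 by (simp add: \<epsilon>_def)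
    have "\<bar>S \<epsilon> x - \<phi> x\<bar> \<le> \<eta>" for x
    proof -
      have i1: "integrable Q (\<lambda>\<omega>. \<phi> (x + \<epsilon> *\<^sub>R N \<omega>))" using B by (intro integrable_const_bound[of _ B]) auto
      have "S \<epsilon> x - \<phi> x = (\<integral>\<omega>. \<phi> (x + \<epsilon> *\<^sub>R N \<omega>) - \<phi> x \<partial>Q)"
        using i1 by (simp add: S_def prob_space)
      also have "\<bar>\<dots>\<bar> \<le> (\<integral>\<omega>. \<bar>\<phi> (x + \<epsilon> *\<^sub>R N \<omega>) - \<phi> x\<bar> \<partial>Q)" by (rule integral_abs_bound)
      also have "\<dots> \<le> (\<integral>\<omega>. \<eta> / 2 + 2 * B * (\<epsilon> * norm (N \<omega>) / \<delta>) \<partial>Q)"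
      proof (rule integral_mono)
        show "integrable Q (\<lambda>\<omega>. \<bar>\<phi> (x + \<epsilon> *\<^sub>R N \<omega>) - \<phi> x\<bar>)" using i1 by auto
        show "integrable Q (\<lambda>\<omega>. \<eta> / 2 + 2 * B * (\<epsilon> * norm (N \<omega>) / \<delta>))" using iN by auto
        fix \<omega>
        show "\<bar>\<phi> (x + \<epsilon> *\<^sub>R N \<omega>) - \<phi> x\<bar> \<le> \<eta> / 2 + 2 * B * (\<epsilon> * norm (N \<omega>) / \<delta>)"
        proof (cases "\<epsilon> * norm (N \<omega>) < \<delta>")
          case True
          then have "\<bar>\<phi> (x + \<epsilon> *\<^sub>R N \<omega>) - \<phi> x\<bar> < \<eta> / 2" using \<epsilon> by (intro \<delta>(2)) simp
          moreover have "0 \<le> 2 * B * (\<epsilon> * norm (N \<omega>) / \<delta>)" using B(2) \<epsilon> \<delta>(1) by simp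
          ultimately show ?thesis by linarith
        next
          case False
          \<comment> \<open>Markov's inequality in pointwise form: the trivial bound
            \<open>2 * B\<close> is multiplied by a quantity that is at least 1 here.\<close>
          then have "1 \<le> \<epsilon> * norm (N \<omega>) / \<delta>" using \<delta>(1) by simp
          then have "2 * B * 1 \<le> 2 * B * (\<epsilon> * norm (N \<omega>) / \<delta>)" using B(2) by (intro mult_left_mono) auto
          then show ?thesis using B(1)[of "x + \<epsilon> *\<^sub>R N \<omega>"] B(1)[of x] \<eta> by linarith
        qed
      qed
      also have "\<dots> = \<eta> / 2 + 2 * B * (\<epsilon> * E / \<delta>)" using iN by (simp add: prob_space E_def)
      also have "2 * B * (\<epsilon> * E / \<delta>) = \<eta> / 2 * (E / (E + 1))" using B(2) \<delta>(1) E0 by (simp add: \<epsilon>_def divide_simps)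
      also have "\<eta> / 2 * (E / (E + 1)) \<le> \<eta> / 2 * 1" using \<eta> E0 by (intro mult_left_mono) auto
      finally show ?thesis by simp
    qed
    then show ?thesis using \<epsilon> by blast
  qed
  have close: "\<bar>(\<integral>x. S \<epsilon> x \<partial>M) - (\<integral>x. \<phi> x \<partial>M)\<bar> \<le> \<eta>"
    if M: "prob_space M" "sets M = sets borel" and "\<And>x. \<bar>S \<epsilon> x - \<phi> x\<bar> \<le> \<eta>" for M :: "(real^'d) measure" and \<epsilon> \<eta>
  proof -
    interpret M: prob_space M by fact
    have [measurable_cong]: "sets M = sets borel" by fact
    have i: "integrable M (S \<epsilon>)" "integrable M \<phi>"
      using B Sbd by (auto intro!: M.integrable_const_bound[of _ B])
    then have "\<bar>(\<integral>x. S \<epsilon> x \<partial>M) - (\<integral>x. \<phi> x \<partial>M)\<bar> = \<bar>\<integral>x. S \<epsilon> x - \<phi> x \<partial>M\<bar>" by simp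
    also have "\<dots> \<le> (\<integral>x. \<bar>S \<epsilon> x - \<phi> x\<bar> \<partial>M)" by (rule integral_abs_bound)
    also have "\<dots> \<le> (\<integral>x. \<eta> \<partial>M)" using i that(3) by (intro integral_mono) auto
    finally show ?thesis by (simp add: M.prob_space)
  qed
  show ?thesis
  proof (rule LIMSEQ_I)
    fix r :: real assume r: "0 < r"
    obtain \<epsilon> where \<epsilon>: "\<epsilon> > 0" "\<And>x. \<bar>S \<epsilon> x - \<phi> x\<bar> \<le> r / 4" using Sclose[of "r / 4"] r by auto
    obtain n0 where n0: "\<And>n. n \<ge> n0 \<Longrightarrow> \<bar>(\<integral>x. S \<epsilon> x \<partial>m n) - (\<integral>x. S \<epsilon> x \<partial>m0)\<bar> < r / 4"
      using LIMSEQ_D[OF Slim[OF \<epsilon>(1)], of "r / 4"] r by auto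
    have "norm ((\<integral>x. \<phi> x \<partial>m n) - (\<integral>x. \<phi> x \<partial>m0)) < r" if "n \<ge> n0" for n
      using n0[OF that] close[OF m(1)[of n] m(2) \<epsilon>(2)] close[OF m0 \<epsilon>(2)]
      unfolding real_norm_def by linarith
    then show "\<exists>no. \<forall>n\<ge>no. norm ((\<integral>x. \<phi> x \<partial>m n) - (\<integral>x. \<phi> x \<partial>m0)) < r" by blast
  qed
qed

end

section \<open>Sums of independent variables\<close>

text \<open>Expanding the exponential to second order gives n (z_n - 1) \<longlongrightarrow> -a/2
  for the characteristic function z_n of one summand. The n-th powers are then compared with those
  of exp(-a/(2n)) through the telescoping bound on the unit disc.\<close>

lemma char_power_tendsto:
  fixes u :: "nat \<Rightarrow> 'a \<Rightarrow> real"
  assumes M: "prob_space M" and [measurable]: "\<And>n. u n \<in> borel_measurable M"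
    and int3: "\<And>n. integrable M (\<lambda>x. \<bar>u n x\<bar> ^ 3)"
    and l1: "(\<lambda>n. real n * (\<integral>x. u n x \<partial>M)) \<longlonglongrightarrow> 0"
    and l2: "(\<lambda>n. real n * (\<integral>x. (u n x)\<^sup>2 \<partial>M)) \<longlonglongrightarrow> a"
    and l3: "(\<lambda>n. real n * (\<integral>x. \<bar>u n x\<bar> ^ 3 \<partial>M)) \<longlonglongrightarrow> 0"
  shows "(\<lambda>n. (\<integral>x. iexp (u n x) \<partial>M) ^ n) \<longlonglongrightarrow> complex_of_real (exp (- a / 2))"
proof -
  interpret M: prob_space M by fact
  have int1: "integrable M (u n)" and int2: "integrable M (\<lambda>x. (u n x)\<^sup>2)" for n
  proof -
    have "r \<le> 1 + r ^ 3 \<and> r\<^sup>2 \<le> 1 + r ^ 3" if "0 \<le> r" for r :: real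
    proof (cases "r \<le> 1")
      case True
      then have "r\<^sup>2 \<le> 1" using that by (simp add: power_le_one)
      then show ?thesis using True that zero_le_power[OF that, of 3] by linarith
    next
      case False
      then have "r ^ 1 \<le> r ^ 3" "r\<^sup>2 \<le> r ^ 3" by (intro power_increasing; simp)+
      then show ?thesis by simp
    qed
    from this[of "\<bar>u n _\<bar>"] have b: "\<bar>u n x\<bar> \<le> 1 + \<bar>u n x\<bar> ^ 3" "(u n x)\<^sup>2 \<le> 1 + \<bar>u n x\<bar> ^ 3" for x by auto
    have i: "integrable M (\<lambda>x. 1 + \<bar>u n x\<bar> ^ 3)" using int3 by simp
    show "integrable M (u n)" "integrable M (\<lambda>x. (u n x)\<^sup>2)"
      by (rule Bochner_Integration.integrable_bound[OF i], use b in auto)+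
  qed
  define z where "z n = (\<integral>x. iexp (u n x) \<partial>M)" for n
  have iz: "integrable M (\<lambda>x. iexp (u n x))" for n by (rule M.integrable_const_bound[of _ 1]) auto
  have nz: "norm (z n) \<le> 1" for n
  proof -
    have "norm (z n) \<le> (\<integral>x. norm (iexp (u n x)) \<partial>M)" unfolding z_def by (rule integral_norm_bound)
    then show ?thesis by (simp add: M.prob_space)
  qed
  define q where "q n = complex_of_real (- (real n * (\<integral>x. (u n x)\<^sup>2 \<partial>M)) / 2) + \<i> * complex_of_real (real n * (\<integral>x. u n x \<partial>M))" for n
  have zq: "norm (of_nat n * (z n - 1) - q n) \<le> real n * (\<integral>x. \<bar>u n x\<bar> ^ 3 \<partial>M)" for n
  proof -
    let ?p = "\<lambda>r::real. 1 + \<i> * complex_of_real r - complex_of_real (r\<^sup>2 / 2)"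
    have ip: "integrable M (\<lambda>x. ?p (u n x))"
      by (intro Bochner_Integration.integrable_diff Bochner_Integration.integrable_add
          integrable_mult_right integrable_of_real integrable_divide int1 int2) auto
    have "(\<integral>x. ?p (u n x) \<partial>M) = 1 + \<i> * complex_of_real (\<integral>x. u n x \<partial>M) - complex_of_real ((\<integral>x. (u n x)\<^sup>2 \<partial>M) / 2)"
      using int1[of n] int2[of n] by (simp add: M.prob_space del: of_real_power)
    then have e: "of_nat n * (z n - 1) - q n = of_nat n * (\<integral>x. iexp (u n x) - ?p (u n x) \<partial>M)"
      using iz[of n] ip by (simp add: z_def q_def ring_distribs)
    have "norm (\<integral>x. iexp (u n x) - ?p (u n x) \<partial>M) \<le> (\<integral>x. norm (iexp (u n x) - ?p (u n x)) \<partial>M)"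
      by (rule integral_norm_bound)
    also have "\<dots> \<le> (\<integral>x. \<bar>u n x\<bar> ^ 3 \<partial>M)"
    proof (rule integral_mono)
      fix x
      have "norm (iexp (u n x) - ?p (u n x)) \<le> \<bar>u n x\<bar> ^ 3 / 6"
        using iexp_approx1[of "u n x" 2] by (simp add: eval_nat_numeral algebra_simps power_mult_distrib)
      also have "\<dots> \<le> \<bar>u n x\<bar> ^ 3" by simp
      finally show "norm (iexp (u n x) - ?p (u n x)) \<le> \<bar>u n x\<bar> ^ 3" .
    qed (use int3 iz ip in auto)
    finally show ?thesis unfolding e by (simp add: norm_mult mult_left_mono)
  qed
  have "q \<longlonglongrightarrow> complex_of_real (- a / 2) + \<i> * complex_of_real 0"
    unfolding q_def by (intro tendsto_intros l1 l2) auto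
  moreover have "(\<lambda>n. of_nat n * (z n - 1) - q n) \<longlonglongrightarrow> 0"
    by (rule Lim_null_comparison[OF always_eventually l3]) (use zq in auto)
  ultimately have nzl: "(\<lambda>n. of_nat n * (z n - 1)) \<longlonglongrightarrow> complex_of_real (- a / 2)"
    using tendsto_add[of "\<lambda>n. of_nat n * (z n - 1) - q n" 0 sequentially q] by simp
  have a: "0 \<le> a" by (rule LIMSEQ_le_const[OF l2]) auto
  \<comment> \<open>The n-th power of this number is exactly exp(-a/2) for positive
    \<open>n\<close>, and a \<ge> 0 keeps it in the unit disc.\<close>
  define w where "w n = complex_of_real (exp (- a / 2 / real n))" for n
  have "((\<lambda>x. (exp (- a / 2 * x) - 1) / x) \<longlongrightarrow> - a / 2) (at 0)"
  proof -
    have "((\<lambda>x. exp (- a / 2 * x)) has_field_derivative - a / 2) (at 0)"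
      by (auto intro!: derivative_eq_intros)
    then show ?thesis by (simp add: DERIV_def)
  qed
  then have "((\<lambda>n. (exp (- a / 2 * (1 / real n)) - 1) / (1 / real n)) \<longlonglongrightarrow> - a / 2)"
    by (rule filterlim_compose) (auto simp: filterlim_at intro!: lim_1_over_n eventually_sequentiallyI[of 1])
  then have "(\<lambda>n. complex_of_real ((exp (- a / 2 * (1 / real n)) - 1) / (1 / real n))) \<longlonglongrightarrow> complex_of_real (- a / 2)"
    by (rule tendsto_of_real)
  then have nwl: "(\<lambda>n. of_nat n * (w n - 1)) \<longlonglongrightarrow> complex_of_real (- a / 2)"
    by (simp add: w_def mult.commute)
  have nw: "norm (w n) \<le> 1" for n using a by (simp add: w_def)
  have "(\<lambda>n. norm (of_nat n * (z n - 1) - of_nat n * (w n - 1))) \<longlonglongrightarrow> 0"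
    using tendsto_diff[OF nzl nwl] by (intro tendsto_norm_zero) simp
  then have "(\<lambda>n. z n ^ n - w n ^ n) \<longlonglongrightarrow> 0"
  proof (rule Lim_null_comparison[rotated], intro always_eventually allI)
    fix n
    have "norm (z n ^ n - w n ^ n) \<le> n * norm (z n - w n)" by (rule norm_power_diff[OF nz nw])
    also have "\<dots> = norm (of_nat n * (z n - 1) - of_nat n * (w n - 1))"
      by (simp add: ring_distribs[symmetric] norm_mult)
    finally show "norm (z n ^ n - w n ^ n) \<le> norm (of_nat n * (z n - 1) - of_nat n * (w n - 1))" .
  qed
  moreover have "(\<lambda>n. w n ^ n) \<longlonglongrightarrow> complex_of_real (exp (- a / 2))"
  proof (rule tendsto_eventually, rule eventually_sequentiallyI[of 1])
    fix n :: nat assume "1 \<le> n"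
    then show "w n ^ n = complex_of_real (exp (- a / 2))"
      by (simp add: w_def flip: of_real_power exp_of_nat_mult)
  qed
  ultimately show ?thesis
    unfolding z_def[symmetric] using tendsto_add[of "\<lambda>n. z n ^ n - w n ^ n" 0 sequentially "\<lambda>n. w n ^ n"] by simp
qed

context prob_space
begin

lemma iid_integral:
  fixes g :: "'s \<Rightarrow> 'b::{banach, second_countable_topology}"
  assumes X: "indep_vars (\<lambda>_. S) X UNIV" and law: "\<And>i. distr M S (X i) = \<nu>"
    and g: "g \<in> borel_measurable S"
  shows "(\<integral>\<omega>. g (X i \<omega>) \<partial>M) = (\<integral>x. g x \<partial>\<nu>)"
    and "integrable M (\<lambda>\<omega>. g (X i \<omega>)) \<longleftrightarrow> integrable \<nu> g"
proof -
  have [measurable]: "X i \<in> measurable M S" using X by (simp add: indep_vars_def)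
  show "(\<integral>\<omega>. g (X i \<omega>) \<partial>M) = (\<integral>x. g x \<partial>\<nu>)" "integrable M (\<lambda>\<omega>. g (X i \<omega>)) \<longleftrightarrow> integrable \<nu> g"
    unfolding law[of i, symmetric] using g by (simp_all add: integral_distr integrable_distr_eq)
qed

lemma char_iid_sum:
  fixes g :: "'s \<Rightarrow> real"
  assumes X: "indep_vars (\<lambda>_. S) X UNIV" and law: "\<And>i. distr M S (X i) = \<nu>"
    and g [measurable]: "g \<in> borel_measurable S"
  shows "(\<integral>\<omega>. iexp (\<Sum>i<n. g (X i \<omega>)) \<partial>M) = (\<integral>x. iexp (g x) \<partial>\<nu>) ^ n"
proof -
  have [measurable]: "X i \<in> measurable M S" for i using X by (simp add: indep_vars_def)
  have "(\<integral>\<omega>. iexp (\<Sum>i<n. g (X i \<omega>)) \<partial>M) = char (distr M borel (\<lambda>\<omega>. \<Sum>i<n. g (X i \<omega>))) 1"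
    by (simp add: char_def integral_distr)
  also have "\<dots> = (\<Prod>i<n. char (distr M borel (\<lambda>\<omega>. g (X i \<omega>))) 1)"
    by (intro char_distr_sum indep_vars_compose2[OF indep_vars_subset[OF X]]) auto
  also have "\<dots> = (\<Prod>i<n. \<integral>x. iexp (g x) \<partial>\<nu>)"
  proof (intro prod.cong refl)
    fix i
    show "char (distr M borel (\<lambda>\<omega>. g (X i \<omega>))) 1 = (\<integral>x. iexp (g x) \<partial>\<nu>)"
      using iid_integral(1)[OF X law, of "\<lambda>x. iexp (g x)" i] by (simp add: char_def integral_distr)
  qed
  finally show ?thesis by simp
qed

text \<open>Variance plus squared bias, where the variance of one summand is bounded by its second
  moment.\<close>

lemma iid_sum_second_moment:
  fixes g :: "'s \<Rightarrow> real"
  assumes X: "indep_vars (\<lambda>_. S) X UNIV" and law: "\<And>i. distr M S (X i) = \<nu>"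
    and g [measurable]: "g \<in> borel_measurable S" and g1: "integrable \<nu> g" and g2: "integrable \<nu> (\<lambda>x. (g x)\<^sup>2)"
  shows "integrable M (\<lambda>\<omega>. ((\<Sum>i<n. g (X i \<omega>)) - c)\<^sup>2)"
    and "(\<integral>\<omega>. ((\<Sum>i<n. g (X i \<omega>)) - c)\<^sup>2 \<partial>M) \<le> real n * (\<integral>x. (g x)\<^sup>2 \<partial>\<nu>) + (real n * (\<integral>x. g x \<partial>\<nu>) - c)\<^sup>2"
proof -
  let ?W = "\<lambda>i \<omega>. g (X i \<omega>)" and ?m = "\<integral>x. g x \<partial>\<nu>" and ?s = "\<integral>x. (g x)\<^sup>2 \<partial>\<nu>"
  have iW: "integrable M (?W i)" and eW: "(\<integral>\<omega>. ?W i \<omega> \<partial>M) = ?m" for i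
    using iid_integral[OF X law g] g1 by auto
  have i2: "integrable M (\<lambda>\<omega>. ?W i \<omega> * ?W i \<omega>)" and e2: "(\<integral>\<omega>. ?W i \<omega> * ?W i \<omega> \<partial>M) = ?s" for i
    using iid_integral[OF X law, of "\<lambda>x. (g x)\<^sup>2" i] g2 by (auto simp: power2_eq_square)
  have iv: "indep_vars (\<lambda>_. borel) ?W UNIV" by (intro indep_vars_compose2[OF X]) auto
  have ij: "integrable M (\<lambda>\<omega>. ?W i \<omega> * ?W j \<omega>) \<and> (\<integral>\<omega>. ?W i \<omega> * ?W j \<omega> \<partial>M) = ?m * ?m" if "i \<noteq> j" for i j
  proof -
    have "indep_vars (\<lambda>_. borel) ?W {i, j}" by (rule indep_vars_subset[OF iv]) auto
    from indep_vars_lebesgue_integral[OF _ this] indep_vars_integrable[OF _ this] show ?thesis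
      using that iW eW by auto
  qed
  have ii: "integrable M (\<lambda>\<omega>. ?W i \<omega> * ?W j \<omega>)" for i j using i2 ij by (cases "i = j") auto
  have ee: "(\<integral>\<omega>. ?W i \<omega> * ?W j \<omega> \<partial>M) = ?m * ?m + (if i = j then ?s - ?m * ?m else 0)" for i j
    using e2 ij by (cases "i = j") auto
  let ?S = "\<lambda>\<omega>. \<Sum>i<n. ?W i \<omega>"
  have sq: "(?S \<omega> - c)\<^sup>2 = (\<Sum>i<n. \<Sum>j<n. ?W i \<omega> * ?W j \<omega>) - 2 * c * ?S \<omega> + c\<^sup>2" for \<omega>
  proof -
    have "?S \<omega> * ?S \<omega> = (\<Sum>i<n. \<Sum>j<n. ?W i \<omega> * ?W j \<omega>)" by (rule sum_product)
    moreover have "(a - c)\<^sup>2 = a * a - 2 * c * a + c\<^sup>2" for a by (simp add: power2_eq_square algebra_simps)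
    ultimately show ?thesis by metis
  qed
  have iSS: "integrable M (\<lambda>\<omega>. \<Sum>i<n. \<Sum>j<n. ?W i \<omega> * ?W j \<omega>)" and iS: "integrable M ?S"
    by (intro Bochner_Integration.integrable_sum ii iW)+
  show "integrable M (\<lambda>\<omega>. (?S \<omega> - c)\<^sup>2)" unfolding sq using iSS iS by auto
  have "(\<integral>\<omega>. (\<Sum>i<n. \<Sum>j<n. ?W i \<omega> * ?W j \<omega>) \<partial>M) = (\<Sum>i<n. \<Sum>j<n. (\<integral>\<omega>. ?W i \<omega> * ?W j \<omega> \<partial>M))"
    by (subst Bochner_Integration.integral_sum, intro Bochner_Integration.integrable_sum ii)
      (simp add: Bochner_Integration.integral_sum[OF ii])
  also have "\<dots> = real n * real n * (?m * ?m) + real n * (?s - ?m * ?m)"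
    unfolding ee by (simp add: sum.distrib algebra_simps)
  finally have eSS: "(\<integral>\<omega>. (\<Sum>i<n. \<Sum>j<n. ?W i \<omega> * ?W j \<omega>) \<partial>M) = real n * real n * (?m * ?m) + real n * (?s - ?m * ?m)" .
  have eS: "(\<integral>\<omega>. ?S \<omega> \<partial>M) = real n * ?m"
    by (subst Bochner_Integration.integral_sum[OF iW]) (simp add: eW)
  have "(\<integral>\<omega>. (?S \<omega> - c)\<^sup>2 \<partial>M) = real n * real n * (?m * ?m) + real n * (?s - ?m * ?m) - 2 * c * (real n * ?m) + c\<^sup>2"
    unfolding sq using iSS iS by (simp add: eSS eS prob_space)
  also have "\<dots> = real n * ?s - real n * (?m * ?m) + (real n * ?m - c)\<^sup>2"
    by (simp add: power2_eq_square algebra_simps)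
  also have "\<dots> \<le> real n * ?s + (real n * ?m - c)\<^sup>2"
    by simp
  finally show "(\<integral>\<omega>. (?S \<omega> - c)\<^sup>2 \<partial>M) \<le> real n * ?s + (real n * ?m - c)\<^sup>2" .
qed

end

text \<open>At a fixed frequency \<open>t\<close> the characteristic function of the row sum is that
  of the scalar array \<open>t \<bullet> \<xi>\<close>. The cubic hypothesis is Lyapunov's
  condition; \<open>n\<close> numbers the row and counts its summands.\<close>

lemma (in std_gaussian_vector) triangular_clt:
  fixes \<xi> :: "nat \<Rightarrow> 's \<Rightarrow> real^'d" and \<phi> :: "real^'d \<Rightarrow> real"
  assumes P: "prob_space P" and X: "prob_space.indep_vars P (\<lambda>_. S) X UNIV"
    and law: "\<And>i. distr P S (X i) = \<nu>"
    and \<xi> [measurable]: "\<And>n. \<xi> n \<in> borel_measurable S"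
    and i3: "\<And>n. integrable \<nu> (\<lambda>x. norm (\<xi> n x) ^ 3)"
    and l1: "\<And>t. (\<lambda>n. real n * (\<integral>x. t \<bullet> \<xi> n x \<partial>\<nu>)) \<longlonglongrightarrow> 0"
    and l2: "\<And>t. (\<lambda>n. real n * (\<integral>x. (t \<bullet> \<xi> n x)\<^sup>2 \<partial>\<nu>)) \<longlonglongrightarrow> s\<^sup>2 * (norm t)\<^sup>2"
    and l3: "(\<lambda>n. real n * (\<integral>x. norm (\<xi> n x) ^ 3 \<partial>\<nu>)) \<longlonglongrightarrow> 0"
    and \<phi>: "continuous_on UNIV \<phi>" "\<And>x. L \<le> norm x \<Longrightarrow> \<phi> x = 0"
  shows "(\<lambda>n. \<integral>\<omega>. \<phi> (\<Sum>i<n. \<xi> n (X i \<omega>)) \<partial>P) \<longlonglongrightarrow> expectation (\<lambda>\<omega>. \<phi> (s *\<^sub>R N \<omega>))"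
proof -
  interpret P: prob_space P by fact
  have XS [measurable]: "X i \<in> measurable P S" for i using X by (simp add: P.indep_vars_def)
  have nu: "prob_space \<nu>" "sets \<nu> = sets S" using P.prob_space_distr[OF XS, of 0] law[of 0] by auto
  have [measurable_cong]: "sets \<nu> = sets S" by fact
  have [measurable]: "\<phi> \<in> borel_measurable borel" using \<phi>(1) by (rule borel_measurable_continuous_onI)
  define A where "A n \<omega> = (\<Sum>i<n. \<xi> n (X i \<omega>))" for n \<omega>
  have [measurable]: "A n \<in> borel_measurable P" for n unfolding A_def by measurable
  define m where "m n = distr P borel (A n)" for n
  define m0 where "m0 = distr Q borel (\<lambda>\<omega>. s *\<^sub>R N \<omega>)"
  have ch: "(\<lambda>n. \<integral>x. iexp (t \<bullet> x) \<partial>m n) \<longlonglongrightarrow> (\<integral>x. iexp (t \<bullet> x) \<partial>m0)" for t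
  proof -
    have "(\<integral>x. iexp (t \<bullet> x) \<partial>m n) = (\<integral>x. iexp (t \<bullet> \<xi> n x) \<partial>\<nu>) ^ n" for n
      using P.char_iid_sum[OF X law, of "\<lambda>x. t \<bullet> \<xi> n x" n]
      by (simp add: m_def integral_distr A_def inner_sum_right)
    moreover have "(\<integral>x. iexp (t \<bullet> x) \<partial>m0) = complex_of_real (exp (- (s\<^sup>2 * (norm t)\<^sup>2) / 2))"
      using char_N[of "s *\<^sub>R t"] by (simp add: m0_def integral_distr power_mult_distrib)
    moreover have "(\<lambda>n. (\<integral>x. iexp (t \<bullet> \<xi> n x) \<partial>\<nu>) ^ n) \<longlonglongrightarrow> complex_of_real (exp (- (s\<^sup>2 * (norm t)\<^sup>2) / 2))"
    proof (rule char_power_tendsto[OF nu(1) _ _ l1 l2])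
      have b: "\<bar>t \<bullet> \<xi> n x\<bar> ^ 3 \<le> norm t ^ 3 * norm (\<xi> n x) ^ 3" for n x
        using power_mono[OF Cauchy_Schwarz_ineq2[of t "\<xi> n x"], of 3] by (simp add: power_mult_distrib)
      show i3': "integrable \<nu> (\<lambda>x. \<bar>t \<bullet> \<xi> n x\<bar> ^ 3)" for n
        by (rule Bochner_Integration.integrable_bound[OF integrable_mult_right[OF i3, of "norm t ^ 3"]])
          (use b in auto)
      have l3': "(\<lambda>n. norm t ^ 3 * (real n * (\<integral>x. norm (\<xi> n x) ^ 3 \<partial>\<nu>))) \<longlonglongrightarrow> 0"
        using tendsto_mult_right_zero[OF l3] by auto
      show "(\<lambda>n. real n * (\<integral>x. \<bar>t \<bullet> \<xi> n x\<bar> ^ 3 \<partial>\<nu>)) \<longlonglongrightarrow> 0"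
      proof (rule Lim_null_comparison[OF always_eventually l3'], intro allI)
        fix n
        have "(\<integral>x. \<bar>t \<bullet> \<xi> n x\<bar> ^ 3 \<partial>\<nu>) \<le> (\<integral>x. norm t ^ 3 * norm (\<xi> n x) ^ 3 \<partial>\<nu>)"
          using i3' i3 b by (intro integral_mono) auto
        then have "real n * (\<integral>x. \<bar>t \<bullet> \<xi> n x\<bar> ^ 3 \<partial>\<nu>) \<le> real n * (norm t ^ 3 * (\<integral>x. norm (\<xi> n x) ^ 3 \<partial>\<nu>))"
          by (intro mult_left_mono) auto
        moreover have "0 \<le> (\<integral>x. \<bar>t \<bullet> \<xi> n x\<bar> ^ 3 \<partial>\<nu>)" by simp
        ultimately show "norm (real n * (\<integral>x. \<bar>t \<bullet> \<xi> n x\<bar> ^ 3 \<partial>\<nu>)) \<le> norm t ^ 3 * (real n * (\<integral>x. norm (\<xi> n x) ^ 3 \<partial>\<nu>))"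
          by (simp add: mult.left_commute abs_mult)
      qed
    qed measurable
    ultimately show ?thesis by simp
  qed
  have "(\<lambda>n. \<integral>x. \<phi> x \<partial>m n) \<longlonglongrightarrow> (\<integral>x. \<phi> x \<partial>m0)"
    by (rule compact_support_tendsto[OF _ _ _ _ ch \<phi>])
      (auto simp: m_def m0_def intro!: P.prob_space_distr prob_space_distr)
  then show ?thesis by (simp add: m_def m0_def integral_distr A_def)
qed

section \<open>Convergence in law of perturbed finite-dimensional processes\<close>

text \<open>The integrable lower bound also shows that the infimum in the definition is over a set
  bounded below, so that it has its intended meaning.\<close>

lemma outer_expectation_bounds:
  assumes "integrable P s" "integrable P S" "\<And>\<omega>. \<omega> \<in> space P \<Longrightarrow> s \<omega> \<le> T \<omega>" "\<And>\<omega>. \<omega> \<in> space P \<Longrightarrow> T \<omega> \<le> S \<omega>"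
  shows "integral\<^sup>L P s \<le> outer_expectation P T" "outer_expectation P T \<le> integral\<^sup>L P S"
proof -
  let ?A = "{integral\<^sup>L P S | S. integrable P S \<and> (\<forall>\<omega>\<in>space P. T \<omega> \<le> S \<omega>)}"
  have lb: "integral\<^sup>L P s \<le> a" if a: "a \<in> ?A" for a
  proof -
    obtain S' where S': "a = integral\<^sup>L P S'" "integrable P S'" "\<And>\<omega>. \<omega> \<in> space P \<Longrightarrow> T \<omega> \<le> S' \<omega>" using a by auto
    have "integral\<^sup>L P s \<le> integral\<^sup>L P S'"
      using assms(1) S'(2) assms(3) S'(3) by (intro integral_mono) (auto intro: order_trans)
    then show ?thesis using S' by simp
  qed
  have mem: "integral\<^sup>L P S \<in> ?A" using assms(2,4) by auto
  show "integral\<^sup>L P s \<le> outer_expectation P T"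
    unfolding outer_expectation_def
  proof (rule cInf_greatest)
    show "?A \<noteq> {}" using mem by (metis empty_iff)
  qed (rule lb)
  show "outer_expectation P T \<le> integral\<^sup>L P S"
    unfolding outer_expectation_def by (rule cInf_lower[OF mem bdd_belowI[OF lb]])
qed

text \<open>\<open>H\<close> is merely continuous on a space that is not locally compact, yet its
  modulus can be made uniform around the compact set \<Phi>(K). A finite subcover is taken in the
  parameter space and carried over by the Lipschitz bound.\<close>

lemma uniform_continuity_near_compact:
  fixes \<Phi> :: "'b::metric_space \<Rightarrow> 'a"
  assumes H: "continuous_map (mtopology_of m) euclideanreal H"
    and \<Phi>: "\<And>a. \<Phi> a \<in> mspace m" and lip: "\<And>a b. mdist m (\<Phi> a) (\<Phi> b) \<le> C * dist a b" and C: "0 \<le> C"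
    and K: "compact K" and \<epsilon>: "0 < \<epsilon>"
  shows "\<exists>\<delta>>0. \<forall>a\<in>K. \<forall>y\<in>mspace m. mdist m (\<Phi> a) y < \<delta> \<longrightarrow> \<bar>H y - H (\<Phi> a)\<bar> \<le> \<epsilon>"
proof -
  interpret Metric_space "mspace m" "mdist m" by (rule Metric_space_mspace_mdist)
  have "\<exists>\<delta>>0. \<forall>y\<in>mspace m. mdist m (\<Phi> a) y < 2 * \<delta> \<longrightarrow> \<bar>H y - H (\<Phi> a)\<bar> < \<epsilon> / 2" for a
  proof -
    have "openin (mtopology_of m) {x \<in> topspace (mtopology_of m). H x \<in> ball (H (\<Phi> a)) (\<epsilon> / 2)}"
      by (rule openin_continuous_map_preimage[OF H]) auto
    then have "openin mtopology {x \<in> mspace m. H x \<in> ball (H (\<Phi> a)) (\<epsilon> / 2)}"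
      by (simp add: mtopology_of_def)
    moreover have "\<Phi> a \<in> {x \<in> mspace m. H x \<in> ball (H (\<Phi> a)) (\<epsilon> / 2)}" using \<Phi> \<epsilon> by simp
    ultimately obtain r where r: "r > 0" "mball (\<Phi> a) r \<subseteq> {x \<in> mspace m. H x \<in> ball (H (\<Phi> a)) (\<epsilon> / 2)}"
      unfolding openin_mtopology by blast
    then show ?thesis using \<Phi>
      by (intro exI[of _ "r / 2"]) (auto simp: subset_iff dist_real_def abs_minus_commute)
  qed
  then obtain \<delta> where \<delta>: "\<And>a. \<delta> a > 0"
    and \<delta>2: "\<And>a y. y \<in> mspace m \<Longrightarrow> mdist m (\<Phi> a) y < 2 * \<delta> a \<Longrightarrow> \<bar>H y - H (\<Phi> a)\<bar> < \<epsilon> / 2" by metis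
  \<comment> \<open>This radius puts \<Phi> of the ball within \<open>\<delta> a\<close> of
    \<Phi>(a); adding 1 allows \<open>C = 0\<close>.\<close>
  define B where "B a = ball a (\<delta> a / (C + 1))" for a
  obtain T where T: "T \<subseteq> K" "finite T" "K \<subseteq> (\<Union>a\<in>T. B a)"
  proof (rule compactE_image[OF K, of K B])
    have "a \<in> B a" for a using \<delta>[of a] C by (simp add: B_def)
    then show "K \<subseteq> (\<Union>a\<in>K. B a)" by blast
  qed (auto simp: B_def)
  define d where "d = Min (insert 1 (\<delta> ` T))"
  have d: "d > 0" "\<And>a. a \<in> T \<Longrightarrow> d \<le> \<delta> a" using T \<delta> by (auto simp: d_def)
  have "\<bar>H y - H (\<Phi> b)\<bar> \<le> \<epsilon>" if b: "b \<in> K" and y: "y \<in> mspace m" "mdist m (\<Phi> b) y < d" for b y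
  proof -
    obtain a where a: "a \<in> T" "dist a b < \<delta> a / (C + 1)" using T b by (auto simp: B_def)
    have "C * dist a b \<le> (C + 1) * dist a b" by (simp add: mult_right_mono)
    also have "\<dots> < \<delta> a" using a(2) C by (simp add: pos_less_divide_eq mult.commute)
    finally have ab: "mdist m (\<Phi> a) (\<Phi> b) < \<delta> a" using lip[of a b] by linarith
    then have 1: "\<bar>H (\<Phi> b) - H (\<Phi> a)\<bar> < \<epsilon> / 2" using \<delta>2[OF \<Phi>, of a b] \<delta>[of a] by simp
    have "mdist m (\<Phi> a) y < 2 * \<delta> a"
      using triangle[OF \<Phi> \<Phi> y(1), of a b] ab y(2) d(2)[OF a(1)] by linarith
    then have "\<bar>H y - H (\<Phi> a)\<bar> < \<epsilon> / 2" using \<delta>2[OF y(1)] by simp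
    then show ?thesis using 1 by linarith
  qed
  then show ?thesis using d(1) by (intro exI[of _ d] conjI ballI impI)
qed

text \<open>Since H(Y_n) may fail to be measurable, it is enclosed between \<phi>(A_n) - D_n and
  \<phi>(A_n) + D_n, with \<open>\<phi>\<close> a compactly supported version of H o \<Phi>. The
  mass of A_n outside a large ball is controlled by applying \<open>lim\<close> to the cut-off
  itself.\<close>

lemma (in std_gaussian_vector) converges_in_law_perturbed:
  fixes A :: "nat \<Rightarrow> 'w \<Rightarrow> real^'d" and \<Phi> :: "real^'d \<Rightarrow> 'a"
  assumes P: "prob_space P" and Y: "\<And>n. Y n \<in> space P \<rightarrow> mspace m"
    and \<Phi>: "\<And>a. \<Phi> a \<in> mspace m" and lip: "\<And>a b. mdist m (\<Phi> a) (\<Phi> b) \<le> C * dist a b" and C: "0 \<le> C"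
    and A [measurable]: "\<And>n. A n \<in> borel_measurable P"
    and R: "\<And>n. integrable P (R n)" and Rlim: "(\<lambda>n. \<integral>\<omega>. R n \<omega> \<partial>P) \<longlonglongrightarrow> 0"
    and near: "\<forall>\<^sub>F n in sequentially. \<forall>\<omega>\<in>space P. mdist m (Y n \<omega>) (\<Phi> (A n \<omega>)) \<le> R n \<omega>"
    and lim: "\<And>(\<phi> :: real^'d \<Rightarrow> real) L. continuous_on UNIV \<phi> \<Longrightarrow> (\<And>x. L \<le> norm x \<Longrightarrow> \<phi> x = 0) \<Longrightarrow>
       (\<lambda>n. \<integral>\<omega>. \<phi> (A n \<omega>) \<partial>P) \<longlonglongrightarrow> expectation (\<lambda>\<omega>. \<phi> (s *\<^sub>R N \<omega>))"
  shows "converges_in_law m P Y Q (\<lambda>\<omega>. \<Phi> (s *\<^sub>R N \<omega>))"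
proof -
  interpret P: prob_space P by fact
  interpret MS: Metric_space "mspace m" "mdist m" by (rule Metric_space_mspace_mdist)
  have \<Phi>open: "open {a. \<Phi> a \<in> W}" if W: "openin (mtopology_of m) W" for W
  proof (rule openI)
    fix a assume a: "a \<in> {a. \<Phi> a \<in> W}"
    obtain r where r: "r > 0" "MS.mball (\<Phi> a) r \<subseteq> W"
    proof -
      have "\<forall>x. x \<in> W \<longrightarrow> (\<exists>r>0. MS.mball x r \<subseteq> W)"
        using W unfolding mtopology_of_def MS.openin_mtopology by (rule conjunct2)
      moreover have "\<Phi> a \<in> W" using a by simp
      ultimately show ?thesis using that by metis
    qed
    have "\<Phi> b \<in> W" if "dist a b < r / (C + 1)" for b
    proof -
      have "C * dist a b \<le> (C + 1) * dist a b" by (simp add: mult_right_mono)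
      also have "\<dots> < r" using that C by (simp add: pos_less_divide_eq mult.commute)
      finally have "mdist m (\<Phi> a) (\<Phi> b) < r" using lip[of a b] by linarith
      then show ?thesis using r(2) \<Phi> by auto
    qed
    then show "\<exists>e>0. ball a e \<subseteq> {a. \<Phi> a \<in> W}" using r(1) C by (intro exI[of _ "r / (C + 1)"]) auto
  qed
  have Gm: "(\<lambda>\<omega>. \<Phi> (s *\<^sub>R N \<omega>)) \<in> measurable Q (sigma (mspace m) {W. openin (mtopology_of m) W})"
  proof (rule measurable_measure_of)
    show "{W. openin (mtopology_of m) W} \<subseteq> Pow (mspace m)" using openin_subset by fastforce
    show "(\<lambda>\<omega>. \<Phi> (s *\<^sub>R N \<omega>)) \<in> space Q \<rightarrow> mspace m" using \<Phi> by auto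
    fix W assume "W \<in> {W. openin (mtopology_of m) W}"
    then have o: "open {a. \<Phi> a \<in> W}" using \<Phi>open by simp
    have "(\<lambda>\<omega>. s *\<^sub>R N \<omega>) \<in> borel_measurable Q" by measurable
    from measurable_sets[OF this, of "{a. \<Phi> a \<in> W}"] o
    show "(\<lambda>\<omega>. \<Phi> (s *\<^sub>R N \<omega>)) -` W \<inter> space Q \<in> sets Q" by (simp add: vimage_def)
  qed
  have main: "(\<lambda>n. outer_expectation P (\<lambda>\<omega>. H (Y n \<omega>))) \<longlonglongrightarrow> integral\<^sup>L Q (\<lambda>\<omega>. H (\<Phi> (s *\<^sub>R N \<omega>)))"
    if H: "continuous_map (mtopology_of m) euclideanreal H" and bd: "bounded (H ` mspace m)" for H
  proof -
    obtain B0 where B0: "\<And>x. x \<in> mspace m \<Longrightarrow> \<bar>H x\<bar> \<le> B0" using bd by (auto simp: bounded_iff)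
    define B where "B = \<bar>B0\<bar> + 1"
    have B: "\<bar>H x\<bar> \<le> B" if "x \<in> mspace m" for x
      using B0[OF that] unfolding B_def by linarith
    have B_pos: "0 < B" unfolding B_def by linarith
    have H\<Phi>: "continuous_on UNIV (\<lambda>a. H (\<Phi> a))"
    proof (rule continuous_on_open_vimage[THEN iffD2])
      show "\<forall>U. open U \<longrightarrow> open ((\<lambda>a. H (\<Phi> a)) -` U \<inter> UNIV)"
      proof (intro allI impI)
        fix U :: "real set" assume "open U"
        then have "openin (mtopology_of m) {x \<in> topspace (mtopology_of m). H x \<in> U}"
          by (intro openin_continuous_map_preimage[OF H]) (rule open_openin[THEN iffD1])
        then have "open {a. \<Phi> a \<in> {x \<in> topspace (mtopology_of m). H x \<in> U}}" by (rule \<Phi>open)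
        moreover have "{a. \<Phi> a \<in> {x \<in> topspace (mtopology_of m). H x \<in> U}} = (\<lambda>a. H (\<Phi> a)) -` U \<inter> UNIV"
          using \<Phi> by (intro set_eqI) simp
        ultimately show "open ((\<lambda>a. H (\<Phi> a)) -` U \<inter> UNIV)" by (rule subst[rotated])
      qed
    qed simp
    have [measurable]: "(\<lambda>a. H (\<Phi> a)) \<in> borel_measurable borel" using H\<Phi> by (rule borel_measurable_continuous_onI)
    \<comment> \<open>A continuous cut-off, equal to 1 up to radius \<open>L - 1\<close> and to 0
      from radius \<open>L\<close> on, hence admissible in \<open>lim\<close>.\<close>
    define \<kappa> where "\<kappa> L a = max 0 (min 1 (L - norm a))" for L and a :: "real^'d"
    have \<kappa>01: "0 \<le> \<kappa> L a" "\<kappa> L a \<le> 1" for L a by (auto simp: \<kappa>_def)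
    have \<kappa>0: "L \<le> norm a \<Longrightarrow> \<kappa> L a = 0" for L a by (simp add: \<kappa>_def)
    have \<kappa>c: "continuous_on UNIV (\<kappa> L)" for L unfolding \<kappa>_def by (intro continuous_intros)
    have [measurable]: "\<kappa> L \<in> borel_measurable borel" for L using \<kappa>c by (rule borel_measurable_continuous_onI)
    have i\<kappa>: "integrable Q (\<lambda>\<omega>. \<kappa> L (s *\<^sub>R N \<omega>))" "integrable P (\<lambda>\<omega>. \<kappa> L (A n \<omega>))" for L n
      using \<kappa>01 by (auto intro!: integrable_const_bound[of _ 1] P.integrable_const_bound[of _ 1])
    have tail: "(\<lambda>k. expectation (\<lambda>\<omega>. \<kappa> (real k) (s *\<^sub>R N \<omega>))) \<longlonglongrightarrow> expectation (\<lambda>\<omega>. 1)"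
    proof (rule integral_dominated_convergence[where w="\<lambda>_. 1"])
      show "AE \<omega> in Q. (\<lambda>k. \<kappa> (real k) (s *\<^sub>R N \<omega>)) \<longlonglongrightarrow> 1"
      proof (intro AE_I2 tendsto_eventually eventually_sequentiallyI)
        fix \<omega> k assume "nat \<lceil>norm (s *\<^sub>R N \<omega>)\<rceil> + 1 \<le> k"
        then have "norm (s *\<^sub>R N \<omega>) + 1 \<le> real k" by linarith
        then show "\<kappa> (real k) (s *\<^sub>R N \<omega>) = 1" by (simp add: \<kappa>_def)
      qed
    qed (use \<kappa>01 in auto)
    show ?thesis
    proof (rule LIMSEQ_I)
      fix r :: real assume r: "0 < r"
      \<comment> \<open>The expectation of \<open>D\<close> costs less than 3e, convergence of the
        truncated test function less than e, and truncation in the limit at most e; their sum is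
        below 8e.\<close>
      define e where "e = r / 8"
      have e: "0 < e" using r by (simp add: e_def)
      obtain k where k: "\<bar>expectation (\<lambda>\<omega>. \<kappa> (real k) (s *\<^sub>R N \<omega>)) - 1\<bar> < e / B"
        using LIMSEQ_D[OF tail, of "e / B"] e B_pos by (auto simp: prob_space)
      define L where "L = real k"
      define \<kappa>' where "\<kappa>' = \<kappa> L"
      define \<phi> where "\<phi> a = H (\<Phi> a) * \<kappa>' a" for a
      have [measurable]: "\<kappa>' \<in> borel_measurable borel" "\<phi> \<in> borel_measurable borel"
        unfolding \<phi>_def \<kappa>'_def by measurable
      obtain \<delta> where \<delta>: "\<delta> > 0" "\<And>a y. a \<in> cball 0 L \<Longrightarrow> y \<in> mspace m \<Longrightarrow> mdist m (\<Phi> a) y < \<delta> \<Longrightarrow> \<bar>H y - H (\<Phi> a)\<bar> \<le> e"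
        using uniform_continuity_near_compact[OF H \<Phi> lip C compact_cball e, of 0 L] by auto
      have \<phi>c: "continuous_on UNIV \<phi>" unfolding \<phi>_def \<kappa>'_def by (intro continuous_intros H\<Phi> \<kappa>c)
      have \<phi>bd: "\<bar>\<phi> a\<bar> \<le> B" for a
        using mult_mono[OF B[OF \<Phi>, of a] _ _ abs_ge_zero, of "\<kappa>' a" 1] \<kappa>01[of L a] B_pos by (simp add: \<phi>_def \<kappa>'_def abs_mult)
      have l\<phi>: "(\<lambda>n. \<integral>\<omega>. \<phi> (A n \<omega>) \<partial>P) \<longlonglongrightarrow> expectation (\<lambda>\<omega>. \<phi> (s *\<^sub>R N \<omega>))"
        by (rule lim[OF \<phi>c, of L]) (simp add: \<phi>_def \<kappa>'_def \<kappa>0)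
      have l\<kappa>: "(\<lambda>n. \<integral>\<omega>. \<kappa>' (A n \<omega>) \<partial>P) \<longlonglongrightarrow> expectation (\<lambda>\<omega>. \<kappa>' (s *\<^sub>R N \<omega>))"
        unfolding \<kappa>'_def by (rule lim[OF \<kappa>c, of L]) (simp add: \<kappa>0)
      let ?\<theta> = "expectation (\<lambda>\<omega>. \<kappa>' (s *\<^sub>R N \<omega>))"
      have \<theta>: "B * (1 - ?\<theta>) < e"
        using k B_pos e by (simp add: \<kappa>'_def L_def abs_less_iff pos_less_divide_eq field_simps)
      \<comment> \<open>The summands are the modulus of continuity near the compact image, the loss
        through the cut-off, and a Markov-type bound for outcomes with \<open>R n \<omega>\<close>
        at least \<open>\<delta>\<close>.\<close>
      define D where "D n \<omega> = e + B * (1 - \<kappa>' (A n \<omega>)) + 2 * B / \<delta> * R n \<omega>" for n \<omega>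
      have i\<phi>: "integrable P (\<lambda>\<omega>. \<phi> (A n \<omega>))" "integrable Q (\<lambda>\<omega>. \<phi> (s *\<^sub>R N \<omega>))" for n
        using \<phi>bd by (auto intro!: integrable_const_bound[of _ B] P.integrable_const_bound[of _ B])
      have iD: "integrable P (D n)" for n
        unfolding D_def using R[of n] i\<kappa>(2)[of L n] by (auto simp: \<kappa>'_def)
      have eD: "(\<integral>\<omega>. D n \<omega> \<partial>P) = e + B * (1 - (\<integral>\<omega>. \<kappa>' (A n \<omega>) \<partial>P)) + 2 * B / \<delta> * (\<integral>\<omega>. R n \<omega> \<partial>P)" for n
        unfolding D_def using R[of n] i\<kappa>(2)[of L n] by (simp add: \<kappa>'_def P.prob_space)
      have lD: "(\<lambda>n. \<integral>\<omega>. D n \<omega> \<partial>P) \<longlonglongrightarrow> e + B * (1 - ?\<theta>) + 2 * B / \<delta> * 0"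
        unfolding eD by (intro tendsto_intros l\<kappa> Rlim)
      then have evD: "\<forall>\<^sub>F n in sequentially. (\<integral>\<omega>. D n \<omega> \<partial>P) < 3 * e"
        using \<theta> e by (intro order_tendstoD) auto
      have ev\<phi>: "\<forall>\<^sub>F n in sequentially. \<bar>(\<integral>\<omega>. \<phi> (A n \<omega>) \<partial>P) - expectation (\<lambda>\<omega>. \<phi> (s *\<^sub>R N \<omega>))\<bar> < e"
        using tendstoD[OF l\<phi> e] by (simp add: dist_real_def)
      have lim\<phi>: "\<bar>expectation (\<lambda>\<omega>. \<phi> (s *\<^sub>R N \<omega>)) - expectation (\<lambda>\<omega>. H (\<Phi> (s *\<^sub>R N \<omega>)))\<bar> \<le> e"
      proof -
        have iH: "integrable Q (\<lambda>\<omega>. H (\<Phi> (s *\<^sub>R N \<omega>)))"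
        proof (rule integrable_const_bound[of _ B])
          show "(\<lambda>\<omega>. H (\<Phi> (s *\<^sub>R N \<omega>))) \<in> borel_measurable Q"
            using measurable_compose[of "\<lambda>\<omega>. s *\<^sub>R N \<omega>" Q borel "\<lambda>a. H (\<Phi> a)"] by measurable
        qed (use B \<Phi> in auto)
        have "\<bar>expectation (\<lambda>\<omega>. \<phi> (s *\<^sub>R N \<omega>)) - expectation (\<lambda>\<omega>. H (\<Phi> (s *\<^sub>R N \<omega>)))\<bar>
          = \<bar>expectation (\<lambda>\<omega>. \<phi> (s *\<^sub>R N \<omega>) - H (\<Phi> (s *\<^sub>R N \<omega>)))\<bar>" using i\<phi>(2) iH by simp
        also have "\<dots> \<le> expectation (\<lambda>\<omega>. \<bar>\<phi> (s *\<^sub>R N \<omega>) - H (\<Phi> (s *\<^sub>R N \<omega>))\<bar>)" by (rule integral_abs_bound)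
        also have "\<dots> \<le> expectation (\<lambda>\<omega>. B * (1 - \<kappa>' (s *\<^sub>R N \<omega>)))"
        proof (rule integral_mono)
          show "integrable Q (\<lambda>\<omega>. \<bar>\<phi> (s *\<^sub>R N \<omega>) - H (\<Phi> (s *\<^sub>R N \<omega>))\<bar>)" using i\<phi>(2) iH by auto
          show "integrable Q (\<lambda>\<omega>. B * (1 - \<kappa>' (s *\<^sub>R N \<omega>)))" using i\<kappa>(1)[of L] by (auto simp: \<kappa>'_def)
          fix \<omega>
          let ?a = "s *\<^sub>R N \<omega>"
          have "\<phi> ?a - H (\<Phi> ?a) = - (H (\<Phi> ?a) * (1 - \<kappa>' ?a))" by (simp add: \<phi>_def algebra_simps)
          then have "\<bar>\<phi> ?a - H (\<Phi> ?a)\<bar> = \<bar>H (\<Phi> ?a)\<bar> * (1 - \<kappa>' ?a)"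
            using \<kappa>01[of L ?a] by (simp add: abs_mult \<kappa>'_def)
          also have "\<dots> \<le> B * (1 - \<kappa>' ?a)" using B[OF \<Phi>] \<kappa>01[of L ?a] by (intro mult_right_mono) (auto simp: \<kappa>'_def)
          finally show "\<bar>\<phi> ?a - H (\<Phi> ?a)\<bar> \<le> B * (1 - \<kappa>' ?a)" .
        qed
        also have "\<dots> = B * (1 - ?\<theta>)" using i\<kappa>(1)[of L] by (simp add: \<kappa>'_def prob_space)
        finally show ?thesis using \<theta> by linarith
      qed
      have "\<forall>\<^sub>F n in sequentially. norm (outer_expectation P (\<lambda>\<omega>. H (Y n \<omega>)) - expectation (\<lambda>\<omega>. H (\<Phi> (s *\<^sub>R N \<omega>)))) < r"
        using near evD ev\<phi>
      proof eventually_elim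
        case (elim n)
        have dd: "\<bar>H (Y n \<omega>) - \<phi> (A n \<omega>)\<bar> \<le> D n \<omega>" if \<omega>: "\<omega> \<in> space P" for \<omega>
        proof -
          let ?a = "A n \<omega>" and ?y = "Y n \<omega>" and ?R = "R n \<omega>"
          have y: "?y \<in> mspace m" using Y \<omega> by auto
          have dist: "mdist m (\<Phi> ?a) ?y \<le> ?R" using elim(1) \<omega> by (simp add: MS.commute)
          have R0: "0 \<le> ?R" using dist MS.nonneg[of "\<Phi> ?a" ?y] by linarith
          have c0: "0 \<le> B * (1 - \<kappa>' ?a)" using B_pos \<kappa>01[of L ?a] by (simp add: \<kappa>'_def)
          have r0: "0 \<le> 2 * B / \<delta> * ?R" using B_pos \<delta>(1) R0 by simp
          show ?thesis
          proof (cases "?R < \<delta>")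
            case False
            then have "1 \<le> ?R / \<delta>" using \<delta>(1) by simp
            then have "2 * B * 1 \<le> 2 * B * (?R / \<delta>)" using B_pos by (intro mult_left_mono) auto
            then have "2 * B \<le> 2 * B / \<delta> * ?R" by simp
            then show ?thesis using B[OF y] \<phi>bd[of ?a] c0 e unfolding D_def by linarith
          next
            case True
            show ?thesis
            proof (cases "norm ?a \<le> L")
              case True
              then have h: "\<bar>H ?y - H (\<Phi> ?a)\<bar> \<le> e" using \<open>?R < \<delta>\<close> dist by (intro \<delta>(2) y) auto
              have "H (\<Phi> ?a) - \<phi> ?a = H (\<Phi> ?a) * (1 - \<kappa>' ?a)" by (simp add: \<phi>_def algebra_simps)
              then have "\<bar>H (\<Phi> ?a) - \<phi> ?a\<bar> = \<bar>H (\<Phi> ?a)\<bar> * (1 - \<kappa>' ?a)"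
                using \<kappa>01[of L ?a] by (simp add: abs_mult \<kappa>'_def)
              also have "\<dots> \<le> B * (1 - \<kappa>' ?a)" using B[OF \<Phi>] \<kappa>01[of L ?a] by (intro mult_right_mono) (auto simp: \<kappa>'_def)
              finally show ?thesis using h r0 unfolding D_def by linarith
            next
              case False
              then have "\<kappa>' ?a = 0" "\<phi> ?a = 0" by (auto simp: \<phi>_def \<kappa>'_def \<kappa>0)
              then show ?thesis using B[OF y] r0 e unfolding D_def by auto
            qed
          qed
        qed
        have i1: "integrable P (\<lambda>\<omega>. \<phi> (A n \<omega>) - D n \<omega>)" "integrable P (\<lambda>\<omega>. \<phi> (A n \<omega>) + D n \<omega>)"
          using i\<phi>(1)[of n] iD[of n] by auto
        have b: "\<phi> (A n \<omega>) - D n \<omega> \<le> H (Y n \<omega>)" "H (Y n \<omega>) \<le> \<phi> (A n \<omega>) + D n \<omega>" if "\<omega> \<in> space P" for \<omega>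
          using dd[OF that] by linarith+
        have o1: "(\<integral>\<omega>. \<phi> (A n \<omega>) - D n \<omega> \<partial>P) \<le> outer_expectation P (\<lambda>\<omega>. H (Y n \<omega>))"
          by (rule outer_expectation_bounds(1)[OF i1 b])
        have o2: "outer_expectation P (\<lambda>\<omega>. H (Y n \<omega>)) \<le> (\<integral>\<omega>. \<phi> (A n \<omega>) + D n \<omega> \<partial>P)"
          by (rule outer_expectation_bounds(2)[OF i1 b])
        have p1: "(\<integral>\<omega>. \<phi> (A n \<omega>) - D n \<omega> \<partial>P) = (\<integral>\<omega>. \<phi> (A n \<omega>) \<partial>P) - (\<integral>\<omega>. D n \<omega> \<partial>P)"
          and p2: "(\<integral>\<omega>. \<phi> (A n \<omega>) + D n \<omega> \<partial>P) = (\<integral>\<omega>. \<phi> (A n \<omega>) \<partial>P) + (\<integral>\<omega>. D n \<omega> \<partial>P)"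
          using i\<phi>(1)[of n] iD[of n] by auto
        have "r = 8 * e" by (simp add: e_def)
        then show ?case using o1 o2 elim(2,3) lim\<phi> e unfolding p1 p2 real_norm_def by linarith
      qed
      then show "\<exists>no. \<forall>n\<ge>no. norm (outer_expectation P (\<lambda>\<omega>. H (Y n \<omega>)) - expectation (\<lambda>\<omega>. H (\<Phi> (s *\<^sub>R N \<omega>)))) < r"
        by (simp add: eventually_sequentially)
    qed
  qed
  show ?thesis
    unfolding converges_in_law_def
  proof (intro conjI allI impI)
    fix H assume "continuous_map (mtopology_of m) euclideanreal H \<and> bounded (H ` mspace m)"
    then show "(\<lambda>n. outer_expectation P (\<lambda>\<omega>. H (Y n \<omega>))) \<longlonglongrightarrow> integral\<^sup>L Q (\<lambda>\<omega>. H (\<Phi> (s *\<^sub>R N \<omega>)))"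
      by (intro main) auto
  qed (fact Y Gm)+
qed

section \<open>Laplace's method\<close>

context std_gaussian_vector
begin

lemma gaussian_integral:
  fixes w :: "real^'d \<Rightarrow> real"
  assumes \<tau>: "0 < \<tau>" and w [measurable]: "w \<in> borel_measurable borel"
  shows "integrable lborel (\<lambda>y. exp (- (norm y)\<^sup>2 / (2 * \<tau>\<^sup>2)) * w y) \<longleftrightarrow> integrable Q (\<lambda>\<omega>. w (\<tau> *\<^sub>R N \<omega>))"
    and "(\<integral>y. exp (- (norm y)\<^sup>2 / (2 * \<tau>\<^sup>2)) * w y \<partial>lborel) = (sqrt (2 * pi) * \<tau>) ^ CARD('d) * expectation (\<lambda>\<omega>. w (\<tau> *\<^sub>R N \<omega>))"
proof -
  let ?c = "(sqrt (2 * pi) * \<tau>) ^ CARD('d)"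
  have c: "?c \<noteq> 0" using \<tau> by simp
  have eq: "exp (- (norm y)\<^sup>2 / (2 * \<tau>\<^sup>2)) * w y = ?c * (gauss_density \<tau> (y - 0) *\<^sub>R w y)" for y
    using c unfolding gauss_density_def by simp
  show "integrable lborel (\<lambda>y. exp (- (norm y)\<^sup>2 / (2 * \<tau>\<^sup>2)) * w y) \<longleftrightarrow> integrable Q (\<lambda>\<omega>. w (\<tau> *\<^sub>R N \<omega>))"
    unfolding eq integrable_mult_left_iff using c integrable_gauss[OF \<tau> w, of 0] by simp
  show "(\<integral>y. exp (- (norm y)\<^sup>2 / (2 * \<tau>\<^sup>2)) * w y \<partial>lborel) = ?c * expectation (\<lambda>\<omega>. w (\<tau> *\<^sub>R N \<omega>))"
    unfolding eq using integral_gauss[OF \<tau> w, of 0] by simp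
qed

definition abs_moment :: "nat \<Rightarrow> real" where "abs_moment k = expectation (\<lambda>\<omega>. norm (N \<omega>) ^ k)"

lemma abs_moment_nonneg: "0 \<le> abs_moment k"
  unfolding abs_moment_def by (rule Bochner_Integration.integral_nonneg) simp

lemma gaussian_norm_moment:
  assumes \<tau>: "0 < \<tau>"
  shows "integrable lborel (\<lambda>y::real^'d. exp (- (norm y)\<^sup>2 / (2 * \<tau>\<^sup>2)) * norm y ^ k)"
    and "(\<integral>y. exp (- (norm (y::real^'d))\<^sup>2 / (2 * \<tau>\<^sup>2)) * norm y ^ k \<partial>lborel) = (sqrt (2 * pi) * \<tau>) ^ CARD('d) * (\<tau> ^ k * abs_moment k)"
proof -
  have e: "norm (\<tau> *\<^sub>R N \<omega>) ^ k = \<tau> ^ k * norm (N \<omega>) ^ k" for \<omega> using \<tau> by (simp add: power_mult_distrib)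
  have m: "(\<lambda>y::real^'d. norm y ^ k) \<in> borel_measurable borel" by measurable
  show "integrable lborel (\<lambda>y::real^'d. exp (- (norm y)\<^sup>2 / (2 * \<tau>\<^sup>2)) * norm y ^ k)"
    unfolding gaussian_integral(1)[OF \<tau> m] e by (intro integrable_mult_right integrable_norm_N_power)
  show "(\<integral>y. exp (- (norm (y::real^'d))\<^sup>2 / (2 * \<tau>\<^sup>2)) * norm y ^ k \<partial>lborel) = (sqrt (2 * pi) * \<tau>) ^ CARD('d) * (\<tau> ^ k * abs_moment k)"
    unfolding gaussian_integral(2)[OF \<tau> m] e abs_moment_def by simp
qed

lemma abs_expectation_le_moment:
  assumes [measurable]: "w \<in> borel_measurable borel" and w: "\<And>y. \<bar>w y\<bar> \<le> c * norm y ^ k" and \<tau>: "0 < \<tau>"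
  shows "integrable Q (\<lambda>\<omega>. w (\<tau> *\<^sub>R N \<omega>))" and "\<bar>expectation (\<lambda>\<omega>. w (\<tau> *\<^sub>R N \<omega>))\<bar> \<le> c * (\<tau> ^ k * abs_moment k)"
proof -
  have e: "norm (\<tau> *\<^sub>R N \<omega>) ^ k = \<tau> ^ k * norm (N \<omega>) ^ k" for \<omega> using \<tau> by (simp add: power_mult_distrib)
  have b: "\<bar>w (\<tau> *\<^sub>R N \<omega>)\<bar> \<le> c * (\<tau> ^ k * norm (N \<omega>) ^ k)" for \<omega> using w[of "\<tau> *\<^sub>R N \<omega>"] unfolding e .
  have ib: "integrable Q (\<lambda>\<omega>. c * (\<tau> ^ k * norm (N \<omega>) ^ k))" by (intro integrable_mult_right integrable_norm_N_power)
  show i: "integrable Q (\<lambda>\<omega>. w (\<tau> *\<^sub>R N \<omega>))"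
  proof (rule Bochner_Integration.integrable_bound[OF ib])
    show "AE \<omega> in Q. norm (w (\<tau> *\<^sub>R N \<omega>)) \<le> norm (c * (\<tau> ^ k * norm (N \<omega>) ^ k))"
      using order_trans[OF b abs_ge_self] by (simp only: real_norm_def) simp
  qed measurable
  have "\<bar>expectation (\<lambda>\<omega>. w (\<tau> *\<^sub>R N \<omega>))\<bar> \<le> expectation (\<lambda>\<omega>. \<bar>w (\<tau> *\<^sub>R N \<omega>)\<bar>)" by (rule integral_abs_bound)
  also have "\<dots> \<le> expectation (\<lambda>\<omega>. c * (\<tau> ^ k * norm (N \<omega>) ^ k))"
    using i ib b by (intro integral_mono) auto
  also have "\<dots> = c * (\<tau> ^ k * abs_moment k)" by (simp add: abs_moment_def)
  finally show "\<bar>expectation (\<lambda>\<omega>. w (\<tau> *\<^sub>R N \<omega>))\<bar> \<le> c * (\<tau> ^ k * abs_moment k)" .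
qed

text \<open>On the half-line from \<open>m\<close> upwards the derivative of exp(-x) is at most
  exp(-m) in absolute value.\<close>

lemma exp_diff_bound:
  fixes x y m :: real
  assumes "m \<le> x" "m \<le> y" shows "\<bar>exp (- x) - exp (- y)\<bar> \<le> \<bar>x - y\<bar> * exp (- m)"
proof -
  have *: "exp (- u) - exp (- v) \<le> (v - u) * exp (- m)" if "m \<le> u" "u \<le> v" for u v :: real
  proof -
    have "exp (- u) - exp (- v) = exp (- u) * (1 - exp (- (v - u)))" by (simp add: right_diff_distrib exp_add[symmetric])
    also have "\<dots> \<le> exp (- u) * (v - u)" 
    proof (rule mult_left_mono)
      show "1 - exp (- (v - u)) \<le> v - u" using exp_ge_add_one_self[of "- (v - u)"] by linarith
    qed simp
    also have "\<dots> \<le> exp (- m) * (v - u)" using that by (intro mult_right_mono) auto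
    finally show ?thesis by (simp add: mult.commute)
  qed
  show ?thesis
  proof (cases "x \<le> y")
    case True
    then have "exp (- y) \<le> exp (- x)" by simp
    then show ?thesis using *[OF assms(1) True] True by simp
  next
    case False
    then have "exp (- x) \<le> exp (- y)" by simp
    then show ?thesis using *[OF assms(2), of x] False by simp
  qed
qed

text \<open>The integrand is compared pointwise with the exact Gaussian on the whole space. Density
  and exponent contribute |y|^2 and |y|^4 / h^2 times a wider Gaussian, and outside the ball the
  missing Gaussian is absorbed because |y|/r \<ge> 1 there. Integration against |y|^k gives the
  relative order h^2 with a constant uniform in \<open>h\<close>, \<open>w\<close> and
  \<open>c\<close>.\<close>

lemma laplace_method:
  fixes q D :: "real^'d \<Rightarrow> real"
  assumes [measurable]: "q \<in> borel_measurable borel" "D \<in> borel_measurable borel"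
    and r: "0 < r" and C: "0 \<le> C" and \<sigma>: "0 < \<sigma>"
    and D: "\<And>y. y \<in> ball 0 r \<Longrightarrow> \<bar>D y - 1\<bar> \<le> C * (norm y)\<^sup>2"
    and q: "\<And>y. y \<in> ball 0 r \<Longrightarrow> \<bar>q y - (norm y)\<^sup>2\<bar> \<le> C * norm y ^ 4"
      "\<And>y. y \<in> ball 0 r \<Longrightarrow> (norm y)\<^sup>2 / 2 \<le> q y"
  shows "\<exists>K\<ge>0. \<forall>h w c. 0 < h \<longrightarrow> w \<in> borel_measurable borel \<longrightarrow> (\<forall>y. \<bar>w y\<bar> \<le> c * norm y ^ k) \<longrightarrow>
    integrable lborel (\<lambda>y. indicator (ball 0 r) y * (exp (- q y / (2 * (\<sigma> * h)\<^sup>2)) * D y * w y)) \<and>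
    \<bar>(\<integral>y. indicator (ball 0 r) y * (exp (- q y / (2 * (\<sigma> * h)\<^sup>2)) * D y * w y) \<partial>lborel)
       - (sqrt (2 * pi) * (\<sigma> * h)) ^ CARD('d) * expectation (\<lambda>\<omega>. w ((\<sigma> * h) *\<^sub>R N \<omega>))\<bar> \<le> K * c * h ^ (CARD('d) + k + 2)"
proof -
  \<comment> \<open>The summands pay for the density, for the exponent and for the complement of the
    ball.\<close>
  define C' where "C' = C + C / (2 * \<sigma>\<^sup>2) + 1 / r\<^sup>2"
  have C': "0 \<le> C'" "C \<le> C'" "C / (2 * \<sigma>\<^sup>2) \<le> C'" "1 / r\<^sup>2 \<le> C'" using C r \<sigma> by (auto simp: C'_def)
  \<comment> \<open>\<open>q\<close> is known only to be at least half the squared norm, so the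
    dominating Gaussian has twice the variance.\<close>
  let ?s = "sqrt 2 * \<sigma>"
  have s: "0 < ?s" using \<sigma> by simp
  \<comment> \<open>The two errors use moments of orders \<open>k + 2\<close> and
    \<open>k + 4\<close>; dividing the second by h^2 brings both to the same power of
    \<open>h\<close>.\<close>
  define K where "K = C' * ((sqrt (2 * pi) * ?s) ^ CARD('d) * (?s ^ (k + 2) * abs_moment (k + 2))
      + (sqrt (2 * pi) * ?s) ^ CARD('d) * (?s ^ (k + 4) * abs_moment (k + 4)))"
  have K: "0 \<le> K" using C'(1) s abs_moment_nonneg by (simp add: K_def)
  have pt: "\<bar>indicator (ball 0 r) y * (exp (- q y / (2 * (\<sigma> * h)\<^sup>2)) * D y) - exp (- (norm y)\<^sup>2 / (2 * (\<sigma> * h)\<^sup>2))\<bar>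
     \<le> C' * ((norm y)\<^sup>2 + norm y ^ 4 / h\<^sup>2) * exp (- (norm y)\<^sup>2 / (2 * (?s * h)\<^sup>2))" if h: "0 < h" for h y
  proof -
    define \<tau> where "\<tau> = \<sigma> * h"
    have \<tau>: "0 < \<tau>" using \<sigma> h by (simp add: \<tau>_def)
    let ?a = "q y / (2 * \<tau>\<^sup>2)" and ?b = "(norm y)\<^sup>2 / (2 * \<tau>\<^sup>2)"
    let ?m = "(norm y)\<^sup>2 / (4 * \<tau>\<^sup>2)"
    have m: "exp (- (norm y)\<^sup>2 / (2 * (?s * h)\<^sup>2)) = exp (- ?m)"
      by (simp add: \<tau>_def power_mult_distrib)
    have nn: "0 \<le> C' * (norm y ^ 4 / h\<^sup>2)" "0 \<le> C' * (norm y)\<^sup>2" using C' by auto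
    have mb: "?m \<le> ?b" using \<tau> by (intro divide_left_mono) auto
    show ?thesis
    proof (cases "y \<in> ball 0 r")
      case True
      have ma: "?m \<le> ?a"
      proof -
        have "?m = ((norm y)\<^sup>2 / 2) / (2 * \<tau>\<^sup>2)" by simp
        also have "\<dots> \<le> ?a" using q(2)[OF True] by (intro divide_right_mono) auto
        finally show ?thesis .
      qed
      have "exp (- ?a) * D y - exp (- ?b) = exp (- ?a) * (D y - 1) + (exp (- ?a) - exp (- ?b))" by (simp add: algebra_simps)
      then have "\<bar>exp (- ?a) * D y - exp (- ?b)\<bar> \<le> \<bar>exp (- ?a) * (D y - 1)\<bar> + \<bar>exp (- ?a) - exp (- ?b)\<bar>" by linarith
      also have "\<bar>exp (- ?a) * (D y - 1)\<bar> \<le> exp (- ?m) * (C * (norm y)\<^sup>2)"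
        unfolding abs_mult using ma D[OF True] by (intro mult_mono) auto
      also have "exp (- ?m) * (C * (norm y)\<^sup>2) \<le> exp (- ?m) * (C' * (norm y)\<^sup>2)"
        using C' by (intro mult_left_mono mult_right_mono) auto
      also have "\<bar>exp (- ?a) - exp (- ?b)\<bar> \<le> \<bar>?a - ?b\<bar> * exp (- ?m)" by (rule exp_diff_bound[OF ma mb])
      also have "\<bar>?a - ?b\<bar> \<le> C' * (norm y ^ 4 / h\<^sup>2)"
      proof -
        have "\<bar>?a - ?b\<bar> = \<bar>q y - (norm y)\<^sup>2\<bar> / (2 * \<tau>\<^sup>2)" by (simp add: diff_divide_distrib[symmetric] abs_divide)
        also have "\<dots> \<le> C * norm y ^ 4 / (2 * \<tau>\<^sup>2)" using q(1)[OF True] by (intro divide_right_mono) auto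
        also have "\<dots> = C / (2 * \<sigma>\<^sup>2) * (norm y ^ 4 / h\<^sup>2)" by (simp add: \<tau>_def power_mult_distrib)
        also have "\<dots> \<le> C' * (norm y ^ 4 / h\<^sup>2)" using C'(3) by (intro mult_right_mono) auto
        finally show ?thesis .
      qed
      finally have "\<bar>exp (- ?a) * D y - exp (- ?b)\<bar> \<le> exp (- ?m) * (C' * (norm y)\<^sup>2) + C' * (norm y ^ 4 / h\<^sup>2) * exp (- ?m)"
        by (simp add: mult_right_mono)
      then show ?thesis unfolding m using True by (simp add: \<tau>_def algebra_simps)
    next
      case False
      have ny: "r \<le> norm y" using False by simp
      then have "r\<^sup>2 \<le> (norm y)\<^sup>2" using r by (intro power_mono) auto
      then have "1 \<le> 1 / r\<^sup>2 * (norm y)\<^sup>2" using r by simp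
      also have "\<dots> \<le> C' * (norm y)\<^sup>2" using C'(4) by (intro mult_right_mono) auto
      finally have one: "1 \<le> C' * ((norm y)\<^sup>2 + norm y ^ 4 / h\<^sup>2)" using nn by (simp add: distrib_left)
      have "exp (- ?b) \<le> exp (- ?m)" using mb by simp
      also have "\<dots> \<le> C' * ((norm y)\<^sup>2 + norm y ^ 4 / h\<^sup>2) * exp (- ?m)" using mult_right_mono[OF one, of "exp (- ?m)"] by simp
      finally show ?thesis unfolding m using False by (simp add: \<tau>_def)
    qed
  qed
  show ?thesis
  proof (intro exI[of _ K] conjI K allI impI)
    fix h :: real and w :: "real^'d \<Rightarrow> real" and c
    assume h: "0 < h" and w [measurable]: "w \<in> borel_measurable borel" and wb: "\<forall>y. \<bar>w y\<bar> \<le> c * norm y ^ k"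
    have sh: "0 < ?s * h" and \<sigma>h: "0 < \<sigma> * h" using s \<sigma> h by auto
    let ?f = "\<lambda>y. indicator (ball 0 r) y * (exp (- q y / (2 * (\<sigma> * h)\<^sup>2)) * D y * w y)"
    let ?g = "\<lambda>y. exp (- (norm y)\<^sup>2 / (2 * (\<sigma> * h)\<^sup>2)) * w y"
    let ?e = "\<lambda>y::real^'d. exp (- (norm y)\<^sup>2 / (2 * (?s * h)\<^sup>2))"
    let ?b = "\<lambda>y. C' * c * (?e y * norm y ^ (k + 2)) + C' * c / h\<^sup>2 * (?e y * norm y ^ (k + 4))"
    have ib: "integrable lborel ?b"
      by (intro Bochner_Integration.integrable_add integrable_mult_right gaussian_norm_moment[OF sh])
    have fg: "\<bar>?f y - ?g y\<bar> \<le> ?b y" for y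
    proof -
      have "?f y - ?g y = (indicator (ball 0 r) y * (exp (- q y / (2 * (\<sigma> * h)\<^sup>2)) * D y) - exp (- (norm y)\<^sup>2 / (2 * (\<sigma> * h)\<^sup>2))) * w y"
        by (simp add: algebra_simps)
      then have "\<bar>?f y - ?g y\<bar> \<le> (C' * ((norm y)\<^sup>2 + norm y ^ 4 / h\<^sup>2) * ?e y) * (c * norm y ^ k)"
        using pt[OF h, of y] wb C' by (simp only: abs_mult) (intro mult_mono, auto)
      also have "\<dots> = ?b y" by (simp add: power_add algebra_simps) (simp add: power2_eq_square)
      finally show ?thesis .
    qed
    have ig: "integrable lborel ?g"
      using abs_expectation_le_moment(1)[OF w _ \<sigma>h, of c k] wb gaussian_integral(1)[OF \<sigma>h w] by blast
    have [measurable]: "ball 0 r \<in> sets (borel :: (real^'d) measure)" by simp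
    have ifg: "integrable lborel (\<lambda>y. ?f y - ?g y)"
    proof (rule Bochner_Integration.integrable_bound[OF ib])
      show "AE y in lborel. norm (?f y - ?g y) \<le> norm (?b y)"
        using order_trans[OF fg abs_ge_self] by (intro AE_I2) (simp only: real_norm_def)
    qed measurable
    have "integrable lborel (\<lambda>y. (?f y - ?g y) + ?g y)" using ifg ig by (rule Bochner_Integration.integrable_add)
    then show if': "integrable lborel ?f" by simp
    have d1: "(\<integral>y. ?f y \<partial>lborel) - (\<integral>y. ?g y \<partial>lborel) = (\<integral>y. ?f y - ?g y \<partial>lborel)"
      by (rule Bochner_Integration.integral_diff[OF if' ig, symmetric])
    have d2: "\<bar>\<integral>y. ?f y - ?g y \<partial>lborel\<bar> \<le> (\<integral>y. \<bar>?f y - ?g y\<bar> \<partial>lborel)" by (rule integral_abs_bound)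
    have d3: "(\<integral>y. \<bar>?f y - ?g y\<bar> \<partial>lborel) \<le> (\<integral>y. ?b y \<partial>lborel)"
      by (rule integral_mono[OF integrable_abs[OF ifg] ib]) (rule fg)
    have d4: "(\<integral>y. ?b y \<partial>lborel) = C' * c * ((sqrt (2 * pi) * (?s * h)) ^ CARD('d) * ((?s * h) ^ (k + 2) * abs_moment (k + 2)))
        + C' * c / h\<^sup>2 * ((sqrt (2 * pi) * (?s * h)) ^ CARD('d) * ((?s * h) ^ (k + 4) * abs_moment (k + 4)))"
    proof -
      have "(\<integral>y. ?b y \<partial>lborel) = C' * c * (\<integral>y. ?e y * norm y ^ (k + 2) \<partial>lborel) + C' * c / h\<^sup>2 * (\<integral>y. ?e y * norm y ^ (k + 4) \<partial>lborel)"
        using gaussian_norm_moment(1)[OF sh, of "k + 2"] gaussian_norm_moment(1)[OF sh, of "k + 4"]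
        by (subst Bochner_Integration.integral_add) (auto simp del: power_Suc)
      then show ?thesis by (simp only: gaussian_norm_moment(2)[OF sh])
    qed
    have d5: "C' * c * ((sqrt (2 * pi) * (?s * h)) ^ CARD('d) * ((?s * h) ^ (k + 2) * abs_moment (k + 2)))
        + C' * c / h\<^sup>2 * ((sqrt (2 * pi) * (?s * h)) ^ CARD('d) * ((?s * h) ^ (k + 4) * abs_moment (k + 4)))
        = K * c * h ^ (CARD('d) + k + 2)"
    proof -
      have "(sqrt (2 * pi) * (?s * h)) ^ CARD('d) = (sqrt (2 * pi) * ?s) ^ CARD('d) * h ^ CARD('d)"
        by (simp add: power_mult_distrib)
      moreover have "(?s * h) ^ (k + 2) = ?s ^ (k + 2) * (h ^ k * h\<^sup>2)" "(?s * h) ^ (k + 4) = ?s ^ (k + 4) * (h ^ k * h\<^sup>2) * h\<^sup>2"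
      proof -
        have "h ^ (k + 2) = h ^ k * h\<^sup>2" by (rule power_add)
        moreover have "h ^ (k + 4) = h ^ k * h\<^sup>2 * h\<^sup>2"
          unfolding power_add[symmetric] by (rule arg_cong[where f="\<lambda>n. h ^ n"]) simp
        ultimately show "(?s * h) ^ (k + 2) = ?s ^ (k + 2) * (h ^ k * h\<^sup>2)" "(?s * h) ^ (k + 4) = ?s ^ (k + 4) * (h ^ k * h\<^sup>2) * h\<^sup>2"
          unfolding power_mult_distrib[of ?s h] by (simp_all only: mult.assoc)
      qed
      moreover have "h ^ (CARD('d) + k + 2) = h ^ CARD('d) * (h ^ k * h\<^sup>2)" by (simp only: power_add mult.assoc)
      moreover have "C' * c * (A * hd * (S * X * m)) + C' * c / h\<^sup>2 * (A * hd * (S' * X * h\<^sup>2 * m')) = C' * (A * (S * m) + A * (S' * m')) * c * (hd * X)"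
        for A hd S X m S' m' :: real
        using h by (simp add: field_simps)
      ultimately show ?thesis unfolding K_def by (simp only:)
    qed
    show "\<bar>(\<integral>y. ?f y \<partial>lborel) - (sqrt (2 * pi) * (\<sigma> * h)) ^ CARD('d) * expectation (\<lambda>\<omega>. w ((\<sigma> * h) *\<^sub>R N \<omega>))\<bar>
        \<le> K * c * h ^ (CARD('d) + k + 2)"
      using d2 d3 unfolding gaussian_integral(2)[OF \<sigma>h w, symmetric] d1 d4 d5 by (rule order_trans)
  qed
qed

end

section \<open>Moments of the kernel on the manifold\<close>

locale sampled_chart = normal_chart M p \<psi> \<kappa> W R e + G: std_gaussian_vector Q Z
  for M :: "(real^'m::finite) set" and p and \<psi> :: "real^'d::finite \<Rightarrow> real^'m" and \<kappa> W R e
    and Q :: "'q measure" and Z :: "'d \<Rightarrow> 'q \<Rightarrow> real" +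
  fixes \<mu> :: "(real^'m) measure" and r C :: real
  assumes \<mu>: "riemannian_volume TYPE('d) M \<mu>"
    and \<mu>_M: "emeasure \<mu> M \<noteq> 0" "emeasure \<mu> M \<noteq> \<infinity>"
    and r: "0 < r" "r < R" "r \<le> 1" and C: "0 < C"
    and dens_near_1: "\<And>y. y \<in> ball 0 r \<Longrightarrow> \<bar>dens y - 1\<bar> \<le> C * (norm y)\<^sup>2"
    and dist_near: "\<And>y. y \<in> ball 0 r \<Longrightarrow> \<bar>(norm (\<psi> y - p))\<^sup>2 - (norm y)\<^sup>2\<bar> \<le> C * norm y ^ 4"
    and dist_ge: "\<And>y. y \<in> ball 0 r \<Longrightarrow> (norm y)\<^sup>2 / 2 \<le> (norm (\<psi> y - p))\<^sup>2"
    and dens_nonneg: "\<And>y. y \<in> ball 0 r \<Longrightarrow> 0 \<le> dens y"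
begin

definition vol :: real where "vol = measure \<mu> M"

definition \<nu> :: "(real^'m) measure" where "\<nu> = scale_measure (inverse (emeasure \<mu> M)) \<mu>"

definition B :: "(real^'m) set" where "B = \<psi> ` ball 0 r"

definition kern :: "real \<Rightarrow> real^'m \<Rightarrow> real" where "kern h x = gauss_kernel CARD('d) ((p - x) /\<^sub>R h)"

text \<open>Extended by 0 outside \<open>W\<close>, so that the coordinates are Borel functions on
  the ambient space; on \<open>B\<close> they are the normal coordinates.\<close>

definition \<kappa>' :: "real^'m \<Rightarrow> real^'d" where "\<kappa>' x = (if x \<in> W then \<kappa> x else 0)"

definition c4 :: real where "c4 = 1 / (4 * pi) powr (real CARD('d) / 2)"

lemma c4_pos: "0 < c4" by (simp add: c4_def)

lemma vol_pos: "0 < vol"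
  using \<mu>_M by (simp add: vol_def measure_def enn2real_positive_iff less_top zero_less_iff_neq_zero)

lemma emeasure_\<mu>_M: "emeasure \<mu> M = ennreal vol"
  using \<mu>_M by (simp add: vol_def emeasure_eq_ennreal_measure)

lemma sets_\<mu> [measurable_cong]: "sets \<mu> = sets (restrict_space borel M)"
  using \<mu> unfolding riemannian_volume_def by blast

lemma \<nu>_eq: "\<nu> = density \<mu> (\<lambda>_. ennreal (1 / vol))"
proof -
  have inv: "inverse (emeasure \<mu> M) = ennreal (1 / vol)"
    using vol_pos by (simp add: emeasure_\<mu>_M inverse_ennreal inverse_eq_divide)
  show ?thesis unfolding \<nu>_def inv by (rule measure_eqI) (simp_all add: emeasure_density_const)
qed

lemma sets_\<nu> [measurable_cong]: "sets \<nu> = sets (restrict_space borel M)"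
  by (simp add: \<nu>_eq sets_\<mu>)

lemma B_sets: "B \<in> sets (restrict_space borel M)"
  unfolding B_def using image_ball_sets[of r] r by simp

lemma kern_eq: "kern h x = c4 * exp (- (norm (x - p))\<^sup>2 / (4 * h\<^sup>2))"
proof -
  have "(norm ((p - x) /\<^sub>R h))\<^sup>2 = (norm (x - p))\<^sup>2 / h\<^sup>2"
    by (simp add: power_mult_distrib norm_minus_commute divide_inverse power_inverse)
  then have "- (norm ((p - x) /\<^sub>R h))\<^sup>2 / 4 = - (norm (x - p))\<^sup>2 / (4 * h\<^sup>2)" by (simp only:) (simp add: mult.commute)
  then show ?thesis unfolding kern_def gauss_kernel_def c4_def by (simp only:)
qed

lemma kern_nonneg: "0 \<le> kern h x" using c4_pos by (simp add: kern_eq)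

lemma kern_le: "kern h x \<le> c4" using mult_left_mono[of "exp (- (norm (x - p))\<^sup>2 / (4 * h\<^sup>2))" 1 c4] c4_pos by (simp add: kern_eq)

lemma kern_measurable [measurable]: "kern h \<in> borel_measurable borel"
  unfolding kern_eq[abs_def] by measurable

lemma \<kappa>'_measurable [measurable]: "\<kappa>' \<in> borel_measurable borel"
proof -
  have "continuous_on W \<kappa>"
    by (rule continuous_at_imp_continuous_on, rule ballI) (rule has_derivative_continuous[OF der_\<kappa>])
  then show ?thesis unfolding \<kappa>'_def using W by (intro borel_measurable_continuous_on_if) auto
qed

lemma ball_facts:
  assumes "y \<in> ball 0 r"
  shows "\<psi>_ext y = \<psi> y" "\<kappa>' (\<psi> y) = y" "\<psi> y \<in> B" "\<psi> y \<in> M"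
proof -
  have y: "y \<in> ball 0 R" using assms r by simp
  show "\<psi>_ext y = \<psi> y" "\<kappa>' (\<psi> y) = y" "\<psi> y \<in> B" "\<psi> y \<in> M"
    using y assms \<psi>_W[OF y] \<kappa>_\<psi>[OF y] \<psi>_in_M[OF y] by (auto simp: \<psi>_ext_def \<kappa>'_def B_def)
qed

lemma integral_\<nu>_B:
  assumes g [measurable]: "g \<in> borel_measurable borel"
  shows "integrable \<nu> (\<lambda>x. indicator B x * g x :: real) \<longleftrightarrow> integrable lborel (\<lambda>y. indicator (ball 0 r) y * (dens y * g (\<psi>_ext y)))"
    and "(\<integral>x. indicator B x * g x \<partial>\<nu>) = 1 / vol * (\<integral>y. indicator (ball 0 r) y * (dens y * g (\<psi>_ext y)) \<partial>lborel)"
proof -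
  have [measurable]: "B \<in> sets \<mu>" using B_sets sets_\<mu> by simp
  have gM [measurable]: "g \<in> borel_measurable (restrict_space borel M)" by (rule measurable_restrict_space1[OF g])
  then have g\<mu> [measurable]: "g \<in> borel_measurable \<mu>" using measurable_cong_sets[OF sets_\<mu> refl] by blast
  have [measurable]: "ball 0 r \<in> sets (borel :: (real^'d) measure)" by simp
  have \<psi>m: "\<psi>_ext \<in> measurable (density lborel (\<lambda>y. ennreal (indicator (ball 0 r) y * dens y))) (restrict_space borel M)"
    using \<psi>_ext_measurable by simp
  have nn: "AE y in lborel. 0 \<le> indicator (ball 0 r) y * dens y"
    using dens_nonneg by (intro AE_I2) (auto simp: indicator_def)
  have D: "density \<mu> (\<lambda>x. ennreal (indicator B x)) =
    distr (density lborel (\<lambda>y. ennreal (indicator (ball 0 r) y * dens y))) (restrict_space borel M) \<psi>_ext"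
    unfolding B_def using r by (intro volume_in_chart[OF \<mu>]) simp
  have g\<psi> [measurable]: "(\<lambda>y. g (\<psi>_ext y)) \<in> borel_measurable borel" by measurable
  have dm: "(\<lambda>y. indicator (ball 0 r) y * dens y) \<in> borel_measurable borel" by measurable
  have iB: "integrable \<mu> (\<lambda>x. indicator B x * g x) \<longleftrightarrow> integrable lborel (\<lambda>y. (indicator (ball 0 r) y * dens y) * g (\<psi>_ext y))"
  proof -
    have "integrable \<mu> (\<lambda>x. indicator B x *\<^sub>R g x) \<longleftrightarrow> integrable (density \<mu> (\<lambda>x. ennreal (indicator B x))) g"
      by (subst integrable_density) auto
    also have "\<dots> \<longleftrightarrow> integrable (density lborel (\<lambda>y. ennreal (indicator (ball 0 r) y * dens y))) (\<lambda>y. g (\<psi>_ext y))"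
      unfolding D by (rule integrable_distr_eq[OF \<psi>m gM])
    also have "\<dots> \<longleftrightarrow> integrable lborel (\<lambda>y. (indicator (ball 0 r) y * dens y) *\<^sub>R g (\<psi>_ext y))"
      using dm nn by (subst integrable_density) auto
    finally show ?thesis by simp
  qed
  have eB: "(\<integral>x. indicator B x * g x \<partial>\<mu>) = (\<integral>y. (indicator (ball 0 r) y * dens y) * g (\<psi>_ext y) \<partial>lborel)"
  proof -
    have "(\<integral>x. indicator B x *\<^sub>R g x \<partial>\<mu>) = (\<integral>x. g x \<partial>density \<mu> (\<lambda>x. ennreal (indicator B x)))"
      by (subst integral_density) auto
    also have "\<dots> = (\<integral>y. g (\<psi>_ext y) \<partial>density lborel (\<lambda>y. ennreal (indicator (ball 0 r) y * dens y)))"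
      unfolding D by (rule integral_distr[OF \<psi>m gM])
    also have "\<dots> = (\<integral>y. (indicator (ball 0 r) y * dens y) *\<^sub>R g (\<psi>_ext y) \<partial>lborel)"
      using dm nn by (subst integral_density) auto
    finally show ?thesis by simp
  qed
  have Bg: "(\<lambda>x. indicator B x * g x) \<in> borel_measurable \<mu>" by measurable
  have "integrable \<nu> (\<lambda>x. indicator B x * g x) \<longleftrightarrow> integrable \<mu> (\<lambda>x. indicator B x * g x)"
  proof -
    have "integrable \<nu> (\<lambda>x. indicator B x * g x) \<longleftrightarrow> integrable \<mu> (\<lambda>x. (1 / vol) *\<^sub>R (indicator B x * g x))"
      unfolding \<nu>_eq using vol_pos Bg by (subst integrable_density) auto
    also have "\<dots> \<longleftrightarrow> integrable \<mu> (\<lambda>x. indicator B x * g x)"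
      unfolding real_scaleR_def integrable_mult_left_iff using vol_pos by simp
    finally show ?thesis .
  qed
  then show "integrable \<nu> (\<lambda>x. indicator B x * g x) \<longleftrightarrow> integrable lborel (\<lambda>y. indicator (ball 0 r) y * (dens y * g (\<psi>_ext y)))"
    by (simp only: iB mult.assoc)
  have "(\<integral>x. indicator B x * g x \<partial>\<nu>) = (\<integral>x. (1 / vol) *\<^sub>R (indicator B x * g x) \<partial>\<mu>)"
    unfolding \<nu>_eq using vol_pos Bg by (subst integral_density) auto
  then show "(\<integral>x. indicator B x * g x \<partial>\<nu>) = 1 / vol * (\<integral>y. indicator (ball 0 r) y * (dens y * g (\<psi>_ext y)) \<partial>lborel)"
    by (simp add: eB mult.assoc)
qed

text \<open>Raising the kernel to the power \<open>a\<close> divides its variance by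
  \<open>a\<close>, so Laplace's method applies with standard deviation sqrt(2/a) h after passing to
  coordinates.\<close>

lemma kernel_moment:
  fixes a k :: nat
  assumes a: "0 < a"
  shows "\<exists>K\<ge>0. \<forall>h w c. 0 < h \<longrightarrow> w \<in> borel_measurable borel \<longrightarrow> (\<forall>y. \<bar>w y\<bar> \<le> c * norm y ^ k) \<longrightarrow>
    integrable \<nu> (\<lambda>x. indicator B x * (kern h x ^ a * w (\<kappa>' x))) \<and>
    \<bar>(\<integral>x. indicator B x * (kern h x ^ a * w (\<kappa>' x)) \<partial>\<nu>)
       - c4 ^ a / vol * ((sqrt (2 * pi) * (sqrt (2 / real a) * h)) ^ CARD('d) * G.expectation (\<lambda>\<omega>. w ((sqrt (2 / real a) * h) *\<^sub>R G.N \<omega>)))\<bar>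
      \<le> K * c * h ^ (CARD('d) + k + 2)"
proof -
  let ?\<sigma> = "sqrt (2 / real a)"
  let ?q = "\<lambda>y. (norm (\<psi>_ext y - p))\<^sup>2"
  have \<sigma>: "0 < ?\<sigma>" using a by simp
  have qm: "?q \<in> borel_measurable borel" by measurable
  have q1: "\<bar>?q y - (norm y)\<^sup>2\<bar> \<le> C * norm y ^ 4" "(norm y)\<^sup>2 / 2 \<le> ?q y" if "y \<in> ball 0 r" for y
    unfolding ball_facts(1)[OF that] by (rule dist_near[OF that], rule dist_ge[OF that])
  obtain K where KLM: "0 \<le> K \<and> (\<forall>h w c. 0 < h \<longrightarrow> w \<in> borel_measurable borel \<longrightarrow> (\<forall>y. \<bar>w y\<bar> \<le> c * norm y ^ k) \<longrightarrow>
    integrable lborel (\<lambda>y. indicator (ball 0 r) y * (exp (- ?q y / (2 * (?\<sigma> * h)\<^sup>2)) * dens y * w y)) \<and>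
    \<bar>(\<integral>y. indicator (ball 0 r) y * (exp (- ?q y / (2 * (?\<sigma> * h)\<^sup>2)) * dens y * w y) \<partial>lborel)
       - (sqrt (2 * pi) * (?\<sigma> * h)) ^ CARD('d) * G.expectation (\<lambda>\<omega>. w ((?\<sigma> * h) *\<^sub>R G.N \<omega>))\<bar> \<le> K * c * h ^ (CARD('d) + k + 2))"
    using G.laplace_method[OF qm dens_measurable r(1) less_imp_le[OF C] \<sigma> dens_near_1 q1, of k] by (rule exE)
  note K = KLM[THEN conjunct1] and LM = KLM[THEN conjunct2]
  show ?thesis
  proof (intro exI[of _ "c4 ^ a / vol * K"] conjI allI impI)
    show "0 \<le> c4 ^ a / vol * K" using c4_pos vol_pos K by simp
    fix h :: real and w :: "real^'d \<Rightarrow> real" and c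
    assume h: "0 < h" and w [measurable]: "w \<in> borel_measurable borel" and wb: "\<forall>y. \<bar>w y\<bar> \<le> c * norm y ^ k"
    let ?g = "\<lambda>x. kern h x ^ a * w (\<kappa>' x)"
    let ?f = "\<lambda>y. indicator (ball 0 r) y * (exp (- ?q y / (2 * (?\<sigma> * h)\<^sup>2)) * dens y * w y)"
    have eq: "indicator (ball 0 r) y * (dens y * ?g (\<psi>_ext y)) = c4 ^ a * ?f y" for y
    proof (cases "y \<in> ball 0 r")
      case True
      have "kern h (\<psi> y) ^ a = c4 ^ a * exp (real a * (- (norm (\<psi> y - p))\<^sup>2 / (4 * h\<^sup>2)))"
        by (simp only: kern_eq power_mult_distrib exp_of_nat_mult)
      also have "real a * (- (norm (\<psi> y - p))\<^sup>2 / (4 * h\<^sup>2)) = - (norm (\<psi> y - p))\<^sup>2 / (2 * (?\<sigma> * h)\<^sup>2)"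
        using a by (simp add: power_mult_distrib divide_simps)
      finally show ?thesis using True by (simp add: ball_facts)
    qed simp
    note lm = LM[THEN spec[of _ h], THEN spec[of _ w], THEN spec[of _ c], THEN mp, OF h, THEN mp, OF w, THEN mp, OF wb]
    have gm: "?g \<in> borel_measurable borel" by measurable
    show "integrable \<nu> (\<lambda>x. indicator B x * ?g x)"
      unfolding integral_\<nu>_B(1)[OF gm] eq by (rule integrable_mult_right[OF lm[THEN conjunct1]])
    have "(\<integral>x. indicator B x * ?g x \<partial>\<nu>) = c4 ^ a / vol * (\<integral>y. ?f y \<partial>lborel)"
      unfolding integral_\<nu>_B(2)[OF gm] eq by simp
    then have "(\<integral>x. indicator B x * ?g x \<partial>\<nu>)
       - c4 ^ a / vol * ((sqrt (2 * pi) * (?\<sigma> * h)) ^ CARD('d) * G.expectation (\<lambda>\<omega>. w ((?\<sigma> * h) *\<^sub>R G.N \<omega>)))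
      = c4 ^ a / vol * ((\<integral>y. ?f y \<partial>lborel) - (sqrt (2 * pi) * (?\<sigma> * h)) ^ CARD('d) * G.expectation (\<lambda>\<omega>. w ((?\<sigma> * h) *\<^sub>R G.N \<omega>)))"
      by (simp only: right_diff_distrib)
    also have "\<bar>\<dots>\<bar> \<le> c4 ^ a / vol * (K * c * h ^ (CARD('d) + k + 2))"
    proof -
      have "0 \<le> c4 ^ a / vol" using c4_pos vol_pos by simp
      then show ?thesis unfolding abs_mult using lm[THEN conjunct2] by (simp only: abs_of_nonneg mult_left_mono)
    qed
    finally show "\<bar>(\<integral>x. indicator B x * ?g x \<partial>\<nu>)
       - c4 ^ a / vol * ((sqrt (2 * pi) * (?\<sigma> * h)) ^ CARD('d) * G.expectation (\<lambda>\<omega>. w ((?\<sigma> * h) *\<^sub>R G.N \<omega>)))\<bar>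
      \<le> c4 ^ a / vol * K * c * h ^ (CARD('d) + k + 2)" by (simp only: mult.assoc)
  qed
qed

text \<open>The Gaussian main term is itself of order h^(d+k), and for h \<le> 1 the error term is
  no larger.\<close>

lemma kernel_moment_bound:
  fixes a k :: nat
  assumes a: "0 < a"
  shows "\<exists>K\<ge>0. \<forall>h w c. 0 < h \<longrightarrow> h \<le> 1 \<longrightarrow> w \<in> borel_measurable borel \<longrightarrow> (\<forall>y. \<bar>w y\<bar> \<le> c * norm y ^ k) \<longrightarrow>
    \<bar>\<integral>x. indicator B x * (kern h x ^ a * w (\<kappa>' x)) \<partial>\<nu>\<bar> \<le> K * c * h ^ (CARD('d) + k)"
proof -
  let ?\<sigma> = "sqrt (2 / real a)"
  have \<sigma>: "0 < ?\<sigma>" using a by simp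
  obtain K where KLM: "0 \<le> K \<and> (\<forall>h w c. 0 < h \<longrightarrow> w \<in> borel_measurable borel \<longrightarrow> (\<forall>y. \<bar>w y\<bar> \<le> c * norm y ^ k) \<longrightarrow>
    integrable \<nu> (\<lambda>x. indicator B x * (kern h x ^ a * w (\<kappa>' x))) \<and>
    \<bar>(\<integral>x. indicator B x * (kern h x ^ a * w (\<kappa>' x)) \<partial>\<nu>)
       - c4 ^ a / vol * ((sqrt (2 * pi) * (?\<sigma> * h)) ^ CARD('d) * G.expectation (\<lambda>\<omega>. w ((?\<sigma> * h) *\<^sub>R G.N \<omega>)))\<bar>
      \<le> K * c * h ^ (CARD('d) + k + 2))"
    using kernel_moment[OF a, of k] by (rule exE)
  note K = KLM[THEN conjunct1] and KM = KLM[THEN conjunct2]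
  define L where "L = c4 ^ a / vol * ((sqrt (2 * pi) * ?\<sigma>) ^ CARD('d) * (?\<sigma> ^ k * G.abs_moment k))"
  have L: "0 \<le> L" using c4_pos vol_pos \<sigma> G.abs_moment_nonneg by (simp add: L_def)
  show ?thesis
  proof (intro exI[of _ "K + L"] conjI allI impI)
    show "0 \<le> K + L" using K L by simp
    fix h :: real and w :: "real^'d \<Rightarrow> real" and c
    assume h: "0 < h" "h \<le> 1" and w: "w \<in> borel_measurable borel" and wb: "\<forall>y. \<bar>w y\<bar> \<le> c * norm y ^ k"
    have \<sigma>h: "0 < ?\<sigma> * h" using \<sigma> h by simp
    \<comment> \<open>The growth bound at a unit vector forces this.\<close>
    have c: "0 \<le> c" using wb[rule_format, of "axis undefined 1"] by (simp add: order_trans[OF abs_ge_zero])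
    let ?E = "G.expectation (\<lambda>\<omega>. w ((?\<sigma> * h) *\<^sub>R G.N \<omega>))"
    let ?m = "c4 ^ a / vol * ((sqrt (2 * pi) * (?\<sigma> * h)) ^ CARD('d) * ?E)"
    have p: "0 \<le> c4 ^ a / vol" "0 \<le> (sqrt (2 * pi) * (?\<sigma> * h)) ^ CARD('d)" using c4_pos vol_pos \<sigma> h by auto
    have "\<bar>?m\<bar> = c4 ^ a / vol * ((sqrt (2 * pi) * (?\<sigma> * h)) ^ CARD('d) * \<bar>?E\<bar>)"
      using p by (simp only: abs_mult abs_of_nonneg)
    also have "\<dots> \<le> c4 ^ a / vol * ((sqrt (2 * pi) * (?\<sigma> * h)) ^ CARD('d) * (c * ((?\<sigma> * h) ^ k * G.abs_moment k)))"
      using wb p by (intro mult_left_mono G.abs_expectation_le_moment(2)[OF w _ \<sigma>h]) auto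
    also have "\<dots> = L * c * h ^ (CARD('d) + k)" by (simp add: L_def power_mult_distrib power_add mult_ac)
    finally have m: "\<bar>?m\<bar> \<le> L * c * h ^ (CARD('d) + k)" .
    have "h ^ (CARD('d) + k + 2) \<le> h ^ (CARD('d) + k)" using h by (intro power_decreasing) auto
    then have "K * c * h ^ (CARD('d) + k + 2) \<le> K * c * h ^ (CARD('d) + k)" using K c by (intro mult_left_mono) auto
    then show "\<bar>\<integral>x. indicator B x * (kern h x ^ a * w (\<kappa>' x)) \<partial>\<nu>\<bar> \<le> (K + L) * c * h ^ (CARD('d) + k)"
      using KM[THEN spec[of _ h], THEN spec[of _ w], THEN spec[of _ c], THEN mp, OF h(1), THEN mp, OF w, THEN mp, OF wb,
          THEN conjunct2] m unfolding distrib_right by linarith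
  qed
qed

end

section \<open>The central limit theorem for the graph Laplacian\<close>

lemma (in std_gaussian_vector) integrable_Z: "integrable Q (Z j)"
  by (rule Bochner_Integration.integrable_bound[OF integrable_Z_power[of j 1]]) auto

lemma (in std_gaussian_vector) expectation_inner: "expectation (\<lambda>\<omega>. t \<bullet> N \<omega>) = 0"
proof -
  have "expectation (\<lambda>\<omega>. t \<bullet> N \<omega>) = expectation (\<lambda>\<omega>. \<Sum>j\<in>UNIV. t $ j * Z j \<omega>)"
    by (simp add: inner_vec_def)
  also have "\<dots> = (\<Sum>j\<in>UNIV. t $ j * expectation (Z j))"
    using integrable_Z by (subst Bochner_Integration.integral_sum) auto
  finally show ?thesis by (simp add: expectation_Z)
qed

text \<open>Nonnegativity of the variance of the absolute value.\<close>

lemma (in prob_space) expectation_abs_le_sqrt: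
  assumes [measurable]: "f \<in> borel_measurable M" and f2: "integrable M (\<lambda>x. (f x)\<^sup>2 :: real)"
  shows "integrable M f" and "expectation (\<lambda>x. \<bar>f x\<bar>) \<le> sqrt (expectation (\<lambda>x. (f x)\<^sup>2))"
proof -
  show i: "integrable M f" by (rule square_integrable_imp_integrable[OF _ f2]) simp
  have "0 \<le> variance (\<lambda>x. \<bar>f x\<bar>)" by (rule variance_positive)
  also have "\<dots> = expectation (\<lambda>x. (\<bar>f x\<bar>)\<^sup>2) - (expectation (\<lambda>x. \<bar>f x\<bar>))\<^sup>2"
    using i f2 by (intro variance_eq) auto
  finally have "(expectation (\<lambda>x. \<bar>f x\<bar>))\<^sup>2 \<le> expectation (\<lambda>x. (f x)\<^sup>2)" by simp
  then show "expectation (\<lambda>x. \<bar>f x\<bar>) \<le> sqrt (expectation (\<lambda>x. (f x)\<^sup>2))" by (rule real_le_rsqrt)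
qed

text \<open>With x = a/h^2 the exponential dominates (1 + x/m)^m and hence (x/m)^m. Inverting yields
  h^(2m), of which only h^m is kept.\<close>

lemma exp_neg_le_power:
  fixes a h :: real
  assumes a: "0 < a" and h: "0 < h" "h \<le> 1" and m: "0 < m"
  shows "exp (- a / h\<^sup>2) \<le> (real m / a) ^ m * h ^ m"
proof -
  have x: "0 < a / h\<^sup>2" using a h by simp
  have "(a / h\<^sup>2 / real m) ^ m \<le> (1 + a / h\<^sup>2 / real m) ^ m"
  proof (rule power_mono)
    show "0 \<le> a / h\<^sup>2 / real m" using a h by (intro divide_nonneg_nonneg) auto
  qed simp
  also have "\<dots> \<le> exp (a / h\<^sup>2)" using x m by (intro exp_ge_one_plus_x_over_n_power_n) auto
  finally have le: "(a / h\<^sup>2 / real m) ^ m \<le> exp (a / h\<^sup>2)" .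
  have pos: "0 < (a / h\<^sup>2 / real m) ^ m" using a h m by (intro zero_less_power divide_pos_pos) auto
  have "inverse (exp (a / h\<^sup>2)) \<le> inverse ((a / h\<^sup>2 / real m) ^ m)" by (rule le_imp_inverse_le[OF le pos])
  also have "inverse ((a / h\<^sup>2 / real m) ^ m) = (real m / a) ^ m * (h\<^sup>2) ^ m"
    using a h m by (simp add: power_mult_distrib power_divide field_simps)
  also have "\<dots> \<le> (real m / a) ^ m * h ^ m"
  proof (intro mult_left_mono power_mono)
    show "h\<^sup>2 \<le> h" using h by (simp add: power2_eq_square mult_left_le)
  qed (use a h in auto)
  finally show ?thesis by (simp add: exp_minus)
qed

locale graph_clt = sampled_chart M p \<psi> \<kappa> W R e Q Z \<mu> r C + P: prob_space P
  for M :: "(real^'m::finite) set" and p and \<psi> :: "real^'d::finite \<Rightarrow> real^'m" and \<kappa> W R e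
    and Q :: "'q measure" and Z :: "'d \<Rightarrow> 'q \<Rightarrow> real" and \<mu> r C and P :: "'w measure" +
  fixes X :: "nat \<Rightarrow> 'w \<Rightarrow> real^'m" and h :: "nat \<Rightarrow> real"
  assumes X: "P.indep_vars (\<lambda>_. restrict_space borel M) X UNIV"
    and law: "\<And>i. distr P (restrict_space borel M) (X i) = \<nu>"
    and h_pos: "\<And>n. 0 < h n"
    and lim_bias: "(\<lambda>n. real n * h n ^ (CARD('d) + 4)) \<longlonglongrightarrow> 0"
    and lim_size: "filterlim (\<lambda>n. real n * h n ^ CARD('d)) at_top sequentially"
begin

text \<open>The normalization of the process. Its square is the denominator of the graph Laplacian,
  so the normalized sums carry the factor \<open>1 / b n\<close>.\<close>

definition b :: "nat \<Rightarrow> real" where "b n = sqrt (real n * h n ^ (CARD('d) + 2))"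

lemma b_nonneg: "0 \<le> b n" using h_pos[of n] by (simp add: b_def)

lemma b_pos: "0 < n \<Longrightarrow> 0 < b n" using h_pos[of n] by (simp add: b_def)

lemma b_sq: "(b n)\<^sup>2 = real n * h n ^ (CARD('d) + 2)" using h_pos[of n] by (simp add: b_def)

lemma n_over_b: "real n / b n = b n / h n ^ (CARD('d) + 2)"
proof (cases "n = 0")
  \<comment> \<open>For \<open>n = 0\<close> both quotients vanish, the left one by the convention
    on division by zero.\<close>
  case True then show ?thesis by (simp add: b_def)
next
  case False
  then show ?thesis using b_pos[of n] b_sq[of n] h_pos[of n] by (simp add: divide_simps power2_eq_square)
qed

lemma n_over_b_sq: "0 < n \<Longrightarrow> real n / (b n)\<^sup>2 = 1 / h n ^ (CARD('d) + 2)"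
  using h_pos[of n] by (simp add: b_sq)

text \<open>The bandwidth is not assumed to vanish; the quotient of the two rate hypotheses is
  h^4.\<close>

lemma h_tendsto: "h \<longlonglongrightarrow> 0"
proof -
  have "(\<lambda>n. (real n * h n ^ (CARD('d) + 4)) * inverse (real n * h n ^ CARD('d))) \<longlonglongrightarrow> 0 * 0"
    by (intro tendsto_mult lim_bias filterlim_compose[OF tendsto_inverse_0_at_top lim_size] tendsto_inverse_0_at_top[OF lim_size])
  then have "(\<lambda>n. (real n * h n ^ (CARD('d) + 4)) * inverse (real n * h n ^ CARD('d))) \<longlonglongrightarrow> 0" by simp
  moreover have "\<forall>\<^sub>F n in sequentially. (real n * h n ^ (CARD('d) + 4)) * inverse (real n * h n ^ CARD('d)) = h n ^ 4"
  proof (rule eventually_sequentiallyI[of 1])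
    fix n :: nat assume "1 \<le> n"
    then have nz: "real n * h n ^ CARD('d) \<noteq> 0" using h_pos[of n] by simp
    have gen: "(x * y) * inverse x = y" if "x \<noteq> 0" for x y :: real using that by simp
    have "real n * h n ^ (CARD('d) + 4) = (real n * h n ^ CARD('d)) * h n ^ 4" by (simp only: power_add mult.assoc)
    then show "(real n * h n ^ (CARD('d) + 4)) * inverse (real n * h n ^ CARD('d)) = h n ^ 4"
      by (simp only: gen[OF nz])
  qed
  ultimately have "(\<lambda>n. h n ^ 4) \<longlonglongrightarrow> 0" by (rule Lim_transform_eventually)
  then have "(\<lambda>n. root 4 (h n ^ 4)) \<longlonglongrightarrow> root 4 0" by (rule tendsto_real_root)
  then show ?thesis using h_pos by (simp add: real_root_power_cancel less_imp_le)
qed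

lemma h_le_1: "\<forall>\<^sub>F n in sequentially. h n \<le> 1 \<and> 0 < n"
proof -
  have "\<forall>\<^sub>F n in sequentially. h n < 1" using order_tendstoD(2)[OF h_tendsto] by simp
  moreover have "\<forall>\<^sub>F n in sequentially. 0 < n" by (rule eventually_gt_at_top)
  ultimately show ?thesis by eventually_elim simp
qed

text \<open>The product is sqrt(n h^(d+4)), the rate of every bias term below.\<close>

lemma bh_tendsto: "(\<lambda>n. b n * h n) \<longlonglongrightarrow> 0"
proof -
  have "b n * h n = sqrt (real n * h n ^ (CARD('d) + 4))" for n
  proof -
    have "real n * h n ^ (CARD('d) + 4) = (b n * h n)\<^sup>2"
      unfolding power_mult_distrib b_sq by (simp add: power_add power2_eq_square eval_nat_numeral)
    then show ?thesis using b_nonneg[of n] h_pos[of n] by (simp add: less_imp_le)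
  qed
  then show ?thesis using tendsto_real_sqrt[OF lim_bias] by simp
qed

text \<open>The quotient is 1/sqrt(n h^d), the rate in Lyapunov's condition.\<close>

lemma h_over_b_tendsto: "(\<lambda>n. h n / b n) \<longlonglongrightarrow> 0"
proof -
  have "(\<lambda>n. inverse (sqrt (real n * h n ^ CARD('d)))) \<longlonglongrightarrow> 0"
    by (rule tendsto_inverse_0_at_top[OF filterlim_compose[OF sqrt_at_top lim_size]])
  moreover have "inverse (sqrt (real n * h n ^ CARD('d))) = h n / b n" for n
    using h_pos[of n] by (simp add: b_def power_add real_sqrt_mult divide_simps)
  ultimately show ?thesis by simp
qed

lemma X_measurable [measurable]: "X i \<in> measurable P (restrict_space borel M)"
  using X by (simp add: P.indep_vars_def)

lemma X_in_M: "\<omega> \<in> space P \<Longrightarrow> X i \<omega> \<in> M"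
  using measurable_space[OF X_measurable] by (simp add: space_restrict_space)

lemma prob_space_\<nu>: "prob_space \<nu>"
  using P.prob_space_distr[OF X_measurable[of 0]] law[of 0] by simp

lemma restrict_measurable: "g \<in> borel_measurable borel \<Longrightarrow> g \<in> borel_measurable (restrict_space borel M)"
  by (rule measurable_restrict_space1)

lemma B_measurable [measurable]: "B \<in> sets (restrict_space borel M)" by (rule B_sets)

lemma kern_M_measurable [measurable]: "kern hh \<in> borel_measurable (restrict_space borel M)"
  and \<kappa>'_M_measurable [measurable]: "\<kappa>' \<in> borel_measurable (restrict_space borel M)"
  by (rule restrict_measurable, measurable)+

section \<open>Moments of the localized kernel\<close>

definition I :: "nat \<Rightarrow> real \<Rightarrow> (real^'d \<Rightarrow> real) \<Rightarrow> real" where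
  "I a hh w = (\<integral>x. indicator B x * (kern hh x ^ a * w (\<kappa>' x)) \<partial>\<nu>)"

lemma I_integrable:
  assumes "0 < a" "0 < hh" "w \<in> borel_measurable borel" "\<forall>y. \<bar>w y\<bar> \<le> c * norm y ^ k"
  shows "integrable \<nu> (\<lambda>x. indicator B x * (kern hh x ^ a * w (\<kappa>' x)))"
  using kernel_moment[OF assms(1), of k] assms(2-4) by blast

lemma I_bound:
  assumes "0 < a"
  shows "\<exists>K\<ge>0. \<forall>hh w c. 0 < hh \<longrightarrow> hh \<le> 1 \<longrightarrow> w \<in> borel_measurable borel \<longrightarrow> (\<forall>y. \<bar>w y\<bar> \<le> c * norm y ^ k) \<longrightarrow>
    \<bar>I a hh w\<bar> \<le> K * c * hh ^ (CARD('d) + k)"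
  unfolding I_def by (rule kernel_moment_bound[OF assms])

lemma I_main:
  assumes "0 < a"
  shows "\<exists>K\<ge>0. \<forall>hh w c. 0 < hh \<longrightarrow> w \<in> borel_measurable borel \<longrightarrow> (\<forall>y. \<bar>w y\<bar> \<le> c * norm y ^ k) \<longrightarrow>
    \<bar>I a hh w - c4 ^ a / vol * ((sqrt (2 * pi) * (sqrt (2 / real a) * hh)) ^ CARD('d) * G.expectation (\<lambda>\<omega>. w ((sqrt (2 / real a) * hh) *\<^sub>R G.N \<omega>)))\<bar>
      \<le> K * c * hh ^ (CARD('d) + k + 2)"
  unfolding I_def using kernel_moment[OF assms, of k] by blast

text \<open>A linear function has Gaussian mean 0, so the leading term of order h^(d+1) disappears
  and only the geometric error remains.\<close>

lemma I_inner: "\<exists>K\<ge>0. \<forall>hh t. 0 < hh \<longrightarrow> \<bar>I 1 hh (\<lambda>y. t \<bullet> y)\<bar> \<le> K * norm t * hh ^ (CARD('d) + 3)"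
proof -
  obtain K where K: "0 \<le> K \<and> (\<forall>hh w c. 0 < hh \<longrightarrow> w \<in> borel_measurable borel \<longrightarrow> (\<forall>y. \<bar>w y\<bar> \<le> c * norm y ^ 1) \<longrightarrow>
    \<bar>I 1 hh w - c4 ^ 1 / vol * ((sqrt (2 * pi) * (sqrt (2 / real 1) * hh)) ^ CARD('d) * G.expectation (\<lambda>\<omega>. w ((sqrt (2 / real 1) * hh) *\<^sub>R G.N \<omega>)))\<bar>
      \<le> K * c * hh ^ (CARD('d) + 1 + 2))"
    using I_main[of 1 1, OF zero_less_one] by (rule exE)
  have "\<bar>I 1 hh (\<lambda>y. t \<bullet> y)\<bar> \<le> K * norm t * hh ^ (CARD('d) + 3)" if hh: "0 < hh" for hh t
  proof -
    have m: "(\<lambda>y. t \<bullet> y) \<in> borel_measurable borel" by measurable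
    have bd: "\<forall>y. \<bar>t \<bullet> y\<bar> \<le> norm t * norm y ^ 1" unfolding power_one_right by (intro allI Cauchy_Schwarz_ineq2)
    have e0: "G.expectation (\<lambda>\<omega>. t \<bullet> ((sqrt (2 / real 1) * hh) *\<^sub>R G.N \<omega>)) = 0"
      unfolding inner_scaleR_right using G.expectation_inner[of t] by simp
    have d: "CARD('d) + 1 + 2 = CARD('d) + 3" by simp
    show ?thesis
      using K[THEN conjunct2, THEN spec[of _ hh], THEN spec[of _ "\<lambda>y. t \<bullet> y"], THEN spec[of _ "norm t"], THEN mp, OF hh, THEN mp, OF m, THEN mp, OF bd]
      unfolding e0 d by simp
  qed
  then show ?thesis using K by blast
qed

text \<open>The limiting variance per unit direction: the squared kernel is
  \<open>c4\<^sup>2\<close> times a Gaussian of standard deviation h, whose total integral is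
  (sqrt(2 pi) h)^d.\<close>

definition s2 :: real where "s2 = c4\<^sup>2 / vol * sqrt (2 * pi) ^ CARD('d)"

lemma I_inner_sq: "\<exists>K\<ge>0. \<forall>hh t. 0 < hh \<longrightarrow> \<bar>I 2 hh (\<lambda>y. (t \<bullet> y)\<^sup>2) - s2 * (norm t)\<^sup>2 * hh ^ (CARD('d) + 2)\<bar> \<le> K * (norm t)\<^sup>2 * hh ^ (CARD('d) + 4)"
proof -
  have s1: "sqrt (2 / real 2) = 1" by simp
  obtain K where K: "0 \<le> K \<and> (\<forall>hh w c. 0 < hh \<longrightarrow> w \<in> borel_measurable borel \<longrightarrow> (\<forall>y. \<bar>w y\<bar> \<le> c * norm y ^ 2) \<longrightarrow>
    \<bar>I 2 hh w - c4 ^ 2 / vol * ((sqrt (2 * pi) * (1 * hh)) ^ CARD('d) * G.expectation (\<lambda>\<omega>. w ((1 * hh) *\<^sub>R G.N \<omega>)))\<bar>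
      \<le> K * c * hh ^ (CARD('d) + 2 + 2))"
    using I_main[of 2 2, OF zero_less_numeral] unfolding s1 by (rule exE)
  have "\<bar>I 2 hh (\<lambda>y. (t \<bullet> y)\<^sup>2) - s2 * (norm t)\<^sup>2 * hh ^ (CARD('d) + 2)\<bar> \<le> K * (norm t)\<^sup>2 * hh ^ (CARD('d) + 4)" if hh: "0 < hh" for hh t
  proof -
    have m: "(\<lambda>y. (t \<bullet> y)\<^sup>2) \<in> borel_measurable borel" by measurable
    have bd: "\<forall>y. \<bar>(t \<bullet> y)\<^sup>2\<bar> \<le> (norm t)\<^sup>2 * norm y ^ 2"
      using power_mono[OF Cauchy_Schwarz_ineq2 abs_ge_zero, of t _ 2] by (simp add: power_mult_distrib)
    have e0: "G.expectation (\<lambda>\<omega>. (t \<bullet> ((1 * hh) *\<^sub>R G.N \<omega>))\<^sup>2) = hh\<^sup>2 * (norm t)\<^sup>2"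
      unfolding inner_scaleR_right power_mult_distrib using G.expectation_inner_sq[of t] by simp
    have e1: "c4 ^ 2 / vol * ((sqrt (2 * pi) * (1 * hh)) ^ CARD('d) * (hh\<^sup>2 * (norm t)\<^sup>2)) = s2 * (norm t)\<^sup>2 * hh ^ (CARD('d) + 2)"
      by (simp only: s2_def power_mult_distrib power_add mult_1 times_divide_eq_left times_divide_eq_right mult_ac)
    have d: "CARD('d) + 2 + 2 = CARD('d) + 4" by simp
    show ?thesis
      using K[THEN conjunct2, THEN spec[of _ hh], THEN spec[of _ "\<lambda>y. (t \<bullet> y)\<^sup>2"], THEN spec[of _ "(norm t)\<^sup>2"], THEN mp, OF hh, THEN mp, OF m, THEN mp, OF bd]
      unfolding e0 e1 d .
  qed
  then show ?thesis using K by blast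
qed

text \<open>At bandwidth 1 the kernel is the density of a centred Gaussian vector with variance 2 in
  each coordinate.\<close>

lemma c4_normalises: "c4 * (sqrt (2 * pi) * sqrt 2) ^ CARD('d) = 1"
proof -
  have "sqrt (2 * pi) * sqrt 2 = sqrt (4 * pi)" by (simp add: real_sqrt_mult[symmetric])
  also have "\<dots> = (4 * pi) powr (1 / 2)" by (simp add: powr_half_sqrt)
  finally have "(sqrt (2 * pi) * sqrt 2) ^ CARD('d) = (4 * pi) powr (real CARD('d) / 2)"
    by (simp add: powr_power)
  then show ?thesis by (simp add: c4_def)
qed

text \<open>The leading 2 is the coordinate variance of this Gaussian. It will cancel the 1/2 of
  Taylor's formula and leave the Laplace--Beltrami operator divided by the volume.\<close>

lemma I_prod: "\<exists>K\<ge>0. \<forall>hh j l. 0 < hh \<longrightarrow>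
    \<bar>I 1 hh (\<lambda>y. y $ j * y $ l) - 2 * (if j = l then 1 else 0) / vol * hh ^ (CARD('d) + 2)\<bar> \<le> K * hh ^ (CARD('d) + 4)"
proof -
  have s1: "sqrt (2 / real 1) = sqrt 2" by simp
  obtain K where K: "0 \<le> K \<and> (\<forall>hh w c. 0 < hh \<longrightarrow> w \<in> borel_measurable borel \<longrightarrow> (\<forall>y. \<bar>w y\<bar> \<le> c * norm y ^ 2) \<longrightarrow>
    \<bar>I 1 hh w - c4 ^ 1 / vol * ((sqrt (2 * pi) * (sqrt 2 * hh)) ^ CARD('d) * G.expectation (\<lambda>\<omega>. w ((sqrt 2 * hh) *\<^sub>R G.N \<omega>)))\<bar>
      \<le> K * c * hh ^ (CARD('d) + 2 + 2))"
    using I_main[of 1 2, OF zero_less_one] unfolding s1 by (rule exE)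
  have "\<bar>I 1 hh (\<lambda>y. y $ j * y $ l) - 2 * (if j = l then 1 else 0) / vol * hh ^ (CARD('d) + 2)\<bar> \<le> K * hh ^ (CARD('d) + 4)"
    if hh: "0 < hh" for hh j l
  proof -
    let ?\<delta> = "if j = l then 1 else 0 :: real"
    have m: "(\<lambda>y :: real^'d. y $ j * y $ l) \<in> borel_measurable borel" by measurable
    have bd: "\<forall>y :: real^'d. \<bar>y $ j * y $ l\<bar> \<le> 1 * norm y ^ 2"
      unfolding abs_mult power2_eq_square mult_1 by (intro allI mult_mono component_le_norm_cart) auto
    have e0: "G.expectation (\<lambda>\<omega>. ((sqrt 2 * hh) *\<^sub>R G.N \<omega>) $ j * ((sqrt 2 * hh) *\<^sub>R G.N \<omega>) $ l) = 2 * hh\<^sup>2 * ?\<delta>"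
    proof -
      have "((sqrt 2 * hh) *\<^sub>R G.N \<omega>) $ j * ((sqrt 2 * hh) *\<^sub>R G.N \<omega>) $ l = 2 * hh\<^sup>2 * (Z j \<omega> * Z l \<omega>)" for \<omega>
      proof -
        have "((sqrt 2 * hh) *\<^sub>R G.N \<omega>) $ j * ((sqrt 2 * hh) *\<^sub>R G.N \<omega>) $ l = (sqrt 2 * sqrt 2) * (hh * hh) * (Z j \<omega> * Z l \<omega>)"
          by (simp only: vector_scaleR_component real_scaleR_def G.N_nth mult_ac)
        then show ?thesis by (simp only: real_sqrt_mult_self power2_eq_square abs_numeral)
      qed
      then show ?thesis by (simp only: integral_mult_right_zero G.expectation_Z_Z)
    qed
    have e1: "c4 ^ 1 / vol * ((sqrt (2 * pi) * (sqrt 2 * hh)) ^ CARD('d) * (2 * hh\<^sup>2 * ?\<delta>)) = 2 * ?\<delta> / vol * hh ^ (CARD('d) + 2)"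
    proof -
      have "(sqrt (2 * pi) * (sqrt 2 * hh)) ^ CARD('d) = (sqrt (2 * pi) * sqrt 2) ^ CARD('d) * hh ^ CARD('d)"
        by (simp only: power_mult_distrib mult.assoc)
      then have "c4 ^ 1 / vol * ((sqrt (2 * pi) * (sqrt 2 * hh)) ^ CARD('d) * (2 * hh\<^sup>2 * ?\<delta>))
         = (c4 * (sqrt (2 * pi) * sqrt 2) ^ CARD('d)) * (2 * ?\<delta> / vol * (hh ^ CARD('d) * hh\<^sup>2))"
        by (simp only: power_one_right times_divide_eq_left times_divide_eq_right mult_ac)
      then show ?thesis unfolding c4_normalises power_add by (simp only: mult_1)
    qed
    have d: "CARD('d) + 2 + 2 = CARD('d) + 4" by simp
    show ?thesis
      using K[THEN conjunct2, THEN spec[of _ hh], THEN spec[of _ "\<lambda>y. y $ j * y $ l"], THEN spec[of _ 1], THEN mp, OF hh, THEN mp, OF m, THEN mp, OF bd]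
      unfolding e0 e1 d mult_1_right .
  qed
  then show ?thesis using K by blast
qed

text \<open>Kernel-weighted normal coordinates, cut off to the chart and normalized. Pairing the row
  sum with the first partial derivatives of \<open>f\<close> gives the linear part of the
  process.\<close>

definition \<xi> :: "nat \<Rightarrow> real^'m \<Rightarrow> real^'d" where
  "\<xi> n x = (1 / b n * (indicator B x * kern (h n) x)) *\<^sub>R \<kappa>' x"

lemma \<xi>_measurable [measurable]: "\<xi> n \<in> borel_measurable (restrict_space borel M)"
  unfolding \<xi>_def by measurable

lemma inner_\<xi>: "t \<bullet> \<xi> n x = 1 / b n * (indicator B x * (kern (h n) x ^ 1 * (t \<bullet> \<kappa>' x)))"
  by (simp add: \<xi>_def)

lemma inner_\<xi>_sq: "(t \<bullet> \<xi> n x)\<^sup>2 = (1 / b n)\<^sup>2 * (indicator B x * (kern (h n) x ^ 2 * (t \<bullet> \<kappa>' x)\<^sup>2))"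
  by (cases "x \<in> B") (simp_all add: \<xi>_def power_mult_distrib power_divide)

lemma norm_\<xi>_cube: "norm (\<xi> n x) ^ 3 = (1 / b n) ^ 3 * (indicator B x * (kern (h n) x ^ 3 * norm (\<kappa>' x) ^ 3))"
  using kern_nonneg[of "h n" x] b_nonneg[of n] by (cases "x \<in> B") (simp_all add: \<xi>_def power_mult_distrib power_divide)

text \<open>The bound is (n/b) h^(d+3) = b h, up to a constant.\<close>

lemma clt_first_moment: "(\<lambda>n. real n * (\<integral>x. t \<bullet> \<xi> n x \<partial>\<nu>)) \<longlonglongrightarrow> 0"
proof -
  obtain K where K: "0 \<le> K" "\<And>hh t. 0 < hh \<Longrightarrow> \<bar>I 1 hh (\<lambda>y. t \<bullet> y)\<bar> \<le> K * norm t * hh ^ (CARD('d) + 3)"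
    using I_inner by blast
  have l: "(\<lambda>n. K * norm t * (b n * h n)) \<longlonglongrightarrow> 0" using tendsto_mult_right_zero[OF bh_tendsto] .
  show ?thesis
  proof (rule Lim_null_comparison[OF always_eventually l], intro allI)
    fix n
    have "real n * (\<integral>x. t \<bullet> \<xi> n x \<partial>\<nu>) = (real n / b n) * I 1 (h n) (\<lambda>y. t \<bullet> y)"
      by (simp add: inner_\<xi> I_def)
    then have "norm (real n * (\<integral>x. t \<bullet> \<xi> n x \<partial>\<nu>)) = (b n / h n ^ (CARD('d) + 2)) * \<bar>I 1 (h n) (\<lambda>y. t \<bullet> y)\<bar>"
      unfolding n_over_b using b_nonneg[of n] h_pos[of n] by (simp add: abs_mult)
    also have "\<dots> \<le> (b n / h n ^ (CARD('d) + 2)) * (K * norm t * h n ^ (CARD('d) + 3))"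
      using K(2)[OF h_pos] b_nonneg[of n] h_pos[of n] by (intro mult_left_mono) auto
    also have "\<dots> = K * norm t * (b n * h n)"
    proof -
      have "h n ^ (CARD('d) + 3) = h n ^ (CARD('d) + 2) * h n" by (simp add: eval_nat_numeral)
      then show ?thesis using h_pos[of n] by simp
    qed
    finally show "norm (real n * (\<integral>x. t \<bullet> \<xi> n x \<partial>\<nu>)) \<le> K * norm t * (b n * h n)" .
  qed
qed

lemma clt_second_moment: "(\<lambda>n. real n * (\<integral>x. (t \<bullet> \<xi> n x)\<^sup>2 \<partial>\<nu>)) \<longlonglongrightarrow> s2 * (norm t)\<^sup>2"
proof -
  obtain K where K: "0 \<le> K" "\<And>hh t. 0 < hh \<Longrightarrow> \<bar>I 2 hh (\<lambda>y. (t \<bullet> y)\<^sup>2) - s2 * (norm t)\<^sup>2 * hh ^ (CARD('d) + 2)\<bar> \<le> K * (norm t)\<^sup>2 * hh ^ (CARD('d) + 4)"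
    using I_inner_sq by blast
  have "(\<lambda>n. K * (norm t)\<^sup>2 * (h n)\<^sup>2) \<longlonglongrightarrow> K * (norm t)\<^sup>2 * 0\<^sup>2"
    by (intro tendsto_intros h_tendsto)
  then have l: "(\<lambda>n. K * (norm t)\<^sup>2 * (h n)\<^sup>2) \<longlonglongrightarrow> 0" by simp
  have "(\<lambda>n. real n * (\<integral>x. (t \<bullet> \<xi> n x)\<^sup>2 \<partial>\<nu>) - s2 * (norm t)\<^sup>2) \<longlonglongrightarrow> 0"
  proof (rule Lim_null_comparison[OF eventually_sequentiallyI[of 1] l])
    fix n :: nat assume "1 \<le> n"
    then have n: "0 < n" by simp
    let ?H = "h n ^ (CARD('d) + 2)"
    have H: "0 < ?H" using h_pos[of n] by simp
    have "real n * (\<integral>x. (t \<bullet> \<xi> n x)\<^sup>2 \<partial>\<nu>) = (real n / (b n)\<^sup>2) * I 2 (h n) (\<lambda>y. (t \<bullet> y)\<^sup>2)"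
      by (simp add: inner_\<xi>_sq I_def power_divide)
    also have "\<dots> = I 2 (h n) (\<lambda>y. (t \<bullet> y)\<^sup>2) / ?H" unfolding n_over_b_sq[OF n] by simp
    finally have eq: "real n * (\<integral>x. (t \<bullet> \<xi> n x)\<^sup>2 \<partial>\<nu>) = I 2 (h n) (\<lambda>y. (t \<bullet> y)\<^sup>2) / ?H" .
    have gen: "x / y - c = (x - c * y) / y" if "0 < y" for x y c :: real using that by (simp add: diff_divide_distrib)
    have eq2: "real n * (\<integral>x. (t \<bullet> \<xi> n x)\<^sup>2 \<partial>\<nu>) - s2 * (norm t)\<^sup>2 = (I 2 (h n) (\<lambda>y. (t \<bullet> y)\<^sup>2) - s2 * (norm t)\<^sup>2 * ?H) / ?H"
      unfolding eq by (rule gen[OF H])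
    then have "norm (real n * (\<integral>x. (t \<bullet> \<xi> n x)\<^sup>2 \<partial>\<nu>) - s2 * (norm t)\<^sup>2) = \<bar>I 2 (h n) (\<lambda>y. (t \<bullet> y)\<^sup>2) - s2 * (norm t)\<^sup>2 * ?H\<bar> / ?H"
      unfolding eq2 real_norm_def abs_divide by (simp only: abs_of_pos[OF H])
    also have "\<dots> \<le> K * (norm t)\<^sup>2 * h n ^ (CARD('d) + 4) / ?H" using K(2)[OF h_pos] H by (intro divide_right_mono) auto
    also have "\<dots> = K * (norm t)\<^sup>2 * (h n)\<^sup>2"
    proof -
      have "h n ^ (CARD('d) + 4) = ?H * (h n)\<^sup>2" unfolding power_add[symmetric] by (rule arg_cong[where f="\<lambda>k. h n ^ k"]) simp
      then show ?thesis using h_pos[of n] by simp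
    qed
    finally show "norm (real n * (\<integral>x. (t \<bullet> \<xi> n x)\<^sup>2 \<partial>\<nu>) - s2 * (norm t)\<^sup>2) \<le> K * (norm t)\<^sup>2 * (h n)\<^sup>2" .
  qed
  from tendsto_add[OF this tendsto_const[of "s2 * (norm t)\<^sup>2"]] show ?thesis by simp
qed

lemma cube_measurable: "(\<lambda>y::real^'d. norm y ^ 3) \<in> borel_measurable borel" by measurable

lemma clt_third_integrable: "integrable \<nu> (\<lambda>x. norm (\<xi> n x) ^ 3)"
  unfolding norm_\<xi>_cube
  by (intro integrable_mult_right I_integrable[where c=1 and k=3] h_pos cube_measurable) auto

text \<open>Lyapunov's condition: (n/b^3) h^(d+3) = h/b, up to a constant.\<close>

lemma clt_third_moment: "(\<lambda>n. real n * (\<integral>x. norm (\<xi> n x) ^ 3 \<partial>\<nu>)) \<longlonglongrightarrow> 0"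
proof -
  obtain K where K: "0 \<le> K \<and> (\<forall>hh w c. 0 < hh \<longrightarrow> hh \<le> 1 \<longrightarrow> w \<in> borel_measurable borel \<longrightarrow> (\<forall>y. \<bar>w y\<bar> \<le> c * norm y ^ 3) \<longrightarrow>
    \<bar>I 3 hh w\<bar> \<le> K * c * hh ^ (CARD('d) + 3))"
    using I_bound[of 3 3, OF zero_less_numeral] by (rule exE)
  have bd: "\<forall>y::real^'d. \<bar>norm y ^ 3\<bar> \<le> 1 * norm y ^ 3" by simp
  have l: "(\<lambda>n. K * (h n / b n)) \<longlonglongrightarrow> 0" using tendsto_mult_right_zero[OF h_over_b_tendsto] .
  show ?thesis
  proof (rule Lim_null_comparison[OF eventually_mono[OF h_le_1] l])
    fix n assume n: "h n \<le> 1 \<and> 0 < n"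
    have bp: "0 < b n" using b_pos n by simp
    have Ib: "\<bar>I 3 (h n) (\<lambda>y. norm y ^ 3)\<bar> \<le> K * 1 * h n ^ (CARD('d) + 3)"
      using K[THEN conjunct2, THEN spec[of _ "h n"], THEN spec[of _ "\<lambda>y. norm y ^ 3"], THEN spec[of _ 1], THEN mp, OF h_pos, THEN mp,
          OF n[THEN conjunct1], THEN mp, OF cube_measurable, THEN mp, OF bd] .
    have "real n * (\<integral>x. norm (\<xi> n x) ^ 3 \<partial>\<nu>) = (real n / (b n)\<^sup>2) * (1 / b n) * I 3 (h n) (\<lambda>y. norm y ^ 3)"
    proof -
      have "(\<integral>x. norm (\<xi> n x) ^ 3 \<partial>\<nu>) = (1 / b n) ^ 3 * I 3 (h n) (\<lambda>y. norm y ^ 3)"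
        unfolding norm_\<xi>_cube I_def by (rule integral_mult_right_zero)
      then show ?thesis by (simp add: power3_eq_cube power2_eq_square)
    qed
    also have "\<dots> = 1 / (h n ^ (CARD('d) + 2) * b n) * I 3 (h n) (\<lambda>y. norm y ^ 3)"
      using n by (simp add: n_over_b_sq)
    finally have "norm (real n * (\<integral>x. norm (\<xi> n x) ^ 3 \<partial>\<nu>)) = 1 / (h n ^ (CARD('d) + 2) * b n) * \<bar>I 3 (h n) (\<lambda>y. norm y ^ 3)\<bar>"
      using bp h_pos[of n] by (simp add: abs_mult)
    also have "\<dots> \<le> 1 / (h n ^ (CARD('d) + 2) * b n) * (K * 1 * h n ^ (CARD('d) + 3))"
      using Ib bp h_pos[of n] by (intro mult_left_mono) auto
    also have "\<dots> = K * (h n / b n)"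
    proof -
      have "h n ^ (CARD('d) + 3) = h n ^ (CARD('d) + 2) * h n" by (simp add: eval_nat_numeral)
      then show ?thesis using h_pos[of n] by simp
    qed
    finally show "norm (real n * (\<integral>x. norm (\<xi> n x) ^ 3 \<partial>\<nu>)) \<le> K * (h n / b n)" .
  qed
qed

text \<open>The quadratic Taylor terms concentrate: their sums converge in quadratic mean.\<close>

definition quad :: "'d \<Rightarrow> 'd \<Rightarrow> nat \<Rightarrow> real^'m \<Rightarrow> real" where
  "quad j l n x = 1 / b n * (indicator B x * (kern (h n) x ^ 1 * (\<kappa>' x $ j * \<kappa>' x $ l)))"

text \<open>The leading term of \<open>I_prod\<close> after multiplication by n/b, because (n/b)
  h^(d+2) = b.\<close>

definition quad_mean :: "'d \<Rightarrow> 'd \<Rightarrow> nat \<Rightarrow> real" where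
  "quad_mean j l n = b n * (2 * (if j = l then 1 else 0) / vol)"

definition quad_dev :: "'d \<Rightarrow> 'd \<Rightarrow> nat \<Rightarrow> 'w \<Rightarrow> real" where
  "quad_dev j l n \<omega> = (\<Sum>i<n. quad j l n (X i \<omega>)) - quad_mean j l n"

lemma prod_facts:
  "(\<lambda>y :: real^'d. y $ j * y $ l) \<in> borel_measurable borel" "\<forall>y :: real^'d. \<bar>y $ j * y $ l\<bar> \<le> 1 * norm y ^ 2"
  "(\<lambda>y :: real^'d. (y $ j * y $ l)\<^sup>2) \<in> borel_measurable borel" "\<forall>y :: real^'d. \<bar>(y $ j * y $ l)\<^sup>2\<bar> \<le> 1 * norm y ^ 4"
proof -
  show "(\<lambda>y :: real^'d. y $ j * y $ l) \<in> borel_measurable borel" "(\<lambda>y :: real^'d. (y $ j * y $ l)\<^sup>2) \<in> borel_measurable borel"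
    by measurable
  show b: "\<forall>y :: real^'d. \<bar>y $ j * y $ l\<bar> \<le> 1 * norm y ^ 2"
    unfolding abs_mult power2_eq_square mult_1 by (intro allI mult_mono component_le_norm_cart) auto
  show "\<forall>y :: real^'d. \<bar>(y $ j * y $ l)\<^sup>2\<bar> \<le> 1 * norm y ^ 4"
  proof
    fix y :: "real^'d"
    have "\<bar>y $ j * y $ l\<bar>\<^sup>2 \<le> (1 * norm y ^ 2)\<^sup>2" using b by (intro power_mono) auto
    then show "\<bar>(y $ j * y $ l)\<^sup>2\<bar> \<le> 1 * norm y ^ 4" by (simp flip: power_mult)
  qed
qed

lemma quad_measurable [measurable]: "quad j l n \<in> borel_measurable (restrict_space borel M)"
proof -
  have vn: "(\<lambda>y::real^'d. y $ j) \<in> borel_measurable borel" for j by measurable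
  have [measurable]: "(\<lambda>x. \<kappa>' x $ j) \<in> borel_measurable (restrict_space borel M)" for j
    by (rule measurable_compose[OF \<kappa>'_M_measurable vn])
  show ?thesis unfolding quad_def by measurable
qed

lemma quad_sq: "(quad j l n x)\<^sup>2 = (1 / b n)\<^sup>2 * (indicator B x * (kern (h n) x ^ 2 * (\<kappa>' x $ j * \<kappa>' x $ l)\<^sup>2))"
  by (cases "x \<in> B") (simp_all add: quad_def power_mult_distrib power_divide)

lemma quad_integrable: "integrable \<nu> (quad j l n)" "integrable \<nu> (\<lambda>x. (quad j l n x)\<^sup>2)"
  unfolding quad_sq unfolding quad_def
  by (intro integrable_mult_right I_integrable[OF _ h_pos prod_facts(1,2)] I_integrable[OF _ h_pos prod_facts(3,4)]; simp)+

lemma quad_dev_measurable [measurable]: "quad_dev j l n \<in> borel_measurable P"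
  unfolding quad_dev_def by measurable

lemma quad_dev_integrable: "integrable P (\<lambda>\<omega>. (quad_dev j l n \<omega>)\<^sup>2)"
  unfolding quad_dev_def by (rule P.iid_sum_second_moment(1)[OF X law quad_measurable quad_integrable])

text \<open>The squared deviation has variance of order (n/b^2) h^(d+4) = h^2 and squared bias of
  order (b h^2)^2; Jensen's inequality passes to the first moment.\<close>

lemma quad_dev_tendsto: "(\<lambda>n. P.expectation (\<lambda>\<omega>. \<bar>quad_dev j l n \<omega>\<bar>)) \<longlonglongrightarrow> 0"
proof -
  obtain K1 where K1: "0 \<le> K1 \<and> (\<forall>hh w c. 0 < hh \<longrightarrow> hh \<le> 1 \<longrightarrow> w \<in> borel_measurable borel \<longrightarrow> (\<forall>y. \<bar>w y\<bar> \<le> c * norm y ^ 4) \<longrightarrow>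
    \<bar>I 2 hh w\<bar> \<le> K1 * c * hh ^ (CARD('d) + 4))"
    using I_bound[of 2 4, OF zero_less_numeral] by (rule exE)
  obtain K2 where K2: "0 \<le> K2" "\<And>hh j l. 0 < hh \<Longrightarrow>
    \<bar>I 1 hh (\<lambda>y. y $ j * y $ l) - 2 * (if j = l then 1 else 0) / vol * hh ^ (CARD('d) + 2)\<bar> \<le> K2 * hh ^ (CARD('d) + 4)"
    using I_prod by blast
  have "(\<lambda>n. K1 * (h n)\<^sup>2 + (K2 * ((b n * h n) * h n))\<^sup>2) \<longlonglongrightarrow> K1 * 0\<^sup>2 + (K2 * (0 * 0))\<^sup>2"
    by (intro tendsto_intros h_tendsto bh_tendsto)
  then have "(\<lambda>n. sqrt (K1 * (h n)\<^sup>2 + (K2 * ((b n * h n) * h n))\<^sup>2)) \<longlonglongrightarrow> sqrt (K1 * 0\<^sup>2 + (K2 * (0 * 0))\<^sup>2)"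
    by (rule tendsto_real_sqrt)
  then have l: "(\<lambda>n. sqrt (K1 * (h n)\<^sup>2 + (K2 * ((b n * h n) * h n))\<^sup>2)) \<longlonglongrightarrow> 0" by simp
  show ?thesis
  proof (rule Lim_null_comparison[OF eventually_mono[OF h_le_1] l])
    fix n assume n: "h n \<le> 1 \<and> 0 < n"
    let ?H = "h n ^ (CARD('d) + 2)" and ?\<delta> = "if j = l then 1 else 0 :: real"
    have H: "0 < ?H" using h_pos[of n] by simp
    have H4: "h n ^ (CARD('d) + 4) = ?H * (h n)\<^sup>2" unfolding power_add[symmetric] by (rule arg_cong[where f="\<lambda>k. h n ^ k"]) simp
    have A: "real n * (\<integral>x. (quad j l n x)\<^sup>2 \<partial>\<nu>) \<le> K1 * (h n)\<^sup>2"
    proof -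
      have "real n * (\<integral>x. (quad j l n x)\<^sup>2 \<partial>\<nu>) = (real n / (b n)\<^sup>2) * I 2 (h n) (\<lambda>y. (y $ j * y $ l)\<^sup>2)"
        unfolding quad_sq I_def by (simp add: power_divide)
      also have "\<dots> = I 2 (h n) (\<lambda>y. (y $ j * y $ l)\<^sup>2) / ?H" using n by (simp add: n_over_b_sq)
      also have "\<dots> \<le> (K1 * 1 * h n ^ (CARD('d) + 4)) / ?H"
        using K1[THEN conjunct2, THEN spec[of _ "h n"], THEN spec[of _ "\<lambda>y. (y $ j * y $ l)\<^sup>2"], THEN spec[of _ 1], THEN mp, OF h_pos, THEN mp,
          OF n[THEN conjunct1], THEN mp, OF prod_facts(3), THEN mp, OF prod_facts(4)] H
        by (intro divide_right_mono) auto
      also have "\<dots> = K1 * (h n)\<^sup>2" unfolding H4 using h_pos[of n] by simp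
      finally show ?thesis .
    qed
    have Bb: "(real n * (\<integral>x. quad j l n x \<partial>\<nu>) - quad_mean j l n)\<^sup>2 \<le> (K2 * ((b n * h n) * h n))\<^sup>2"
    proof -
      let ?i = "I 1 (h n) (\<lambda>y. y $ j * y $ l)"
      have "real n * (\<integral>x. quad j l n x \<partial>\<nu>) = (real n / b n) * ?i" unfolding quad_def I_def by simp
      also have "\<dots> = b n / ?H * ?i" by (simp only: n_over_b)
      finally have eq: "real n * (\<integral>x. quad j l n x \<partial>\<nu>) = b n / ?H * ?i" .
      have gen: "x / y * i - x * c = x / y * (i - c * y)" if "0 < y" for x y i c :: real using that by (simp add: right_diff_distrib)
      have p: "0 \<le> b n / ?H" using b_nonneg[of n] H by (intro divide_nonneg_nonneg) auto
      have "real n * (\<integral>x. quad j l n x \<partial>\<nu>) - quad_mean j l n = b n / ?H * (?i - 2 * ?\<delta> / vol * ?H)"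
        unfolding eq quad_mean_def by (rule gen[OF H])
      then have "\<bar>real n * (\<integral>x. quad j l n x \<partial>\<nu>) - quad_mean j l n\<bar> = b n / ?H * \<bar>?i - 2 * ?\<delta> / vol * ?H\<bar>"
        by (simp only: abs_mult abs_of_nonneg[OF p])
      also have "\<dots> \<le> b n / ?H * (K2 * h n ^ (CARD('d) + 4))"
        by (rule mult_left_mono[OF K2(2)[OF h_pos] p])
      also have "\<dots> = K2 * ((b n * h n) * h n)" unfolding H4 using h_pos[of n] by (simp add: power2_eq_square)
      finally have "\<bar>real n * (\<integral>x. quad j l n x \<partial>\<nu>) - quad_mean j l n\<bar>\<^sup>2 \<le> (K2 * ((b n * h n) * h n))\<^sup>2" by (intro power_mono) auto
      then show ?thesis by simp
    qed
    have "P.expectation (\<lambda>\<omega>. \<bar>quad_dev j l n \<omega>\<bar>) \<le> sqrt (P.expectation (\<lambda>\<omega>. (quad_dev j l n \<omega>)\<^sup>2))"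
      by (rule P.expectation_abs_le_sqrt(2)[OF quad_dev_measurable quad_dev_integrable])
    also have "\<dots> \<le> sqrt (K1 * (h n)\<^sup>2 + (K2 * ((b n * h n) * h n))\<^sup>2)"
      unfolding quad_dev_def
      by (rule real_sqrt_le_mono[OF order_trans[OF P.iid_sum_second_moment(2)[OF X law quad_measurable quad_integrable] add_mono[OF A Bb]]])
    finally show "norm (P.expectation (\<lambda>\<omega>. \<bar>quad_dev j l n \<omega>\<bar>)) \<le> sqrt (K1 * (h n)\<^sup>2 + (K2 * ((b n * h n) * h n))\<^sup>2)"
      by simp
  qed
qed

text \<open>The cubic Taylor remainder on the chart and the exponentially small contribution from outside.\<close>

definition rem :: "(real^'m \<Rightarrow> real) \<Rightarrow> real \<Rightarrow> nat \<Rightarrow> real^'m \<Rightarrow> real" where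
  "rem g C3 n x = C3 * (indicator B x * (kern (h n) x ^ 1 * norm (\<kappa>' x) ^ 3)) + indicator (M - B) x * (kern (h n) x * g x)"

text \<open>Outside the chart image the distance to \<open>p\<close> is bounded below, so the kernel
  is exponentially small. The power \<open>CARD('d) + 3\<close> is the order of the cubic remainder,
  which gives both parts of \<open>rem\<close> the same rate.\<close>

lemma kern_outside: "\<exists>K\<ge>0. \<forall>n x. h n \<le> 1 \<longrightarrow> x \<in> M - B \<longrightarrow> kern (h n) x \<le> K * h n ^ (CARD('d) + 3)"
proof -
  obtain \<rho> where \<rho>: "\<rho> > 0" "\<And>x. x \<in> M \<Longrightarrow> norm (x - p) < \<rho> \<Longrightarrow> norm (\<kappa> x) < r \<and> \<psi> (\<kappa> x) = x"
    using near_p[OF r(1)] by blast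
  define a where "a = \<rho>\<^sup>2 / 4"
  have a: "0 < a" using \<rho> by (simp add: a_def)
  let ?m = "CARD('d) + 3"
  have "kern (h n) x \<le> c4 * (real ?m / a) ^ ?m * h n ^ ?m" if hn: "h n \<le> 1" and x: "x \<in> M - B" for n x
  proof -
    have "\<rho> \<le> norm (x - p)"
    proof (rule ccontr)
      assume "\<not> \<rho> \<le> norm (x - p)"
      then have "norm (\<kappa> x) < r" "\<psi> (\<kappa> x) = x" using \<rho>(2)[of x] x by auto
      then have "x \<in> B" unfolding B_def by (intro image_eqI[of _ _ "\<kappa> x"]) auto
      then show False using x by simp
    qed
    then have "\<rho>\<^sup>2 \<le> (norm (x - p))\<^sup>2" using \<rho>(1) by (intro power_mono) auto
    then have "- (norm (x - p))\<^sup>2 / (4 * (h n)\<^sup>2) \<le> - a / (h n)\<^sup>2"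
      using h_pos[of n] by (simp add: a_def divide_simps)
    then have "exp (- (norm (x - p))\<^sup>2 / (4 * (h n)\<^sup>2)) \<le> exp (- a / (h n)\<^sup>2)" by (simp only: exp_le_cancel_iff)
    also have "\<dots> \<le> (real ?m / a) ^ ?m * h n ^ ?m" by (rule exp_neg_le_power[OF a h_pos hn]) simp
    finally have "c4 * exp (- (norm (x - p))\<^sup>2 / (4 * (h n)\<^sup>2)) \<le> c4 * ((real ?m / a) ^ ?m * h n ^ ?m)"
      using c4_pos by (intro mult_left_mono) auto
    then show ?thesis by (simp only: kern_eq mult.assoc)
  qed
  moreover have "0 \<le> c4 * (real ?m / a) ^ ?m" using c4_pos a by simp
  ultimately show ?thesis by blast
qed

lemma rem_facts:
  assumes g: "integrable \<nu> g" "\<And>x. 0 \<le> g x" and C3: "0 \<le> C3"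
  shows "rem g C3 n \<in> borel_measurable (restrict_space borel M)" and "integrable \<nu> (rem g C3 n)"
    and "\<exists>K\<ge>0. \<forall>n. h n \<le> 1 \<longrightarrow> (\<integral>x. rem g C3 n x \<partial>\<nu>) \<le> K * h n ^ (CARD('d) + 3)"
proof -
  have g\<nu>: "g \<in> borel_measurable \<nu>" using g(1) by simp
  have gm [measurable]: "g \<in> borel_measurable (restrict_space borel M)"
    using g\<nu> measurable_cong_sets[OF sets_\<nu> refl] by blast
  have Mm [measurable]: "M \<in> sets (restrict_space borel M)"
    using sets.top[of "restrict_space borel M"] by (simp add: space_restrict_space)
  show m: "rem g C3 n \<in> borel_measurable (restrict_space borel M)" for n
    unfolding rem_def by measurable
  have i1: "integrable \<nu> (\<lambda>x. indicator B x * (kern (h n) x ^ 1 * norm (\<kappa>' x) ^ 3))" for n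
    by (rule I_integrable[where c=1 and k=3, OF _ h_pos cube_measurable]) auto
  have out_m: "(\<lambda>x. indicator (M - B) x * (kern (h n) x * g x)) \<in> borel_measurable \<nu>" for n
  proof -
    have "(\<lambda>x. indicator (M - B) x * (kern (h n) x * g x)) \<in> borel_measurable (restrict_space borel M)" by measurable
    then show ?thesis using measurable_cong_sets[OF sets_\<nu> refl] by blast
  qed
  have i2: "integrable \<nu> (\<lambda>x. indicator (M - B) x * (kern (h n) x * g x))" for n
  proof (rule Bochner_Integration.integrable_bound[OF integrable_mult_right[OF g(1), of c4]])
    show "AE x in \<nu>. norm (indicator (M - B) x * (kern (h n) x * g x)) \<le> norm (c4 * g x)"
    proof (rule AE_I2)
      fix x
      have "indicator (M - B) x * (kern (h n) x * g x) \<le> 1 * (c4 * g x)"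
        using kern_nonneg[of "h n" x] kern_le[of "h n" x] g(2)[of x] c4_pos by (intro mult_mono) auto
      moreover have "0 \<le> indicator (M - B) x * (kern (h n) x * g x)" using kern_nonneg[of "h n" x] g(2)[of x] by simp
      ultimately show "norm (indicator (M - B) x * (kern (h n) x * g x)) \<le> norm (c4 * g x)" by simp
    qed
  qed (rule out_m)
  show "integrable \<nu> (rem g C3 n)" for n
    unfolding rem_def[abs_def] by (intro Bochner_Integration.integrable_add integrable_mult_right i1 i2)
  obtain K1 where K1: "0 \<le> K1 \<and> (\<forall>hh w c. 0 < hh \<longrightarrow> hh \<le> 1 \<longrightarrow> w \<in> borel_measurable borel \<longrightarrow> (\<forall>y. \<bar>w y\<bar> \<le> c * norm y ^ 3) \<longrightarrow>
    \<bar>I 1 hh w\<bar> \<le> K1 * c * hh ^ (CARD('d) + 3))"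
    using I_bound[of 1 3, OF zero_less_one] by (rule exE)
  obtain K2 where K2: "0 \<le> K2" "\<And>n x. h n \<le> 1 \<Longrightarrow> x \<in> M - B \<Longrightarrow> kern (h n) x \<le> K2 * h n ^ (CARD('d) + 3)"
    using kern_outside by blast
  have bd: "\<forall>y::real^'d. \<bar>norm y ^ 3\<bar> \<le> 1 * norm y ^ 3" by simp
  let ?g = "\<integral>x. g x \<partial>\<nu>"
  have g0: "0 \<le> ?g" using g(2) by simp
  have "(\<integral>x. rem g C3 n x \<partial>\<nu>) \<le> (C3 * K1 + K2 * ?g) * h n ^ (CARD('d) + 3)" if hn: "h n \<le> 1" for n
  proof -
    let ?H = "h n ^ (CARD('d) + 3)"
    have H: "0 \<le> ?H" using h_pos[of n] by simp
    have e: "(\<integral>x. rem g C3 n x \<partial>\<nu>) = C3 * I 1 (h n) (\<lambda>y. norm y ^ 3) + (\<integral>x. indicator (M - B) x * (kern (h n) x * g x) \<partial>\<nu>)"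
      unfolding rem_def I_def using i1[of n] i2[of n] by (subst Bochner_Integration.integral_add) auto
    have "\<bar>I 1 (h n) (\<lambda>y. norm y ^ 3)\<bar> \<le> K1 * 1 * ?H"
      using K1[THEN conjunct2, THEN spec[of _ "h n"], THEN spec[of _ "\<lambda>y. norm y ^ 3"], THEN spec[of _ 1], THEN mp, OF h_pos, THEN mp,
          OF hn, THEN mp, OF cube_measurable, THEN mp, OF bd] .
    then have "I 1 (h n) (\<lambda>y. norm y ^ 3) \<le> K1 * ?H" by simp
    then have 1: "C3 * I 1 (h n) (\<lambda>y. norm y ^ 3) \<le> C3 * (K1 * ?H)" using C3 by (rule mult_left_mono)
    have 2: "(\<integral>x. indicator (M - B) x * (kern (h n) x * g x) \<partial>\<nu>) \<le> (\<integral>x. K2 * ?H * g x \<partial>\<nu>)"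
    proof (rule integral_mono[OF i2 integrable_mult_right[OF g(1)]])
      fix x
      show "indicator (M - B) x * (kern (h n) x * g x) \<le> K2 * ?H * g x"
      proof (cases "x \<in> M - B")
        case True
        then show ?thesis using K2(2)[OF hn True] g(2)[of x] by (simp add: mult_right_mono)
      next
        case False
        then show ?thesis using K2(1) H g(2)[of x] by simp
      qed
    qed
    have "(\<integral>x. K2 * ?H * g x \<partial>\<nu>) = K2 * ?H * ?g" by simp
    then show ?thesis unfolding e using 1 2 by (simp add: algebra_simps)
  qed
  then show "\<exists>K\<ge>0. \<forall>n. h n \<le> 1 \<longrightarrow> (\<integral>x. rem g C3 n x \<partial>\<nu>) \<le> K * h n ^ (CARD('d) + 3)"
    using C3 K1 K2(1) g0 by (intro exI[of _ "C3 * K1 + K2 * ?g"]) auto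
qed

section \<open>The uniform error and the decomposition of the process\<close>

definition total_rem :: "(real^'m \<Rightarrow> real) \<Rightarrow> real \<Rightarrow> real \<Rightarrow> nat \<Rightarrow> 'w \<Rightarrow> real" where
  "total_rem g C0 C3 n \<omega> = (\<Sum>j\<in>UNIV. \<Sum>l\<in>UNIV. C0 / 2 * \<bar>quad_dev j l n \<omega>\<bar>) + 1 / b n * (\<Sum>i<n. rem g C3 n (X i \<omega>))"

lemma total_rem_facts:
  assumes g: "integrable \<nu> g" "\<And>x. 0 \<le> g x" and C3: "0 \<le> C3"
  shows "integrable P (total_rem g C0 C3 n)" and "(\<lambda>n. P.expectation (total_rem g C0 C3 n)) \<longlonglongrightarrow> 0"
proof -
  note rf = rem_facts[OF g C3]
  have iq: "integrable P (\<lambda>\<omega>. \<bar>quad_dev j l n \<omega>\<bar>)" for j l n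
    by (rule integrable_abs[OF P.expectation_abs_le_sqrt(1)[OF quad_dev_measurable quad_dev_integrable]])
  have ir: "integrable P (\<lambda>\<omega>. rem g C3 n (X i \<omega>))" "P.expectation (\<lambda>\<omega>. rem g C3 n (X i \<omega>)) = (\<integral>x. rem g C3 n x \<partial>\<nu>)" for n i
    using P.iid_integral[OF X law rf(1)[of n], of i] rf(2)[of n] by auto
  have iA: "integrable P (\<lambda>\<omega>. \<Sum>j\<in>UNIV. \<Sum>l\<in>UNIV. C0 / 2 * \<bar>quad_dev j l n \<omega>\<bar>)" for n
    by (intro Bochner_Integration.integrable_sum integrable_mult_right iq)
  have iB: "integrable P (\<lambda>\<omega>. 1 / b n * (\<Sum>i<n. rem g C3 n (X i \<omega>)))" for n
    by (intro Bochner_Integration.integrable_sum integrable_mult_right ir)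
  show "integrable P (total_rem g C0 C3 n)"
    unfolding total_rem_def[abs_def] by (rule Bochner_Integration.integrable_add[OF iA iB])
  have eA: "P.expectation (\<lambda>\<omega>. \<Sum>j\<in>UNIV. \<Sum>l\<in>UNIV. C0 / 2 * \<bar>quad_dev j l n \<omega>\<bar>)
      = (\<Sum>j\<in>UNIV. \<Sum>l\<in>UNIV. C0 / 2 * P.expectation (\<lambda>\<omega>. \<bar>quad_dev j l n \<omega>\<bar>))" for n
  proof -
    have "P.expectation (\<lambda>\<omega>. \<Sum>j\<in>UNIV. \<Sum>l\<in>UNIV. C0 / 2 * \<bar>quad_dev j l n \<omega>\<bar>)
      = (\<Sum>j\<in>UNIV. P.expectation (\<lambda>\<omega>. \<Sum>l\<in>UNIV. C0 / 2 * \<bar>quad_dev j l n \<omega>\<bar>))"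
      by (intro Bochner_Integration.integral_sum Bochner_Integration.integrable_sum integrable_mult_right iq)
    also have "\<dots> = (\<Sum>j\<in>UNIV. \<Sum>l\<in>UNIV. P.expectation (\<lambda>\<omega>. C0 / 2 * \<bar>quad_dev j l n \<omega>\<bar>))"
      by (intro sum.cong refl Bochner_Integration.integral_sum integrable_mult_right iq)
    finally show ?thesis by (simp only: integral_mult_right_zero)
  qed
  have eB: "P.expectation (\<lambda>\<omega>. 1 / b n * (\<Sum>i<n. rem g C3 n (X i \<omega>))) = real n / b n * (\<integral>x. rem g C3 n x \<partial>\<nu>)" for n
    unfolding integral_mult_right_zero by (subst Bochner_Integration.integral_sum[OF ir(1)]) (simp add: ir(2))
  have e: "P.expectation (total_rem g C0 C3 n) = (\<Sum>j\<in>UNIV. \<Sum>l\<in>UNIV. C0 / 2 * P.expectation (\<lambda>\<omega>. \<bar>quad_dev j l n \<omega>\<bar>))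
      + real n / b n * (\<integral>x. rem g C3 n x \<partial>\<nu>)" for n
    unfolding total_rem_def[abs_def] eA[symmetric] eB[symmetric] by (rule Bochner_Integration.integral_add[OF iA iB])
  have "(\<lambda>n. \<Sum>j\<in>(UNIV::'d set). \<Sum>l\<in>(UNIV::'d set). C0 / 2 * P.expectation (\<lambda>\<omega>. \<bar>quad_dev j l n \<omega>\<bar>)) \<longlonglongrightarrow> (\<Sum>j\<in>(UNIV::'d set). \<Sum>l\<in>(UNIV::'d set). C0 / 2 * 0)"
    by (intro tendsto_sum tendsto_mult tendsto_const quad_dev_tendsto)
  moreover have "(\<lambda>n. real n / b n * (\<integral>x. rem g C3 n x \<partial>\<nu>)) \<longlonglongrightarrow> 0"
  proof -
    obtain K where K: "0 \<le> K" "\<And>n. h n \<le> 1 \<Longrightarrow> (\<integral>x. rem g C3 n x \<partial>\<nu>) \<le> K * h n ^ (CARD('d) + 3)"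
      using rf(3) by blast
    have l: "(\<lambda>n. K * (b n * h n)) \<longlonglongrightarrow> 0" using tendsto_mult_right_zero[OF bh_tendsto] .
    show ?thesis
    proof (rule Lim_null_comparison[OF eventually_mono[OF h_le_1] l])
      fix n assume n: "h n \<le> 1 \<and> 0 < n"
      have r0: "0 \<le> (\<integral>x. rem g C3 n x \<partial>\<nu>)"
        using C3 g(2) kern_nonneg by (intro Bochner_Integration.integral_nonneg) (simp add: rem_def)
      have p: "0 \<le> b n / h n ^ (CARD('d) + 2)" using b_nonneg[of n] h_pos[of n] by simp
      have "norm (real n / b n * (\<integral>x. rem g C3 n x \<partial>\<nu>)) = b n / h n ^ (CARD('d) + 2) * (\<integral>x. rem g C3 n x \<partial>\<nu>)"
        unfolding n_over_b real_norm_def by (rule abs_of_nonneg[OF mult_nonneg_nonneg[OF p r0]])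
      also have "\<dots> \<le> b n / h n ^ (CARD('d) + 2) * (K * h n ^ (CARD('d) + 3))"
        using K(2) n p by (intro mult_left_mono) auto
      also have "\<dots> = K * (b n * h n)"
      proof -
        have "h n ^ (CARD('d) + 3) = h n ^ (CARD('d) + 2) * h n" by (simp add: eval_nat_numeral)
        then show ?thesis using h_pos[of n] by simp
      qed
      finally show "norm (real n / b n * (\<integral>x. rem g C3 n x \<partial>\<nu>)) \<le> K * (b n * h n)" .
    qed
  qed
  ultimately have "(\<lambda>n. (\<Sum>j\<in>(UNIV::'d set). \<Sum>l\<in>(UNIV::'d set). C0 / 2 * P.expectation (\<lambda>\<omega>. \<bar>quad_dev j l n \<omega>\<bar>))
      + real n / b n * (\<integral>x. rem g C3 n x \<partial>\<nu>)) \<longlonglongrightarrow> (\<Sum>j\<in>(UNIV::'d set). \<Sum>l\<in>(UNIV::'d set). C0 / 2 * 0) + 0"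
    by (rule tendsto_add)
  then show "(\<lambda>n. P.expectation (total_rem g C0 C3 n)) \<longlonglongrightarrow> 0" unfolding e by simp
qed

text \<open>On \<open>B\<close> the second-order Taylor polynomial is subtracted from the increments
  of \<open>f\<close>. The linear terms form the row sum, the quadratic ones are centred by the
  Laplace--Beltrami term, and everything left is bounded through \<open>C0\<close>,
  \<open>C3\<close> and \<open>g\<close>, hence uniformly over a class that shares them.\<close>

lemma process_decomposition:
  fixes f :: "real^'m \<Rightarrow> real"
  assumes C0: "0 \<le> C0" and D2: "\<And>j l. \<bar>D2 j l\<bar> \<le> C0"
    and LB: "LB = (\<Sum>j\<in>UNIV. D2 j j)"
    and inB: "\<And>x. x \<in> B \<Longrightarrow> \<bar>f x - f p - (\<Sum>j\<in>UNIV. \<kappa>' x $ j * D1 j)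
        - (\<Sum>j\<in>UNIV. \<Sum>l\<in>UNIV. \<kappa>' x $ j * \<kappa>' x $ l * D2 j l) / 2\<bar> \<le> C3 * norm (\<kappa>' x) ^ 3"
    and out: "\<And>x. x \<in> M - B \<Longrightarrow> \<bar>f x - f p\<bar> \<le> g x"
    and n: "0 < n" and \<omega>: "\<omega> \<in> space P"
  shows "\<bar>sqrt (real n * h n ^ (CARD('d) + 2)) * (graph_laplacian CARD('d) (h n) n (\<lambda>i. X i \<omega>) f p - 1 / vol * LB)
     - (\<Sum>j\<in>UNIV. (\<Sum>i<n. \<xi> n (X i \<omega>)) $ j * D1 j)\<bar> \<le> total_rem g C0 C3 n \<omega>"
proof -
  let ?x = "\<lambda>i. X i \<omega>" and ?k = "kern (h n)"
  define lin where "lin x = (\<Sum>j\<in>UNIV. \<kappa>' x $ j * D1 j)" for x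
  define qua where "qua x = (\<Sum>j\<in>UNIV. \<Sum>l\<in>UNIV. \<kappa>' x $ j * \<kappa>' x $ l * D2 j l)" for x
  define err where "err x = ?k x * (f x - f p) - indicator B x * ?k x * lin x - indicator B x * ?k x * qua x / 2" for x
  have bp: "0 < b n" using b_pos[OF n] .
  have err: "\<bar>err x\<bar> \<le> rem g C3 n x" if x: "x \<in> M" for x
  proof (cases "x \<in> B")
    case True
    have "err x = ?k x * (f x - f p - lin x - qua x / 2)" using True by (simp add: err_def algebra_simps)
    then have "\<bar>err x\<bar> = ?k x * \<bar>f x - f p - lin x - qua x / 2\<bar>" using kern_nonneg[of "h n" x] by (simp add: abs_mult)
    also have "\<dots> \<le> ?k x * (C3 * norm (\<kappa>' x) ^ 3)"
      unfolding lin_def qua_def by (rule mult_left_mono[OF inB[OF True] kern_nonneg])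
    finally show ?thesis using True by (simp add: rem_def mult_ac)
  next
    case False
    then have "\<bar>err x\<bar> = ?k x * \<bar>f x - f p\<bar>" using kern_nonneg[of "h n" x] by (simp add: err_def abs_mult)
    also have "\<dots> \<le> ?k x * g x" using False x by (intro mult_left_mono[OF out kern_nonneg]) simp
    finally show ?thesis using False x by (simp add: rem_def)
  qed
  have L: "1 / b n * (\<Sum>i<n. indicator B (?x i) * ?k (?x i) * lin (?x i)) = (\<Sum>j\<in>UNIV. (\<Sum>i<n. \<xi> n (?x i)) $ j * D1 j)"
  proof -
    have "(\<Sum>j\<in>UNIV. (\<Sum>i<n. \<xi> n (?x i)) $ j * D1 j) = (\<Sum>j\<in>UNIV. \<Sum>i<n. 1 / b n * (indicator B (?x i) * ?k (?x i)) * (\<kappa>' (?x i) $ j * D1 j))"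
      by (simp add: \<xi>_def sum_distrib_right mult.assoc)
    also have "\<dots> = (\<Sum>i<n. \<Sum>j\<in>UNIV. 1 / b n * (indicator B (?x i) * ?k (?x i)) * (\<kappa>' (?x i) $ j * D1 j))" by (rule sum.swap)
    finally show ?thesis by (simp only: lin_def sum_distrib_left mult.assoc)
  qed
  have Qd: "1 / b n * (\<Sum>i<n. indicator B (?x i) * ?k (?x i) * qua (?x i) / 2) = (\<Sum>j\<in>UNIV. \<Sum>l\<in>UNIV. D2 j l / 2 * (\<Sum>i<n. quad j l n (?x i)))"
  proof -
    have "1 / b n * (\<Sum>i<n. indicator B (?x i) * ?k (?x i) * qua (?x i) / 2)
       = (\<Sum>i<n. \<Sum>j\<in>UNIV. \<Sum>l\<in>UNIV. D2 j l / 2 * quad j l n (?x i))"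
      unfolding qua_def quad_def sum_distrib_left sum_divide_distrib by (intro sum.cong refl) (simp add: mult_ac)
    also have "\<dots> = (\<Sum>j\<in>UNIV. \<Sum>i<n. \<Sum>l\<in>UNIV. D2 j l / 2 * quad j l n (?x i))" by (rule sum.swap)
    also have "\<dots> = (\<Sum>j\<in>UNIV. \<Sum>l\<in>UNIV. \<Sum>i<n. D2 j l / 2 * quad j l n (?x i))"
      by (intro sum.cong refl) (rule sum.swap)
    finally show ?thesis by (simp only: sum_distrib_left)
  qed
  \<comment> \<open>Only the diagonal survives in \<open>quad_mean\<close>, and its factor 2 meets
    the 1/2 of Taylor's formula, so the centring is exactly the sum of the means.\<close>
  have Mn: "b n * (1 / vol * LB) = (\<Sum>j\<in>UNIV. \<Sum>l\<in>UNIV. D2 j l / 2 * quad_mean j l n)"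
  proof -
    have "(\<Sum>l\<in>UNIV. D2 j l / 2 * quad_mean j l n) = b n * (1 / vol * D2 j j)" for j
    proof -
      have "(\<Sum>l\<in>UNIV. D2 j l / 2 * quad_mean j l n) = (\<Sum>l\<in>UNIV. if j = l then b n * (1 / vol * D2 j l) else 0)"
        by (intro sum.cong refl) (simp add: quad_mean_def)
      then show ?thesis by simp
    qed
    then show ?thesis unfolding LB by (simp only: sum_distrib_left)
  qed
  have S: "b n * graph_laplacian CARD('d) (h n) n ?x f p = 1 / b n * (\<Sum>i<n. ?k (?x i) * (f (?x i) - f p))"
  proof -
    have "graph_laplacian CARD('d) (h n) n ?x f p = 1 / (b n)\<^sup>2 * (\<Sum>i<n. ?k (?x i) * (f (?x i) - f p))"
      unfolding graph_laplacian_def kern_def b_sq ..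
    then show ?thesis using bp by (simp add: power2_eq_square)
  qed
  have sum: "(\<Sum>i<n. ?k (?x i) * (f (?x i) - f p)) = (\<Sum>i<n. err (?x i)) + (\<Sum>i<n. indicator B (?x i) * ?k (?x i) * lin (?x i))
      + (\<Sum>i<n. indicator B (?x i) * ?k (?x i) * qua (?x i) / 2)"
    unfolding sum.distrib[symmetric] by (intro sum.cong refl) (simp add: err_def)
  have "b n * (graph_laplacian CARD('d) (h n) n ?x f p - 1 / vol * LB) - (\<Sum>j\<in>UNIV. (\<Sum>i<n. \<xi> n (?x i)) $ j * D1 j)
     = 1 / b n * (\<Sum>i<n. err (?x i)) + ((\<Sum>j\<in>UNIV. \<Sum>l\<in>UNIV. D2 j l / 2 * (\<Sum>i<n. quad j l n (?x i))) - (\<Sum>j\<in>UNIV. \<Sum>l\<in>UNIV. D2 j l / 2 * quad_mean j l n))"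
    unfolding right_diff_distrib[of "b n"] S sum distrib_left[of "1 / b n"] L Qd Mn by linarith
  also have "(\<Sum>j\<in>UNIV. \<Sum>l\<in>UNIV. D2 j l / 2 * (\<Sum>i<n. quad j l n (?x i))) - (\<Sum>j\<in>UNIV. \<Sum>l\<in>UNIV. D2 j l / 2 * quad_mean j l n)
     = (\<Sum>j\<in>UNIV. \<Sum>l\<in>UNIV. D2 j l / 2 * quad_dev j l n \<omega>)"
    by (simp only: quad_dev_def right_diff_distrib sum_subtractf)
  finally have eq: "b n * (graph_laplacian CARD('d) (h n) n ?x f p - 1 / vol * LB) - (\<Sum>j\<in>UNIV. (\<Sum>i<n. \<xi> n (?x i)) $ j * D1 j)
     = 1 / b n * (\<Sum>i<n. err (?x i)) + (\<Sum>j\<in>UNIV. \<Sum>l\<in>UNIV. D2 j l / 2 * quad_dev j l n \<omega>)" .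
  have e1: "\<bar>1 / b n * (\<Sum>i<n. err (?x i))\<bar> \<le> 1 / b n * (\<Sum>i<n. rem g C3 n (?x i))"
  proof -
    have p: "0 \<le> 1 / b n" using bp by simp
    have "\<bar>\<Sum>i<n. err (?x i)\<bar> \<le> (\<Sum>i<n. rem g C3 n (?x i))"
      by (rule order_trans[OF sum_abs sum_mono]) (rule err[OF X_in_M[OF \<omega>]])
    then show ?thesis unfolding abs_mult abs_of_nonneg[OF p] using p by (rule mult_left_mono)
  qed
  have e2: "\<bar>\<Sum>j\<in>UNIV. \<Sum>l\<in>UNIV. D2 j l / 2 * quad_dev j l n \<omega>\<bar> \<le> (\<Sum>j\<in>(UNIV::'d set). \<Sum>l\<in>(UNIV::'d set). C0 / 2 * \<bar>quad_dev j l n \<omega>\<bar>)"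
  proof (rule order_trans[OF sum_abs sum_mono], rule order_trans[OF sum_abs sum_mono])
    fix j l
    show "\<bar>D2 j l / 2 * quad_dev j l n \<omega>\<bar> \<le> C0 / 2 * \<bar>quad_dev j l n \<omega>\<bar>"
      unfolding abs_mult using D2[of j l] by (intro mult_right_mono) auto
  qed
  show ?thesis
    unfolding b_def[symmetric] eq total_rem_def using e1 e2 by (intro order_trans[OF abs_triangle_ineq]) linarith
qed

text \<open>The candidate limit map sends a vector \<open>a\<close> to its pairing with the first
  partials. The bound \<open>C0\<close> on these makes it Lipschitz into the space of bounded
  functions, so the abstract perturbation result applies with \<open>total_rem\<close> as
  error.\<close>

lemma clt_over_class:
  fixes F :: "(real^'m \<Rightarrow> real) set"
  assumes s: "s\<^sup>2 = s2" and C0: "0 \<le> C0" and C3: "0 \<le> C3" and g: "integrable \<nu> g" "\<And>x. 0 \<le> g x"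
    and D1: "\<And>f j. f \<in> F \<Longrightarrow> \<bar>D1 f j\<bar> \<le> C0" and D2: "\<And>f j l. f \<in> F \<Longrightarrow> \<bar>D2 f j l\<bar> \<le> C0"
    and LB: "\<And>f. f \<in> F \<Longrightarrow> LB f = (\<Sum>j\<in>UNIV. D2 f j j)"
    and inB: "\<And>f x. f \<in> F \<Longrightarrow> x \<in> B \<Longrightarrow> \<bar>f x - f p - (\<Sum>j\<in>UNIV. \<kappa>' x $ j * D1 f j)
        - (\<Sum>j\<in>UNIV. \<Sum>l\<in>UNIV. \<kappa>' x $ j * \<kappa>' x $ l * D2 f j l) / 2\<bar> \<le> C3 * norm (\<kappa>' x) ^ 3"
    and out: "\<And>f x. f \<in> F \<Longrightarrow> x \<in> M - B \<Longrightarrow> \<bar>f x - f p\<bar> \<le> g x"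
  shows "converges_in_law (linf_metric F) P
    (\<lambda>n \<omega>. \<lambda>f\<in>F. sqrt (real n * h n ^ (CARD('d) + 2)) * (graph_laplacian CARD('d) (h n) n (\<lambda>i. X i \<omega>) f p - 1 / vol * LB f))
    Q (\<lambda>\<omega>. \<lambda>f\<in>F. \<Sum>j\<in>UNIV. (s *\<^sub>R G.N \<omega>) $ j * D1 f j)"
proof -
  define \<Phi> where "\<Phi> a = (\<lambda>f\<in>F. \<Sum>j\<in>UNIV. a $ j * D1 f j)" for a :: "real^'d"
  define Y where "Y n \<omega> = (\<lambda>f\<in>F. sqrt (real n * h n ^ (CARD('d) + 2)) *
     (graph_laplacian CARD('d) (h n) n (\<lambda>i. X i \<omega>) f p - 1 / vol * LB f))" for n \<omega>
  define A where "A n \<omega> = (\<Sum>i<n. \<xi> n (X i \<omega>))" for n \<omega>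
  let ?L = "real CARD('d) * C0"
  have lin: "\<bar>\<Sum>j\<in>UNIV. a $ j * D1 f j\<bar> \<le> ?L * norm a" if f: "f \<in> F" for a f
  proof -
    have "\<bar>\<Sum>j\<in>UNIV. a $ j * D1 f j\<bar> \<le> (\<Sum>j\<in>UNIV. \<bar>a $ j * D1 f j\<bar>)" by (rule sum_abs)
    also have "\<dots> \<le> (\<Sum>j\<in>(UNIV::'d set). norm a * C0)"
      unfolding abs_mult by (intro sum_mono mult_mono component_le_norm_cart D1[OF f]) auto
    finally show ?thesis by (simp add: mult_ac)
  qed
  have \<Phi>m: "\<Phi> a \<in> linf_space F" for a
    unfolding linf_space_def \<Phi>_def using lin by (auto simp: bounded_iff intro!: exI[of _ "?L * norm a"])
  have dec: "\<bar>Y n \<omega> f - \<Phi> (A n \<omega>) f\<bar> \<le> total_rem g C0 C3 n \<omega>" if "0 < n" "\<omega> \<in> space P" "f \<in> F" for n \<omega> f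
    unfolding Y_def \<Phi>_def A_def restrict_apply' [OF that(3)]
    by (rule process_decomposition[OF C0 D2[OF that(3)] LB[OF that(3)] inB[OF that(3)] out[OF that(3)] that(1,2)])
  have Ym: "Y n \<omega> \<in> linf_space F" if \<omega>: "\<omega> \<in> space P" for n \<omega>
  proof -
    have "\<exists>c. \<forall>f\<in>F. \<bar>Y n \<omega> f\<bar> \<le> c"
    proof (cases "n = 0")
      \<comment> \<open>For an empty sample the factor sqrt(0) makes the process identically
        0.\<close>
      case True then show ?thesis by (intro exI[of _ 0]) (simp add: Y_def)
    next
      case False
      have "\<bar>Y n \<omega> f\<bar> \<le> ?L * norm (A n \<omega>) + total_rem g C0 C3 n \<omega>" if f: "f \<in> F" for f
      proof -
        have "\<bar>\<Phi> (A n \<omega>) f\<bar> \<le> ?L * norm (A n \<omega>)" unfolding \<Phi>_def restrict_apply'[OF f] by (rule lin[OF f])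
        then show ?thesis using dec[OF _ \<omega> f, of n] False by linarith
      qed
      then show ?thesis by blast
    qed
    moreover have "Y n \<omega> \<in> extensional F" by (simp add: Y_def)
    ultimately show ?thesis unfolding linf_space_def bounded_iff by auto
  qed
  have dist_le: "linf_dist F z w \<le> c" if "z \<in> linf_space F" "w \<in> linf_space F" "0 \<le> c" "\<And>f. f \<in> F \<Longrightarrow> \<bar>z f - w f\<bar> \<le> c" for z w c
  proof -
    have "Sup (insert 0 ((\<lambda>i. \<bar>z i - w i\<bar>) ` F)) \<le> c" using that(3,4) by (intro cSup_least) auto
    then show ?thesis using that(1,2) by (simp add: linf_dist_def)
  qed
  have "converges_in_law (linf_metric F) P Y Q (\<lambda>\<omega>. \<Phi> (s *\<^sub>R G.N \<omega>))"
  proof (rule G.converges_in_law_perturbed[where A=A and R="\<lambda>n. total_rem g C0 C3 n" and C="?L"])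
    show "prob_space P" by (rule P.prob_space_axioms)
    show "Y n \<in> space P \<rightarrow> mspace (linf_metric F)" for n unfolding mspace_linf_metric using Ym by blast
    show "\<Phi> a \<in> mspace (linf_metric F)" for a unfolding mspace_linf_metric by (rule \<Phi>m)
    show "mdist (linf_metric F) (\<Phi> a) (\<Phi> a') \<le> ?L * dist a a'" for a a'
      unfolding mdist_linf_metric
    proof (rule dist_le[OF \<Phi>m \<Phi>m])
      show "0 \<le> ?L * dist a a'" using C0 by simp
      fix f assume f: "f \<in> F"
      have "\<Phi> a f - \<Phi> a' f = (\<Sum>j\<in>UNIV. (a - a') $ j * D1 f j)"
        unfolding \<Phi>_def restrict_apply'[OF f] by (simp add: left_diff_distrib sum_subtractf)
      then show "\<bar>\<Phi> a f - \<Phi> a' f\<bar> \<le> ?L * dist a a'" using lin[OF f, of "a - a'"] by (simp add: dist_norm)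
    qed
    show "0 \<le> ?L" using C0 by simp
    show "A n \<in> borel_measurable P" for n unfolding A_def by measurable
    show "integrable P (total_rem g C0 C3 n)" for n by (rule total_rem_facts(1)[OF g C3])
    show "(\<lambda>n. P.expectation (total_rem g C0 C3 n)) \<longlonglongrightarrow> 0" by (rule total_rem_facts(2)[OF g C3])
    show "\<forall>\<^sub>F n in sequentially. \<forall>\<omega>\<in>space P. mdist (linf_metric F) (Y n \<omega>) (\<Phi> (A n \<omega>)) \<le> total_rem g C0 C3 n \<omega>"
    proof (rule eventually_sequentiallyI[of 1], rule ballI)
      fix n :: nat and \<omega> assume n: "1 \<le> n" and \<omega>: "\<omega> \<in> space P"
      have "0 \<le> total_rem g C0 C3 n \<omega>"
        using C0 C3 g(2) kern_nonneg b_nonneg[of n] by (simp add: total_rem_def rem_def sum_nonneg)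
      then show "mdist (linf_metric F) (Y n \<omega>) (\<Phi> (A n \<omega>)) \<le> total_rem g C0 C3 n \<omega>"
        unfolding mdist_linf_metric using n by (intro dist_le[OF Ym[OF \<omega>] \<Phi>m] dec[OF _ \<omega>]) auto
    qed
    fix \<phi> :: "real^'d \<Rightarrow> real" and L assume \<phi>: "continuous_on UNIV \<phi>" "\<And>x. L \<le> norm x \<Longrightarrow> \<phi> x = 0"
    show "(\<lambda>n. P.expectation (\<lambda>\<omega>. \<phi> (A n \<omega>))) \<longlonglongrightarrow> G.expectation (\<lambda>\<omega>. \<phi> (s *\<^sub>R G.N \<omega>))"
      unfolding A_def
      by (rule G.triangular_clt[OF P.prob_space_axioms X law \<xi>_measurable clt_third_integrable clt_first_moment _ clt_third_moment \<phi>])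
        (simp_all add: s clt_second_moment)
  qed
  then show ?thesis unfolding Y_def \<Phi>_def .
qed

end

text \<open>Injectivity on all of \<open>U\<close>, beyond the ball covered by the chart, lets
  \<open>inv_into\<close> recover every point of \<open>U\<close>, so that the order-zero bound on
  the class holds throughout \<open>U\<close>.\<close>

lemma normal_coords_inj:
  fixes M U V :: "(real^'m::finite) set" and e :: "'d::finite \<Rightarrow> real^'m"
  assumes frame: "orthonormal_frame (tangent_space TYPE('d) M p) e" and nn: "normal_neighborhood TYPE('d) M p V U"
  shows "inj_on (normal_coords M p V e) U"
proof (rule inj_onI)
  let ?T = "tangent_space TYPE('d) M p" and ?exp = "exp_map TYPE('d) M p"
  have ortho: "e i \<bullet> e j = (if i = j then 1 else 0)" and span: "span (range e) = ?T" for i j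
    using frame unfolding orthonormal_frame_def by auto
  note n = nn[unfolded normal_neighborhood_def, THEN conjunct2, THEN conjunct2, THEN conjunct2]
  have VT: "V \<subseteq> ?T" using n[THEN conjunct1] by (rule openin_imp_subset)
  have im: "?exp ` V = U"
    using n[THEN conjunct2, THEN conjunct2, THEN conjunct2] unfolding diffeomorphism_def bij_betw_def by blast
  fix x x' assume x: "x \<in> U" "x' \<in> U" "normal_coords M p V e x = normal_coords M p V e x'"
  have c: "inv_into V ?exp x \<bullet> e i = inv_into V ?exp x' \<bullet> e i" for i
    using x(3) unfolding normal_coords_def by (simp add: vec_eq_iff)
  have t: "inv_into V ?exp z \<in> span (range e)" if "z \<in> U" for z
    unfolding span using VT inv_into_into[of z ?exp V] im that by blast
  have "inv_into V ?exp x = inv_into V ?exp x'"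
    using orthonormal_expansion[of e, OF ortho t[OF x(1)]] orthonormal_expansion[of e, OF ortho t[OF x(2)]] by (simp only: c)
  then have "?exp (inv_into V ?exp x) = ?exp (inv_into V ?exp x')" by (rule arg_cong)
  moreover have "?exp (inv_into V ?exp z) = z" if "z \<in> U" for z using f_inv_into_f[of z ?exp V] im that by simp
  ultimately show "x = x'" using x(1,2) by simp
qed

section \<open>Normal coordinates and the limiting constant\<close>

context normal_chart
begin

text \<open>\<open>G\<close> and f o \<psi> agree only on the ball, but derivatives at its centre
  see nothing else.\<close>

lemma laplace_beltrami_partial:
  assumes G: "times_differentiable_on 2 G (ball 0 R)" and eq: "\<And>y. y \<in> ball 0 R \<Longrightarrow> G y = f (\<psi> y)"
  shows "laplace_beltrami TYPE('d) M f p = (\<Sum>j\<in>UNIV. partial j (partial j G) 0)"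
proof -
  have G2: "times_differentiable_on (Suc (Suc 0)) G (ball 0 R)" using G by (simp only: numeral_2_eq_2)
  have "times_differentiable_on 2 (\<lambda>y. f (\<psi> y)) (ball 0 R)"
    using times_differentiable_on_cong[of "ball 0 R" G "\<lambda>y. f (\<psi> y)" 2] eq G by simp
  then have "laplace_beltrami TYPE('d) M f p = (\<Sum>j\<in>UNIV. deriv2 (\<lambda>y. f (\<psi> y)) 0 (axis j 1) (axis j 1))"
    by (rule laplace_beltrami_eq)
  moreover have "deriv2 (\<lambda>y. f (\<psi> y)) 0 (axis j 1) (axis j 1) = partial j (partial j G) 0" for j
  proof -
    have "frechet_derivative (\<lambda>y. f (\<psi> y)) (at y) = frechet_derivative G (at y)" if "y \<in> ball 0 R" for y
      using frechet_derivative_cong_open[OF open_ball that, of "\<lambda>y. f (\<psi> y)" G] eq by simp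
    then have "deriv2 (\<lambda>y. f (\<psi> y)) 0 (axis j 1) (axis j 1) = deriv2 G 0 (axis j 1) (axis j 1)"
      unfolding deriv2_def
      using frechet_derivative_cong_open[OF open_ball zero_in_ball, of "\<lambda>x. frechet_derivative (\<lambda>y. f (\<psi> y)) (at x) (axis j 1)"
        "\<lambda>x. frechet_derivative G (at x) (axis j 1)"] by simp
    then show ?thesis using deriv2_partial[OF G2 open_ball zero_in_ball] by simp
  qed
  ultimately show ?thesis by simp
qed

end

text \<open>By \<open>c4_normalises\<close> the square of \<open>c4\<close> times (2 pi)^(d/2)
  equals 2^(-d) (2 pi)^(-d/2), the square of the constant of the limit apart from the
  volume.\<close>

lemma (in graph_clt) limit_scale_sq:
  "(1 / (2 powr (CARD('d) / 2) * (2 * pi) powr (CARD('d) / 4) * vol powr (1 / 2)))\<^sup>2 = s2"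
proof -
  let ?A = "sqrt (2 * pi) ^ CARD('d)" and ?S = "sqrt 2 ^ CARD('d) :: real"
  have A: "((2 * pi) powr (CARD('d) / 4))\<^sup>2 = ?A"
    by (simp add: powr_half_sqrt[symmetric] powr_power)
  have S: "2 powr (CARD('d) / 2) = ?S" by (simp add: powr_half_sqrt[symmetric] powr_power)
  have v: "(vol powr (1 / 2))\<^sup>2 = vol" using vol_pos by (simp add: powr_half_sqrt)
  have gen: "c\<^sup>2 / v * a = 1 / (b\<^sup>2 * a * v)" if "c * (a * b) = 1" for a b c v :: real
  proof -
    have nz: "a * b \<noteq> 0" using that by auto
    then have "c = 1 / (a * b)" using that by (simp add: eq_divide_eq)
    then show ?thesis using nz by (simp add: power2_eq_square)
  qed
  have "s2 = 1 / (?S\<^sup>2 * ?A * vol)"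
    unfolding s2_def by (rule gen) (rule c4_normalises[unfolded power_mult_distrib])
  then show ?thesis by (simp only: power_divide power_mult_distrib A S v power_one)
qed

text \<open>Boundedness up to third order in \<open>U\<close> says nothing about the class on the
  rest of \<open>M\<close>; there the integrable envelope \<open>env\<close> takes over, and the
  exponential decay of the kernel makes that contribution negligible.\<close>

theorem theorem4p2:
  fixes M U V :: "(real^'m::finite) set"
    and p :: "real^'m"
    and e :: "'d::finite \<Rightarrow> real^'m"
    and \<mu> :: "(real^'m) measure"
    and P :: "'w measure" and X :: "nat \<Rightarrow> 'w \<Rightarrow> real^'m"
    and h :: "nat \<Rightarrow> real"
    and F :: "(real^'m \<Rightarrow> real) set" and env :: "real^'m \<Rightarrow> real"
    and Q :: "'q measure" and Z :: "'d \<Rightarrow> 'q \<Rightarrow> real"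
  assumes "compact M" and "connected M" and "submanifold TYPE('d) M"
    and "CARD('d) < CARD('m)"
    and "riemannian_volume TYPE('d) M \<mu>"
    and "p \<in> manifold_interior TYPE('d) M"
    and "prob_space P"
    and "prob_space.indep_vars P (\<lambda>_. restrict_space borel M) X UNIV"
    and "\<And>i. distr P (restrict_space borel M) (X i) = scale_measure (inverse (emeasure \<mu> M)) \<mu>"
    and "\<And>n. 0 < h n"
    and "orthonormal_frame (tangent_space TYPE('d) M p) e"
    and "normal_neighborhood TYPE('d) M p V U"
    and "uniformly_bounded_upto 3 U (normal_coords M p V e) F"
    and "integrable \<mu> env" and "\<And>f x. f \<in> F \<Longrightarrow> x \<in> M - U \<Longrightarrow> \<bar>f x\<bar> \<le> env x"
    and "(\<lambda>n. real n * h n ^ (CARD('d) + 4)) \<longlonglongrightarrow> 0"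
    and "filterlim (\<lambda>n. real n * h n ^ CARD('d)) at_top sequentially"
    and "prob_space Q"
    and "prob_space.indep_vars Q (\<lambda>_. borel) Z UNIV"
    and "\<And>j. distributed Q lborel (Z j) std_normal_density"
  shows "converges_in_law (linf_metric F)
    P (\<lambda>n \<omega>. \<lambda>f\<in>F. sqrt (real n * h n ^ (CARD('d) + 2)) *
         (graph_laplacian CARD('d) (h n) n (\<lambda>i. X i \<omega>) f p
            - 1 / measure \<mu> M * laplace_beltrami TYPE('d) M f p))
    Q (\<lambda>\<omega>. \<lambda>f\<in>F.
         1 / (2 powr (CARD('d) / 2) * (2 * pi) powr (CARD('d) / 4) * measure \<mu> M powr (1 / 2)) *
         (\<Sum>j\<in>UNIV. Z j \<omega> *
            partial j (in_coords U (normal_coords M p V e) f) (normal_coords M p V e p)))"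
proof -
  let ?c = "normal_coords M p V e"
  interpret P: prob_space P by fact
  have "\<exists>\<psi> \<kappa> W R. normal_chart M p \<psi> \<kappa> W R e \<and> ?c p = 0 \<and>
      (\<forall>y\<in>ball 0 R. \<psi> y \<in> U \<and> y \<in> ?c ` U \<and> inv_into U ?c y = \<psi> y)"
    by (rule normal_chart_exists[OF assms(3,11,12)])
  then obtain \<psi> \<kappa> W R where nc: "normal_chart M p \<psi> \<kappa> W R e" and c0: "?c p = 0"
    and chart: "\<And>y. y \<in> ball 0 R \<Longrightarrow> \<psi> y \<in> U \<and> y \<in> ?c ` U \<and> inv_into U ?c y = \<psi> y" by blast
  interpret nc: normal_chart M p \<psi> \<kappa> W R e by (rule nc)
  obtain r0 C where r0: "0 < r0" "r0 < R" "r0 \<le> 1" and C: "0 < C"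
    and est: "\<And>y. y \<in> ball 0 r0 \<Longrightarrow> \<bar>nc.dens y - 1\<bar> \<le> C * (norm y)\<^sup>2 \<and>
     \<bar>(norm (\<psi> y - p))\<^sup>2 - (norm y)\<^sup>2\<bar> \<le> C * norm y ^ 4 \<and> (norm y)\<^sup>2 / 2 \<le> (norm (\<psi> y - p))\<^sup>2"
    using nc.chart_estimates by blast
  \<comment> \<open>On this smaller ball \<open>C * (norm y)\<^sup>2\<close> is at most 1, so the
    density estimate gives a nonnegative density.\<close>
  define r where "r = min r0 (1 / (C + 1))"
  have r: "0 < r" "r < R" "r \<le> 1" "ball 0 r \<subseteq> ball (0 :: real^'d) r0" using r0 C by (auto simp: r_def)
  have dens: "0 \<le> nc.dens y" if y: "y \<in> ball 0 r" for y
  proof -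
    have "norm y < r" using y by simp
    moreover have "r \<le> 1 / (C + 1)" by (simp add: r_def)
    ultimately have "norm y \<le> 1" "norm y \<le> 1 / (C + 1)" using r(3) by linarith+
    then have "(norm y)\<^sup>2 \<le> 1 / (C + 1) * 1" unfolding power2_eq_square using C by (intro mult_mono) auto
    then have "C * (norm y)\<^sup>2 \<le> C * (1 / (C + 1))" using C by (intro mult_left_mono) auto
    also have "\<dots> \<le> 1" using C by simp
    finally have "C * (norm y)\<^sup>2 \<le> 1" .
    moreover have "y \<in> ball 0 r0" using y r(4) by blast
    then have "\<bar>nc.dens y - 1\<bar> \<le> C * (norm y)\<^sup>2" using est by blast
    ultimately show ?thesis by linarith
  qed
  have Xm: "X 0 \<in> measurable P (restrict_space borel M)" using assms(8) by (simp add: P.indep_vars_def)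
  \<comment> \<open>Positivity and finiteness of the volume are read off from the law: otherwise the
    normalized measure would have total mass 0 instead of 1.\<close>
  have "emeasure (distr P (restrict_space borel M) (X 0)) M = 1"
    using prob_space.emeasure_space_1[OF P.prob_space_distr[OF Xm]] by (simp add: space_restrict_space)
  then have one: "inverse (emeasure \<mu> M) * emeasure \<mu> M = 1" unfolding assms(9) by simp
  have \<mu>M: "emeasure \<mu> M \<noteq> 0" "emeasure \<mu> M \<noteq> \<infinity>"
    using one by auto
  interpret G: std_gaussian_vector Q Z
    by (intro std_gaussian_vector.intro std_gaussian_vector_axioms.intro assms(18,19,20))
  interpret S: sampled_chart M p \<psi> \<kappa> W R e Q Z \<mu> r C
  proof
    show "riemannian_volume TYPE('d) M \<mu>" by fact
    show "emeasure \<mu> M \<noteq> 0" "emeasure \<mu> M \<noteq> \<infinity>" by (rule \<mu>M)+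
    show "0 < r" "r < R" "r \<le> 1" "0 < C" using r C by auto
    fix y :: "real^'d" assume y: "y \<in> ball 0 r"
    then have y0: "y \<in> ball 0 r0" using r(4) by blast
    show "\<bar>nc.dens y - 1\<bar> \<le> C * (norm y)\<^sup>2" "\<bar>(norm (\<psi> y - p))\<^sup>2 - (norm y)\<^sup>2\<bar> \<le> C * norm y ^ 4"
      "(norm y)\<^sup>2 / 2 \<le> (norm (\<psi> y - p))\<^sup>2"
      using est[OF y0] by blast+
    show "0 \<le> nc.dens y" by (rule dens[OF y])
  qed
  interpret T: graph_clt M p \<psi> \<kappa> W R e Q Z \<mu> r C P X h
    by unfold_locales (use assms(8,9,10,16,17) in \<open>simp_all add: S.\<nu>_def\<close>)
  let ?G = "in_coords U ?c"
  obtain C0' where smooth: "\<And>f. f \<in> F \<Longrightarrow> times_differentiable_on 3 (?G f) (?c ` U)"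
    and C0': "\<And>f is y. f \<in> F \<Longrightarrow> length is \<le> 3 \<Longrightarrow> y \<in> ?c ` U \<Longrightarrow> \<bar>partials is (?G f) y\<bar> \<le> C0'"
    using assms(13) unfolding uniformly_bounded_upto_def by blast
  \<comment> \<open>The absolute value secures a nonnegative constant even for an empty
    class.\<close>
  define C0 where "C0 = \<bar>C0'\<bar>"
  have C0: "\<bar>partials is (?G f) y\<bar> \<le> C0" if "f \<in> F" "length is \<le> 3" "y \<in> ?c ` U" for f "is" y
    using C0'[OF that] unfolding C0_def by linarith
  have zero: "0 \<in> ?c ` U" using chart[OF nc.zero_in_ball] by blast
  have Geq: "?G f y = f (\<psi> y)" if "y \<in> ball 0 R" for f y using chart[OF that] by (simp add: in_coords_def)
  have G0: "f p = ?G f 0" for f using Geq[OF nc.zero_in_ball] by (simp add: nc.\<psi>_0)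
  have sub: "ball 0 R \<subseteq> ?c ` U" using chart by blast
  have smooth_ball: "times_differentiable_on 3 (?G f) (ball 0 R)" if "f \<in> F" for f
    by (rule times_differentiable_on_subset[OF smooth[OF that] sub])
  \<comment> \<open>One \<open>C0\<close> pays for \<open>f p\<close>, the other for
    \<open>f x\<close> on \<open>U\<close>; off \<open>U\<close> the envelope bounds
    \<open>f x\<close>.\<close>
  define g where "g x = \<bar>env x\<bar> + 2 * C0" for x
  define D1 where "D1 f j = partial j (?G f) 0" for f j
  define D2 where "D2 f j l = partial l (partial j (?G f)) 0" for f j l
  let ?s = "1 / (2 powr (CARD('d) / 2) * (2 * pi) powr (CARD('d) / 4) * S.vol powr (1 / 2))"
  interpret \<nu>: prob_space S.\<nu> by (rule T.prob_space_\<nu>)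
  have "converges_in_law (linf_metric F) P
    (\<lambda>n \<omega>. \<lambda>f\<in>F. sqrt (real n * h n ^ (CARD('d) + 2)) *
       (graph_laplacian CARD('d) (h n) n (\<lambda>i. X i \<omega>) f p - 1 / S.vol * laplace_beltrami TYPE('d) M f p))
    Q (\<lambda>\<omega>. \<lambda>f\<in>F. \<Sum>j\<in>UNIV. (?s *\<^sub>R G.N \<omega>) $ j * D1 f j)"
  proof (rule T.clt_over_class[of ?s C0 "real CARD('d) ^ 3 * C0" g F D1 D2 "\<lambda>f. laplace_beltrami TYPE('d) M f p"])
    show "?s\<^sup>2 = T.s2" by (rule T.limit_scale_sq)
    show "0 \<le> C0" by (simp add: C0_def)
    show "0 \<le> real CARD('d) ^ 3 * C0" by (simp add: C0_def)
    have "integrable S.\<nu> env"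
      unfolding S.\<nu>_eq using assms(14) S.vol_pos by (subst integrable_density) auto
    then show "integrable S.\<nu> g" unfolding g_def by simp
    show "0 \<le> g x" for x by (simp add: g_def C0_def)
    fix f assume f: "f \<in> F"
    show "\<bar>D1 f j\<bar> \<le> C0" for j using C0[OF f, of "[j]" 0] zero by (simp add: D1_def)
    show "\<bar>D2 f j l\<bar> \<le> C0" for j l using C0[OF f, of "[l, j]" 0] zero by (simp add: D2_def)
    show "laplace_beltrami TYPE('d) M f p = (\<Sum>j\<in>UNIV. D2 f j j)"
      unfolding D2_def
      by (rule nc.laplace_beltrami_partial[OF times_differentiable_on_le[OF smooth_ball[OF f]] Geq]) auto
    fix x
    show "\<bar>f x - f p - (\<Sum>j\<in>UNIV. S.\<kappa>' x $ j * D1 f j)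
        - (\<Sum>j\<in>UNIV. \<Sum>l\<in>UNIV. S.\<kappa>' x $ j * S.\<kappa>' x $ l * D2 f j l) / 2\<bar>
        \<le> real CARD('d) ^ 3 * C0 * norm (S.\<kappa>' x) ^ 3" if xB: "x \<in> S.B"
    proof -
      obtain y where y: "y \<in> ball 0 r" "x = \<psi> y" using xB unfolding S.B_def by blast
      have yR: "y \<in> ball 0 R" using y(1) r(2) by simp
      have "f x = ?G f y" unfolding y(2) by (rule Geq[OF yR, symmetric])
      moreover have "S.\<kappa>' x = y" unfolding y(2) by (rule S.ball_facts(2)[OF y(1)])
      ultimately show ?thesis
        unfolding D1_def D2_def G0
        using taylor_partials[OF smooth_ball[OF f] C0[OF f] yR] sub by (simp only: subset_iff)
    qed
    show "\<bar>f x - f p\<bar> \<le> g x" if x: "x \<in> M - S.B"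
    proof -
      have "\<bar>f p\<bar> \<le> C0" unfolding G0 using C0[OF f, of "[]" 0] zero by simp
      moreover have "\<bar>f x\<bar> \<le> \<bar>env x\<bar> + C0"
      proof (cases "x \<in> U")
        case True
        have "\<bar>?G f (?c x)\<bar> \<le> C0" using C0[OF f, of "[]" "?c x"] True by simp
        then show ?thesis
          using inv_into_f_f[OF normal_coords_inj[OF assms(11,12)] True] by (simp add: in_coords_def)
      next
        case False
        then have "\<bar>f x\<bar> \<le> env x" using assms(15)[OF f] x by blast
        then show ?thesis using abs_ge_zero[of C0'] unfolding C0_def by linarith
      qed
      ultimately show ?thesis unfolding g_def by linarith
    qed
  qed
  then show ?thesis
    unfolding D1_def c0 S.vol_def by (simp add: sum_distrib_left mult.assoc)
qed

end
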